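(* Let $G$ be a profinite group. Then a nondegenerate representation $\pi$ of the pro-C*-algebra of $G$ is continuous if and only if the image of $G$ under the corresponding unitary representation of $G$ is finite. In particular, there is a bijective correspondence between continuous nondegenerate representations of the pro-C*-algebra of $G$ and unitary representations of $G$ with finite range.
   Context: A topological group is profinite if it is topologically isomorphic to an inverse limit of finite discrete groups. Homomorphisms of C*-algebras are *-homomorphisms and representations are *-representations on Hilbert spaces; $L(H)$ denotes the bounded operators on $H$ (with the norm topology). Unitary representations of topological groups are strongly continuous. $C^*(G)$ is the (full) group C*-algebra and $M(\cdot)$ denotes the multiplier algebra. For $g\in G$, $u_g\in M(C^*(G))$ is the canonical unitary, the image of the point mass at $g$ under the map from the measure algebra of $G$ to $M(C^*(G))$. Nondegenerate representations $\pi\colon C^*(G)\to L(H)$ correspond bijectively to unitary representations $v$ of $G$ on $H$ via $v_g=\widetilde{\pi}(u_g)$, where $\widetilde{\pi}$ is the unique extension of $\pi$ to $M(C^*(G))$. $\mathcal{N}_G$ is the set of closed normal subgroups $N\subset G$ of finite index, ordered by reverse inclusion (a directed set). For $N\in\mathcal{N}_G$, $\kappa_N\colon C^*(G)\to C^*(G/N)$ is the unique surjective homomorphism whose extension $\widetilde{\kappa}_N\colon M(C^*(G))\to C^*(G/N)$ satisfies $\widetilde{\kappa}_N(u_g)=u_{gN}$ for all $g\in G$. The pro-C*-algebra of $G$ is $C^*(G)$ equipped with the family of C*-seminorms $\|a\|_N=\|\kappa_N(a)\|$, $N\in\mathcal{N}_G$. A net $(a_\alpha)$ converges to $a$ in its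 topology if and only if $\|a_\alpha-a\|_N\to 0$ for all $N\in\mathcal{N}_G$; a representation of the pro-C*-algebra of $G$ is a representation of $C^*(G)$, and it is called continuous if it is continuous for this topology. *)

theory Defs
  imports "HOL-Analysis.Analysis" "HOL-Algebra.Algebra"
begin

section \<open>Profinite groups\<close>

definition topological_group :: "('g, 'm) monoid_scheme \<Rightarrow> 'g topology \<Rightarrow> bool" where
  "topological_group G T \<longleftrightarrow>
     group G \<and> topspace T = carrier G \<and>
     continuous_map (prod_topology T T) T (\<lambda>(x, y). x \<otimes>\<^bsub>G\<^esub> y) \<and>
     continuous_map T T (\<lambda>x. inv\<^bsub>G\<^esub> x)"

text \<open>Directed systems of finite groups; \<open>(i, j) \<in> r\<close> means \<open>i \<le> j\<close>, and the connecting
  map \<open>\<phi> i j\<close> then goes from \<open>F j\<close> to \<open>F i\<close>.\<close>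

definition finite_inverse_system ::
    "'i set \<Rightarrow> 'i rel \<Rightarrow> ('i \<Rightarrow> 'f monoid) \<Rightarrow> ('i \<Rightarrow> 'i \<Rightarrow> 'f \<Rightarrow> 'f) \<Rightarrow> bool" where
  "finite_inverse_system I r F \<phi> \<longleftrightarrow>
     I \<noteq> {} \<and> partial_order_on I r \<and>
     (\<forall>i\<in>I. \<forall>j\<in>I. \<exists>k\<in>I. (i, k) \<in> r \<and> (j, k) \<in> r) \<and>
     (\<forall>i\<in>I. group (F i) \<and> finite (carrier (F i))) \<and>
     (\<forall>i\<in>I. \<forall>j\<in>I. (i, j) \<in> r \<longrightarrow> \<phi> i j \<in> hom (F j) (F i)) \<and>
     (\<forall>i\<in>I. \<forall>x\<in>carrier (F i). \<phi> i i x = x) \<and>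
     (\<forall>i\<in>I. \<forall>j\<in>I. \<forall>k\<in>I. (i, j) \<in> r \<longrightarrow> (j, k) \<in> r \<longrightarrow>
        (\<forall>x\<in>carrier (F k). \<phi> i j (\<phi> j k x) = \<phi> i k x))"

definition inverse_limit_set ::
    "'i set \<Rightarrow> 'i rel \<Rightarrow> ('i \<Rightarrow> 'f monoid) \<Rightarrow> ('i \<Rightarrow> 'i \<Rightarrow> 'f \<Rightarrow> 'f) \<Rightarrow> ('i \<Rightarrow> 'f) set" where
  "inverse_limit_set I r F \<phi> =
     {x \<in> carrier (product_group I F). \<forall>i\<in>I. \<forall>j\<in>I. (i, j) \<in> r \<longrightarrow> \<phi> i j (x j) = x i}"

definition inverse_limit_group ::
    "'i set \<Rightarrow> 'i rel \<Rightarrow> ('i \<Rightarrow> 'f monoid) \<Rightarrow> ('i \<Rightarrow> 'i \<Rightarrow> 'f \<Rightarrow> 'f) \<Rightarrow> ('i \<Rightarrow> 'f) monoid" where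
  "inverse_limit_group I r F \<phi> = (product_group I F)\<lparr>carrier := inverse_limit_set I r F \<phi>\<rparr>"

definition inverse_limit_topology ::
    "'i set \<Rightarrow> 'i rel \<Rightarrow> ('i \<Rightarrow> 'f monoid) \<Rightarrow> ('i \<Rightarrow> 'i \<Rightarrow> 'f \<Rightarrow> 'f) \<Rightarrow> ('i \<Rightarrow> 'f) topology" where
  "inverse_limit_topology I r F \<phi> =
     subtopology (product_topology (\<lambda>i. discrete_topology (carrier (F i))) I)
       (inverse_limit_set I r F \<phi>)"

text \<open>The two type arguments are the types from which the index set and the elements of the
  finite groups are taken; a theorem assuming \<open>profinite_group TYPE('i) TYPE('f) G T\<close> with
  type variables \<open>'i\<close>, \<open>'f\<close> thus covers inverse systems over arbitrary types.\<close>

definition profinite_group ::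
    "'i itself \<Rightarrow> 'f itself \<Rightarrow> ('g, 'm) monoid_scheme \<Rightarrow> 'g topology \<Rightarrow> bool" where
  "profinite_group ti tf G T \<longleftrightarrow>
     topological_group G T \<and>
     (\<exists>(I :: 'i set) r (F :: 'i \<Rightarrow> 'f monoid) \<phi> h.
        finite_inverse_system I r F \<phi> \<and>
        h \<in> iso G (inverse_limit_group I r F \<phi>) \<and>
        homeomorphic_map T (inverse_limit_topology I r F \<phi>) h)"

section \<open>Hilbert spaces and normed star algebras\<close>

definition complex_ring :: "complex ring" where
  "complex_ring = \<lparr>carrier = UNIV, monoid.mult = (*), monoid.one = 1, ring.zero = 0, ring.add = (+)\<rparr>"

definition linear_maps ::
    "(complex, 'a, 'x) module_scheme \<Rightarrow> (complex, 'b, 'y) module_scheme \<Rightarrow> ('a \<Rightarrow> 'b) set" where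
  "linear_maps V W =
     {f \<in> carrier V \<rightarrow>\<^sub>E carrier W.
        (\<forall>x\<in>carrier V. \<forall>y\<in>carrier V. f (x \<oplus>\<^bsub>V\<^esub> y) = f x \<oplus>\<^bsub>W\<^esub> f y) \<and>
        (\<forall>c. \<forall>x\<in>carrier V. f (c \<odot>\<^bsub>V\<^esub> x) = c \<odot>\<^bsub>W\<^esub> f x)}"

text \<open>The metric is set to \<open>0\<close> off the carrier because \<^locale>\<open>Metric_space\<close> requires
  nonnegativity and symmetry of the distance for all elements of the type.\<close>

definition norm_dist ::
    "(complex, 'a, 'x) module_scheme \<Rightarrow> ('a \<Rightarrow> real) \<Rightarrow> 'a \<Rightarrow> 'a \<Rightarrow> real" where
  "norm_dist V nrm x y = (if x \<in> carrier V \<and> y \<in> carrier V then nrm (x \<ominus>\<^bsub>V\<^esub> y) else 0)"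

definition norm_topology ::
    "(complex, 'a, 'x) module_scheme \<Rightarrow> ('a \<Rightarrow> real) \<Rightarrow> 'a topology" where
  "norm_topology V nrm = Metric_space.mtopology (carrier V) (norm_dist V nrm)"

definition bounded_maps ::
    "(complex, 'a, 'x) module_scheme \<Rightarrow> ('a \<Rightarrow> real) \<Rightarrow> ('a \<Rightarrow> 'a) set" where
  "bounded_maps V nrm =
     {f \<in> linear_maps V V. \<exists>c. \<forall>x\<in>carrier V. nrm (f x) \<le> c * nrm x}"

definition op_norm ::
    "(complex, 'a, 'x) module_scheme \<Rightarrow> ('a \<Rightarrow> real) \<Rightarrow> ('a \<Rightarrow> 'a) \<Rightarrow> real" where
  "op_norm V nrm f = Sup {nrm (f x) | x. x \<in> carrier V \<and> nrm x \<le> 1}"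

text \<open>In a Hilbert space the ring operations \<open>mult\<close> and \<open>one\<close> inherited from the library's
  record of modules play no role. The inner product is linear in the first variable.\<close>

record 'h hilbert = "(complex, 'h) module" +
  hinner :: "'h \<Rightarrow> 'h \<Rightarrow> complex"

definition hnorm :: "'h hilbert \<Rightarrow> 'h \<Rightarrow> real" where
  "hnorm H x = sqrt (Re (hinner H x x))"

definition hilbert_space :: "'h hilbert \<Rightarrow> bool" where
  "hilbert_space H \<longleftrightarrow>
     Module.module complex_ring H \<and>
     (\<forall>x\<in>carrier H. \<forall>y\<in>carrier H. \<forall>z\<in>carrier H.
        hinner H (x \<oplus>\<^bsub>H\<^esub> y) z = hinner H x z + hinner H y z) \<and>
     (\<forall>c. \<forall>x\<in>carrier H. \<forall>y\<in>carrier H. hinner H (c \<odot>\<^bsub>H\<^esub> x) y = c * hinner H x y) \<and>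
     (\<forall>x\<in>carrier H. \<forall>y\<in>carrier H. hinner H y x = cnj (hinner H x y)) \<and>
     (\<forall>x\<in>carrier H. hinner H x x \<in> \<real>\<^sub>\<ge>\<^sub>0 \<and> (hinner H x x = 0 \<longrightarrow> x = \<zero>\<^bsub>H\<^esub>)) \<and>
     Metric_space.mcomplete (carrier H) (norm_dist H (hnorm H))"

text \<open>Algebras need not be unital; the field \<open>one\<close> carries information only for the
  multiplier algebras and the algebras of bounded operators below.\<close>

record 'a star_algebra = "(complex, 'a) module" +
  star :: "'a \<Rightarrow> 'a"
  anorm :: "'a \<Rightarrow> real"

definition star_homs :: "'a star_algebra \<Rightarrow> 'b star_algebra \<Rightarrow> ('a \<Rightarrow> 'b) set" where
  "star_homs A B =
     {\<phi> \<in> linear_maps A B.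
        (\<forall>x\<in>carrier A. \<forall>y\<in>carrier A. \<phi> (x \<otimes>\<^bsub>A\<^esub> y) = \<phi> x \<otimes>\<^bsub>B\<^esub> \<phi> y) \<and>
        (\<forall>x\<in>carrier A. \<phi> (star A x) = star B (\<phi> x))}"

definition bounded_ops :: "'h hilbert \<Rightarrow> ('h \<Rightarrow> 'h) star_algebra" where
  "bounded_ops H =
     \<lparr>carrier = bounded_maps H (hnorm H),
      monoid.mult = compose (carrier H),
      monoid.one = (\<lambda>x\<in>carrier H. x),
      ring.zero = (\<lambda>x\<in>carrier H. \<zero>\<^bsub>H\<^esub>),
      ring.add = (\<lambda>S S'. \<lambda>x\<in>carrier H. S x \<oplus>\<^bsub>H\<^esub> S' x),
      module.smult = (\<lambda>c S. \<lambda>x\<in>carrier H. c \<odot>\<^bsub>H\<^esub> S x),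
      star = (\<lambda>S. THE S'. S' \<in> bounded_maps H (hnorm H) \<and>
                 (\<forall>x\<in>carrier H. \<forall>y\<in>carrier H. hinner H (S x) y = hinner H x (S' y))),
      anorm = op_norm H (hnorm H)\<rparr>"

definition closed_span :: "'h hilbert \<Rightarrow> 'h set \<Rightarrow> 'h set" where
  "closed_span H S =
     \<Inter>{K. submodule K complex_ring H \<and> closedin (norm_topology H (hnorm H)) K \<and> S \<subseteq> K}"

definition nondegenerate_reps :: "'a star_algebra \<Rightarrow> 'h hilbert \<Rightarrow> ('a \<Rightarrow> 'h \<Rightarrow> 'h) set" where
  "nondegenerate_reps A H =
     {\<pi> \<in> star_homs A (bounded_ops H).
        closed_span H {\<pi> a \<xi> | a \<xi>. a \<in> carrier A \<and> \<xi> \<in> carrier H} = carrier H}"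

section \<open>Multiplier algebras\<close>

text \<open>\<open>M(A)\<close> is the algebra of double centralizers \<open>(L, R)\<close>.\<close>

definition multipliers :: "'a star_algebra \<Rightarrow> (('a \<Rightarrow> 'a) \<times> ('a \<Rightarrow> 'a)) set" where
  "multipliers A =
     {(L, R). L \<in> bounded_maps A (anorm A) \<and> R \<in> bounded_maps A (anorm A) \<and>
        (\<forall>a\<in>carrier A. \<forall>b\<in>carrier A.
           L (a \<otimes>\<^bsub>A\<^esub> b) = L a \<otimes>\<^bsub>A\<^esub> b \<and>
           R (a \<otimes>\<^bsub>A\<^esub> b) = a \<otimes>\<^bsub>A\<^esub> R b \<and>
           R a \<otimes>\<^bsub>A\<^esub> b = a \<otimes>\<^bsub>A\<^esub> L b)}"

definition multiplier_algebra ::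
    "'a star_algebra \<Rightarrow> (('a \<Rightarrow> 'a) \<times> ('a \<Rightarrow> 'a)) star_algebra" where
  "multiplier_algebra A =
     \<lparr>carrier = multipliers A,
      monoid.mult = (\<lambda>(L, R) (L', R'). (compose (carrier A) L L', compose (carrier A) R' R)),
      monoid.one = (\<lambda>a\<in>carrier A. a, \<lambda>a\<in>carrier A. a),
      ring.zero = (\<lambda>a\<in>carrier A. \<zero>\<^bsub>A\<^esub>, \<lambda>a\<in>carrier A. \<zero>\<^bsub>A\<^esub>),
      ring.add = (\<lambda>(L, R) (L', R'). (\<lambda>a\<in>carrier A. L a \<oplus>\<^bsub>A\<^esub> L' a, \<lambda>a\<in>carrier A. R a \<oplus>\<^bsub>A\<^esub> R' a)),
      module.smult = (\<lambda>c (L, R). (\<lambda>a\<in>carrier A. c \<odot>\<^bsub>A\<^esub> L a, \<lambda>a\<in>carrier A. c \<odot>\<^bsub>A\<^esub> R a)),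
      star = (\<lambda>(L, R). (\<lambda>a\<in>carrier A. star A (R (star A a)),
                         \<lambda>a\<in>carrier A. star A (L (star A a)))),
      anorm = (\<lambda>(L, R). op_norm A (anorm A) L)\<rparr>"

definition multiplier_embedding :: "'a star_algebra \<Rightarrow> 'a \<Rightarrow> ('a \<Rightarrow> 'a) \<times> ('a \<Rightarrow> 'a)" where
  "multiplier_embedding A a = (\<lambda>b\<in>carrier A. a \<otimes>\<^bsub>A\<^esub> b, \<lambda>b\<in>carrier A. b \<otimes>\<^bsub>A\<^esub> a)"

definition multiplier_extension ::
    "'a star_algebra \<Rightarrow> 'b star_algebra \<Rightarrow> ('a \<Rightarrow> 'b) \<Rightarrow> ('a \<Rightarrow> 'a) \<times> ('a \<Rightarrow> 'a) \<Rightarrow> 'b" where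
  "multiplier_extension A B \<phi> =
     (THE \<psi>. \<psi> \<in> star_homs (multiplier_algebra A) B \<and>
        (\<forall>a\<in>carrier A. \<psi> (multiplier_embedding A a) = \<phi> a))"

section \<open>Completions\<close>

text \<open>The completion of a star algebra with respect to its (semi)norm consists of the classes of
  Cauchy sequences modulo null sequences.\<close>

definition cauchy_seqs :: "'a star_algebra \<Rightarrow> (nat \<Rightarrow> 'a) set" where
  "cauchy_seqs P =
     {V. (\<forall>n. V n \<in> carrier P) \<and>
         (\<forall>e>0. \<exists>M. \<forall>m\<ge>M. \<forall>n\<ge>M. anorm P (V m \<ominus>\<^bsub>P\<^esub> V n) < e)}"

definition cauchy_class :: "'a star_algebra \<Rightarrow> (nat \<Rightarrow> 'a) \<Rightarrow> (nat \<Rightarrow> 'a) set" where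
  "cauchy_class P V = {W \<in> cauchy_seqs P. (\<lambda>n. anorm P (V n \<ominus>\<^bsub>P\<^esub> W n)) \<longlonglongrightarrow> 0}"

definition cauchy_rep :: "(nat \<Rightarrow> 'a) set \<Rightarrow> nat \<Rightarrow> 'a" where
  "cauchy_rep C = (SOME V. V \<in> C)"

definition completion :: "'a star_algebra \<Rightarrow> ((nat \<Rightarrow> 'a) set) star_algebra" where
  "completion P =
     \<lparr>carrier = cauchy_class P ` cauchy_seqs P,
      monoid.mult = (\<lambda>C D. cauchy_class P (\<lambda>n. cauchy_rep C n \<otimes>\<^bsub>P\<^esub> cauchy_rep D n)),
      monoid.one = undefined,
      ring.zero = cauchy_class P (\<lambda>n. \<zero>\<^bsub>P\<^esub>),
      ring.add = (\<lambda>C D. cauchy_class P (\<lambda>n. cauchy_rep C n \<oplus>\<^bsub>P\<^esub> cauchy_rep D n)),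
      module.smult = (\<lambda>c C. cauchy_class P (\<lambda>n. c \<odot>\<^bsub>P\<^esub> cauchy_rep C n)),
      star = (\<lambda>C. cauchy_class P (\<lambda>n. star P (cauchy_rep C n))),
      anorm = (\<lambda>C. lim (\<lambda>n. anorm P (cauchy_rep C n)))\<rparr>"

definition completion_embedding :: "'a star_algebra \<Rightarrow> 'a \<Rightarrow> (nat \<Rightarrow> 'a) set" where
  "completion_embedding P a = cauchy_class P (\<lambda>n. a)"

section \<open>The group C*-algebra of a compact group\<close>

text \<open>All groups below are compact, so \<open>C\<^sub>c(G) = C(G)\<close> and the modular function is trivial.
  Radon measures are taken to be bounded linear functionals on \<open>C(G)\<close>.\<close>

definition cont_funs :: "'g topology \<Rightarrow> ('g \<Rightarrow> complex) set" where
  "cont_funs T = {f \<in> extensional (topspace T). continuous_map T euclidean f}"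

definition radon_measures :: "'g topology \<Rightarrow> (('g \<Rightarrow> complex) \<Rightarrow> complex) set" where
  "radon_measures T =
     {\<mu> \<in> extensional (cont_funs T).
        (\<forall>f\<in>cont_funs T. \<forall>h\<in>cont_funs T. \<mu> (\<lambda>x\<in>topspace T. f x + h x) = \<mu> f + \<mu> h) \<and>
        (\<forall>c. \<forall>f\<in>cont_funs T. \<mu> (\<lambda>x\<in>topspace T. c * f x) = c * \<mu> f) \<and>
        (\<exists>c. \<forall>f\<in>cont_funs T. cmod (\<mu> f) \<le> c * (SUP x\<in>topspace T. cmod (f x)))}"

definition point_mass :: "'g topology \<Rightarrow> 'g \<Rightarrow> ('g \<Rightarrow> complex) \<Rightarrow> complex" where
  "point_mass T g = (\<lambda>f\<in>cont_funs T. f g)"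

definition haar_integral ::
    "('g, 'm) monoid_scheme \<Rightarrow> 'g topology \<Rightarrow> ('g \<Rightarrow> complex) \<Rightarrow> complex" where
  "haar_integral G T =
     (THE \<mu>. \<mu> \<in> radon_measures T \<and>
        (\<forall>f\<in>cont_funs T. (\<forall>x\<in>carrier G. f x \<in> \<real>\<^sub>\<ge>\<^sub>0) \<longrightarrow> \<mu> f \<in> \<real>\<^sub>\<ge>\<^sub>0) \<and>
        (\<forall>g\<in>carrier G. \<forall>f\<in>cont_funs T. \<mu> (\<lambda>x\<in>carrier G. f (g \<otimes>\<^bsub>G\<^esub> x)) = \<mu> f) \<and>
        \<mu> (\<lambda>x\<in>carrier G. 1) = 1)"

definition unitary_group :: "'h hilbert \<Rightarrow> ('h \<Rightarrow> 'h) monoid" where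
  "unitary_group H =
     \<lparr>carrier = {U \<in> carrier (bounded_ops H).
        U \<otimes>\<^bsub>bounded_ops H\<^esub> star (bounded_ops H) U = \<one>\<^bsub>bounded_ops H\<^esub> \<and>
        star (bounded_ops H) U \<otimes>\<^bsub>bounded_ops H\<^esub> U = \<one>\<^bsub>bounded_ops H\<^esub>},
      monoid.mult = monoid.mult (bounded_ops H),
      monoid.one = monoid.one (bounded_ops H)\<rparr>"

definition unitary_reps ::
    "('g, 'm) monoid_scheme \<Rightarrow> 'g topology \<Rightarrow> 'h hilbert \<Rightarrow> ('g \<Rightarrow> 'h \<Rightarrow> 'h) set" where
  "unitary_reps G T H =
     {v \<in> extensional (carrier G).
        v \<in> hom G (unitary_group H) \<and>
        (\<forall>\<xi>\<in>carrier H. continuous_map T (norm_topology H (hnorm H)) (\<lambda>g. v g \<xi>))}"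

definition integrated_form ::
    "('g, 'm) monoid_scheme \<Rightarrow> 'g topology \<Rightarrow> 'h hilbert \<Rightarrow> ('g \<Rightarrow> 'h \<Rightarrow> 'h)
      \<Rightarrow> ('g \<Rightarrow> complex) \<Rightarrow> 'h \<Rightarrow> 'h" where
  "integrated_form G T H v f =
     (THE S. S \<in> carrier (bounded_ops H) \<and>
        (\<forall>\<xi>\<in>carrier H. \<forall>\<eta>\<in>carrier H.
           hinner H (S \<xi>) \<eta> = haar_integral G T (\<lambda>s\<in>carrier G. f s * hinner H (v s \<xi>) \<eta>)))"

text \<open>The universal norm of \<open>f\<close> is the supremum of the norms of \<open>f\<close> under all unitary
  representations. It suffices to let these act on Hilbert spaces whose vectors are functions on
  \<open>G\<close>: for a cyclic representation \<open>v\<close> with cyclic vector \<open>\<xi>\<close>, sending \<open>\<eta>\<close> to the function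
  \<open>g \<mapsto> \<langle>\<eta>, v g \<xi>\<rangle>\<close> is injective, and every representation is a direct sum of cyclic ones.\<close>

definition universal_norm ::
    "('g, 'm) monoid_scheme \<Rightarrow> 'g topology \<Rightarrow> ('g \<Rightarrow> complex) \<Rightarrow> real" where
  "universal_norm G T f =
     Sup {op_norm K (hnorm K) (integrated_form G T K v f) | (K :: ('g \<Rightarrow> complex) hilbert) v.
            hilbert_space K \<and> v \<in> unitary_reps G T K}"

definition convolution_algebra ::
    "('g, 'm) monoid_scheme \<Rightarrow> 'g topology \<Rightarrow> ('g \<Rightarrow> complex) star_algebra" where
  "convolution_algebra G T =
     \<lparr>carrier = cont_funs T,
      monoid.mult = (\<lambda>f h. \<lambda>s\<in>carrier G.
                haar_integral G T (\<lambda>t\<in>carrier G. f t * h (inv\<^bsub>G\<^esub> t \<otimes>\<^bsub>G\<^esub> s))),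
      monoid.one = undefined,
      ring.zero = (\<lambda>s\<in>carrier G. 0),
      ring.add = (\<lambda>f h. \<lambda>s\<in>carrier G. f s + h s),
      module.smult = (\<lambda>c f. \<lambda>s\<in>carrier G. c * f s),
      star = (\<lambda>f. \<lambda>s\<in>carrier G. cnj (f (inv\<^bsub>G\<^esub> s))),
      anorm = universal_norm G T\<rparr>"

definition group_cstar ::
    "('g, 'm) monoid_scheme \<Rightarrow> 'g topology \<Rightarrow> ((nat \<Rightarrow> 'g \<Rightarrow> complex) set) star_algebra" where
  "group_cstar G T = completion (convolution_algebra G T)"

text \<open>The map from the measure algebra to \<open>M(C*(G))\<close>: a measure \<open>\<mu>\<close> acts on \<open>C(G)\<close> by
  \<open>f \<mapsto> \<mu> * f\<close> and \<open>f \<mapsto> f * \<mu>\<close>.\<close>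

definition measure_multiplier ::
    "('g, 'm) monoid_scheme \<Rightarrow> 'g topology \<Rightarrow> (('g \<Rightarrow> complex) \<Rightarrow> complex)
      \<Rightarrow> ((nat \<Rightarrow> 'g \<Rightarrow> complex) set \<Rightarrow> (nat \<Rightarrow> 'g \<Rightarrow> complex) set) \<times>
         ((nat \<Rightarrow> 'g \<Rightarrow> complex) set \<Rightarrow> (nat \<Rightarrow> 'g \<Rightarrow> complex) set)" where
  "measure_multiplier G T \<mu> =
     (THE m. m \<in> multipliers (group_cstar G T) \<and>
        (\<forall>f\<in>cont_funs T.
           fst m (completion_embedding (convolution_algebra G T) f) =
             completion_embedding (convolution_algebra G T)
               (\<lambda>s\<in>carrier G. \<mu> (\<lambda>t\<in>carrier G. f (inv\<^bsub>G\<^esub> t \<otimes>\<^bsub>G\<^esub> s))) \<and>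
           snd m (completion_embedding (convolution_algebra G T) f) =
             completion_embedding (convolution_algebra G T)
               (\<lambda>s\<in>carrier G. \<mu> (\<lambda>t\<in>carrier G. f (s \<otimes>\<^bsub>G\<^esub> inv\<^bsub>G\<^esub> t)))))"

definition canonical_unitary ::
    "('g, 'm) monoid_scheme \<Rightarrow> 'g topology \<Rightarrow> 'g
      \<Rightarrow> ((nat \<Rightarrow> 'g \<Rightarrow> complex) set \<Rightarrow> (nat \<Rightarrow> 'g \<Rightarrow> complex) set) \<times>
         ((nat \<Rightarrow> 'g \<Rightarrow> complex) set \<Rightarrow> (nat \<Rightarrow> 'g \<Rightarrow> complex) set)" where
  "canonical_unitary G T g = measure_multiplier G T (point_mass T g)"

definition corresponding_rep ::
    "('g, 'm) monoid_scheme \<Rightarrow> 'g topology \<Rightarrow> 'h hilbert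
      \<Rightarrow> ((nat \<Rightarrow> 'g \<Rightarrow> complex) set \<Rightarrow> 'h \<Rightarrow> 'h) \<Rightarrow> 'g \<Rightarrow> 'h \<Rightarrow> 'h" where
  "corresponding_rep G T H \<pi> =
     (\<lambda>g\<in>carrier G.
        multiplier_extension (group_cstar G T) (bounded_ops H) \<pi> (canonical_unitary G T g))"

section \<open>The pro-C*-algebra of a group\<close>

definition finite_index_normal ::
    "('g, 'm) monoid_scheme \<Rightarrow> 'g topology \<Rightarrow> 'g set set" where
  "finite_index_normal G T = {N. N \<lhd> G \<and> closedin T N \<and> finite (rcosets\<^bsub>G\<^esub> N)}"

text \<open>Closed subgroups of finite index are open, so the quotient topology on \<open>G/N\<close> is
  discrete.\<close>

definition quotient_cstar ::
    "('g, 'm) monoid_scheme \<Rightarrow> 'g set \<Rightarrow> ((nat \<Rightarrow> 'g set \<Rightarrow> complex) set) star_algebra" where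
  "quotient_cstar G N = group_cstar (G Mod N) (discrete_topology (carrier (G Mod N)))"

text \<open>The extension of \<open>\<kappa>\<^sub>N\<close> takes values in \<open>C*(G/N)\<close>, whereas \<open>u\<^bsub>gN\<^esub>\<close> is formally an
  element of \<open>M(C*(G/N))\<close>; they are compared there.\<close>

definition kappa ::
    "('g, 'm) monoid_scheme \<Rightarrow> 'g topology \<Rightarrow> 'g set
      \<Rightarrow> (nat \<Rightarrow> 'g \<Rightarrow> complex) set \<Rightarrow> (nat \<Rightarrow> 'g set \<Rightarrow> complex) set" where
  "kappa G T N =
     (THE \<phi>. \<phi> \<in> star_homs (group_cstar G T) (quotient_cstar G N) \<and>
        \<phi> ` carrier (group_cstar G T) = carrier (quotient_cstar G N) \<and>
        (\<forall>g\<in>carrier G.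
           multiplier_embedding (quotient_cstar G N)
             (multiplier_extension (group_cstar G T) (quotient_cstar G N) \<phi>
               (canonical_unitary G T g)) =
           canonical_unitary (G Mod N) (discrete_topology (carrier (G Mod N))) (g <#\<^bsub>G\<^esub> N)))"

definition pro_seminorm ::
    "('g, 'm) monoid_scheme \<Rightarrow> 'g topology \<Rightarrow> 'g set \<Rightarrow> (nat \<Rightarrow> 'g \<Rightarrow> complex) set \<Rightarrow> real" where
  "pro_seminorm G T N a = anorm (quotient_cstar G N) (kappa G T N a)"

definition pro_topology ::
    "('g, 'm) monoid_scheme \<Rightarrow> 'g topology \<Rightarrow> (nat \<Rightarrow> 'g \<Rightarrow> complex) set topology" where
  "pro_topology G T =
     topology_generated_by
       {{b \<in> carrier (group_cstar G T). pro_seminorm G T N (b \<ominus>\<^bsub>group_cstar G T\<^esub> a) < e} | N a e.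
          N \<in> finite_index_normal G T \<and> a \<in> carrier (group_cstar G T) \<and> e > 0}"

definition pro_continuous ::
    "('g, 'm) monoid_scheme \<Rightarrow> 'g topology \<Rightarrow> 'h hilbert
      \<Rightarrow> ((nat \<Rightarrow> 'g \<Rightarrow> complex) set \<Rightarrow> 'h \<Rightarrow> 'h) \<Rightarrow> bool" where
  "pro_continuous G T H \<pi> \<longleftrightarrow>
     continuous_map (pro_topology G T)
       (norm_topology (bounded_ops H) (anorm (bounded_ops H))) \<pi>"

end

theory Submission imports Defs begin

text \<open>
  A continuous representation \<open>\<pi>\<close> is bounded on a neighbourhood of \<open>0\<close>. Such a neighbourhood contains
  all multiples of \<open>u\<^sub>n a - a\<close> for \<open>n\<close> in a suitable \<open>N\<close>, because \<open>\<kappa>\<^sub>N\<close> annihilates these elements; so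
  \<open>\<pi>\<close> annihilates them too, and the unitary representation is trivial on \<open>N\<close>. Conversely,
  a representation with finite range is trivial on its kernel \<open>N\<close>, which is closed of finite index. The
  normalised indicator function \<open>e\<close> of \<open>N\<close> is then mapped to the identity, so that
  \<open>\<parallel>\<pi> a\<parallel> \<le> \<parallel>e a\<parallel> \<le> \<parallel>\<kappa>\<^sub>N a\<parallel>\<close>, the last step because functions on \<open>G/N\<close> embed isometrically as the
  \<open>N\<close>-invariant functions on \<open>G\<close>. Everything rests on the fact that continuous functions on a profinite
  group are uniformly close to functions that are constant on the cosets of some \<open>N\<close>; in particular the
  Haar integral is the limit of the averages over \<open>G/N\<close>.
\<close>

section \<open>Complex vector spaces\<close>

text \<open>Most objects of the statement are specified by \<open>THE\<close>: adjoints, the Haar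
  integral, integrated forms, multipliers of point masses, extensions to multipliers and
  \<open>kappa\<close> say nothing until existence and uniqueness are established, and much of the
  development does only that. Two obstacles shape the rest. First, \<open>universal_norm\<close>
  ranges over Hilbert spaces of functions on the group, while \<open>H\<close> is arbitrary;
  \<open>vf_le_un\<close> therefore transports cyclic subspaces along matrix coefficients. Second,
  integrals with values in the group algebra are never formed: \<open>average_principle\<close>
  replaces them by finite sums over cosets, which lie in a closed subspace whenever their summands
  do. Contractivity of homomorphisms is drawn from a square root in a Banach star algebra. The
  functions \<open>eM M\<close> carry the argument twice over: they form a central approximate unit,
  and their translates span a dense subspace, so that a bounded homomorphism is determined by its
  values there. This settles both the uniqueness of \<open>kappa\<close> and the injectivity of the
  correspondence.\<close>

lemma complex_ring_simps [simp]:
  "carrier complex_ring = UNIV" "a \<otimes>\<^bsub>complex_ring\<^esub> b = a * b" "\<one>\<^bsub>complex_ring\<^esub> = 1"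
  "\<zero>\<^bsub>complex_ring\<^esub> = 0" "a \<oplus>\<^bsub>complex_ring\<^esub> b = a + b"
  by (simp_all add: complex_ring_def)

lemma cring_complex_ring: "cring complex_ring"
proof (rule cringI)
  show "abelian_group complex_ring"
    by (rule abelian_groupI) (auto simp: algebra_simps intro: exI[of _ "- x" for x])
  show "comm_monoid complex_ring"
    by (rule comm_monoidI) (auto simp: algebra_simps)
qed (auto simp: algebra_simps)

text \<open>Over the complex numbers \<open>(-1) \<odot> x\<close> supplies the additive inverse,
  which the last assumption makes cancel \<open>x\<close>; negation is thus covered by the axioms
  for scalars.\<close>

lemma complex_moduleI:
  fixes V (structure)
  assumes "\<And>x y. x \<in> carrier V ==> y \<in> carrier V ==> x \<oplus> y \<in> carrier V"
    and "\<zero> \<in> carrier V"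
    and "\<And>c x. x \<in> carrier V ==> c \<odot>\<^bsub>V\<^esub> x \<in> carrier V"
    and "\<And>x y z. x \<in> carrier V ==> y \<in> carrier V ==> z \<in> carrier V ==> (x \<oplus> y) \<oplus> z = x \<oplus> (y \<oplus> z)"
    and "\<And>x y. x \<in> carrier V ==> y \<in> carrier V ==> x \<oplus> y = y \<oplus> x"
    and "\<And>x. x \<in> carrier V ==> \<zero> \<oplus> x = x"
    and "\<And>c d x. x \<in> carrier V ==> (c + d) \<odot>\<^bsub>V\<^esub> x = c \<odot>\<^bsub>V\<^esub> x \<oplus> d \<odot>\<^bsub>V\<^esub> x"
    and "\<And>c x y. x \<in> carrier V ==> y \<in> carrier V ==> c \<odot>\<^bsub>V\<^esub> (x \<oplus> y) = c \<odot>\<^bsub>V\<^esub> x \<oplus> c \<odot>\<^bsub>V\<^esub> y"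
    and "\<And>c d x. x \<in> carrier V ==> (c * d) \<odot>\<^bsub>V\<^esub> x = c \<odot>\<^bsub>V\<^esub> (d \<odot>\<^bsub>V\<^esub> x)"
    and "\<And>x. x \<in> carrier V ==> 1 \<odot>\<^bsub>V\<^esub> x = x"
    and "\<And>x. x \<in> carrier V ==> 0 \<odot>\<^bsub>V\<^esub> x = \<zero>"
  shows "Module.module complex_ring V"
proof (rule moduleI)
  show "abelian_group V"
  proof (rule abelian_groupI)
    fix x assume x: "x \<in> carrier V"
    have "(-1) \<odot>\<^bsub>V\<^esub> x \<oplus> x = \<zero>"
      using assms(7)[OF x, of "-1" 1] assms(10,11)[OF x] by simp
    then show "\<exists>y\<in>carrier V. y \<oplus> x = \<zero>" using assms(3)[OF x] by blast
  qed (use assms in auto)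
qed (use assms cring_complex_ring in auto)

locale complex_module = fixes V :: "(complex, 'a, 'x) module_scheme" (structure)
  assumes module: "Module.module complex_ring V"
begin

abbreviation VV where "VV \<equiv> carrier V"

sublocale M: Module.module complex_ring V by (rule module)

lemma smult_one [simp]: "x \<in> VV ==> 1 \<odot> x = x"
  using M.smult_one[of x] by simp

lemma smult_zero [simp]: "x \<in> VV ==> 0 \<odot> x = \<zero>"
  using M.smult_l_null[of x] by simp

lemma smult_closed [simp, intro]: "x \<in> VV ==> c \<odot> x \<in> VV"
  using M.smult_closed[of c x] by simp

lemma smult_add: "x \<in> VV ==> (c + d) \<odot> x = c \<odot> x \<oplus> d \<odot> x"
  using M.smult_l_distr[of c d x] by simp

lemma smult_add_right: "x \<in> VV ==> y \<in> VV ==> c \<odot> (x \<oplus> y) = c \<odot> x \<oplus> c \<odot> y"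
  using M.smult_r_distr[of c x y] by simp

lemma smult_smult [simp]: "x \<in> VV ==> c \<odot> (d \<odot> x) = (c * d) \<odot> x"
  using M.smult_assoc1[of c d x] by simp

lemma smult_zero_right [simp]: "c \<odot> \<zero> = \<zero>"
  using M.smult_r_null[of c] by simp

lemma minus_eq_smult: "x \<in> VV ==> \<ominus> x = (-1) \<odot> x"
  using smult_add[of x "-1" 1] by (intro M.minus_equality) auto

lemma diff_eq: "x \<in> VV ==> y \<in> VV ==> x \<ominus> y = x \<oplus> (-1) \<odot> y"
  by (simp add: M.minus_eq minus_eq_smult)

lemma diff_zero [simp]: "x \<in> VV ==> x \<ominus> \<zero> = x"
  by (simp add: diff_eq)

lemma diff_self [simp]: "x \<in> VV ==> x \<ominus> x = \<zero>"
  by (simp add: M.minus_eq M.r_neg)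

lemma add_diff_cancel: "x \<in> VV ==> y \<in> VV ==> (x \<ominus> y) \<oplus> y = x"
  by (simp add: M.minus_eq M.a_assoc M.l_neg)

lemma diff_add_diff: 
  "x \<in> VV ==> y \<in> VV ==> z \<in> VV ==> (x \<ominus> y) \<oplus> (y \<ominus> z) = x \<ominus> z"
  by (simp add: M.minus_eq M.a_assoc M.r_neg1)

lemma diff_eq_zero: "x \<in> VV ==> y \<in> VV ==> x \<ominus> y = \<zero> ==> x = y"
  by (metis M.l_zero add_diff_cancel)

lemma add_diff_add:
  assumes "x \<in> VV" "y \<in> VV" "z \<in> VV" "w \<in> VV"
  shows "(x \<oplus> y) \<ominus> (z \<oplus> w) = (x \<ominus> z) \<oplus> (y \<ominus> w)"
  using assms by (simp add: diff_eq smult_add_right M.a_ac)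

lemma smult_diff:
  "x \<in> VV ==> y \<in> VV ==> c \<odot> (x \<ominus> y) = c \<odot> x \<ominus> c \<odot> y"
  by (simp add: diff_eq smult_add_right)

lemma diff_diff_swap: "x \<in> VV ==> y \<in> VV ==> y \<ominus> x = (-1) \<odot> (x \<ominus> y)"
  by (simp add: diff_eq smult_add_right M.a_comm)

end

section \<open>Seminorms, convergence and closed subspaces\<close>

locale seminormed_module = complex_module V for V :: "(complex, 'a, 'x) module_scheme" (structure) +
  fixes nrm :: "'a \<Rightarrow> real"
  assumes nrm_add: "\<lbrakk>x \<in> carrier V; y \<in> carrier V\<rbrakk> \<Longrightarrow> nrm (x \<oplus> y) \<le> nrm x + nrm y"
    and nrm_smult: "x \<in> carrier V ==> nrm (c \<odot> x) = cmod c * nrm x"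
begin

lemma nrm_zero [simp]: "nrm \<zero> = 0"
  using nrm_smult[of "\<zero>" 0] by simp

lemma nrm_nonneg: "x \<in> VV ==> nrm x \<ge> 0"
proof -
  assume x: "x \<in> VV"
  have "nrm (x \<ominus> x) \<le> nrm x + cmod (-1) * nrm x"
    using nrm_add[of x "(-1) \<odot> x"] x by (simp add: diff_eq nrm_smult del: diff_self)
  then show ?thesis using x by simp
qed

lemma nrm_diff_swap: "x \<in> VV ==> y \<in> VV ==> nrm (x \<ominus> y) = nrm (y \<ominus> x)"
  by (simp add: diff_diff_swap[of x y] nrm_smult)

lemma nrm_diff_triangle:
  "x \<in> VV ==> y \<in> VV ==> z \<in> VV ==> nrm (x \<ominus> z) \<le> nrm (x \<ominus> y) + nrm (y \<ominus> z)"
  using nrm_add[of "x \<ominus> y" "y \<ominus> z"] by (simp add: diff_add_diff)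

lemma nrm_triangle_rev: "x \<in> VV ==> y \<in> VV ==> \<bar>nrm x - nrm y\<bar> \<le> nrm (x \<ominus> y)"
  using nrm_diff_triangle[of x y "\<zero>"] nrm_diff_triangle[of y x "\<zero>"] nrm_diff_swap[of x y] by auto

definition tends :: "(nat \<Rightarrow> 'a) \<Rightarrow> 'a \<Rightarrow> bool" where
  "tends u x \<longleftrightarrow> (\<lambda>n. nrm (u n \<ominus> x)) \<longlonglongrightarrow> 0"

text \<open>Closure is phrased by approximation, which makes sense for a seminorm;
  \<open>closed_subspace_iff\<close> matches it with the closed submodules of
  \<open>closed_span\<close> in the normed case.\<close>

definition closed_subspace :: "'a set \<Rightarrow> bool" where
  "closed_subspace S \<longleftrightarrow> S \<subseteq> VV \<and> \<zero> \<in> S \<and> (\<forall>x\<in>S. \<forall>y\<in>S. x \<oplus> y \<in> S) \<and> (\<forall>c. \<forall>x\<in>S. c \<odot> x \<in> S) \<and>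
     (\<forall>x\<in>VV. (\<forall>e>0. \<exists>y\<in>S. nrm (y \<ominus> x) < e) \<longrightarrow> x \<in> S)"

lemma closed_subspaceI:
  assumes "S \<subseteq> VV" "\<zero> \<in> S" "\<And>x y. x \<in> S ==> y \<in> S ==> x \<oplus> y \<in> S"
    "\<And>c x. x \<in> S ==> c \<odot> x \<in> S"
    "\<And>x. x \<in> VV ==> (\<And>e. e > 0 ==> \<exists>y\<in>S. nrm (y \<ominus> x) < e) ==> x \<in> S"
  shows "closed_subspace S"
  using assms unfolding closed_subspace_def by blast

end

locale normed_module = seminormed_module V nrm for V :: "(complex, 'a, 'x) module_scheme" (structure) and nrm +
  assumes nrm_definite: "x \<in> carrier V ==> nrm x = 0 ==> x = \<zero>"
begin

lemma Metric_space_norm_dist: "Metric_space (VV) (norm_dist V nrm)"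
proof
  fix x y z
  show "0 \<le> norm_dist V nrm x y" by (auto simp: norm_dist_def intro: nrm_nonneg)
  show "norm_dist V nrm x y = norm_dist V nrm y x" by (simp add: norm_dist_def nrm_diff_swap)
  assume x: "x \<in> VV" and y: "y \<in> VV"
  then show "norm_dist V nrm x y = 0 \<longleftrightarrow> x = y"
    by (auto simp: norm_dist_def intro: diff_eq_zero nrm_definite)
  assume "z \<in> VV"
  with x y show "norm_dist V nrm x z \<le> norm_dist V nrm x y + norm_dist V nrm y z"
    by (simp add: norm_dist_def nrm_diff_triangle)
qed

sublocale MS: Metric_space "VV" "norm_dist V nrm" by (rule Metric_space_norm_dist)

lemma topspace_norm_topology [simp]: "topspace (norm_topology V nrm) = VV"
  by (simp add: norm_topology_def)

lemma openin_norm_topology: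
  "openin (norm_topology V nrm) U \<longleftrightarrow>
     U \<subseteq> VV \<and> (\<forall>x\<in>U. \<exists>r>0. \<forall>y\<in>VV. nrm (y \<ominus> x) < r \<longrightarrow> y \<in> U)"
proof -
  have "MS.mball x r = {y \<in> VV. nrm (y \<ominus> x) < r}" if "x \<in> VV" for x r
    using that by (auto simp: norm_dist_def nrm_diff_swap)
  then have "U \<subseteq> VV ==> x \<in> U ==> MS.mball x r \<subseteq> U \<longleftrightarrow> (\<forall>y\<in>VV. nrm (y \<ominus> x) < r \<longrightarrow> y \<in> U)"
    for x r by blast
  then show ?thesis unfolding norm_topology_def MS.openin_mtopology by blast
qed

lemma closedin_norm_topology:
  "closedin (norm_topology V nrm) S \<longleftrightarrow>
     S \<subseteq> VV \<and> (\<forall>x\<in>VV. (\<forall>e>0. \<exists>y\<in>S. nrm (y \<ominus> x) < e) \<longrightarrow> x \<in> S)"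
  unfolding closedin_def openin_norm_topology
  by (simp, intro conj_cong refl) blast

lemma continuous_map_norm_topology:
  "continuous_map Y (norm_topology V nrm) f \<longleftrightarrow>
     f \<in> topspace Y \<rightarrow> VV \<and>
     (\<forall>x\<in>topspace Y. \<forall>e>0. \<exists>U. openin Y U \<and> x \<in> U \<and> (\<forall>y\<in>U. nrm (f y \<ominus> f x) < e))"
    (is "?L \<longleftrightarrow> ?R")
proof (cases "f \<in> topspace Y \<rightarrow> VV")
  case True
  have e: "f y \<in> MS.mball (f x) e \<longleftrightarrow> nrm (f y \<ominus> f x) < e" if "x \<in> topspace Y" "y \<in> topspace Y" for x y e
    using that True nrm_diff_swap[of "f x" "f y"] by (auto simp: norm_dist_def Pi_iff)
  have "(\<exists>U. openin Y U \<and> x \<in> U \<and> (\<forall>y\<in>U. f y \<in> MS.mball (f x) e)) \<longleftrightarrow>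
        (\<exists>U. openin Y U \<and> x \<in> U \<and> (\<forall>y\<in>U. nrm (f y \<ominus> f x) < e))" if "x \<in> topspace Y" for x e
  proof -
    have "(\<forall>y\<in>U. f y \<in> MS.mball (f x) e) \<longleftrightarrow> (\<forall>y\<in>U. nrm (f y \<ominus> f x) < e)" if "openin Y U" for U
      using e[OF \<open>x \<in> topspace Y\<close>] openin_subset[OF that] by (intro ball_cong refl) blast
    then show ?thesis by blast
  qed
  then have "?L \<longleftrightarrow> (\<forall>x\<in>topspace Y. \<forall>e>0. \<exists>U. openin Y U \<and> x \<in> U \<and> (\<forall>y\<in>U. nrm (f y \<ominus> f x) < e))"
    unfolding norm_topology_def MS.continuous_map_to_metric
    by (intro ball_cong refl arg_cong[where f = All] ext imp_cong) auto
  then show ?thesis using True by blast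
next
  case False
  then show ?thesis using continuous_map_funspace[of Y "norm_topology V nrm" f] by auto
qed

lemma mcomplete_iff:
  "MS.mcomplete \<longleftrightarrow> (\<forall>u. (\<forall>n. u n \<in> VV) \<and> (\<forall>e>0. \<exists>N. \<forall>m\<ge>N. \<forall>n\<ge>N. nrm (u m \<ominus> u n) < e) \<longrightarrow>
     (\<exists>x\<in>VV. tends u x))" (is "?L \<longleftrightarrow> ?R")
proof -
  have c: "MS.MCauchy u \<longleftrightarrow> (\<forall>n. u n \<in> VV) \<and> (\<forall>e>0. \<exists>N. \<forall>m\<ge>N. \<forall>n\<ge>N. nrm (u m \<ominus> u n) < e)" for u
  proof (cases "\<forall>n. u n \<in> VV")
    case True
    then show ?thesis unfolding MS.MCauchy_def by (simp add: norm_dist_def image_subset_iff)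
  qed (auto simp: MS.MCauchy_def)
  have l: "limitin MS.mtopology u x sequentially \<longleftrightarrow> x \<in> VV \<and> tends u x" if "\<forall>n. u n \<in> VV" for u x
  proof (cases "x \<in> VV")
    case True
    have "dist (nrm (u n \<ominus> x)) 0 = norm_dist V nrm (u n) x" for n
      using that True nrm_nonneg[of "u n \<ominus> x"] by (simp add: norm_dist_def)
    then show ?thesis
      using that True by (simp add: MS.limitin_metric tends_def tendsto_iff)
  qed (simp add: MS.limitin_metric)
  show ?thesis unfolding MS.mcomplete_def c
    by (intro arg_cong[where f = All] ext imp_cong) (auto simp: l)
qed

end

section \<open>Hilbert spaces\<close>

locale hilbert = fixes H :: "'h hilbert" (structure)
  assumes hilbert_space: "hilbert_space H"
begin

abbreviation HH where "HH \<equiv> carrier H"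

sublocale complex_module H
  using hilbert_space by (intro complex_module.intro) (simp add: hilbert_space_def)

abbreviation ip :: "'h \<Rightarrow> 'h \<Rightarrow> complex" where "ip \<equiv> hinner H"
abbreviation hn :: "'h \<Rightarrow> real" where "hn \<equiv> hnorm H"

lemma ip_add_left [simp]:
  "\<lbrakk>x \<in> HH; y \<in> HH; z \<in> HH\<rbrakk> \<Longrightarrow> ip (x \<oplus> y) z = ip x z + ip y z"
  using hilbert_space unfolding hilbert_space_def by blast

lemma ip_smult_left [simp]:
  "\<lbrakk>x \<in> HH; y \<in> HH\<rbrakk> \<Longrightarrow> ip (c \<odot> x) y = c * ip x y"
  using hilbert_space unfolding hilbert_space_def by blast

lemma ip_cnj: "\<lbrakk>x \<in> HH; y \<in> HH\<rbrakk> \<Longrightarrow> ip y x = cnj (ip x y)"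
  using hilbert_space unfolding hilbert_space_def by blast

lemma ip_add_right [simp]:
  "\<lbrakk>x \<in> HH; y \<in> HH; z \<in> HH\<rbrakk> \<Longrightarrow> ip x (y \<oplus> z) = ip x y + ip x z"
  by (metis M.a_closed complex_cnj_add ip_add_left ip_cnj)

lemma ip_smult_right [simp]:
  "\<lbrakk>x \<in> HH; y \<in> HH\<rbrakk> \<Longrightarrow> ip x (c \<odot> y) = cnj c * ip x y"
  by (metis complex_cnj_mult ip_cnj ip_smult_left smult_closed)

lemma ip_zero [simp]: "x \<in> HH ==> ip \<zero> x = 0" "x \<in> HH ==> ip x \<zero> = 0"
  using ip_smult_left[of \<zero> x 0] ip_smult_right[of x \<zero> 0] by simp_all

lemma ip_diff [simp]:
  assumes "x \<in> HH" "y \<in> HH" "z \<in> HH"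
  shows "ip (x \<ominus> y) z = ip x z - ip y z" "ip z (x \<ominus> y) = ip z x - ip z y"
  using assms by (simp_all add: diff_eq)

lemma ip_self: "x \<in> HH ==> ip x x = complex_of_real ((hn x)\<^sup>2)"
proof -
  assume "x \<in> HH"
  then have "ip x x \<in> \<real>\<^sub>\<ge>\<^sub>0" using hilbert_space unfolding hilbert_space_def by blast
  then show ?thesis by (auto simp: hnorm_def complex_nonneg_Reals_iff complex_eq_iff)
qed

lemma ip_self_zero: "x \<in> HH ==> ip x x = 0 ==> x = \<zero>"
  using hilbert_space unfolding hilbert_space_def by blast

lemma hn_nonneg [simp]: "x \<in> HH ==> hn x \<ge> 0"
proof -
  assume "x \<in> HH"
  then have "ip x x \<in> \<real>\<^sub>\<ge>\<^sub>0" using hilbert_space unfolding hilbert_space_def by blast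
  then show ?thesis by (simp add: hnorm_def complex_nonneg_Reals_iff)
qed

lemma hn_power2: "x \<in> HH ==> (hn x)\<^sup>2 = Re (ip x x)"
  by (simp add: ip_self)

lemma ip_ext:
  assumes "x \<in> HH" "y \<in> HH" "\<And>z. z \<in> HH ==> ip x z = ip y z"
  shows "x = y"
proof -
  have "ip (x \<ominus> y) (x \<ominus> y) = 0" using assms by simp
  then have "x \<ominus> y = \<zero>" using assms by (intro ip_self_zero) auto
  then show ?thesis using assms diff_eq_zero by blast
qed

lemma Cauchy_Schwarz:
  assumes x: "x \<in> HH" and y: "y \<in> HH"
  shows "cmod (ip x y) \<le> hn x * hn y"
proof (cases "ip y y = 0")
  case True
  then show ?thesis using x y ip_self_zero[of y] by simp
next
  case False
  \<comment> \<open>The coefficient of the orthogonal projection of \<open>x\<close> onto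
    \<open>y\<close>; positivity of the remainder \<open>?z\<close> is the inequality.\<close>
  define c where "c = ip x y / ip y y"
  have r: "ip y y = complex_of_real ((hn y)\<^sup>2)" using y by (rule ip_self)
  have hy: "(hn y)\<^sup>2 > 0" using False r by auto
  have yx: "ip y x = cnj (ip x y)" using x y by (rule ip_cnj)
  let ?z = "x \<ominus> c \<odot> y"
  have "ip ?z ?z = ip x x - cnj c * ip x y - c * ip y x + c * cnj c * ip y y"
    using x y by (simp add: algebra_simps)
  also have "\<dots> = ip x x - ip x y * cnj (ip x y) / ip y y"
    using False unfolding yx c_def by (simp add: r field_simps power2_eq_square)
  also have "\<dots> = complex_of_real ((hn x)\<^sup>2 - (cmod (ip x y))\<^sup>2 / (hn y)\<^sup>2)"
    using x by (simp add: ip_self r complex_norm_square del: of_real_power)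
  finally have "Re (ip ?z ?z) = (hn x)\<^sup>2 - (cmod (ip x y))\<^sup>2 / (hn y)\<^sup>2" by simp
  moreover have "Re (ip ?z ?z) \<ge> 0" using x y by (subst hn_power2[symmetric]) auto
  ultimately have "(cmod (ip x y))\<^sup>2 / (hn y)\<^sup>2 \<le> (hn x)\<^sup>2" by linarith
  then have "(cmod (ip x y))\<^sup>2 \<le> (hn x * hn y)\<^sup>2"
    unfolding pos_divide_le_eq[OF hy] power_mult_distrib .
  then show ?thesis using x y by (auto intro: power2_le_imp_le)
qed

lemma hn_add_sq: 
  assumes "x \<in> HH" "y \<in> HH"
  shows "(hn (x \<oplus> y))\<^sup>2 = (hn x)\<^sup>2 + (hn y)\<^sup>2 + 2 * Re (ip x y)"
  using assms ip_cnj[of x y] by (simp add: hn_power2)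

sublocale normed_module H hn
proof
  fix x y assume x: "x \<in> HH" and y: "y \<in> HH"
  have "Re (ip x y) \<le> hn x * hn y" using Cauchy_Schwarz[OF x y] complex_Re_le_cmod order_trans by blast
  then have "(hn (x \<oplus> y))\<^sup>2 \<le> (hn x + hn y)\<^sup>2"
    using hn_add_sq[OF x y] by (simp add: power2_eq_square algebra_simps)
  then show "hn (x \<oplus> y) \<le> hn x + hn y" using x y by (auto intro: power2_le_imp_le)
next
  fix c x assume x: "x \<in> HH"
  have "ip (c \<odot> x) (c \<odot> x) = (c * cnj c) * ip x x" using x by simp
  also have "\<dots> = complex_of_real ((cmod c)\<^sup>2 * (hn x)\<^sup>2)"
    using x by (simp only: complex_norm_square[symmetric] ip_self of_real_mult)
  finally have "(hn (c \<odot> x))\<^sup>2 = (cmod c * hn x)\<^sup>2"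
    using x by (simp add: hn_power2[of "c \<odot> x"] power_mult_distrib del: of_real_mult of_real_power)
  then show "hn (c \<odot> x) = cmod c * hn x" using x power2_eq_iff_nonneg[of "hn (c \<odot> x)" "cmod c * hn x"] by simp
next
  fix x assume "x \<in> HH" "hn x = 0"
  then show "x = \<zero>" using ip_self[of x] ip_self_zero[of x] by simp
qed

lemma complete:
  assumes "\<And>n. u n \<in> HH" "\<And>e. e > 0 ==> \<exists>N. \<forall>m\<ge>N. \<forall>n\<ge>N. hn (u m \<ominus> u n) < e"
  obtains x where "x \<in> HH" "tends u x"
proof -
  have "MS.mcomplete" using hilbert_space unfolding hilbert_space_def by blast
  with assms have "\<exists>x\<in>HH. tends u x" unfolding mcomplete_iff by blast
  with that show thesis by blast
qed

lemma tends_ip: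
  assumes "tends u x" "\<And>n. u n \<in> HH" "x \<in> HH" "y \<in> HH"
  shows "(\<lambda>n. ip (u n) y) \<longlonglongrightarrow> ip x y"
proof -
  have "(\<lambda>n. hn (u n \<ominus> x) * hn y) \<longlonglongrightarrow> 0"
    using assms(1) unfolding tends_def by (rule tendsto_mult_left_zero)
  moreover have "cmod (ip (u n) y - ip x y) \<le> hn (u n \<ominus> x) * hn y" for n
    using Cauchy_Schwarz[of "u n \<ominus> x" y] assms by simp
  ultimately show ?thesis
    by (subst LIM_zero_iff[symmetric]) (rule Lim_null_comparison[OF always_eventually], auto)
qed

text \<open>Testing with \<open>y = x\<close> turns the hypothesis into
  \<open>hn x * hn x \<le> C * hn x\<close>.\<close>

lemma hn_eq_of_ip:
  assumes "x \<in> HH" "C \<ge> 0" "\<And>y. y \<in> HH ==> cmod (ip x y) \<le> C * hn y"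
  shows "hn x \<le> C"
proof -
  have "hn x * hn x \<le> C * hn x"
    using assms(3)[OF assms(1)] assms(1) by (simp add: ip_self norm_power power2_eq_square norm_mult)
  then show ?thesis using assms by (metis hn_nonneg mult_right_le_imp_le order_le_less order_trans)
qed

text \<open>The representing vector is the minimizer of \<open>\<parallel>x\<parallel>\<^sup>2 - 2 Re (f x)\<close>; the parallelogram law makes
  minimizing sequences Cauchy.\<close>

theorem Riesz:
  assumes add: "\<And>x y. x \<in> HH ==> y \<in> HH ==> f (x \<oplus> y) = f x + f y"
    and sm: "\<And>c x. x \<in> HH ==> f (c \<odot> x) = c * f x"
    and bd: "\<And>x. x \<in> HH ==> cmod (f x) \<le> C * hn x"
  obtains y where "y \<in> HH" "\<And>x. x \<in> HH ==> f x = ip x y"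
proof -
  have quarters: "a < r" if "a \<le> 2 * p + 2 * q" "p < r / 4" "q < r / 4" for a p q r :: real
    using that by linarith
  define Q where "Q x = (hn x)\<^sup>2 - 2 * Re (f x)" for x
  define m where "m = Inf (Q ` HH)"
  have Qge: "Q x \<ge> - C\<^sup>2" if "x \<in> HH" for x
  proof -
    have "Re (f x) \<le> C * hn x" using bd[OF that] complex_Re_le_cmod order_trans by blast
    then have "Q x \<ge> (hn x - C)\<^sup>2 - C\<^sup>2" unfolding Q_def by (simp add: power2_diff algebra_simps)
    then show ?thesis by (smt (verit) zero_le_power2)
  qed
  then have bdd: "bdd_below (Q ` HH)" by (rule bdd_belowI2)
  have mle: "m \<le> Q x" if "x \<in> HH" for x
    unfolding m_def using bdd that by (auto intro: cInf_lower)
  have "\<exists>x\<in>HH. Q x < m + e" if "e > 0" for e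
    using cInf_lessD[of "Q ` HH" "m + e"] that M.zero_closed unfolding m_def by fastforce
  then have "\<exists>u. \<forall>n. u n \<in> HH \<and> Q (u n) < m + inverse (real (Suc n))"
    by (intro choice) (metis inverse_positive_iff_positive of_nat_0_less_iff zero_less_Suc)
  then obtain u where u: "\<And>n. u n \<in> HH" "\<And>n. Q (u n) < m + inverse (real (Suc n))" by blast
  have par: "(hn (x \<ominus> y))\<^sup>2 \<le> 2 * (Q x - m) + 2 * (Q y - m)" if x: "x \<in> HH" and y: "y \<in> HH" for x y
  proof -
    let ?z = "(1/2) \<odot> (x \<oplus> y)"
    have yx: "Re (ip y x) = Re (ip x y)" using ip_cnj[OF x y] by simp
    have "(hn (x \<ominus> y))\<^sup>2 = 2 * Q x + 2 * Q y - 4 * Q ?z"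
      using x y by (simp add: Q_def hn_power2 add sm yx algebra_simps)
    then show ?thesis using mle[of ?z] x y by simp
  qed
  have "\<exists>N. \<forall>k\<ge>N. \<forall>n\<ge>N. hn (u k \<ominus> u n) < e" if e: "e > 0" for e
  proof -
    obtain N where N: "inverse (real (Suc N)) < e\<^sup>2 / 4"
      using reals_Archimedean[of "e\<^sup>2/4"] e by auto
    have s: "Q (u k) - m < e\<^sup>2/4" if "k \<ge> N" for k
    proof -
      have "inverse (real (Suc k)) \<le> inverse (real (Suc N))" using that by (intro le_imp_inverse_le) auto
      then show ?thesis using u(2)[of k] N by linarith
    qed
    have "hn (u k \<ominus> u n) < e" if "k \<ge> N" "n \<ge> N" for k n
    proof -
      have "(hn (u k \<ominus> u n))\<^sup>2 < e\<^sup>2" 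
        using quarters[OF par[OF u(1) u(1), of k n] s[OF that(1)] s[OF that(2)]] .
      then show ?thesis using e by (simp add: power2_less_imp_less)
    qed
    then show ?thesis by blast
  qed
  then obtain y where y: "y \<in> HH" "tends u y" using complete u(1) by blast
  have fd: "f (x \<ominus> z) = f x - f z" if "x \<in> HH" "z \<in> HH" for x z
    using that by (simp add: diff_eq add sm)
  have "(\<lambda>n. cmod (f (u n) - f y)) \<longlonglongrightarrow> 0"
  proof (rule tendsto_0_le[where K=C])
    show "(\<lambda>n. hn (u n \<ominus> y)) \<longlonglongrightarrow> 0" using y(2) by (simp add: tends_def)
    show "\<forall>\<^sub>F n in sequentially. norm (cmod (f (u n) - f y)) \<le> norm (hn (u n \<ominus> y)) * C"
      using bd[of "u _ \<ominus> y"] u(1) y(1) by (simp add: fd mult.commute)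
  qed
  then have f1: "(\<lambda>n. f (u n)) \<longlonglongrightarrow> f y" by (simp add: LIM_zero_iff tendsto_norm_zero_iff)
  have "(\<lambda>n. \<bar>hn (u n) - hn y\<bar>) \<longlonglongrightarrow> 0"
    using y(2) nrm_triangle_rev[OF u(1) y(1)] unfolding tends_def
    by (intro Lim_null_comparison[of "\<lambda>n. \<bar>hn (u n) - hn y\<bar>" "\<lambda>n. hn (u n \<ominus> y)"]) auto
  then have f2: "(\<lambda>n. hn (u n)) \<longlonglongrightarrow> hn y" by (simp add: LIM_zero_iff tendsto_rabs_zero_iff)
  have "(\<lambda>n. Q (u n)) \<longlonglongrightarrow> Q y" unfolding Q_def by (intro tendsto_intros f1 f2)
  moreover have "(\<lambda>n. m + inverse (real (Suc n))) \<longlonglongrightarrow> m + 0"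
    by (intro tendsto_intros LIMSEQ_inverse_real_of_nat)
  ultimately have "Q y \<le> m + 0"
    by (rule LIMSEQ_le) (intro exI allI impI less_imp_le u(2))
  then have Qy: "Q y \<le> m" by simp
  have key: "f x = ip x y" if x: "x \<in> HH" for x
  proof -
    define d where "d = ip x y - f x"
    define r where "r = (hn x)\<^sup>2"
    have xy: "ip y x = cnj (ip x y)" by (rule ip_cnj[OF x y(1)])
    \<comment> \<open>Moving from the minimizer \<open>y\<close> in direction
      \<open>t \<odot> x\<close> cannot lower \<open>Q\<close>; a defect \<open>d\<close> would show
      up in the term linear in \<open>t\<close>.\<close>
    have q: "0 \<le> 2 * Re (t * d) + (cmod t)\<^sup>2 * r" for t
    proof -
      have "Q (y \<oplus> t \<odot> x) = Q y + 2 * Re (t * d) + (cmod t)\<^sup>2 * r"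
        using x y(1) hn_add_sq[of y "t \<odot> x"]
        by (simp add: Q_def add sm nrm_smult r_def d_def xy power_mult_distrib algebra_simps)
      moreover have "Q (y \<oplus> t \<odot> x) \<ge> m" using mle x y by simp
      ultimately show ?thesis using Qy mle[OF y(1)] by simp
    qed
    have "d = 0"
    proof (rule ccontr)
      assume "d \<noteq> 0"
      \<comment> \<open>For \<open>t = - s * cnj d\<close> the inequality becomes
        \<open>0 \<le> s * (cmod d * cmod d) * (s * r - 2)\<close>. The choice of \<open>s\<close>
        keeps \<open>s * r\<close> below 1, also when \<open>r = 0\<close>.\<close>
      define s where "s = 1 / (r + 1)"
      have r0: "r \<ge> 0" unfolding r_def by simp
      have s: "s > 0" "s * r < 1" using r0 unfolding s_def by (auto simp: field_simps)
      have d2: "cmod d * cmod d > 0" using \<open>d \<noteq> 0\<close> by simp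
      have a: "Re (- complex_of_real s * cnj d * d) = - s * (cmod d * cmod d)"
        by (metis (no_types, opaque_lifting) Re_complex_of_real complex_norm_square mult.assoc mult.commute mult_minus_left of_real_minus of_real_mult power2_eq_square)
      have b: "(cmod (- complex_of_real s * cnj d))\<^sup>2 = s * s * (cmod d * cmod d)"
        using s by (simp add: norm_mult power2_eq_square)
      have "0 \<le> s * (cmod d * cmod d) * (s * r - 2)"
        using q[of "- complex_of_real s * cnj d"] unfolding a b by (simp add: algebra_simps)
      moreover have "s * (cmod d * cmod d) * (s * r - 2) < 0"
        using s d2 by (intro mult_pos_neg) auto
      ultimately show False by linarith
    qed
    then show ?thesis by (simp add: d_def)
  qed
  from that[OF y(1) key] show thesis .
qed

text \<open>For fixed \<open>x\<close>, the conjugate of \<open>B x y\<close> is linear in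
  \<open>y\<close>, so \<open>Riesz\<close> represents it by a vector, which is taken as
  \<open>S x\<close>. Adjoints, integrated forms and extensions to multipliers are all obtained this
  way.\<close>

theorem form_to_operator:
  assumes add1: "\<And>x y z. x \<in> HH ==> y \<in> HH ==> z \<in> HH ==> B (x \<oplus> y) z = B x z + B y z"
    and sm1: "\<And>c x y. x \<in> HH ==> y \<in> HH ==> B (c \<odot> x) y = c * B x y"
    and add2: "\<And>x y z. x \<in> HH ==> y \<in> HH ==> z \<in> HH ==> B x (y \<oplus> z) = B x y + B x z"
    and sm2: "\<And>c x y. x \<in> HH ==> y \<in> HH ==> B x (c \<odot> y) = cnj c * B x y"
    and bd: "\<And>x y. x \<in> HH ==> y \<in> HH ==> cmod (B x y) \<le> C * hn x * hn y"
  obtains S where "S \<in> bounded_maps H hn"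
    "\<And>x y. x \<in> HH ==> y \<in> HH ==> ip (S x) y = B x y"
proof -
  have "\<exists>w\<in>HH. \<forall>y\<in>HH. ip w y = B x y" if x: "x \<in> HH" for x
  proof -
    obtain w where w: "w \<in> HH" "\<And>y. y \<in> HH ==> cnj (B x y) = ip y w"
      using Riesz[of "\<lambda>y. cnj (B x y)" "C * hn x"] x add2 sm2 bd by auto
    then have "ip w y = B x y" if "y \<in> HH" for y using that
      by (metis complex_cnj_cnj ip_cnj)
    then show ?thesis using w(1) by blast
  qed
  then obtain S where S: "\<And>x. x \<in> HH ==> S x \<in> HH"
    "\<And>x y. x \<in> HH ==> y \<in> HH ==> ip (S x) y = B x y" by metis
  \<comment> \<open>\<open>C\<close> may be negative, for instance when \<open>H\<close> is the zero
    space, while \<open>hn_eq_of_ip\<close> asks for a nonnegative constant.\<close>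
  define D where "D = \<bar>C\<bar>"
  have "hn (S x) \<le> D * hn x" if x: "x \<in> HH" for x
  proof (rule hn_eq_of_ip)
    fix y assume y: "y \<in> HH"
    have "C * hn x * hn y \<le> D * hn x * hn y" using x y unfolding D_def by (intro mult_right_mono) auto
    then show "cmod (ip (S x) y) \<le> D * hn x * hn y" using bd[OF x y] S(2)[OF x y] by simp
  qed (use x S D_def in auto)
  note bound = this
  have Sadd: "S (x \<oplus> y) = S x \<oplus> S y" if "x \<in> HH" "y \<in> HH" for x y
    using that S by (intro ip_ext) (simp_all add: add1)
  have Ssm: "S (c \<odot> x) = c \<odot> S x" if "x \<in> HH" for c x
    using that S by (intro ip_ext) (simp_all add: sm1)
  have "restrict S (HH) \<in> linear_maps H H"
    unfolding linear_maps_def by (simp add: S(1) Sadd Ssm)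
  then have bm: "restrict S (HH) \<in> bounded_maps H hn"
    unfolding bounded_maps_def using bound by (auto intro: exI[of _ D])
  show thesis
    by (rule that[OF bm]) (simp add: S(2))
qed

end

section \<open>Haar integration on profinite groups\<close>

text \<open>Restricted functions are evaluated only at points known to lie in the carrier; the
  unconditional rule would leave a case distinction behind every application.\<close>

declare restrict_apply [simp del] restrict_apply' [simp]

text \<open>Identities between integrals are reduced to this form: both sides are compared with
  averages over cosets, at the cost of a fixed multiple of the oscillation \<open>e\<close>.\<close>

lemma zero_if_arbitrarily_small:
  fixes a :: complex
  assumes "\<And>e. e > 0 ==> cmod a \<le> K * e"
  shows "a = 0"
proof (rule ccontr)
  assume "a \<noteq> 0"
  then have a: "cmod a > 0" by simp
  have K: "\<bar>K\<bar> + 1 > 0" by simp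
  have "cmod a \<le> K * (cmod a / (2 * (\<bar>K\<bar> + 1)))" by (rule assms) (use a K in simp)
  also have "\<dots> \<le> (\<bar>K\<bar> + 1) * (cmod a / (2 * (\<bar>K\<bar> + 1)))" using a by (intro mult_right_mono) auto
  also have "\<dots> = cmod a / 2" using K by (simp add: field_simps)
  finally show False using a by simp
qed

lemma (in group) r_coset_eq_iff:
  assumes "subgroup N G" "x \<in> carrier G" "y \<in> carrier G"
  shows "N #> x = N #> y \<longleftrightarrow> x \<otimes> inv y \<in> N"
proof
  assume "N #> x = N #> y"
  then have "x \<in> N #> y" using assms rcos_self by blast
  then obtain n where "n \<in> N" "x = n \<otimes> y" by (auto simp: r_coset_def)
  then show "x \<otimes> inv y \<in> N"
    using assms subgroup.mem_carrier[OF assms(1)] by (simp add: m_assoc)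
next
  assume n: "x \<otimes> inv y \<in> N"
  have "x = (x \<otimes> inv y) \<otimes> y" using assms by (simp add: m_assoc)
  then have "x \<in> N #> y" using n by (auto simp: r_coset_def)
  then show "N #> x = N #> y" using assms repr_independence by metis
qed

text \<open>The first assumption makes equality under \<open>p\<close> a congruence, so the fibre of
  \<open>\<one>\<close> is normal and its cosets are the fibres of \<open>p\<close>. It is applied
  to pairs of cosets, to the coordinates of an inverse limit and to representations of finite
  range.\<close>

lemma (in group) fibre_normal:
  assumes cong: "\<And>x y x' y'. \<lbrakk>x \<in> carrier G; y \<in> carrier G; x' \<in> carrier G; y' \<in> carrier G; p x = p x'; p y = p y'\<rbrakk> \<Longrightarrow> p (x \<otimes> y) = p (x' \<otimes> y')"
    and fin: "finite (p ` carrier G)"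
  defines "K \<equiv> {g \<in> carrier G. p g = p \<one>}"
  shows "K \<lhd> G" "finite (rcosets K)"
proof -
  have inv: "p (inv x) = p \<one>" if x: "x \<in> carrier G" "p x = p \<one>" for x
    using cong[of "inv x" \<one> "inv x" x] x by simp
  have "subgroup K G"
  proof
    show "x \<otimes> y \<in> K" if "x \<in> K" "y \<in> K" for x y using cong[of x y \<one> \<one>] that by (simp add: K_def)
  qed (auto simp: K_def inv)
  moreover have "x \<otimes> h \<otimes> inv x \<in> K" if x: "x \<in> carrier G" and h: "h \<in> K" for x h
    using cong[of "x \<otimes> h" "inv x" x "inv x"] cong[of x h x \<one>] x h by (simp add: K_def)
  ultimately show N: "K \<lhd> G" by (intro normal_invI) auto
  have "K #> g = {x \<in> carrier G. p x = p g}" if g: "g \<in> carrier G" for g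
  proof
    show "K #> g \<subseteq> {x \<in> carrier G. p x = p g}" using cong[of _ g \<one> g] g by (auto simp: r_coset_def K_def)
    show "{x \<in> carrier G. p x = p g} \<subseteq> K #> g"
    proof
      fix x assume x: "x \<in> {x \<in> carrier G. p x = p g}"
      then have "x \<otimes> inv g \<in> K" using cong[of x "inv g" g "inv g"] g by (simp add: K_def)
      moreover have "x = (x \<otimes> inv g) \<otimes> g" using x g by (simp add: m_assoc)
      ultimately show "x \<in> K #> g" unfolding r_coset_def by blast
    qed
  qed
  then have "rcosets K \<subseteq> (\<lambda>c. {x \<in> carrier G. p x = c}) ` p ` carrier G" by (auto simp: RCOSETS_def)
  then show "finite (rcosets K)" using fin by (meson finite_imageI finite_subset)
qed

text \<open>The intrinsic form of profiniteness used throughout. Profinite groups have it by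
  \<open>profinite_imp_pro_group\<close> and finite discrete quotients by
  \<open>pro_group_Q\<close>, so one theory of integration and group algebras serves both
  \<open>G\<close> and \<open>G/N\<close>.\<close>

locale pro_group = group G for G :: "('g, 'm) monoid_scheme" (structure) +
  fixes T :: "'g topology"
  assumes topological_group: "topological_group G T"
    and compact: "compact_space T"
    and small_normal: "\<And>U. openin T U ==> \<one> \<in> U ==> \<exists>N\<in>finite_index_normal G T. N \<subseteq> U"
begin

section \<open>Closed normal subgroups of finite index and their cosets\<close>

abbreviation NN where "NN \<equiv> finite_index_normal G T"
abbreviation GG where "GG \<equiv> carrier G"
abbreviation CF where "CF \<equiv> cont_funs T"

lemma topspace_T [simp]: "topspace T = GG"
  using topological_group by (simp add: topological_group_def)

lemma NN_normal: "N \<in> NN ==> N \<lhd> G"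
  by (simp add: finite_index_normal_def)

lemma NN_subgroup: "N \<in> NN ==> subgroup N G"
  using NN_normal normal_imp_subgroup by blast

lemma NN_mem: "N \<in> NN ==> n \<in> N ==> n \<in> GG"
  using NN_subgroup subgroup.mem_carrier by metis

lemma NN_one: "N \<in> NN ==> \<one> \<in> N"
  using NN_subgroup subgroup.one_closed by metis

lemma NN_finite: "N \<in> NN ==> finite (rcosets N)"
  by (simp add: finite_index_normal_def)

lemma NN_closed: "N \<in> NN ==> closedin T N"
  by (simp add: finite_index_normal_def)

lemma carrier_NN: "GG \<in> NN"
proof -
  have s: "subgroup GG G" by (rule subgroup_self)
  have "GG \<lhd> G" by (rule normal_invI[OF s]) auto
  moreover have "rcosets GG \<subseteq> {GG}"
    by (auto simp: RCOSETS_def dest: coset_join2[OF _ s])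
  then have "finite (rcosets GG)" using finite_subset by blast
  moreover have "closedin T GG" using closedin_topspace[of T] by simp
  ultimately show ?thesis by (simp add: finite_index_normal_def)
qed

lemma coset_mult: 
  assumes "N \<in> NN" "x \<in> GG" "y \<in> GG" "x' \<in> GG" "y' \<in> GG" "N #> x = N #> x'" "N #> y = N #> y'"
  shows "N #> (x \<otimes> y) = N #> (x' \<otimes> y')"
  using normal.rcos_sum[OF NN_normal[OF assms(1)]] assms(2-) by metis

lemma coset_inv:
  assumes "N \<in> NN" "x \<in> GG" "y \<in> GG" "N #> x = N #> y"
  shows "N #> inv x = N #> inv y"
  using normal.rcos_inv[OF NN_normal[OF assms(1)]] assms(2-) by metis

lemma coset_refine:
  assumes "N \<in> NN" "M \<in> NN" "M \<subseteq> N" "x \<in> GG" "y \<in> GG" "M #> x = M #> y"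
  shows "N #> x = N #> y"
  using assms r_coset_eq_iff[OF NN_subgroup] by blast

lemma coset_mem:
  assumes "N \<in> NN" "n \<in> N" "x \<in> GG"
  shows "N #> (n \<otimes> x) = N #> x" "N #> (x \<otimes> n) = N #> x"
proof -
  have n: "n \<in> GG" "N #> n = N #> \<one>"
    using assms NN_mem NN_one r_coset_eq_iff[OF NN_subgroup] by auto
  show "N #> (n \<otimes> x) = N #> x" "N #> (x \<otimes> n) = N #> x"
    using coset_mult[OF assms(1), of n x \<one> x] coset_mult[OF assms(1), of x n x \<one>] n assms by simp_all
qed

text \<open>The map sending \<open>x\<close> to its pair of cosets has finite range, so
  \<open>fibre_normal\<close> covers normality and the index at once.\<close>

lemma Int_NN:
  assumes N: "N \<in> NN" and M: "M \<in> NN"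
  shows "N \<inter> M \<in> NN"
proof -
  define p where "p x = (N #> x, M #> x)" for x
  have c: "p (x \<otimes> y) = p (x' \<otimes> y')" if "x \<in> GG" "y \<in> GG" "x' \<in> GG" "y' \<in> GG" "p x = p x'" "p y = p y'" for x y x' y'
    using coset_mult[OF N that(1-4)] coset_mult[OF M that(1-4)] that(5,6) by (simp add: p_def)
  have "p ` GG \<subseteq> (rcosets N) \<times> (rcosets M)" unfolding p_def RCOSETS_def by blast
  then have f: "finite (p ` GG)"
    using finite_subset finite_cartesian_product[OF NN_finite[OF N] NN_finite[OF M]] by metis
  have eq: "{g \<in> GG. p g = p \<one>} = N \<inter> M"
  proof -
    have k: "K #> g = K #> \<one> \<longleftrightarrow> g \<in> K" if "g \<in> GG" "K \<in> NN" for g K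
      using r_coset_eq_iff[OF NN_subgroup[OF that(2)] that(1) one_closed] that(1) by simp
    have "g \<in> GG \<and> p g = p \<one> \<longleftrightarrow> g \<in> N \<and> g \<in> M" for g
    proof (cases "g \<in> GG")
      case True
      then show ?thesis by (simp add: p_def k[OF True N] k[OF True M])
    qed (use NN_mem[OF N] in blast)
    then show ?thesis by blast
  qed
  then show ?thesis
    using fibre_normal[of p, OF c f] closedin_Int[OF NN_closed[OF N] NN_closed[OF M]] unfolding finite_index_normal_def eq by blast
qed

lemma Inter_NN:
  assumes "finite I" "\<And>i. i \<in> I ==> P i \<in> NN"
  shows "\<exists>N\<in>NN. \<forall>i\<in>I. N \<subseteq> P i"
  using assms
proof (induction I)
  case empty then show ?case using carrier_NN by blast
next
  case (insert i I)
  then obtain N where "N \<in> NN" "\<forall>j\<in>I. N \<subseteq> P j" by auto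
  then have "N \<inter> P i \<in> NN" "\<forall>j\<in>insert i I. N \<inter> P i \<subseteq> P j" using insert.prems Int_NN by auto
  then show ?case by blast
qed

lemma continuous_mult_right: "g \<in> GG ==> continuous_map T T (\<lambda>x. x \<otimes> g)"
proof -
  assume g: "g \<in> GG"
  have "continuous_map T (prod_topology T T) (\<lambda>x. (x, g))"
    using g by (intro continuous_map_pairedI) auto
  moreover have "continuous_map (prod_topology T T) T (\<lambda>(x, y). x \<otimes> y)"
    using topological_group by (simp add: topological_group_def)
  ultimately show ?thesis
    using continuous_map_compose[of T "prod_topology T T" "\<lambda>x. (x, g)" T "\<lambda>(x, y). x \<otimes> y"] by (simp add: o_def)
qed

lemma coset_subset: "N \<in> NN ==> C \<in> rcosets N ==> C \<subseteq> GG"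
  using rcosets_part_G[OF NN_subgroup] by blast

lemma closedin_coset:
  assumes N: "N \<in> NN" and C: "C \<in> rcosets N"
  shows "closedin T C"
proof -
  obtain x where x: "x \<in> GG" "C = N #> x" using C by (auto simp: RCOSETS_def)
  have "C = {y \<in> topspace T. y \<otimes> inv x \<in> N}"
  proof
    show "C \<subseteq> {y \<in> topspace T. y \<otimes> inv x \<in> N}"
      using x NN_mem[OF N] by (auto simp: r_coset_def m_assoc)
    show "{y \<in> topspace T. y \<otimes> inv x \<in> N} \<subseteq> C"
    proof clarsimp
      fix y assume y: "y \<in> GG" "y \<otimes> inv x \<in> N"
      have "y = (y \<otimes> inv x) \<otimes> x" using x y by (simp add: m_assoc)
      then show "y \<in> C" using x y by (auto simp: r_coset_def)
    qed
  qed
  then show ?thesis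
    using closedin_continuous_map_preimage[OF continuous_mult_right[of "inv x"] NN_closed[OF N]] x by simp
qed

text \<open>The complement is a union of cosets; these are closed and finite in number, so it is
  closed. In particular the cosets themselves are open.\<close>

lemma coset_union_open:
  assumes N: "N \<in> NN" and U: "U \<subseteq> GG" and cl: "\<And>x y. x \<in> U ==> y \<in> GG ==> N #> x = N #> y ==> y \<in> U"
  shows "openin T U"
proof -
  have sg: "subgroup N G" using N by (rule NN_subgroup)
  let ?F = "{C \<in> rcosets N. C \<inter> U = {}}"
  have "GG - U = \<Union>?F"
  proof
    show "GG - U \<subseteq> \<Union>?F"
    proof
      fix x assume x: "x \<in> GG - U"
      have "N #> x \<in> rcosets N" "x \<in> N #> x"
        using x sg rcosetsI[OF subgroup.subset[OF sg]] rcos_self[OF _ sg] by auto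
      moreover have "(N #> x) \<inter> U = {}"
      proof -
        have False if "y \<in> N #> x" "y \<in> U" for y
        proof -
          have "N #> x = N #> y" using that x sg repr_independence by blast
          then show False using cl[of y x] that x by auto
        qed
        then show ?thesis by blast
      qed
      ultimately show "x \<in> \<Union>?F" by blast
    qed
    show "\<Union>?F \<subseteq> GG - U" using coset_subset[OF N] by blast
  qed
  moreover have "closedin T (\<Union>?F)"
    using NN_finite[OF N] closedin_coset[OF N] by (intro closedin_Union) auto
  ultimately show ?thesis using U by (metis closedin_def double_diff openin_closedin_eq topspace_T subset_refl)
qed

section \<open>Continuity measured by oscillation on cosets\<close>

definition osc :: "'g set \<Rightarrow> ('g \<Rightarrow> complex) \<Rightarrow> real \<Rightarrow> bool" where
  "osc N f e \<longleftrightarrow> (\<forall>x\<in>GG. \<forall>y\<in>GG. N #> x = N #> y \<longrightarrow> cmod (f x - f y) \<le> e)"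

lemma oscI: "(\<And>x y. x \<in> GG ==> y \<in> GG ==> N #> x = N #> y ==> cmod (f x - f y) \<le> e) ==> osc N f e"
  by (simp add: osc_def)

lemma oscD: "osc N f e ==> x \<in> GG ==> y \<in> GG ==> N #> x = N #> y ==> cmod (f x - f y) \<le> e"
  by (simp add: osc_def)

lemma osc_refine: "osc N f e ==> N \<in> NN ==> M \<in> NN ==> M \<subseteq> N ==> osc M f e"
  unfolding osc_def using coset_refine by blast

lemma osc_mono: "osc N f e ==> e \<le> e' ==> osc N f e'"
  unfolding osc_def by (meson order_trans)

text \<open>Heine-Cantor argument: by compactness finitely many of the open sets \<open>W x\<close>
  cover the group, and a common subgroup of the corresponding \<open>P x\<close> works for all
  points.\<close>

lemma cont_osc:
  assumes f: "f \<in> CF" and e: "e > 0"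
  shows "\<exists>N\<in>NN. osc N f e"
proof -
  have cf: "continuous_map T euclidean f" using f by (simp add: cont_funs_def)
  have "\<exists>N\<in>NN. \<forall>y\<in>GG. N #> x = N #> y \<longrightarrow> cmod (f y - f x) < e/2" if x: "x \<in> GG" for x
  proof -
    let ?V = "{y \<in> topspace T. f y \<in> ball (f x) (e/2)}"
    have "openin T ?V" using cf by (rule openin_continuous_map_preimage) auto
    then have "openin T {y \<in> topspace T. y \<otimes> x \<in> ?V}"
      by (rule openin_continuous_map_preimage[OF continuous_mult_right[OF x]])
    moreover have "\<one> \<in> {y \<in> topspace T. y \<otimes> x \<in> ?V}" using x e by simp
    ultimately obtain N where N: "N \<in> NN" "N \<subseteq> {y \<in> topspace T. y \<otimes> x \<in> ?V}" using small_normal by blast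
    have "cmod (f y - f x) < e/2" if y: "y \<in> GG" "N #> x = N #> y" for y
    proof -
      have "y \<otimes> inv x \<in> N" using r_coset_eq_iff[OF NN_subgroup[OF N(1)] y(1) x] y by simp
      then have "(y \<otimes> inv x) \<otimes> x \<in> ?V" using N by blast
      then show ?thesis using x y by (simp add: m_assoc dist_norm norm_minus_commute)
    qed
    then show ?thesis using N by blast
  qed
  then obtain P where P: "\<And>x. x \<in> GG ==> P x \<in> NN"
    "\<And>x y. x \<in> GG ==> y \<in> GG ==> P x #> x = P x #> y ==> cmod (f y - f x) < e/2" by metis
  define W where "W x = {y \<in> GG. P x #> x = P x #> y}" for x
  have "openin T (W x)" if "x \<in> GG" for x
    by (rule coset_union_open[OF P(1)[OF that]]) (auto simp: W_def)
  moreover have "GG \<subseteq> \<Union>(W ` GG)" by (auto simp: W_def)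
  moreover have "compactin T GG" using compact by (simp add: compact_space_def)
  ultimately obtain \<F> where F: "finite \<F>" "\<F> \<subseteq> W ` GG" "GG \<subseteq> \<Union>\<F>"
    using compactinD[of T GG "W ` GG"] by blast
  then obtain I where I: "I \<subseteq> GG" "finite I" "\<F> = W ` I" using finite_subset_image by metis
  obtain N where N: "N \<in> NN" "\<forall>i\<in>I. N \<subseteq> P i" using Inter_NN[OF I(2), of P] P(1) I(1) by blast
  have "osc N f e"
  proof (rule oscI)
    fix x y assume x: "x \<in> GG" and y: "y \<in> GG" and xy: "N #> x = N #> y"
    obtain i where i: "i \<in> I" "x \<in> W i" using F(3) I(3) x by blast
    have iX: "i \<in> GG" using i I by blast
    have Ni: "N \<subseteq> P i" using N i by blast
    have "P i #> x = P i #> y" using coset_refine[OF P(1)[OF iX] N(1) Ni x y xy] .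
    then have "cmod (f x - f i) < e/2" "cmod (f y - f i) < e/2"
      using P(2)[OF iX x] P(2)[OF iX y] i by (auto simp: W_def)
    then show "cmod (f x - f y) \<le> e" using norm_triangle_ineq4[of "f x - f i" "f y - f i"] by simp
  qed
  then show ?thesis using N by blast
qed

lemma cont_osc2:
  assumes "f \<in> CF" "h \<in> CF" "e > 0"
  shows "\<exists>N\<in>NN. osc N f e \<and> osc N h e"
proof -
  obtain N M where "N \<in> NN" "osc N f e" "M \<in> NN" "osc M h e" using cont_osc assms by metis
  then show ?thesis using Int_NN[of N M] osc_refine by (metis inf_le1 inf_le2)
qed

text \<open>Converse of \<open>cont_osc\<close>: with both at hand, continuity of functions can be
  handled through \<open>osc\<close> instead of open sets.\<close>

lemma cont_funsI:
  assumes ext: "f \<in> extensional GG" and o: "\<And>e. e > 0 ==> \<exists>N\<in>NN. osc N f e"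
  shows "f \<in> CF"
proof -
  have "openin T {x \<in> topspace T. f x \<in> U}" if U: "open U" for U
  proof (subst openin_subopen, intro ballI)
    fix x assume x: "x \<in> {x \<in> topspace T. f x \<in> U}"
    then obtain e where e: "e > 0" "ball (f x) e \<subseteq> U" using U openE by blast
    then obtain N where N: "N \<in> NN" "osc N f (e/2)" using o[of "e/2"] by auto
    let ?W = "{y \<in> GG. N #> x = N #> y}"
    have "openin T ?W" by (rule coset_union_open[OF N(1)]) auto
    moreover have "?W \<subseteq> {x \<in> topspace T. f x \<in> U}"
    proof clarsimp
      fix y assume y: "y \<in> GG" "N #> x = N #> y"
      then have "cmod (f x - f y) \<le> e/2" using oscD[OF N(2), of x y] x by simp
      then have "f y \<in> ball (f x) e" using e(1) by (simp add: dist_norm)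
      then show "f y \<in> U" using e(2) by blast
    qed
    moreover have "x \<in> ?W" using x by simp
    ultimately show "\<exists>W. openin T W \<and> x \<in> W \<and> W \<subseteq> {x \<in> topspace T. f x \<in> U}" by blast
  qed
  then show ?thesis using ext by (simp add: cont_funs_def continuous_map)
qed

lemma cont_ext: "f \<in> CF ==> f \<in> extensional GG"
  by (simp add: cont_funs_def)

lemma cont_eqI: "f \<in> CF ==> h \<in> CF ==> (\<And>x. x \<in> GG ==> f x = h x) ==> f = h"
  by (rule extensionalityI[OF cont_ext cont_ext])

text \<open>A Lipschitz combination of \<open>f\<close> and \<open>h\<close> inherits their modulus
  of continuity; sums, multiples, conjugates and products are instances, with \<open>h = f\<close>
  where only one function enters.\<close>

lemma cont_comb:
  assumes f: "f \<in> CF" and h: "h \<in> CF" and ext: "F \<in> extensional GG" and K: "K \<ge> 0"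
    and bd: "\<And>x y. x \<in> GG ==> y \<in> GG ==> cmod (F x - F y) \<le> K * (cmod (f x - f y) + cmod (h x - h y))"
  shows "F \<in> CF"
proof (rule cont_funsI[OF ext])
  fix e :: real assume e: "e > 0"
  \<comment> \<open>\<open>K + 1\<close> instead of \<open>K\<close> allows \<open>K = 0\<close>;
    one half is spent on \<open>f\<close> and one on \<open>h\<close>.\<close>
  define d where "d = e / (K + 1) / 2"
  have d: "d > 0" using e K by (simp add: d_def)
  have Kd: "K * (d + d) \<le> e"
  proof -
    have K1: "K + 1 \<noteq> 0" using K by linarith
    have dd: "d + d = e / (K + 1)" unfolding d_def by (rule field_sum_of_halves)
    have "K * (d + d) \<le> (K + 1) * (d + d)" using d by (intro mult_right_mono) auto
    also have "\<dots> = e" unfolding dd using K1 by simp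
    finally show ?thesis .
  qed
  obtain N where N: "N \<in> NN" "osc N f d" "osc N h d" using cont_osc2[OF f h d] by blast
  have "osc N F e"
  proof (rule oscI)
    fix x y assume xy: "x \<in> GG" "y \<in> GG" "N #> x = N #> y"
    have "K * (cmod (f x - f y) + cmod (h x - h y)) \<le> K * (d + d)"
      using oscD[OF N(2) xy] oscD[OF N(3) xy] K by (intro mult_left_mono add_mono) auto
    then show "cmod (F x - F y) \<le> e" using bd[OF xy(1,2)] Kd by linarith
  qed
  then show "\<exists>N\<in>NN. osc N F e" using N by blast
qed

lemma cont_add [simp]: "f \<in> CF ==> h \<in> CF ==> (\<lambda>x\<in>GG. f x + h x) \<in> CF"
  by (rule cont_comb[where K = 1 and f = f and h = h]) (auto simp: norm_diff_triangle_ineq)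

lemma cont_smult [simp]: "f \<in> CF ==> (\<lambda>x\<in>GG. c * f x) \<in> CF"
  by (rule cont_comb[where K = "cmod c" and h = f]) 
     (auto simp: right_diff_distrib[symmetric] norm_mult intro!: mult_left_mono)

lemma cont_cnj [simp]: "f \<in> CF ==> (\<lambda>x\<in>GG. cnj (f x)) \<in> CF"
  by (rule cont_comb[where K = 1 and h = f]) (auto simp: complex_cnj_diff[symmetric] simp del: complex_cnj_diff)

lemma cont_const [simp]: "(\<lambda>x\<in>GG. c) \<in> CF"
  by (rule cont_funsI) (use carrier_NN in \<open>auto simp: osc_def\<close>)

text \<open>A map that respects the cosets of every \<open>N\<close> preserves
  \<open>osc N f e\<close> with the same \<open>N\<close> and \<open>e\<close>. Translations and
  inversion are of this kind.\<close>

lemma cont_comp: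
  assumes f: "f \<in> CF" and p: "\<And>x. x \<in> GG ==> p x \<in> GG"
    and c: "\<And>N x y. N \<in> NN ==> x \<in> GG ==> y \<in> GG ==> N #> x = N #> y ==> N #> p x = N #> p y"
  shows "(\<lambda>x\<in>GG. f (p x)) \<in> CF"
proof (rule cont_funsI)
  fix e :: real assume "e > 0"
  then obtain N where "N \<in> NN" "osc N f e" using cont_osc[OF f] by blast
  then have "osc N (\<lambda>x\<in>GG. f (p x)) e"
    using oscD[of N f e, OF _ p p c] unfolding osc_def by simp
  then show "\<exists>N\<in>NN. osc N (\<lambda>x\<in>GG. f (p x)) e" using \<open>N \<in> NN\<close> by blast
qed simp

lemma cont_left [simp]:
  assumes f: "f \<in> CF" and g: "g \<in> GG" shows "(\<lambda>x\<in>GG. f (g \<otimes> x)) \<in> CF"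
proof (rule cont_comp[OF f])
  show "N #> (g \<otimes> x) = N #> (g \<otimes> y)" if "N \<in> NN" "x \<in> GG" "y \<in> GG" "N #> x = N #> y" for N x y
    using coset_mult[OF that(1) g that(2) g that(3) refl that(4)] .
qed (use g in simp)

lemma cont_right [simp]:
  assumes f: "f \<in> CF" and g: "g \<in> GG" shows "(\<lambda>x\<in>GG. f (x \<otimes> g)) \<in> CF"
proof (rule cont_comp[OF f])
  show "N #> (x \<otimes> g) = N #> (y \<otimes> g)" if "N \<in> NN" "x \<in> GG" "y \<in> GG" "N #> x = N #> y" for N x y
    using coset_mult[OF that(1,2) g that(3) g that(4) refl] .
qed (use g in simp)

lemma cont_inv [simp]: "f \<in> CF ==> (\<lambda>x\<in>GG. f (inv x)) \<in> CF"
  by (rule cont_comp) (assumption, simp, rule coset_inv)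

section \<open>Averages over the cosets of a subgroup\<close>

definition rep :: "'g set \<Rightarrow> 'g" where "rep C = (SOME x. x \<in> C)"

lemma rep:
  assumes N: "N \<in> NN" and C: "C \<in> rcosets N"
  shows "rep C \<in> GG" "N #> rep C = C" "rep C \<in> C"
proof -
  obtain x where x: "x \<in> GG" "C = N #> x" using C by (auto simp: RCOSETS_def)
  have "x \<in> C" using x rcos_self NN_subgroup[OF N] by blast
  then show r: "rep C \<in> C" unfolding rep_def by (rule someI)
  then show "rep C \<in> GG" using coset_subset[OF N C] by blast
  show "N #> rep C = C" using r x repr_independence NN_subgroup[OF N] by blast
qed

lemma coset_in: "N \<in> NN ==> x \<in> GG ==> N #> x \<in> rcosets N"
  using NN_subgroup subgroup.subset rcosetsI by metis

lemma card_rcosets_pos: "N \<in> NN ==> card (rcosets N) > 0"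
  using NN_finite coset_in[of N \<one>] by (auto simp: card_gt_0_iff)

text \<open>Up to an error of 1 the function takes only finitely many values, one for each coset of
  a suitable subgroup.\<close>

lemma cont_bounded:
  assumes "f \<in> CF" shows "\<exists>B. B > 0 \<and> (\<forall>x\<in>GG. cmod (f x) \<le> B)"
proof -
  obtain N where N: "N \<in> NN" "osc N f 1" using cont_osc[OF assms, of 1] by auto
  define B where "B = (\<Sum>C\<in>rcosets N. cmod (f (rep C))) + 1"
  have "cmod (f x) \<le> B" if x: "x \<in> GG" for x
  proof -
    have C: "N #> x \<in> rcosets N" by (rule coset_in[OF N(1) x])
    have "cmod (f x - f (rep (N #> x))) \<le> 1" using oscD[OF N(2) x rep(1)[OF N(1) C]] rep(2)[OF N(1) C] by simp
    then have "cmod (f x) \<le> cmod (f (rep (N #> x))) + 1" using norm_triangle_ineq2[of "f x" "f (rep (N #> x))"] by simp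
    also have "\<dots> \<le> B" unfolding B_def using member_le_sum[OF C, of "\<lambda>C. cmod (f (rep C))"] NN_finite[OF N(1)] by simp
    finally show ?thesis .
  qed
  moreover have "B > 0" unfolding B_def by (simp add: add_nonneg_pos sum_nonneg)
  ultimately show ?thesis by blast
qed

lemma cont_mult [simp]: 
  assumes f: "f \<in> CF" and h: "h \<in> CF" shows "(\<lambda>x\<in>GG. f x * h x) \<in> CF"
proof -
  obtain B where B: "B > 0" "\<And>x. x \<in> GG ==> cmod (f x) \<le> B" using cont_bounded f by blast
  obtain D where D: "D > 0" "\<And>x. x \<in> GG ==> cmod (h x) \<le> D" using cont_bounded h by blast
  show ?thesis
  proof (rule cont_comb[OF f h, where K = "B + D"])
    fix x y assume x: "x \<in> GG" and y: "y \<in> GG"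
    have "cmod (f x * h x - f y * h y) = cmod (f x * (h x - h y) + (f x - f y) * h y)"
      by (simp add: algebra_simps)
    also have "\<dots> \<le> cmod (f x) * cmod (h x - h y) + cmod (f x - f y) * cmod (h y)"
      by (metis norm_mult norm_triangle_ineq)
    also have "\<dots> \<le> (B + D) * cmod (h x - h y) + cmod (f x - f y) * (B + D)"
      using B(1) D(1) B(2)[OF x] D(2)[OF y] by (intro add_mono mult_right_mono mult_left_mono) auto
    finally show "cmod ((\<lambda>x\<in>GG. f x * h x) x - (\<lambda>x\<in>GG. f x * h x) y) \<le> (B + D) * (cmod (f x - f y) + cmod (h x - h y))"
      using x y by (simp add: algebra_simps)
  qed (use B D in auto)
qed

text \<open>A Riemann sum for Haar measure, in which every coset has mass one over the index. The
  sample point in each coset is arbitrary, so the value is intrinsic only for functions constant on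
  the cosets.\<close>

definition avg :: "'g set \<Rightarrow> ('g \<Rightarrow> complex) \<Rightarrow> complex" where
  "avg N f = (\<Sum>C\<in>rcosets N. f (rep C)) / of_nat (card (rcosets N))"

lemma avg_cong: "N \<in> NN ==> (\<And>x. x \<in> GG ==> f x = h x) ==> avg N f = avg N h"
  unfolding avg_def using rep by (metis (mono_tags, lifting) sum.cong)

lemma avg_add: "avg N (\<lambda>x. f x + h x) = avg N f + avg N h"
  by (simp add: avg_def sum.distrib add_divide_distrib)

lemma avg_diff: "avg N (\<lambda>x. f x - h x) = avg N f - avg N h"
  by (simp add: avg_def sum_subtractf diff_divide_distrib)

lemma avg_smult: "avg N (\<lambda>x. c * f x) = c * avg N f"
  by (simp add: avg_def sum_distrib_left)

lemma avg_const: "N \<in> NN ==> avg N (\<lambda>x. c) = c"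
  using card_rcosets_pos[of N] by (simp add: avg_def)

lemma avg_cnj: "avg N (\<lambda>x. cnj (f x)) = cnj (avg N f)"
  by (simp add: avg_def)

lemma avg_le:
  assumes "N \<in> NN" "\<And>x. x \<in> GG ==> cmod (f x) \<le> Re (h x)"
  shows "cmod (avg N f) \<le> Re (avg N h)"
proof -
  have "cmod (\<Sum>C\<in>rcosets N. f (rep C)) \<le> (\<Sum>C\<in>rcosets N. Re (h (rep C)))"
    by (rule order_trans[OF norm_sum]) (rule sum_mono, use assms rep(1) in blast)
  then show ?thesis using card_rcosets_pos[OF assms(1)]
    by (simp add: avg_def norm_divide divide_right_mono)
qed

lemma avg_bound:
  assumes "N \<in> NN" "\<And>x. x \<in> GG ==> cmod (f x) \<le> e" shows "cmod (avg N f) \<le> e"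
  using avg_le[OF assms(1), of f "\<lambda>x. of_real e"] avg_const[OF assms(1)] assms(2) by simp

text \<open>Every coset of \<open>N\<close> splits into the same number \<open>k\<close> of cosets
  of \<open>M\<close>: right multiplication by a representative carries those inside
  \<open>N\<close> bijectively to those inside the given coset.\<close>

lemma avg_refine:
  assumes N: "N \<in> NN" and M: "M \<in> NN" and MN: "M \<subseteq> N" and f: "osc N f 0"
  shows "avg M f = avg N f"
proof -
  \<comment> \<open>The coset of \<open>N\<close> that contains the coset \<open>C\<close> of
    \<open>M\<close>.\<close>
  define g where "g C = N #> rep C" for C
  define k where "k = card {C \<in> rcosets M. g C = N}"
  have gX: "g (M #> x) = N #> x" if "x \<in> GG" for x
    unfolding g_def using rep[OF M coset_in[OF M that]] that by (intro coset_refine[OF N M MN]) auto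
  have Nc: "N #> \<one> = N" using coset_mult_one subgroup.subset[OF NN_subgroup[OF N]] by blast
  have Csub: "C \<subseteq> GG" if "C \<in> rcosets M" for C using coset_subset[OF M that] .
  have fib: "card {C \<in> rcosets M. g C = D} = k" if D: "D \<in> rcosets N" for D
  proof -
    define d where "d = rep D"
    have d: "d \<in> GG" "N #> d = D" using rep[OF N D] d_def by auto
    have Msub: "M \<subseteq> GG" using subgroup.subset[OF NN_subgroup[OF M]] .
    have Nsub: "N \<subseteq> GG" using subgroup.subset[OF NN_subgroup[OF N]] .
    have shift: "C #> y \<in> rcosets M \<and> g (C #> y) = g C #> y" if C: "C \<in> rcosets M" and y: "y \<in> GG" for C y
    proof -
      have r: "rep C \<in> GG" "M #> rep C = C" using rep[OF M C] by auto
      have e: "C #> y = M #> (rep C \<otimes> y)" using coset_mult_assoc[OF Msub r(1) y] r by simp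
      have "g (C #> y) = N #> (rep C \<otimes> y)" unfolding e using r y by (intro gX) auto
      also have "\<dots> = g C #> y" unfolding g_def using coset_mult_assoc[OF Nsub r(1) y] by simp
      finally show ?thesis using e coset_in[OF M, of "rep C \<otimes> y"] r y by simp
    qed
    have "bij_betw (\<lambda>C. C #> d) {C \<in> rcosets M. g C = N} {C \<in> rcosets M. g C = D}"
    proof (rule bij_betw_byWitness[where f' = "\<lambda>C. C #> inv d"])
      show "\<forall>C\<in>{C \<in> rcosets M. g C = N}. C #> d #> inv d = C"
        using d Csub by (auto simp: coset_mult_assoc coset_mult_one)
      show "\<forall>C\<in>{C \<in> rcosets M. g C = D}. C #> inv d #> d = C"
        using d Csub by (auto simp: coset_mult_assoc coset_mult_one)
      show "(\<lambda>C. C #> d) ` {C \<in> rcosets M. g C = N} \<subseteq> {C \<in> rcosets M. g C = D}"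
        using shift d by auto
      have "D #> inv d = N" using d coset_mult_assoc[OF Nsub, of d "inv d"] Nc by simp
      then show "(\<lambda>C. C #> inv d) ` {C \<in> rcosets M. g C = D} \<subseteq> {C \<in> rcosets M. g C = N}"
        using shift d by auto
    qed
    then show ?thesis unfolding k_def by (simp add: bij_betw_same_card)
  qed
  have gim: "g ` (rcosets M) \<subseteq> rcosets N" unfolding g_def using rep(1)[OF M] coset_in[OF N] by blast
  have fin: "finite (rcosets M)" "finite (rcosets N)" using NN_finite M N by auto
  have S: "(\<Sum>C\<in>rcosets M. h (g C)) = of_nat k * (\<Sum>D\<in>rcosets N. h D)" for h :: "'g set \<Rightarrow> complex"
  proof -
    have "(\<Sum>C\<in>rcosets M. h (g C)) = (\<Sum>D\<in>rcosets N. \<Sum>C\<in>{C \<in> rcosets M. g C = D}. h (g C))"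
      using sum.group[OF fin gim, of "\<lambda>C. h (g C)"] by simp
    also have "\<dots> = (\<Sum>D\<in>rcosets N. of_nat k * h D)"
      by (intro sum.cong refl) (simp add: fib)
    finally show ?thesis by (simp add: sum_distrib_left)
  qed
  \<comment> \<open>The constant function 1 turns \<open>S\<close> into multiplicativity of the
    index, which relates the denominators of the two averages.\<close>
  have c: "of_nat (card (rcosets M)) = (of_nat k * of_nat (card (rcosets N)) :: complex)"
    using S[of "\<lambda>_. 1"] by simp
  have k: "k \<noteq> 0" using c card_rcosets_pos[OF M] by (metis less_irrefl mult_zero_left of_nat_0 of_nat_eq_0_iff)
  have "f (rep C) = f (rep (g C))" if C: "C \<in> rcosets M" for C
  proof -
    have "g C \<in> rcosets N" using gim C by blast
    then have "N #> rep C = N #> rep (g C)" using rep(2)[OF N] unfolding g_def by simp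
    then show ?thesis using oscD[OF f rep(1)[OF M C] rep(1)[OF N \<open>g C \<in> rcosets N\<close>]] by simp
  qed
  then have "(\<Sum>C\<in>rcosets M. f (rep C)) = of_nat k * (\<Sum>D\<in>rcosets N. f (rep D))"
    using S[of "\<lambda>D. f (rep D)"] by simp
  then show ?thesis unfolding avg_def c using k by simp
qed

lemma invariant_cont:
  assumes N: "N \<in> NN" and f: "f \<in> extensional GG" "osc N f 0" shows "f \<in> CF"
proof (rule cont_funsI[OF f(1)])
  fix e :: real assume "e > 0"
  then show "\<exists>N\<in>NN. osc N f e" using osc_mono[OF f(2)] N by (intro bexI[of _ N]) auto
qed

text \<open>The locally constant replacement of \<open>f\<close>: it has the same average and stays
  within the oscillation of \<open>f\<close>.\<close>

definition step :: "'g set \<Rightarrow> ('g \<Rightarrow> complex) \<Rightarrow> 'g \<Rightarrow> complex" where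
  "step N f = (\<lambda>x\<in>GG. f (rep (N #> x)))"

lemma step_osc: "osc N (step N f) 0"
  by (rule oscI) (simp add: step_def)

lemma step_cont: "N \<in> NN ==> step N f \<in> CF"
  by (rule invariant_cont[OF _ _ step_osc]) (simp_all add: step_def)

lemma step_close: "N \<in> NN ==> osc N f e ==> x \<in> GG ==> cmod (f x - step N f x) \<le> e"
  using oscD[of N f e x "rep (N #> x)"] rep[OF _ coset_in, of N x] by (simp add: step_def)

lemma avg_step: "N \<in> NN ==> avg N (step N f) = avg N f"
  unfolding avg_def step_def using rep by (intro arg_cong2[where f = "(/)"] sum.cong refl) simp

lemma avg_approx:
  assumes N: "N \<in> NN" and M: "M \<in> NN" and MN: "M \<subseteq> N" and f: "osc N f e"
  shows "cmod (avg M f - avg N f) \<le> e"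
proof -
  have "avg N f = avg M (step N f)" using avg_refine[OF N M MN step_osc] avg_step[OF N] by simp
  then have "avg M f - avg N f = avg M (\<lambda>x. f x - step N f x)" by (simp add: avg_diff)
  then show ?thesis using avg_bound[OF M] step_close[OF N f] by simp
qed

section \<open>Construction of the invariant integral\<close>

definition approximates :: "('g \<Rightarrow> complex) \<Rightarrow> complex \<Rightarrow> bool" where
  "approximates f c \<longleftrightarrow> (\<forall>N\<in>NN. \<forall>e. osc N f e \<longrightarrow> cmod (c - avg N f) \<le> e)"

text \<open>The two subgroups are compared through their intersection, since neither need contain
  the other.\<close>

lemma avg_approx2:
  assumes "N \<in> NN" "osc N f e" "M \<in> NN" "osc M f d"
  shows "cmod (avg N f - avg M f) \<le> e + d"
proof -
  have I: "N \<inter> M \<in> NN" using Int_NN assms by blast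
  have "cmod (avg (N \<inter> M) f - avg N f) \<le> e" "cmod (avg (N \<inter> M) f - avg M f) \<le> d"
    using avg_approx[OF assms(1) I _ assms(2)] avg_approx[OF assms(3) I _ assms(4)] by auto
  then show ?thesis
    using norm_triangle_ineq4[of "avg (N \<inter> M) f - avg M f" "avg (N \<inter> M) f - avg N f"] by simp
qed

text \<open>Averages along subgroups of oscillation \<open>1/(k+1)\<close> form a Cauchy sequence by
  \<open>avg_approx2\<close>, and the same estimate compares its limit with any other
  average.\<close>

lemma approximates_exists:
  assumes f: "f \<in> CF" shows "\<exists>c. approximates f c"
proof -
  have "\<forall>k. \<exists>N\<in>NN. osc N f (inverse (real (Suc k)))" using cont_osc[OF f] by simp
  then obtain P where P: "\<And>k. P k \<in> NN" "\<And>k. osc (P k) f (inverse (real (Suc k)))" by metis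
  have lim0: "(\<lambda>k. inverse (real (Suc k))) \<longlonglongrightarrow> 0" by (rule LIMSEQ_inverse_real_of_nat)
  have "Cauchy (\<lambda>k. avg (P k) f)"
  proof (rule metric_CauchyI)
    fix e :: real assume e: "e > 0"
    obtain K where K: "inverse (real (Suc K)) < e/2" using reals_Archimedean[of "e/2"] e by auto
    have "dist (avg (P m) f) (avg (P n) f) < e" if "m \<ge> K" "n \<ge> K" for m n
    proof -
      have "inverse (real (Suc m)) \<le> inverse (real (Suc K))" "inverse (real (Suc n)) \<le> inverse (real (Suc K))"
        using that by (auto intro!: le_imp_inverse_le)
      then have "cmod (avg (P m) f - avg (P n) f) < e"
        using avg_approx2[OF P P, of m n] K by linarith
      then show ?thesis by (simp add: dist_norm)
    qed
    then show "\<exists>M. \<forall>m\<ge>M. \<forall>n\<ge>M. dist (avg (P m) f) (avg (P n) f) < e" by blast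
  qed
  then obtain c where c: "(\<lambda>k. avg (P k) f) \<longlonglongrightarrow> c" using Cauchy_convergent convergentD by blast
  have "cmod (c - avg N f) \<le> e" if N: "N \<in> NN" "osc N f e" for N e
  proof -
    have "cmod (c - avg N f) \<le> 0 + e"
    proof (rule LIMSEQ_le)
      show "(\<lambda>k. cmod (avg (P k) f - avg N f)) \<longlonglongrightarrow> cmod (c - avg N f)" by (intro tendsto_intros c)
      show "(\<lambda>k. inverse (real (Suc k)) + e) \<longlonglongrightarrow> 0 + e" by (intro tendsto_intros lim0)
      show "\<exists>K. \<forall>k\<ge>K. cmod (avg (P k) f - avg N f) \<le> inverse (real (Suc k)) + e"
        using avg_approx2[OF P N] by blast
    qed
    then show ?thesis by simp
  qed
  then show ?thesis unfolding approximates_def by blast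
qed

text \<open>A candidate obtained from the averages, kept apart from \<open>haar_integral\<close>
  until \<open>haar_eq_haar0\<close> shows that the \<open>THE\<close> there has exactly this
  solution.\<close>

definition haar0 :: "('g \<Rightarrow> complex) \<Rightarrow> complex" where "haar0 f = (SOME c. approximates f c)"

lemma haar0: "f \<in> CF ==> N \<in> NN ==> osc N f e ==> cmod (haar0 f - avg N f) \<le> e"
  using someI_ex[OF approximates_exists, of f] unfolding haar0_def approximates_def by blast

text \<open>The factor \<open>K\<close> leaves room for functionals that are bounded without being
  contractive, as in \<open>functional_unique\<close>.\<close>

lemma haar0_eqI:
  assumes f: "f \<in> CF" and c: "\<And>e N. e > 0 ==> N \<in> NN ==> osc N f e ==> cmod (c - avg N f) \<le> K * e"
  shows "c = haar0 f"
proof -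
  have "cmod (c - haar0 f) \<le> (K + 1) * e" if e: "e > 0" for e
  proof -
    obtain N where N: "N \<in> NN" "osc N f e" using cont_osc[OF f e] by blast
    have "cmod (c - avg N f) \<le> K * e" "cmod (haar0 f - avg N f) \<le> e" using c[OF e N] haar0[OF f N] by auto
    then show ?thesis
      using norm_triangle_ineq4[of "c - avg N f" "haar0 f - avg N f"] by (simp add: algebra_simps)
  qed
  then have "c - haar0 f = 0" by (rule zero_if_arbitrarily_small)
  then show ?thesis by simp
qed

lemma haar0_invariant: "N \<in> NN ==> f \<in> CF ==> osc N f 0 ==> haar0 f = avg N f"
  using haar0[of f N 0] by simp

lemma haar0_add:
  assumes f: "f \<in> CF" and h: "h \<in> CF"
  shows "haar0 (\<lambda>x\<in>GG. f x + h x) = haar0 f + haar0 h"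
proof -
  let ?s = "\<lambda>x\<in>GG. f x + h x"
  have "haar0 ?s - (haar0 f + haar0 h) = 0"
  \<comment> \<open>The sum may oscillate by \<open>2 * e\<close>; each summand adds another
    \<open>e\<close>.\<close>
  proof (rule zero_if_arbitrarily_small[where K = 4])
    fix e :: real assume e: "e > 0"
    obtain N where N: "N \<in> NN" "osc N f e" "osc N h e" using cont_osc2[OF f h e] by blast
    have "osc N ?s (e + e)"
    proof (rule oscI)
      fix x y assume xy: "x \<in> GG" "y \<in> GG" "N #> x = N #> y"
      show "cmod (?s x - ?s y) \<le> e + e"
        using oscD[OF N(2) xy] oscD[OF N(3) xy] norm_diff_triangle_ineq[of "f x" "h x" "f y" "h y"] xy by simp
    qed
    then have "cmod (haar0 ?s - avg N ?s) \<le> e + e" using haar0[OF cont_add[OF f h] N(1)] by blast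
    moreover have "avg N ?s = avg N f + avg N h"
      unfolding avg_add[symmetric] by (rule avg_cong[OF N(1)]) simp
    moreover have "cmod (haar0 f - avg N f) \<le> e" "cmod (haar0 h - avg N h) \<le> e"
      using haar0[OF f N(1,2)] haar0[OF h N(1,3)] by auto
    ultimately show "cmod (haar0 ?s - (haar0 f + haar0 h)) \<le> 4 * e"
      using norm_triangle_ineq4[of "haar0 ?s - avg N ?s" "(haar0 f - avg N f) + (haar0 h - avg N h)"]
        norm_triangle_ineq[of "haar0 f - avg N f" "haar0 h - avg N h"] by (simp add: algebra_simps)
  qed
  then show ?thesis by simp
qed

lemma haar0_smult:
  assumes f: "f \<in> CF" shows "haar0 (\<lambda>x\<in>GG. c * f x) = c * haar0 f"
proof -
  let ?s = "\<lambda>x\<in>GG. c * f x"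
  have "haar0 ?s - c * haar0 f = 0"
  proof (rule zero_if_arbitrarily_small[where K = "2 * cmod c"])
    fix e :: real assume e: "e > 0"
    obtain N where N: "N \<in> NN" "osc N f e" using cont_osc[OF f e] by blast
    have "osc N ?s (cmod c * e)"
      using N(2) unfolding osc_def by (auto simp: right_diff_distrib[symmetric] norm_mult intro!: mult_left_mono)
    then have "cmod (haar0 ?s - avg N ?s) \<le> cmod c * e" using haar0[OF cont_smult[OF f] N(1)] by blast
    moreover have a: "avg N ?s = c * avg N f"
      unfolding avg_smult[symmetric] by (rule avg_cong[OF N(1)]) simp
    moreover have "cmod (c * haar0 f - c * avg N f) \<le> cmod c * e"
      using haar0[OF f N] by (simp add: right_diff_distrib[symmetric] norm_mult mult_left_mono)
    ultimately show "cmod (haar0 ?s - c * haar0 f) \<le> 2 * cmod c * e"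
      using norm_triangle_ineq4[of "haar0 ?s - avg N ?s" "c * haar0 f - c * avg N f"] by simp
  qed
  then show ?thesis by simp
qed

lemma haar0_le:
  assumes f: "f \<in> CF" and h: "h \<in> CF" and le: "\<And>x. x \<in> GG ==> cmod (f x) \<le> Re (h x)"
  shows "cmod (haar0 f) \<le> Re (haar0 h)"
proof (rule field_le_epsilon)
  fix e :: real assume e: "e > 0"
  then obtain N where N: "N \<in> NN" "osc N f (e/2)" "osc N h (e/2)" using cont_osc2[OF f h, of "e/2"] by auto
  have "cmod (haar0 f) \<le> cmod (avg N f) + e/2"
    using haar0[OF f N(1,2)] norm_triangle_ineq2[of "haar0 f" "avg N f"] by simp
  moreover have "Re (avg N h) \<le> Re (haar0 h) + e/2"
    using haar0[OF h N(1,3)] abs_Re_le_cmod[of "haar0 h - avg N h"] by simp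
  ultimately show "cmod (haar0 f) \<le> Re (haar0 h) + e" using avg_le[OF N(1), of f h, OF le] by linarith
qed

lemma haar0_const: "haar0 (\<lambda>x\<in>GG. c) = c"
proof -
  have "osc GG (\<lambda>x\<in>GG. c) 0" by (simp add: osc_def)
  then show ?thesis using haar0_invariant[OF carrier_NN cont_const] avg_const[OF carrier_NN, of c]
      avg_cong[OF carrier_NN, of "\<lambda>x\<in>GG. c" "\<lambda>x. c"] by simp
qed

text \<open>Translation by \<open>g\<close> permutes the cosets by \<open>b\<close> but need not
  carry sample points to sample points, so the two averages agree only up to the
  oscillation.\<close>

lemma haar0_left:
  assumes f: "f \<in> CF" and g: "g \<in> GG"
  shows "haar0 (\<lambda>x\<in>GG. f (g \<otimes> x)) = haar0 f"
proof -
  let ?s = "\<lambda>x\<in>GG. f (g \<otimes> x)"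
  have "haar0 ?s - haar0 f = 0"
  proof (rule zero_if_arbitrarily_small[where K = 3])
    fix e :: real assume e: "e > 0"
    obtain N where N: "N \<in> NN" "osc N f e" using cont_osc[OF f e] by blast
    have s: "osc N ?s e"
    proof (rule oscI)
      fix x y assume xy: "x \<in> GG" "y \<in> GG" "N #> x = N #> y"
      then show "cmod (?s x - ?s y) \<le> e"
        using oscD[OF N(2) _ _ coset_mult[OF N(1) g xy(1) g xy(2) refl xy(3)]] g by simp
    qed
    define b where "b C = N #> (g \<otimes> rep C)" for C
    have bij: "bij_betw b (rcosets N) (rcosets N)"
    proof (rule bij_betw_byWitness[where f' = "\<lambda>C. N #> (inv g \<otimes> rep C)"])
      have A: "N #> (h \<otimes> rep (N #> (k \<otimes> rep C))) = C"
        if "C \<in> rcosets N" "h \<in> GG" "k \<in> GG" "h \<otimes> k = \<one>" for C h k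
      proof -
        have r: "rep C \<in> GG" "N #> rep C = C" using rep[OF N(1) that(1)] by auto
        have "N #> (k \<otimes> rep C) \<in> rcosets N" using coset_in[OF N(1)] r that by simp
        note r2 = rep[OF N(1) this]
        have "N #> (h \<otimes> rep (N #> (k \<otimes> rep C))) = N #> (h \<otimes> (k \<otimes> rep C))"
          using r r2 that by (intro coset_mult[OF N(1)]) auto
        also have "\<dots> = C" using r that by (simp add: m_assoc[symmetric])
        finally show ?thesis .
      qed
      show "\<forall>C\<in>rcosets N. N #> (inv g \<otimes> rep (b C)) = C" "\<forall>C\<in>rcosets N. b (N #> (inv g \<otimes> rep C)) = C"
        unfolding b_def using A g by auto
      show "b ` (rcosets N) \<subseteq> rcosets N" "(\<lambda>C. N #> (inv g \<otimes> rep C)) ` (rcosets N) \<subseteq> rcosets N"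
        unfolding b_def using coset_in[OF N(1)] rep(1)[OF N(1)] g by auto
    qed
    have "avg N f = (\<Sum>C\<in>rcosets N. f (rep (b C))) / of_nat (card (rcosets N))"
      unfolding avg_def using sum.reindex_bij_betw[OF bij, of "\<lambda>C. f (rep C)"] by simp
    then have "avg N ?s - avg N f = (\<Sum>C\<in>rcosets N. ?s (rep C) - f (rep (b C))) / of_nat (card (rcosets N))"
      by (simp add: avg_def sum_subtractf diff_divide_distrib)
    moreover have "cmod (\<Sum>C\<in>rcosets N. ?s (rep C) - f (rep (b C))) \<le> of_nat (card (rcosets N)) * e"
    proof (rule sum_norm_bound)
      fix C assume C: "C \<in> rcosets N"
      have r: "rep C \<in> GG" using rep[OF N(1) C] by auto
      have "b C \<in> rcosets N" unfolding b_def using coset_in[OF N(1)] r g by simp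
      note r2 = rep[OF N(1) this]
      show "cmod (?s (rep C) - f (rep (b C))) \<le> e"
        using oscD[OF N(2) _ r2(1), of "g \<otimes> rep C"] r r2(2) g unfolding b_def by simp
    qed
    ultimately have "cmod (avg N ?s - avg N f) \<le> e"
      using card_rcosets_pos[OF N(1)] by (simp add: norm_divide divide_le_eq mult.commute)
    moreover have "cmod (haar0 ?s - avg N ?s) \<le> e" "cmod (haar0 f - avg N f) \<le> e"
      using haar0[OF cont_left[OF f g] N(1) s] haar0[OF f N] by auto
    ultimately show "cmod (haar0 ?s - haar0 f) \<le> 3 * e"
      using norm_triangle_ineq4[of "(haar0 ?s - avg N ?s) + (avg N ?s - avg N f)" "haar0 f - avg N f"]
        norm_triangle_ineq[of "haar0 ?s - avg N ?s" "avg N ?s - avg N f"] by simp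
  qed
  then show ?thesis by simp
qed

section \<open>Uniqueness of the invariant integral\<close>

definition functional :: "(('g \<Rightarrow> complex) \<Rightarrow> complex) \<Rightarrow> bool" where
  "functional \<mu> \<longleftrightarrow> (\<forall>f\<in>CF. \<forall>h\<in>CF. \<mu> (\<lambda>x\<in>GG. f x + h x) = \<mu> f + \<mu> h) \<and>
     (\<forall>c. \<forall>f\<in>CF. \<mu> (\<lambda>x\<in>GG. c * f x) = c * \<mu> f)"

lemma cont_sum:
  assumes "finite I" "\<And>i. i \<in> I ==> F i \<in> CF"
  shows "(\<lambda>x\<in>GG. \<Sum>i\<in>I. c i * F i x) \<in> CF"
  using assms
proof (induction I)
  case (insert i I)
  have "(\<lambda>x\<in>GG. (\<lambda>x\<in>GG. c i * F i x) x + (\<lambda>x\<in>GG. \<Sum>i\<in>I. c i * F i x) x) \<in> CF"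
    using insert by (intro cont_add cont_smult) auto
  moreover have "(\<lambda>x\<in>GG. (\<lambda>x\<in>GG. c i * F i x) x + (\<lambda>x\<in>GG. \<Sum>i\<in>I. c i * F i x) x) = (\<lambda>x\<in>GG. \<Sum>i\<in>insert i I. c i * F i x)"
    using insert by (intro restrict_ext) simp
  ultimately show ?case by simp
qed simp

lemma functionalD:
  assumes "functional \<mu>"
  shows "f \<in> CF ==> h \<in> CF ==> \<mu> (\<lambda>x\<in>GG. f x + h x) = \<mu> f + \<mu> h"
    "f \<in> CF ==> \<mu> (\<lambda>x\<in>GG. c * f x) = c * \<mu> f"
  using assms unfolding functional_def by blast+

lemma functional_sum:
  assumes \<mu>: "functional \<mu>" and "finite I" "\<And>i. i \<in> I ==> F i \<in> CF"
  shows "\<mu> (\<lambda>x\<in>GG. \<Sum>i\<in>I. c i * F i x) = (\<Sum>i\<in>I. c i * \<mu> (F i))"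
  using assms(2,3)
proof (induction I)
  case empty
  show ?case using functionalD(2)[OF \<mu> cont_const[of 0], of 0] by simp
next
  case (insert i I)
  have a: "(\<lambda>x\<in>GG. c i * F i x) \<in> CF" "(\<lambda>x\<in>GG. \<Sum>i\<in>I. c i * F i x) \<in> CF"
    using insert by (auto intro: cont_sum)
  have "(\<lambda>x\<in>GG. (\<lambda>x\<in>GG. c i * F i x) x + (\<lambda>x\<in>GG. \<Sum>i\<in>I. c i * F i x) x) = (\<lambda>x\<in>GG. \<Sum>i\<in>insert i I. c i * F i x)"
    using insert by (intro restrict_ext) simp
  then have "\<mu> (\<lambda>x\<in>GG. \<Sum>i\<in>insert i I. c i * F i x) = \<mu> (\<lambda>x\<in>GG. c i * F i x) + \<mu> (\<lambda>x\<in>GG. \<Sum>i\<in>I. c i * F i x)"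
    using functionalD(1)[OF \<mu> a] by simp
  also have "\<dots> = c i * \<mu> (F i) + (\<Sum>i\<in>I. c i * \<mu> (F i))"
    using functionalD(2)[OF \<mu>, of "F i" "c i"] insert by simp
  finally show ?case using insert by simp
qed

definition ind :: "'g set \<Rightarrow> 'g \<Rightarrow> complex" where "ind C = (\<lambda>x\<in>GG. if x \<in> C then 1 else 0)"

lemma coset_mem_iff: "N \<in> NN ==> C \<in> rcosets N ==> x \<in> GG ==> x \<in> C \<longleftrightarrow> N #> x = C"
  by (metis (no_types, lifting) NN_subgroup RCOSETS_def UN_E rcos_self repr_independence singletonD)

lemma ind_osc: "N \<in> NN ==> C \<in> rcosets N ==> osc N (ind C) 0"
  unfolding osc_def by (simp add: ind_def coset_mem_iff[of N C])

lemma ind_cont: "N \<in> NN ==> C \<in> rcosets N ==> ind C \<in> CF"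
  by (rule invariant_cont[OF _ _ ind_osc]) (simp_all add: ind_def)

lemma invariant_sum:
  assumes N: "N \<in> NN" and f: "f \<in> CF" "osc N f 0"
  shows "f = (\<lambda>x\<in>GG. \<Sum>C\<in>rcosets N. f (rep C) * ind C x)"
proof (rule extensionalityI[OF cont_ext[OF f(1)]])
  fix x assume x: "x \<in> GG"
  have C: "N #> x \<in> rcosets N" using coset_in[OF N x] .
  have "(\<Sum>C\<in>rcosets N. f (rep C) * ind C x) = (\<Sum>C\<in>rcosets N. if C = N #> x then f (rep C) else 0)"
    using x coset_mem_iff[OF N] by (intro sum.cong refl) (auto simp: ind_def)
  also have "\<dots> = f (rep (N #> x))" using C NN_finite[OF N] by simp
  also have "\<dots> = f x" using oscD[OF f(2) rep(1)[OF N C] x] rep(2)[OF N C] by simp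
  finally show "f x = (\<lambda>x\<in>GG. \<Sum>C\<in>rcosets N. f (rep C) * ind C x) x" using x by simp
qed simp

text \<open>Invariance gives all cosets of \<open>N\<close> the same mass, normalisation makes it
  one over the index, and the bound passes from step functions to continuous ones. Besides
  uniqueness of Haar measure this yields right invariance, invariance under inversion and the
  integral on quotients.\<close>

lemma functional_unique:
  assumes \<mu>: "functional \<mu>" and left: "\<And>g f. g \<in> GG ==> f \<in> CF ==> \<mu> (\<lambda>x\<in>GG. f (g \<otimes> x)) = \<mu> f"
    and one: "\<mu> (\<lambda>x\<in>GG. 1) = 1"
    and bd: "\<And>f B. f \<in> CF ==> (\<And>x. x \<in> GG ==> cmod (f x) \<le> B) ==> cmod (\<mu> f) \<le> K * B"
    and f: "f \<in> CF"
  shows "\<mu> f = haar0 f"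
proof -
  have inv: "\<mu> h = avg N h" if N: "N \<in> NN" and h: "h \<in> CF" "osc N h 0" for N h
  proof -
    have NC: "N \<in> rcosets N" using coset_in[OF N, of \<one>] coset_mult_one[of N] subgroup.subset[OF NN_subgroup[OF N]] by simp
    have i: "\<mu> (ind C) = \<mu> (ind N)" if C: "C \<in> rcosets N" for C
    proof -
      have r: "rep C \<in> GG" "N #> rep C = C" using rep[OF N C] by auto
      have "(\<lambda>x\<in>GG. ind C (rep C \<otimes> x)) = ind N" unfolding ind_def
      proof (rule restrict_ext)
        fix x assume x: "x \<in> GG"
        have e: "rep C <# N = C" using normal.coset_eq[OF NN_normal[OF N]] r by simp
        have "rep C \<otimes> x \<in> C \<longleftrightarrow> x \<in> N"
        proof
          assume "rep C \<otimes> x \<in> C"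
          then obtain n where "n \<in> N" "rep C \<otimes> x = rep C \<otimes> n" using e by (auto simp: l_coset_def)
          then show "x \<in> N" using r x NN_mem[OF N] by simp
        next
          assume "x \<in> N" then have "rep C \<otimes> x \<in> rep C <# N" by (auto simp: l_coset_def)
          then show "rep C \<otimes> x \<in> C" using e by simp
        qed
        then show "(\<lambda>x\<in>GG. if x \<in> C then 1 else 0) (rep C \<otimes> x) = (if x \<in> N then 1 else (0::complex))"
          using x r by simp
      qed
      then show ?thesis using left[OF r(1) ind_cont[OF N C]] by simp
    qed
    have S: "\<mu> k = (\<Sum>C\<in>rcosets N. k (rep C)) * \<mu> (ind N)" if k: "k \<in> CF" "osc N k 0" for k
    proof -
      have "\<mu> k = \<mu> (\<lambda>x\<in>GG. \<Sum>C\<in>rcosets N. k (rep C) * ind C x)" using invariant_sum[OF N k] by simp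
      also have "\<dots> = (\<Sum>C\<in>rcosets N. k (rep C) * \<mu> (ind C))"
        by (rule functional_sum[OF \<mu> NN_finite[OF N]]) (rule ind_cont[OF N])
      also have "\<dots> = (\<Sum>C\<in>rcosets N. k (rep C) * \<mu> (ind N))" using i by simp
      finally show ?thesis by (simp add: sum_distrib_right)
    qed
    have "1 = of_nat (card (rcosets N)) * \<mu> (ind N)"
      using S[of "\<lambda>x\<in>GG. 1"] one rep(1)[OF N] by (simp add: osc_def)
    then have "\<mu> (ind N) = 1 / of_nat (card (rcosets N))"
      using card_rcosets_pos[OF N] by (simp add: field_simps)
    then show ?thesis using S[OF h] by (simp add: avg_def)
  qed
  show ?thesis
  proof (rule haar0_eqI[OF f])
    fix e N assume e: "(e::real) > 0" and N: "N \<in> NN" "osc N f e"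
    \<comment> \<open>The difference of \<open>f\<close> and its step function, written with the
      operations to which \<open>functionalD\<close> applies.\<close>
    let ?d = "\<lambda>x\<in>GG. f x + (\<lambda>x\<in>GG. (-1) * step N f x) x"
    have st: "step N f \<in> CF" using step_cont[OF N(1)] .
    have "\<mu> ?d = \<mu> f + \<mu> (\<lambda>x\<in>GG. (-1) * step N f x)" by (rule functionalD(1)[OF \<mu> f cont_smult[OF st]])
    also have "\<mu> (\<lambda>x\<in>GG. (-1) * step N f x) = (-1) * \<mu> (step N f)" by (rule functionalD(2)[OF \<mu> st])
    also have "\<mu> (step N f) = avg N f" using inv[OF N(1) st step_osc] avg_step[OF N(1)] by simp
    finally have "\<mu> f - avg N f = \<mu> ?d" by simp
    moreover have "cmod (\<mu> ?d) \<le> K * e"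
      by (rule bd[OF cont_add[OF f cont_smult[OF st]]]) (use step_close[OF N] in simp)
    ultimately show "cmod (\<mu> f - avg N f) \<le> K * e" by simp
  qed
qed

lemma haar0_bound:
  assumes "f \<in> CF" "\<And>x. x \<in> GG ==> cmod (f x) \<le> B" shows "cmod (haar0 f) \<le> B"
  using haar0_le[OF assms(1) cont_const, of "of_real B"] assms(2) by (simp add: haar0_const)

lemma SUP_bound:
  assumes "f \<in> CF" "x \<in> GG" shows "cmod (f x) \<le> (SUP x\<in>topspace T. cmod (f x))"
proof -
  obtain B where "\<forall>x\<in>GG. cmod (f x) \<le> B" using cont_bounded assms by blast
  then show ?thesis using assms by (intro cSUP_upper bdd_aboveI2[where M = B]) auto
qed

lemma haar_eq_haar0: "haar_integral G T = restrict haar0 CF"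
  unfolding haar_integral_def
proof (rule the_equality)
  let ?m = "restrict haar0 CF"
  have "?m \<in> radon_measures T"
    unfolding radon_measures_def
    using haar0_bound SUP_bound by (auto simp: haar0_add haar0_smult intro!: exI[of _ 1])
  moreover have "?m f \<in> \<real>\<^sub>\<ge>\<^sub>0" if f: "f \<in> CF" and pos: "\<forall>x\<in>GG. f x \<in> \<real>\<^sub>\<ge>\<^sub>0" for f
  proof -
    \<comment> \<open>A nonnegative \<open>f\<close> is compared with itself; a complex number whose
      modulus is at most its real part is real and nonnegative.\<close>
    have "cmod (haar0 f) \<le> Re (haar0 f)"
      by (rule haar0_le[OF f f]) (use pos in \<open>auto simp: complex_nonneg_Reals_iff cmod_def\<close>)
    then have "haar0 f = of_real (cmod (haar0 f))"
      by (metis abs_Re_le_cmod abs_of_nonneg complex_Re_le_cmod complex_eq_0 complex_is_Real_iff cmod_eq_Re norm_ge_zero of_real_Re order_antisym order_trans cmod_power2 add_cancel_left_right power2_eq_square mult_eq_0_iff norm_le_zero_iff)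
    then show ?thesis using f nonneg_Reals_of_real_iff norm_ge_zero by (metis restrict_apply')
  qed
  ultimately show "?m \<in> radon_measures T \<and> (\<forall>f\<in>CF. (\<forall>x\<in>GG. f x \<in> \<real>\<^sub>\<ge>\<^sub>0) \<longrightarrow> ?m f \<in> \<real>\<^sub>\<ge>\<^sub>0) \<and>
    (\<forall>g\<in>GG. \<forall>f\<in>CF. ?m (\<lambda>x\<in>GG. f (g \<otimes> x)) = ?m f) \<and> ?m (\<lambda>x\<in>GG. 1) = 1"
    by (simp add: haar0_left haar0_const)
next
  fix \<mu>
  assume \<mu>: "\<mu> \<in> radon_measures T \<and> (\<forall>f\<in>CF. (\<forall>x\<in>GG. f x \<in> \<real>\<^sub>\<ge>\<^sub>0) \<longrightarrow> \<mu> f \<in> \<real>\<^sub>\<ge>\<^sub>0) \<and>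
    (\<forall>g\<in>GG. \<forall>f\<in>CF. \<mu> (\<lambda>x\<in>GG. f (g \<otimes> x)) = \<mu> f) \<and> \<mu> (\<lambda>x\<in>GG. 1) = 1"
  then obtain c where c: "\<And>f. f \<in> CF ==> cmod (\<mu> f) \<le> c * (SUP x\<in>topspace T. cmod (f x))"
    unfolding radon_measures_def by blast
  have "cmod (\<mu> f) \<le> \<bar>c\<bar> * B" if f: "f \<in> CF" and B: "\<And>x. x \<in> GG ==> cmod (f x) \<le> B" for f B
  proof -
    let ?s = "SUP x\<in>topspace T. cmod (f x)"
    have "?s \<ge> 0" using order_trans[OF norm_ge_zero SUP_bound[OF f one_closed]] .
    moreover have "?s \<le> B" using B by (intro cSUP_least) auto
    ultimately have "c * ?s \<le> \<bar>c\<bar> * B" by (meson abs_ge_self abs_ge_zero mult_mono)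
    then show ?thesis using c[OF f] by linarith
  qed
  moreover have "functional \<mu>" using \<mu> by (simp add: radon_measures_def functional_def)
  ultimately have "\<mu> f = haar0 f" if "f \<in> CF" for f
    using \<mu> that by (intro functional_unique[where K = "\<bar>c\<bar>"]) auto
  moreover have "\<mu> \<in> extensional CF" using \<mu> by (simp add: radon_measures_def)
  ultimately show "\<mu> = restrict haar0 CF" by (intro extensionalityI[of _ CF]) auto
qed

section \<open>Invariance properties of the Haar integral\<close>

abbreviation haar where "haar \<equiv> haar_integral G T"

lemma haar_haar0: "f \<in> CF ==> haar f = haar0 f"
  by (simp add: haar_eq_haar0)

lemma haar_approx: "f \<in> CF ==> N \<in> NN ==> osc N f e ==> cmod (haar f - avg N f) \<le> e"
  by (simp add: haar_haar0 haar0)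

lemma haar_invariant: "N \<in> NN ==> f \<in> CF ==> osc N f 0 ==> haar f = avg N f"
  by (simp add: haar_haar0 haar0_invariant)

lemma haar_add: "f \<in> CF ==> h \<in> CF ==> haar (\<lambda>x\<in>GG. f x + h x) = haar f + haar h"
  by (simp add: haar_haar0 haar0_add)

lemma haar_smult: "f \<in> CF ==> haar (\<lambda>x\<in>GG. c * f x) = c * haar f"
  by (simp add: haar_haar0 haar0_smult)

lemma haar_le:
  "f \<in> CF ==> h \<in> CF ==> (\<And>x. x \<in> GG ==> cmod (f x) \<le> Re (h x)) ==> cmod (haar f) \<le> Re (haar h)"
  by (simp add: haar_haar0 haar0_le)

lemma haar_bound: "f \<in> CF ==> (\<And>x. x \<in> GG ==> cmod (f x) \<le> B) ==> cmod (haar f) \<le> B"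
  by (simp add: haar_haar0 haar0_bound)

lemma haar_const: "haar (\<lambda>x\<in>GG. c) = c"
  by (simp add: haar_haar0 haar0_const)

lemma haar_left: "f \<in> CF ==> g \<in> GG ==> haar (\<lambda>x\<in>GG. f (g \<otimes> x)) = haar f"
  by (simp add: haar_haar0 haar0_left)

text \<open>Unimodularity: right translation commutes with left translations, so it turns the
  integral into another invariant normalised functional.\<close>

lemma haar_right:
  assumes f: "f \<in> CF" and g: "g \<in> GG" shows "haar (\<lambda>x\<in>GG. f (x \<otimes> g)) = haar f"
proof -
  let ?\<mu> = "\<lambda>f. haar0 (\<lambda>x\<in>GG. f (x \<otimes> g))"
  have "?\<mu> f = haar0 f"
  proof (rule functional_unique[where K = 1, OF _ _ _ _ f])
    show "functional ?\<mu>" unfolding functional_def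
    proof (intro conjI ballI allI)
      fix f h c assume f: "f \<in> CF" and h: "h \<in> CF"
      show "?\<mu> (\<lambda>x\<in>GG. f x + h x) = ?\<mu> f + ?\<mu> h"
        using haar0_add[OF cont_right[OF f g] cont_right[OF h g]] g
        by (simp cong: restrict_cong)
    next
      fix f c assume f: "f \<in> CF"
      show "?\<mu> (\<lambda>x\<in>GG. c * f x) = c * ?\<mu> f"
        using haar0_smult[OF cont_right[OF f g], of c] g by (simp cong: restrict_cong)
    qed
    show "?\<mu> (\<lambda>x\<in>GG. f (h \<otimes> x)) = ?\<mu> f" if "h \<in> GG" "f \<in> CF" for h f
      using haar0_left[OF cont_right[OF that(2) g] that(1)] that g by (simp add: m_assoc cong: restrict_cong)
    show "?\<mu> (\<lambda>x\<in>GG. 1) = 1" using haar0_const[of 1] g by (simp cong: restrict_cong)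
    show "cmod (?\<mu> f) \<le> 1 * B" if "f \<in> CF" "\<And>x. x \<in> GG ==> cmod (f x) \<le> B" for f B
      using haar0_bound[OF cont_right[OF that(1) g], of B] that g by simp
  qed
  then show ?thesis using haar_haar0 f g by simp
qed

text \<open>Inversion exchanges left and right translations, hence left invariance of the inverted
  functional is \<open>haar_right\<close>.\<close>

lemma haar_inv:
  assumes f: "f \<in> CF" shows "haar (\<lambda>x\<in>GG. f (inv x)) = haar f"
proof -
  let ?\<mu> = "\<lambda>f. haar0 (\<lambda>x\<in>GG. f (inv x))"
  have "?\<mu> f = haar0 f"
  proof (rule functional_unique[where K = 1, OF _ _ _ _ f])
    show "functional ?\<mu>" unfolding functional_def
    proof (intro conjI ballI allI)
      fix f h c assume f: "f \<in> CF" and h: "h \<in> CF"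
      show "?\<mu> (\<lambda>x\<in>GG. f x + h x) = ?\<mu> f + ?\<mu> h"
        using haar0_add[OF cont_inv[OF f] cont_inv[OF h]] by (simp cong: restrict_cong)
    next
      fix f c assume f: "f \<in> CF"
      show "?\<mu> (\<lambda>x\<in>GG. c * f x) = c * ?\<mu> f"
        using haar0_smult[OF cont_inv[OF f], of c] by (simp cong: restrict_cong)
    qed
    show "?\<mu> (\<lambda>x\<in>GG. f (h \<otimes> x)) = ?\<mu> f" if "h \<in> GG" "f \<in> CF" for h f
    proof -
      have "(\<lambda>x\<in>GG. f (h \<otimes> inv x)) \<in> CF"
        using cont_inv[OF cont_left[OF that(2,1)]] by (simp cong: restrict_cong)
      then show ?thesis using haar_right[OF cont_inv[OF that(2)], of "inv h"] that
        by (simp add: inv_mult_group haar_haar0 cong: restrict_cong)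
    qed
    show "?\<mu> (\<lambda>x\<in>GG. 1) = 1" using haar0_const[of 1] by (simp cong: restrict_cong)
    show "cmod (?\<mu> f) \<le> 1 * B" if "f \<in> CF" "\<And>x. x \<in> GG ==> cmod (f x) \<le> B" for f B
      using haar0_bound[OF cont_inv[OF that(1)], of B] that by simp
  qed
  then show ?thesis using haar_haar0 f by simp
qed

lemma haar_cnj:
  assumes f: "f \<in> CF" shows "haar (\<lambda>x\<in>GG. cnj (f x)) = cnj (haar f)"
proof -
  let ?s = "\<lambda>x\<in>GG. cnj (f x)"
  have "cnj (haar f) = haar0 ?s"
  proof (rule haar0_eqI[OF cont_cnj[OF f], where K = 1])
    fix e :: real and N assume e: "e > 0" and N: "N \<in> NN" "osc N ?s e"
    have "osc N f e"
      using N(2) unfolding osc_def by (simp add: complex_cnj_diff[symmetric] del: complex_cnj_diff)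
    moreover have "avg N ?s = cnj (avg N f)"
      unfolding avg_cnj[symmetric] by (rule avg_cong[OF N(1)]) simp
    ultimately show "cmod (cnj (haar f) - avg N ?s) \<le> 1 * e"
      using haar_approx[OF f N(1)] by (simp add: complex_cnj_diff[symmetric] del: complex_cnj_diff)
  qed
  then show ?thesis using f by (simp add: haar_haar0)
qed

section \<open>Iterated integrals\<close>

definition osc2 :: "'g set \<Rightarrow> ('g \<Rightarrow> 'g \<Rightarrow> complex) \<Rightarrow> real \<Rightarrow> bool" where
  "osc2 N F e \<longleftrightarrow> (\<forall>x\<in>GG. \<forall>x'\<in>GG. \<forall>y\<in>GG. \<forall>y'\<in>GG. N #> x = N #> x' \<longrightarrow> N #> y = N #> y' \<longrightarrow>
     cmod (F x y - F x' y') \<le> e)"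

text \<open>Joint uniform continuity on the square of the group, expressed by cosets; the bound
  keeps products in the class (\<open>unif2_mult\<close>).\<close>

definition unif2 :: "('g \<Rightarrow> 'g \<Rightarrow> complex) \<Rightarrow> bool" where
  "unif2 F \<longleftrightarrow> (\<forall>e>0. \<exists>N\<in>NN. osc2 N F e) \<and> (\<exists>B. \<forall>x\<in>GG. \<forall>y\<in>GG. cmod (F x y) \<le> B)"

lemma osc2_inner: "osc2 N F e ==> x \<in> GG ==> osc N (\<lambda>y\<in>GG. F x y) e"
  unfolding osc2_def osc_def by simp

lemma unif2_inner: 
  assumes "unif2 F" "x \<in> GG" shows "(\<lambda>y\<in>GG. F x y) \<in> CF"
proof (rule cont_funsI)
  fix e :: real assume "e > 0"
  then obtain N where "N \<in> NN" "osc2 N F e" using assms unfolding unif2_def by blast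
  then show "\<exists>N\<in>NN. osc N (\<lambda>y\<in>GG. F x y) e" using osc2_inner assms(2) by blast
qed simp

lemma osc2_outer:
  assumes F: "unif2 F" and o: "osc2 N F e"
  shows "osc N (\<lambda>x\<in>GG. haar (\<lambda>y\<in>GG. F x y)) e"
proof (rule oscI)
  fix x x' assume x: "x \<in> GG" "x' \<in> GG" "N #> x = N #> x'"
  note c = unif2_inner[OF F x(1)] unif2_inner[OF F x(2)]
  let ?D = "\<lambda>y\<in>GG. (\<lambda>y\<in>GG. F x y) y + (\<lambda>y\<in>GG. (-1) * (\<lambda>y\<in>GG. F x' y) y) y"
  have "haar ?D = haar (\<lambda>y\<in>GG. F x y) + (-1) * haar (\<lambda>y\<in>GG. F x' y)"
    unfolding haar_add[OF c(1) cont_smult[OF c(2)]] haar_smult[OF c(2)] ..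
  moreover have "cmod (haar ?D) \<le> e"
    by (rule haar_bound[OF cont_add[OF c(1) cont_smult[OF c(2)]]]) (use x o in \<open>simp add: osc2_def\<close>)
  ultimately show "cmod ((\<lambda>x\<in>GG. haar (\<lambda>y\<in>GG. F x y)) x - (\<lambda>x\<in>GG. haar (\<lambda>y\<in>GG. F x y)) x') \<le> e"
    using x by simp
qed

lemma unif2_outer:
  assumes "unif2 F" shows "(\<lambda>x\<in>GG. haar (\<lambda>y\<in>GG. F x y)) \<in> CF"
proof (rule cont_funsI)
  fix e :: real assume "e > 0"
  then obtain N where "N \<in> NN" "osc2 N F e" using assms unfolding unif2_def by blast
  then show "\<exists>N\<in>NN. osc N (\<lambda>x\<in>GG. haar (\<lambda>y\<in>GG. F x y)) e" using osc2_outer assms by blast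
qed simp

text \<open>Both iterated integrals are uniformly close to the same double average over cosets.\<close>

lemma haar_Fubini:
  assumes F: "unif2 F"
  shows "haar (\<lambda>x\<in>GG. haar (\<lambda>y\<in>GG. F x y)) = haar (\<lambda>y\<in>GG. haar (\<lambda>x\<in>GG. F x y))"
proof -
  \<comment> \<open>An error \<open>e\<close> for the outer integral and another \<open>e\<close>,
    uniformly in \<open>x\<close>, for the inner ones.\<close>
  have main: "cmod (haar (\<lambda>x\<in>GG. haar (\<lambda>y\<in>GG. F x y)) - avg N (\<lambda>x. avg N (F x))) \<le> 2 * e"
    if N: "N \<in> NN" and o: "osc2 N F e" and F: "unif2 F" for N e F
  proof -
    have 1: "cmod (haar (\<lambda>x\<in>GG. haar (\<lambda>y\<in>GG. F x y)) - avg N (\<lambda>x\<in>GG. haar (\<lambda>y\<in>GG. F x y))) \<le> e"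
      using haar_approx[OF unif2_outer[OF F] N osc2_outer[OF F o]] .
    have "avg N (\<lambda>x\<in>GG. haar (\<lambda>y\<in>GG. F x y)) - avg N (\<lambda>x. avg N (F x)) =
       avg N (\<lambda>x. (\<lambda>x\<in>GG. haar (\<lambda>y\<in>GG. F x y)) x - avg N (F x))" by (simp only: avg_diff)
    moreover have "cmod (avg N (\<lambda>x. (\<lambda>x\<in>GG. haar (\<lambda>y\<in>GG. F x y)) x - avg N (F x))) \<le> e"
    proof (rule avg_bound[OF N])
      fix x assume x: "x \<in> GG"
      have "avg N (F x) = avg N (\<lambda>y\<in>GG. F x y)" by (rule avg_cong[OF N]) simp
      then show "cmod ((\<lambda>x\<in>GG. haar (\<lambda>y\<in>GG. F x y)) x - avg N (F x)) \<le> e"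
        using haar_approx[OF unif2_inner[OF F x] N osc2_inner[OF o x]] x by simp
    qed
    ultimately have 2: "cmod (avg N (\<lambda>x\<in>GG. haar (\<lambda>y\<in>GG. F x y)) - avg N (\<lambda>x. avg N (F x))) \<le> e" by simp
    show ?thesis using norm_diff_triangle_le[OF 1 2] by simp
  qed
  \<comment> \<open>The swapped integrand lets \<open>main\<close> serve for both orders of
    integration.\<close>
  define F' where "F' y x = F x y" for x y
  have sw: "osc2 N F e \<longleftrightarrow> osc2 N F' e" for N e unfolding osc2_def F'_def by blast
  have F': "unif2 F'" using F unfolding unif2_def sw[symmetric] unfolding F'_def by blast
  have avgs: "avg N (\<lambda>x. avg N (F x)) = avg N (\<lambda>y. avg N (F' y))" for N
    unfolding avg_def F'_def by (simp add: sum_divide_distrib[symmetric]) (rule disjI2, rule sum.swap)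
  have "haar (\<lambda>x\<in>GG. haar (\<lambda>y\<in>GG. F x y)) - haar (\<lambda>y\<in>GG. haar (\<lambda>x\<in>GG. F' y x)) = 0"
  proof (rule zero_if_arbitrarily_small[where K = 4])
    fix e :: real assume "e > 0"
    then obtain N where N: "N \<in> NN" "osc2 N F e" using F unfolding unif2_def by blast
    have "cmod (haar (\<lambda>x\<in>GG. haar (\<lambda>y\<in>GG. F x y)) - avg N (\<lambda>x. avg N (F x))) \<le> 2 * e"
      using main[OF N F] .
    moreover have "cmod (haar (\<lambda>y\<in>GG. haar (\<lambda>x\<in>GG. F' y x)) - avg N (\<lambda>x. avg N (F x))) \<le> 2 * e"
      using main[OF N(1) _ F'] N(2) unfolding avgs sw by blast
    ultimately show "cmod (haar (\<lambda>x\<in>GG. haar (\<lambda>y\<in>GG. F x y)) - haar (\<lambda>y\<in>GG. haar (\<lambda>x\<in>GG. F' y x))) \<le> 4 * e"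
      using norm_triangle_ineq4[of "haar (\<lambda>x\<in>GG. haar (\<lambda>y\<in>GG. F x y)) - avg N (\<lambda>x. avg N (F x))"
        "haar (\<lambda>y\<in>GG. haar (\<lambda>x\<in>GG. F' y x)) - avg N (\<lambda>x. avg N (F x))"] by simp
  qed
  then show ?thesis by (simp add: F'_def)
qed

end

section \<open>Bounded operators\<close>

context normed_module
begin

lemma eq_zeroI: "x \<in> VV ==> nrm x \<le> 0 ==> x = \<zero>"
  using nrm_nonneg[of x] nrm_definite[of x] by linarith

lemma eqI_dist: "x \<in> VV ==> y \<in> VV ==> nrm (x \<ominus> y) \<le> 0 ==> x = y"
  using eq_zeroI[of "x \<ominus> y"] diff_eq_zero[of x y] by simp

lemma closed_subspace_iff:
  "closed_subspace S \<longleftrightarrow> submodule S complex_ring V \<and> closedin (norm_topology V nrm) S"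
proof
  assume S: "closed_subspace S"
  then have "S \<subseteq> VV" "\<zero> \<in> S" "\<And>x y. x \<in> S ==> y \<in> S ==> x \<oplus> y \<in> S"
    and sm: "\<And>c x. x \<in> S ==> c \<odot> x \<in> S" unfolding closed_subspace_def by blast+
  moreover have "inv\<^bsub>add_monoid V\<^esub> x \<in> S" if "x \<in> S" for x
    using sm[OF that, of "-1"] minus_eq_smult[of x] that \<open>S \<subseteq> VV\<close> by (auto simp: a_inv_def)
  ultimately have "submodule S complex_ring V"
    unfolding submodule_def submodule_axioms_def by (auto intro!: subgroup.intro)
  then show "submodule S complex_ring V \<and> closedin (norm_topology V nrm) S"
    using S unfolding closed_subspace_def closedin_norm_topology by blast
next
  assume S: "submodule S complex_ring V \<and> closedin (norm_topology V nrm) S"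
  then have "subgroup S (add_monoid V)" "\<And>c x. x \<in> S ==> c \<odot> x \<in> S"
    unfolding submodule_def submodule_axioms_def by auto
  then show "closed_subspace S" using S unfolding closed_subspace_def closedin_norm_topology
    by (auto dest: subgroup.subset subgroup.one_closed subgroup.m_closed)
qed

end

text \<open>Source and target may differ and extensionality is not imposed, so compositions and maps
  such as multiplication by a fixed element qualify as they stand; a positive constant can be
  divided by.\<close>

definition bounded_between ::
    "(complex, 'a, 'x) module_scheme \<Rightarrow> ('a \<Rightarrow> real) \<Rightarrow> (complex, 'b, 'y) module_scheme \<Rightarrow> ('b \<Rightarrow> real) \<Rightarrow> ('a \<Rightarrow> 'b) \<Rightarrow> bool" where
  "bounded_between V nV W nW f \<longleftrightarrow> (\<forall>x\<in>carrier V. f x \<in> carrier W) \<and>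
     (\<forall>x\<in>carrier V. \<forall>y\<in>carrier V. f (x \<oplus>\<^bsub>V\<^esub> y) = f x \<oplus>\<^bsub>W\<^esub> f y) \<and>
     (\<forall>c. \<forall>x\<in>carrier V. f (c \<odot>\<^bsub>V\<^esub> x) = c \<odot>\<^bsub>W\<^esub> f x) \<and> (\<exists>c>0. \<forall>x\<in>carrier V. nW (f x) \<le> c * nV x)"

lemma bounded_between_comp:
  assumes f: "bounded_between V nV W nW f" and g: "bounded_between W nW Z nZ g"
  shows "bounded_between V nV Z nZ (\<lambda>x. g (f x))"
proof -
  obtain c d where c: "c > 0" "\<forall>x\<in>carrier V. nW (f x) \<le> c * nV x" and d: "d > 0" "\<forall>x\<in>carrier W. nZ (g x) \<le> d * nW x"
    using f g unfolding bounded_between_def by metis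
  have fW: "\<forall>x\<in>carrier V. f x \<in> carrier W" using f unfolding bounded_between_def by blast
  have "nZ (g (f x)) \<le> (d * c) * nV x" if x: "x \<in> carrier V" for x
  proof -
    have "nZ (g (f x)) \<le> d * nW (f x)" using d(2) fW x by blast
    also have "\<dots> \<le> d * (c * nV x)" using c(2) x d(1) by (intro mult_left_mono) auto
    finally show ?thesis by (simp add: mult.assoc)
  qed
  moreover have "d * c > 0" using c(1) d(1) by simp
  ultimately have "\<exists>k>0. \<forall>x\<in>carrier V. nZ (g (f x)) \<le> k * nV x" by blast
  then show ?thesis using f g unfolding bounded_between_def by simp
qed

text \<open>The vehicle of the density arguments: an equation between bounded linear maps spreads
  from a dense subspace to the whole space. Kernels are the case where one map is
  \<open>bounded_between_zero\<close>.\<close>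

lemma (in seminormed_module) equalizer_closed:
  assumes "normed_module W nW" and f: "bounded_between V nrm W nW f" and g: "bounded_between V nrm W nW g"
  shows "closed_subspace {x \<in> VV. f x = g x}"
proof -
  interpret W: normed_module W nW by fact
  obtain c d where c: "c > 0" "\<And>x. x \<in> VV ==> nW (f x) \<le> c * nrm x" and d: "d > 0" "\<And>x. x \<in> VV ==> nW (g x) \<le> d * nrm x"
    using f g unfolding bounded_between_def by metis
  have lin: "\<And>x. x \<in> VV ==> h x \<in> carrier W" "\<And>x y. x \<in> VV ==> y \<in> VV ==> h (x \<oplus> y) = h x \<oplus>\<^bsub>W\<^esub> h y"
    "\<And>k x. x \<in> VV ==> h (k \<odot> x) = k \<odot>\<^bsub>W\<^esub> h x" if "h = f \<or> h = g" for h
    using that f g unfolding bounded_between_def by auto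
  have dif: "h (x \<ominus> y) = h x \<ominus>\<^bsub>W\<^esub> h y" if "h = f \<or> h = g" "x \<in> VV" "y \<in> VV" for h x y
    using lin[OF that(1)] that by (simp add: diff_eq W.diff_eq)
  show ?thesis
  proof (rule closed_subspaceI)
    show "\<zero> \<in> {x \<in> VV. f x = g x}" using lin(3)[of f \<zero> 0] lin(3)[of g \<zero> 0] lin(1)[of f \<zero>] lin(1)[of g \<zero>] by simp
    fix x assume x: "x \<in> VV" and cl: "\<And>e. e > 0 ==> \<exists>y\<in>{x \<in> VV. f x = g x}. nrm (y \<ominus> x) < e"
    have "nW (f x \<ominus>\<^bsub>W\<^esub> g x) \<le> 0"
    proof (rule field_le_epsilon)
      fix e :: real assume e: "e > 0"
      have "e / (c + d) > 0" using e c(1) d(1) by simp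
      then obtain y where y: "y \<in> VV" "f y = g y" "nrm (y \<ominus> x) < e / (c + d)" using cl by blast
      have "nW (f x \<ominus>\<^bsub>W\<^esub> g x) \<le> nW (f x \<ominus>\<^bsub>W\<^esub> f y) + nW (g y \<ominus>\<^bsub>W\<^esub> g x)"
        using W.nrm_diff_triangle[of "f x" "f y" "g x"] lin(1) x y(1,2) by simp
      also have "\<dots> = nW (f (y \<ominus> x)) + nW (g (y \<ominus> x))"
        using W.nrm_diff_swap[of "f x" "f y"] lin(1) dif x y(1) by simp
      also have "\<dots> \<le> (c + d) * nrm (y \<ominus> x)" using c(2)[of "y \<ominus> x"] d(2)[of "y \<ominus> x"] x y(1) by (simp add: distrib_right)
      also have "\<dots> \<le> e" using y(3) c(1) d(1) by (simp add: pos_less_divide_eq mult.commute)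
      finally show "nW (f x \<ominus>\<^bsub>W\<^esub> g x) \<le> 0 + e" by simp
    qed
    then show "x \<in> {x \<in> VV. f x = g x}" using W.eqI_dist[of "f x" "g x"] lin(1) x by simp
  qed (auto simp: lin)
qed

lemma (in seminormed_module) bounded_between_zero:
  "normed_module W nW ==> bounded_between V nrm W nW (\<lambda>x. \<zero>\<^bsub>W\<^esub>)"
proof -
  assume "normed_module W nW"
  then interpret W: normed_module W nW .
  show ?thesis unfolding bounded_between_def using nrm_nonneg by (auto intro!: exI[of _ 1])
qed

context hilbert
begin

section \<open>Operators on a Hilbert space\<close>

abbreviation BO where "BO \<equiv> bounded_ops H"
abbreviation BB where "BB \<equiv> carrier BO"
abbreviation opn where "opn \<equiv> op_norm H hn"

lemma bounded_ops_simps [simp]: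
  "S \<otimes>\<^bsub>BO\<^esub> S' = compose (HH) S S'" "\<one>\<^bsub>BO\<^esub> = (\<lambda>x\<in>HH. x)"
  "\<zero>\<^bsub>BO\<^esub> = (\<lambda>x\<in>HH. \<zero>)" "S \<oplus>\<^bsub>BO\<^esub> S' = (\<lambda>x\<in>HH. S x \<oplus> S' x)"
  "c \<odot>\<^bsub>BO\<^esub> S = (\<lambda>x\<in>HH. c \<odot> S x)" "anorm BO = opn"
  by (simp_all add: bounded_ops_def)

lemma carrier_BO: "BB = bounded_maps H hn"
  by (simp add: bounded_ops_def)

lemma BO_I:
  assumes "S \<in> extensional (HH)" "\<And>x. x \<in> HH ==> S x \<in> HH"
    "\<And>x y. x \<in> HH ==> y \<in> HH ==> S (x \<oplus> y) = S x \<oplus> S y"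
    "\<And>c x. x \<in> HH ==> S (c \<odot> x) = c \<odot> S x"
    "\<And>x. x \<in> HH ==> hn (S x) \<le> c * hn x"
  shows "S \<in> BB"
  unfolding carrier_BO bounded_maps_def linear_maps_def
  by (intro CollectI conjI exI[of _ c] PiE_I ballI allI) (use assms in \<open>simp_all add: extensional_def\<close>)

lemma BO_ext [simp]: "S \<in> BB ==> S \<in> extensional (HH)"
  by (auto simp: carrier_BO bounded_maps_def linear_maps_def PiE_def)

lemma BO_closed [simp]: "S \<in> BB ==> x \<in> HH ==> S x \<in> HH"
  by (auto simp: carrier_BO bounded_maps_def linear_maps_def)

lemma BO_add: "S \<in> BB ==> x \<in> HH ==> y \<in> HH ==> S (x \<oplus> y) = S x \<oplus> S y"
  by (auto simp: carrier_BO bounded_maps_def linear_maps_def)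

lemma BO_smult: "S \<in> BB ==> x \<in> HH ==> S (c \<odot> x) = c \<odot> S x"
  by (auto simp: carrier_BO bounded_maps_def linear_maps_def)

lemma BO_zero [simp]: "S \<in> BB ==> S \<zero> = \<zero>"
  using BO_smult[of S \<zero> 0] by simp

lemma BO_diff: "S \<in> BB ==> x \<in> HH ==> y \<in> HH ==> S (x \<ominus> y) = S x \<ominus> S y"
  by (simp add: diff_eq BO_add BO_smult)

lemma BO_bound:
  assumes S: "S \<in> BB" and x: "x \<in> HH" shows "hn (S x) \<le> opn S * hn x"
proof -
  obtain c where c: "\<And>x. x \<in> HH ==> hn (S x) \<le> c * hn x"
    using S unfolding carrier_BO bounded_maps_def by blast
  show ?thesis
  proof (cases "hn x = 0")
    case True
    then have "x = \<zero>" using x nrm_definite by blast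
    then show ?thesis using S by simp
  next
    case False
    then have hx: "hn x > 0" using hn_nonneg[OF x] by simp
    let ?y = "complex_of_real (1 / hn x) \<odot> x"
    have y: "?y \<in> HH" "hn ?y = 1" using x hx by (simp_all add: nrm_smult norm_divide)
    have "hn (S z) \<le> \<bar>c\<bar>" if z: "z \<in> HH" "hn z \<le> 1" for z
    proof -
      have "c * hn z \<le> \<bar>c\<bar> * 1" using z by (intro mult_mono) auto
      then show ?thesis using c[OF z(1)] by linarith
    qed
    then have "bdd_above {hn (S x) |x. x \<in> HH \<and> hn x \<le> 1}" by (intro bdd_aboveI[of _ "\<bar>c\<bar>"]) blast
    then have "hn (S ?y) \<le> opn S" unfolding op_norm_def using y by (intro cSup_upper) auto
    moreover have "hn (S ?y) = hn (S x) / hn x"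
      using S x hx by (simp add: BO_smult nrm_smult norm_divide)
    ultimately show ?thesis using hx by (simp add: divide_le_eq)
  qed
qed

lemma opn_le:
  assumes "\<And>x. x \<in> HH ==> hn (S x) \<le> c * hn x" "c \<ge> 0"
  shows "opn S \<le> c"
  unfolding op_norm_def
proof (rule cSup_least)
  show "{hn (S x) |x. x \<in> HH \<and> hn x \<le> 1} \<noteq> {}" using M.zero_closed nrm_zero by force
  fix y assume "y \<in> {hn (S x) |x. x \<in> HH \<and> hn x \<le> 1}"
  then obtain x where x: "x \<in> HH" "hn x \<le> 1" "y = hn (S x)" by blast
  have "c * hn x \<le> c * 1" using x assms(2) by (intro mult_left_mono)
  then show "y \<le> c" using assms(1)[OF x(1)] x(3) by linarith
qed

lemma opn_nonneg: "S \<in> BB ==> opn S \<ge> 0"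
proof -
  assume S: "S \<in> BB"
  obtain c where c: "\<And>x. x \<in> HH ==> hn (S x) \<le> c * hn x"
    using S unfolding carrier_BO bounded_maps_def by blast
  have "hn (S z) \<le> \<bar>c\<bar>" if z: "z \<in> HH" "hn z \<le> 1" for z
  proof -
    have "c * hn z \<le> \<bar>c\<bar> * 1" using z by (intro mult_mono) auto
    then show ?thesis using c[OF z(1)] by linarith
  qed
  then have "bdd_above {hn (S x) |x. x \<in> HH \<and> hn x \<le> 1}" by (intro bdd_aboveI[of _ "\<bar>c\<bar>"]) blast
  then have "hn (S \<zero>) \<le> opn S" unfolding op_norm_def by (rule cSup_upper[rotated]) (use M.zero_closed nrm_zero in force)
  then show ?thesis using S by simp
qed

lemma opn_le_form:
  assumes S: "S \<in> BB" and c: "c \<ge> 0"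
    and bd: "\<And>x y. x \<in> HH ==> y \<in> HH ==> cmod (ip (S x) y) \<le> c * hn x * hn y"
  shows "opn S \<le> c"
  by (rule opn_le[OF hn_eq_of_ip c]) (use S c bd in simp_all)

lemma BO_ip_bound:
  assumes "S \<in> BB" "x \<in> HH" "y \<in> HH"
  shows "cmod (ip (S x) y) \<le> opn S * hn x * hn y"
proof -
  have "hn (S x) * hn y \<le> opn S * hn x * hn y" using BO_bound assms by (intro mult_right_mono) auto
  then show ?thesis using Cauchy_Schwarz[of "S x" y] assms by simp
qed

lemma BO_eqI:
  assumes "S \<in> BB" "S' \<in> BB" "\<And>x. x \<in> HH ==> S x = S' x"
  shows "S = S'"
  using assms by (intro extensionalityI[of S "HH"]) auto

lemma BO_eqI2:
  assumes "S \<in> BB" "S' \<in> BB"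
    "\<And>x y. x \<in> HH ==> y \<in> HH ==> ip (S x) y = ip (S' x) y"
  shows "S = S'"
  by (rule BO_eqI[OF assms(1,2)], rule ip_ext) (use assms in auto)

lemma compose_BO [simp]:
  assumes S: "S \<in> BB" and S': "S' \<in> BB"
  shows "compose (HH) S S' \<in> BB" and "opn (compose (HH) S S') \<le> opn S * opn S'"
proof -
  have b: "hn (compose (HH) S S' x) \<le> opn S * opn S' * hn x" if x: "x \<in> HH" for x
  proof -
    have "opn S * hn (S' x) \<le> opn S * (opn S' * hn x)"
      using BO_bound[OF S' x] opn_nonneg[OF S] by (intro mult_left_mono)
    then show ?thesis using BO_bound[OF S, of "S' x"] S' x by (simp add: compose_eq mult.assoc)
  qed
  show "compose (HH) S S' \<in> BB"
    by (rule BO_I[OF _ _ _ _ b]) (use S S' in \<open>simp_all add: compose_eq BO_add BO_smult\<close>)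
  show "opn (compose (HH) S S') \<le> opn S * opn S'"
    using opn_le[OF b mult_nonneg_nonneg[OF opn_nonneg[OF S] opn_nonneg[OF S']]] .
qed

lemma id_BO [simp]: "(\<lambda>x\<in>HH. x) \<in> BB"
  by (rule BO_I[where c = 1]) simp_all

lemma zero_BO [simp]: "(\<lambda>x\<in>HH. \<zero>) \<in> BB"
  by (rule BO_I[where c = 1]) simp_all

lemma add_BO [simp]:
  assumes S: "S \<in> BB" and S': "S' \<in> BB"
  shows "(\<lambda>x\<in>HH. S x \<oplus> S' x) \<in> BB" and "opn (\<lambda>x\<in>HH. S x \<oplus> S' x) \<le> opn S + opn S'"
proof -
  have b: "hn ((\<lambda>x\<in>HH. S x \<oplus> S' x) x) \<le> (opn S + opn S') * hn x" if x: "x \<in> HH" for x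
    using BO_bound[OF S x] BO_bound[OF S' x] nrm_add[of "S x" "S' x"] S S' x by (simp add: algebra_simps)
  show "(\<lambda>x\<in>HH. S x \<oplus> S' x) \<in> BB"
    by (rule BO_I[OF _ _ _ _ b]) (use S S' in \<open>simp_all add: BO_add BO_smult smult_add_right M.a_ac\<close>)
  show "opn (\<lambda>x\<in>HH. S x \<oplus> S' x) \<le> opn S + opn S'"
    by (rule opn_le[OF b]) (use S S' in \<open>simp_all add: opn_nonneg\<close>)
qed

lemma smult_BO [simp]:
  assumes S: "S \<in> BB"
  shows "(\<lambda>x\<in>HH. c \<odot> S x) \<in> BB" and "opn (\<lambda>x\<in>HH. c \<odot> S x) = cmod c * opn S"
proof -
  have b: "hn ((\<lambda>x\<in>HH. c \<odot> S x) x) \<le> (cmod c * opn S) * hn x" if x: "x \<in> HH" and S: "S \<in> BB" for x c S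
    using BO_bound[OF S x] S x by (simp add: nrm_smult mult.assoc mult_left_mono)
  have m: "(\<lambda>x\<in>HH. c \<odot> S x) \<in> BB" if S: "S \<in> BB" for c S
    by (rule BO_I[OF _ _ _ _ b[OF _ S]]) (use S in \<open>simp_all add: BO_add BO_smult smult_add_right mult.commute\<close>)
  have l: "opn (\<lambda>x\<in>HH. c \<odot> S x) \<le> cmod c * opn S" if S: "S \<in> BB" for c S
    by (rule opn_le[OF b[OF _ S]]) (use S in \<open>simp_all add: opn_nonneg\<close>)
  show "(\<lambda>x\<in>HH. c \<odot> S x) \<in> BB" using m S .
  show "opn (\<lambda>x\<in>HH. c \<odot> S x) = cmod c * opn S"
  proof (cases "c = 0")
    case True
    then show ?thesis using l[OF S, of c] opn_nonneg[OF m[OF S, of c]] by simp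
  next
    case False
    have e: "(\<lambda>x\<in>HH. (1/c) \<odot> (\<lambda>x\<in>HH. c \<odot> S x) x) = S"
      using False S by (intro BO_eqI m) simp_all
    have "opn S \<le> cmod (1/c) * opn (\<lambda>x\<in>HH. c \<odot> S x)" using l[OF m[OF S], of "1/c" c] e by simp
    then have "cmod c * opn S \<le> opn (\<lambda>x\<in>HH. c \<odot> S x)"
      using False by (simp add: norm_divide field_simps)
    then show ?thesis using l[OF S, of c] by simp
  qed
qed

lemma normed_module_BO: "normed_module BO opn"
proof -
  have "complex_module BO"
  proof (rule complex_module.intro, rule complex_moduleI)
    show "c \<odot>\<^bsub>BO\<^esub> (S \<oplus>\<^bsub>BO\<^esub> S') = c \<odot>\<^bsub>BO\<^esub> S \<oplus>\<^bsub>BO\<^esub> c \<odot>\<^bsub>BO\<^esub> S'"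
      if "S \<in> BB" "S' \<in> BB" for c S S'
      using that by (auto intro!: restrict_ext simp: smult_add_right)
    show "(c + d) \<odot>\<^bsub>BO\<^esub> S = c \<odot>\<^bsub>BO\<^esub> S \<oplus>\<^bsub>BO\<^esub> d \<odot>\<^bsub>BO\<^esub> S" if "S \<in> BB" for c d S
      using that by (auto intro!: restrict_ext simp: smult_add)
    show "(c * d) \<odot>\<^bsub>BO\<^esub> S = c \<odot>\<^bsub>BO\<^esub> (d \<odot>\<^bsub>BO\<^esub> S)" if "S \<in> BB" for c d S
      using that by (auto intro!: restrict_ext)
    show "1 \<odot>\<^bsub>BO\<^esub> S = S" if "S \<in> BB" for S
      using that by (intro BO_eqI) simp_all
    show "\<zero>\<^bsub>BO\<^esub> \<oplus>\<^bsub>BO\<^esub> S = S" if "S \<in> BB" for S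
      using that by (intro BO_eqI) simp_all
    show "0 \<odot>\<^bsub>BO\<^esub> S = \<zero>\<^bsub>BO\<^esub>" if "S \<in> BB" for S
      using that by (intro BO_eqI) simp_all
  qed (auto intro!: restrict_ext simp: M.a_ac)
  moreover have "S = \<zero>\<^bsub>BO\<^esub>" if S: "S \<in> BB" "opn S = 0" for S
  proof (rule BO_eqI[OF S(1)])
    fix x assume x: "x \<in> HH"
    have "S x = \<zero>" using BO_bound[OF S(1) x] S x by (intro eq_zeroI) simp_all
    then show "S x = \<zero>\<^bsub>BO\<^esub> x" using x by simp
  qed simp
  ultimately show ?thesis
    by (auto intro!: normed_module.intro seminormed_module.intro normed_module_axioms.intro seminormed_module_axioms.intro)
qed

sublocale B: normed_module BO opn by (rule normed_module_BO)

text \<open>The form \<open>ip x (S y)\<close> is represented by an operator, and conjugation turns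
  this into the defining relation. This gives meaning to the \<open>THE\<close> behind
  \<open>star\<close> in \<open>bounded_ops\<close>.\<close>

lemma adjoint_exists:
  assumes S: "S \<in> BB"
  shows "\<exists>!S'. S' \<in> bounded_maps H hn \<and> (\<forall>x\<in>HH. \<forall>y\<in>HH. ip (S x) y = ip x (S' y))"
proof -
  obtain A where A: "A \<in> bounded_maps H hn"
    "\<And>x y. x \<in> HH ==> y \<in> HH ==> ip (A x) y = ip x (S y)"
  proof (rule form_to_operator[of "\<lambda>x y. ip x (S y)" "opn S"])
    fix x y assume "x \<in> HH" "y \<in> HH"
    then show "cmod (ip x (S y)) \<le> opn S * hn x * hn y"
      using BO_ip_bound[OF S, of y x] ip_cnj[of "S y" x] S by (simp add: mult.commute mult.left_commute)
  qed (use S in \<open>simp_all add: BO_add BO_smult\<close>)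
  have a: "ip (S x) y = ip x (A y)" if "x \<in> HH" "y \<in> HH" for x y
    using A that S ip_cnj[of "A y" x] ip_cnj[of y "S x"] by (metis BO_closed carrier_BO complex_cnj_cnj)
  show ?thesis
  proof (rule ex1I[of _ A])
    show "A \<in> bounded_maps H hn \<and> (\<forall>x\<in>HH. \<forall>y\<in>HH. ip (S x) y = ip x (A y))"
      using A a by blast
    fix A' assume A': "A' \<in> bounded_maps H hn \<and> (\<forall>x\<in>HH. \<forall>y\<in>HH. ip (S x) y = ip x (A' y))"
    show "A' = A"
    proof (rule BO_eqI2)
      fix y x assume xy: "y \<in> HH" "x \<in> HH"
      have "ip x (A' y) = ip x (A y)" using A' a xy by simp
      then show "ip (A' y) x = ip (A y) x"
        using ip_cnj[of x "A' y"] ip_cnj[of x "A y"] xy A A' by (metis BO_closed carrier_BO)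
    qed (use A A' in \<open>simp_all add: carrier_BO\<close>)
  qed
qed

lemma star_BO:
  assumes S: "S \<in> BB"
  shows "star BO S \<in> BB"
    and "\<And>x y. x \<in> HH ==> y \<in> HH ==> ip (S x) y = ip x (star BO S y)"
  using theI'[OF adjoint_exists[OF S]] by (auto simp: bounded_ops_def)

lemma star_BO_eqI:
  assumes S: "S \<in> BB" and A: "A \<in> BB"
    and a: "\<And>x y. x \<in> HH ==> y \<in> HH ==> ip (S x) y = ip x (A y)"
  shows "star BO S = A"
proof -
  have "star BO S = (THE S'. S' \<in> bounded_maps H hn \<and> (\<forall>x\<in>HH. \<forall>y\<in>HH. ip (S x) y = ip x (S' y)))"
    by (simp add: bounded_ops_def)
  also have "\<dots> = A" by (rule the1_equality[OF adjoint_exists[OF S]]) (use A a in \<open>simp add: carrier_BO\<close>)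
  finally show ?thesis .
qed

lemma opn_star: assumes S: "S \<in> BB" shows "opn (star BO S) \<le> opn S"
proof (rule opn_le_form)
  fix x y assume x: "x \<in> HH" and y: "y \<in> HH"
  have "cmod (ip (star BO S x) y) = cmod (ip (S y) x)"
    using star_BO[OF S] ip_cnj[of "star BO S x" y] x y by simp
  then show "cmod (ip (star BO S x) y) \<le> opn S * hn x * hn y"
    using BO_ip_bound[OF S y x] by (simp add: mult.commute mult.left_commute)
qed (use S star_BO opn_nonneg in auto)

lemma star_star_BO: assumes S: "S \<in> BB" shows "star BO (star BO S) = S"
proof (rule star_BO_eqI)
  fix x y assume x: "x \<in> HH" and y: "y \<in> HH"
  show "ip (star BO S x) y = ip x (S y)"
    using star_BO(2)[OF S y x] ip_cnj[of "star BO S x" y] ip_cnj[of x "S y"] star_BO(1)[OF S] S x y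
    by (metis BO_closed complex_cnj_cnj)
qed (use S star_BO in auto)

lemma opn_star_eq: "S \<in> BB ==> opn (star BO S) = opn S"
  using opn_star[of S] opn_star[of "star BO S"] star_star_BO[of S] star_BO(1)[of S] by simp

lemma unitaryD:
  assumes "U \<in> carrier (unitary_group H)"
  shows "U \<in> BB" "\<And>x y. x \<in> HH ==> y \<in> HH ==> ip (U x) (U y) = ip x y"
proof -
  show U: "U \<in> BB" using assms by (simp add: unitary_group_def)
  have e: "compose (HH) (star BO U) U = (\<lambda>x\<in>HH. x)"
    using assms by (simp add: unitary_group_def)
  fix x y assume x: "x \<in> HH" and y: "y \<in> HH"
  have "star BO U (U y) = y" using fun_cong[OF e, of y] y by (simp add: compose_eq)
  then show "ip (U x) (U y) = ip x y" using star_BO(2)[OF U x, of "U y"] U y by simp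
qed

lemma unitaryI:
  assumes U: "U \<in> BB" and V: "V \<in> BB"
    and UV: "\<And>x. x \<in> HH ==> U (V x) = x" "\<And>x. x \<in> HH ==> V (U x) = x"
    and ip: "\<And>x y. x \<in> HH ==> y \<in> HH ==> ip (U x) (U y) = ip x y"
  shows "U \<in> carrier (unitary_group H)"
proof -
  have "star BO U = V"
  proof (rule star_BO_eqI[OF U V])
    fix x y assume x: "x \<in> HH" and y: "y \<in> HH"
    show "ip (U x) y = ip x (V y)" using ip[OF x BO_closed[OF V y]] UV(1)[OF y] by simp
  qed
  moreover have "compose (HH) U V = (\<lambda>x\<in>HH. x)" "compose (HH) V U = (\<lambda>x\<in>HH. x)"
    unfolding compose_def using UV by (auto intro: restrict_ext)
  ultimately show ?thesis using U by (simp add: unitary_group_def)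
qed

lemma unitary_group_simps [simp]:
  "U \<otimes>\<^bsub>unitary_group H\<^esub> U' = compose (HH) U U'" "\<one>\<^bsub>unitary_group H\<^esub> = (\<lambda>x\<in>HH. x)"
  by (simp_all add: unitary_group_def)

text \<open>Together with \<open>closed_spanI\<close> this reduces totality questions about
  \<open>closed_span\<close> to closed subspaces in the sense of
  \<open>closed_subspace\<close>.\<close>

lemma closed_span_total:
  assumes "closed_span H S = HH" "closed_subspace K" "S \<subseteq> K"
  shows "K = HH"
proof -
  have "closed_span H S \<subseteq> K" using assms(2,3) unfolding closed_span_def closed_subspace_iff by blast
  then show ?thesis using assms(1,2) unfolding closed_subspace_def by blast
qed

lemma closed_spanI:
  assumes "\<And>K. closed_subspace K ==> S \<subseteq> K ==> K = HH" "S \<subseteq> HH"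
  shows "closed_span H S = HH"
proof -
  have "closed_subspace (HH)" by (rule closed_subspaceI) auto
  then show ?thesis using assms unfolding closed_span_def closed_subspace_iff by blast
qed

lemma bounded_between_BO: assumes S: "S \<in> BB" shows "bounded_between H hn H hn S"
proof -
  have "opn S + 1 > 0" using opn_nonneg[OF S] by linarith
  moreover have "hn (S x) \<le> (opn S + 1) * hn x" if "x \<in> HH" for x
    using BO_bound[OF S that] hn_nonneg[OF that] by (simp add: distrib_right)
  ultimately show ?thesis using S unfolding bounded_between_def by (simp add: BO_add BO_smult) blast
qed

lemma closed_subspace_BO_eq:
  assumes "S \<in> BB" "S' \<in> BB"
  shows "closed_subspace {x \<in> HH. S x = S' x}"
  by (rule equalizer_closed[OF normed_module_axioms bounded_between_BO bounded_between_BO]) fact+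

end

section \<open>Convolution\<close>

context pro_group
begin

lemma unif2_mult:
  assumes F: "unif2 F" and F': "unif2 F'" shows "unif2 (\<lambda>x y. F x y * F' x y)"
proof -
  obtain B where B1: "\<And>x y. x \<in> GG ==> y \<in> GG ==> cmod (F x y) \<le> B" using F unfolding unif2_def by blast
  obtain B' where B2: "\<And>x y. x \<in> GG ==> y \<in> GG ==> cmod (F' x y) \<le> B'" using F' unfolding unif2_def by blast
  note B = B1 B2
  have B0: "B \<ge> 0" "B' \<ge> 0"
    using order_trans[OF norm_ge_zero B(1)[OF one_closed one_closed]] order_trans[OF norm_ge_zero B(2)[OF one_closed one_closed]] .
  have "\<exists>N\<in>NN. osc2 N (\<lambda>x y. F x y * F' x y) e" if e: "e > 0" for e
  proof -
    define d where "d = e / (B + B' + 1)"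
    have d: "d > 0" using e B0 by (simp add: d_def)
    obtain N where N1: "N \<in> NN" "osc2 N F d" using F d unfolding unif2_def by blast
    obtain N' where N2: "N' \<in> NN" "osc2 N' F' d" using F' d unfolding unif2_def by blast
    note N = N1 N2
    let ?M = "N \<inter> N'"
    have M: "?M \<in> NN" using Int_NN N by blast
    have "cmod (F x y * F' x y - F x' y' * F' x' y') \<le> e"
      if "x \<in> GG" "x' \<in> GG" "y \<in> GG" "y' \<in> GG" "?M #> x = ?M #> x'" "?M #> y = ?M #> y'" for x x' y y'
    proof -
      have c: "N #> x = N #> x'" "N' #> x = N' #> x'" "N #> y = N #> y'" "N' #> y = N' #> y'"
        using coset_refine[OF N(1) M Int_lower1 that(1,2,5)] coset_refine[OF N(3) M Int_lower2 that(1,2,5)]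
          coset_refine[OF N(1) M Int_lower1 that(3,4,6)] coset_refine[OF N(3) M Int_lower2 that(3,4,6)] .
      have a: "cmod (F x y - F x' y') \<le> d" using N(2) c that unfolding osc2_def by blast
      have b: "cmod (F' x y - F' x' y') \<le> d" using N(4) c that unfolding osc2_def by blast
      have "cmod (F x y * F' x y - F x' y' * F' x' y') =
         cmod (F x y * (F' x y - F' x' y') + (F x y - F x' y') * F' x' y')" by (simp add: algebra_simps)
      also have "\<dots> \<le> cmod (F x y) * cmod (F' x y - F' x' y') + cmod (F x y - F x' y') * cmod (F' x' y')"
        by (metis norm_mult norm_triangle_ineq)
      also have "\<dots> \<le> B * d + d * B'" using a b B that B0 d by (intro add_mono mult_mono) auto
      also have "\<dots> \<le> (B + B' + 1) * d" using d by (simp add: algebra_simps)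
      also have "\<dots> = e" using B0 by (simp add: d_def)
      finally show ?thesis .
    qed
    then have "osc2 ?M (\<lambda>x y. F x y * F' x y) e" unfolding osc2_def by blast
    then show ?thesis using M by blast
  qed
  moreover have "cmod (F x y * F' x y) \<le> B * B'" if "x \<in> GG" "y \<in> GG" for x y
    using B[OF that] B0 by (simp add: norm_mult mult_mono)
  ultimately show ?thesis unfolding unif2_def by blast
qed

text \<open>Maps of two variables that descend to every finite quotient. The class is closed under
  the group operations, so \<open>resp_intros\<close> verifies it for any word in the
  variables.\<close>

definition resp :: "('g \<Rightarrow> 'g \<Rightarrow> 'g) \<Rightarrow> bool" where
  "resp p \<longleftrightarrow> (\<forall>x\<in>GG. \<forall>y\<in>GG. p x y \<in> GG) \<and>
     (\<forall>N\<in>NN. \<forall>x\<in>GG. \<forall>x'\<in>GG. \<forall>y\<in>GG. \<forall>y'\<in>GG. N #> x = N #> x' \<longrightarrow> N #> y = N #> y' \<longrightarrow> N #> p x y = N #> p x' y')"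

lemma respD:
  assumes "resp p"
  shows "x \<in> GG ==> y \<in> GG ==> p x y \<in> GG"
    "N \<in> NN ==> x \<in> GG ==> x' \<in> GG ==> y \<in> GG ==> y' \<in> GG ==> N #> x = N #> x' ==> N #> y = N #> y' ==>
      N #> p x y = N #> p x' y'"
  using conjunct1[OF assms[unfolded resp_def]] conjunct2[OF assms[unfolded resp_def]] by (blast, blast)

lemma respI:
  assumes "\<And>x y. x \<in> GG ==> y \<in> GG ==> p x y \<in> GG"
    "\<And>N x x' y y'. N \<in> NN ==> x \<in> GG ==> x' \<in> GG ==> y \<in> GG ==> y' \<in> GG ==> N #> x = N #> x' ==> N #> y = N #> y' ==>
      N #> p x y = N #> p x' y'"
  shows "resp p"
  unfolding resp_def
proof (intro conjI ballI impI)
  fix N x x' y y'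
  assume "N \<in> NN" "x \<in> GG" "x' \<in> GG" "y \<in> GG" "y' \<in> GG" "N #> x = N #> x'" "N #> y = N #> y'"
  then show "N #> p x y = N #> p x' y'" by (rule assms(2))
qed (rule assms(1))

lemma resp_fst: "resp (\<lambda>x y. x)"
  by (rule respI)

lemma resp_snd: "resp (\<lambda>x y. y)"
  by (rule respI)

lemma resp_const: "g \<in> GG ==> resp (\<lambda>x y. g)"
  by (rule respI[OF _ refl])

lemma resp_mult:
  assumes "resp p" "resp q" shows "resp (\<lambda>x y. p x y \<otimes> q x y)"
proof -
  have "N #> (p x y \<otimes> q x y) = N #> (p x' y' \<otimes> q x' y')"
    if "N \<in> NN" "x \<in> GG" "x' \<in> GG" "y \<in> GG" "y' \<in> GG" "N #> x = N #> x'" "N #> y = N #> y'" for N x x' y y'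
    by (rule coset_mult[OF that(1) respD(1)[OF assms(1) that(2,4)] respD(1)[OF assms(2) that(2,4)]
          respD(1)[OF assms(1) that(3,5)] respD(1)[OF assms(2) that(3,5)] respD(2)[OF assms(1) that] respD(2)[OF assms(2) that]])
  then show ?thesis by (intro respI m_closed respD(1)[OF assms(1)] respD(1)[OF assms(2)])
qed

lemma resp_inv:
  assumes "resp p" shows "resp (\<lambda>x y. inv (p x y))"
proof -
  have "N #> inv (p x y) = N #> inv (p x' y')"
    if "N \<in> NN" "x \<in> GG" "x' \<in> GG" "y \<in> GG" "y' \<in> GG" "N #> x = N #> x'" "N #> y = N #> y'" for N x x' y y'
    by (rule coset_inv[OF that(1) respD(1)[OF assms that(2,4)] respD(1)[OF assms that(3,5)] respD(2)[OF assms that]])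
  then show ?thesis by (intro respI inv_closed respD(1)[OF assms])
qed

lemmas resp_intros = resp_fst resp_snd resp_const resp_mult resp_inv

lemma unif2_comp:
  assumes f: "f \<in> CF" and p: "resp p" shows "unif2 (\<lambda>x y. f (p x y))"
proof -
  have "\<exists>N\<in>NN. osc2 N (\<lambda>x y. f (p x y)) e" if e: "e > 0" for e
  proof -
    obtain N where N: "N \<in> NN" "osc N f e" using cont_osc[OF f e] by blast
    have "osc2 N (\<lambda>x y. f (p x y)) e"
      unfolding osc2_def
    proof (intro ballI impI)
      fix x x' y y' assume a: "x \<in> GG" "x' \<in> GG" "y \<in> GG" "y' \<in> GG" "N #> x = N #> x'" "N #> y = N #> y'"
      show "cmod (f (p x y) - f (p x' y')) \<le> e"
        by (rule oscD[OF N(2) respD(1)[OF p a(1,3)] respD(1)[OF p a(2,4)] respD(2)[OF p N(1) a]])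
    qed
    then show ?thesis using N(1) by blast
  qed
  moreover obtain B where "\<forall>x\<in>GG. cmod (f x) \<le> B" using cont_bounded[OF f] by blast
  then have "\<forall>x\<in>GG. \<forall>y\<in>GG. cmod (f (p x y)) \<le> B" using respD(1)[OF p] by blast
  ultimately show ?thesis unfolding unif2_def by blast
qed

lemma haar_smult_right: "f \<in> CF ==> haar (\<lambda>x\<in>GG. f x * c) = haar f * c"
  using haar_smult[of f c] by (simp add: mult.commute)

section \<open>The convolution algebra of continuous functions\<close>

definition conv :: "('g \<Rightarrow> complex) \<Rightarrow> ('g \<Rightarrow> complex) \<Rightarrow> 'g \<Rightarrow> complex" where
  "conv f h = (\<lambda>s\<in>GG. haar (\<lambda>t\<in>GG. f t * h (inv t \<otimes> s)))"

definition inv_cnj :: "('g \<Rightarrow> complex) \<Rightarrow> 'g \<Rightarrow> complex" where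
  "inv_cnj f = (\<lambda>s\<in>GG. cnj (f (inv s)))"

lemma conv_integrand: "f \<in> CF ==> h \<in> CF ==> s \<in> GG ==> (\<lambda>t\<in>GG. f t * h (inv t \<otimes> s)) \<in> CF"
  by (rule unif2_inner[of "\<lambda>s t. f t * h (inv t \<otimes> s)" s]) (intro unif2_mult unif2_comp resp_intros, assumption+)

lemma conv_cont [simp]: "f \<in> CF ==> h \<in> CF ==> conv f h \<in> CF"
  unfolding conv_def
  by (rule unif2_outer, intro unif2_mult unif2_comp resp_intros, assumption+)

lemma conv_apply: "s \<in> GG ==> conv f h s = haar (\<lambda>t\<in>GG. f t * h (inv t \<otimes> s))"
  by (simp add: conv_def)

lemma inv_cnj_cont [simp]: "f \<in> CF ==> inv_cnj f \<in> CF"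
  unfolding inv_cnj_def using cont_cnj[OF cont_inv[of f]] by (simp cong: restrict_cong)

lemma inv_cnj_apply: "s \<in> GG ==> inv_cnj f s = cnj (f (inv s))"
  by (simp add: inv_cnj_def)

lemma conv_add_left:
  assumes "f \<in> CF" "f' \<in> CF" "h \<in> CF"
  shows "conv (\<lambda>x\<in>GG. f x + f' x) h = (\<lambda>x\<in>GG. conv f h x + conv f' h x)"
  unfolding conv_def
proof (rule restrict_ext)
  fix s assume s: "s \<in> GG"
  show "haar (\<lambda>t\<in>GG. (\<lambda>x\<in>GG. f x + f' x) t * h (inv t \<otimes> s)) =
    (\<lambda>s\<in>GG. haar (\<lambda>t\<in>GG. f t * h (inv t \<otimes> s))) s + (\<lambda>s\<in>GG. haar (\<lambda>t\<in>GG. f' t * h (inv t \<otimes> s))) s"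
    using haar_add[OF conv_integrand[OF assms(1,3) s] conv_integrand[OF assms(2,3) s]] s
    by (simp add: distrib_right cong: restrict_cong)
qed

lemma conv_add_right:
  assumes "f \<in> CF" "h \<in> CF" "h' \<in> CF"
  shows "conv f (\<lambda>x\<in>GG. h x + h' x) = (\<lambda>x\<in>GG. conv f h x + conv f h' x)"
  unfolding conv_def
proof (rule restrict_ext)
  fix s assume s: "s \<in> GG"
  show "haar (\<lambda>t\<in>GG. f t * (\<lambda>x\<in>GG. h x + h' x) (inv t \<otimes> s)) =
    (\<lambda>s\<in>GG. haar (\<lambda>t\<in>GG. f t * h (inv t \<otimes> s))) s + (\<lambda>s\<in>GG. haar (\<lambda>t\<in>GG. f t * h' (inv t \<otimes> s))) s"
    using haar_add[OF conv_integrand[OF assms(1,2) s] conv_integrand[OF assms(1,3) s]] s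
    by (simp add: distrib_left cong: restrict_cong)
qed

lemma conv_smult_left:
  assumes "f \<in> CF" "h \<in> CF"
  shows "conv (\<lambda>x\<in>GG. c * f x) h = (\<lambda>x\<in>GG. c * conv f h x)"
  unfolding conv_def
proof (rule restrict_ext)
  fix s assume s: "s \<in> GG"
  show "haar (\<lambda>t\<in>GG. (\<lambda>x\<in>GG. c * f x) t * h (inv t \<otimes> s)) = c * (\<lambda>s\<in>GG. haar (\<lambda>t\<in>GG. f t * h (inv t \<otimes> s))) s"
    using haar_smult[OF conv_integrand[OF assms s], of c] s by (simp add: mult.assoc cong: restrict_cong)
qed

lemma conv_smult_right:
  assumes "f \<in> CF" "h \<in> CF"
  shows "conv f (\<lambda>x\<in>GG. c * h x) = (\<lambda>x\<in>GG. c * conv f h x)"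
  unfolding conv_def
proof (rule restrict_ext)
  fix s assume s: "s \<in> GG"
  show "haar (\<lambda>t\<in>GG. f t * (\<lambda>x\<in>GG. c * h x) (inv t \<otimes> s)) = c * (\<lambda>s\<in>GG. haar (\<lambda>t\<in>GG. f t * h (inv t \<otimes> s))) s"
    using haar_smult[OF conv_integrand[OF assms s], of c] s by (simp add: mult.left_commute cong: restrict_cong)
qed

lemma inv_mult_cancel: "a \<in> GG ==> b \<in> GG ==> inv a \<otimes> (a \<otimes> b) = b" "a \<in> GG ==> b \<in> GG ==> a \<otimes> (inv a \<otimes> b) = b"
  by (simp_all add: m_assoc[symmetric])

text \<open>Interchange of the integrals, followed by left invariance in the inner one.\<close>

lemma conv_assoc:
  assumes f: "f \<in> CF" and h: "h \<in> CF" and k: "k \<in> CF"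
  shows "conv (conv f h) k = conv f (conv h k)"
proof (rule cont_eqI)
  fix s assume s: "s \<in> GG"
  have u: "unif2 (\<lambda>t r. f r * h (inv r \<otimes> t) * k (inv t \<otimes> s))"
    using f h k s by (intro unif2_mult unif2_comp resp_intros)
  have "conv (conv f h) k s = haar (\<lambda>t\<in>GG. haar (\<lambda>r\<in>GG. f r * h (inv r \<otimes> t) * k (inv t \<otimes> s)))"
    unfolding conv_apply[OF s]
  proof (rule arg_cong[where f = haar], rule restrict_ext)
    fix t assume t: "t \<in> GG"
    show "conv f h t * k (inv t \<otimes> s) = haar (\<lambda>r\<in>GG. f r * h (inv r \<otimes> t) * k (inv t \<otimes> s))"
      using haar_smult_right[OF conv_integrand[OF f h t], of "k (inv t \<otimes> s)"] t
      by (simp add: conv_apply cong: restrict_cong)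
  qed
  also have "\<dots> = haar (\<lambda>r\<in>GG. haar (\<lambda>t\<in>GG. f r * h (inv r \<otimes> t) * k (inv t \<otimes> s)))"
    by (rule haar_Fubini[OF u])
  also have "\<dots> = conv f (conv h k) s"
    unfolding conv_apply[OF s]
  proof (rule arg_cong[where f = haar], rule restrict_ext)
    fix r assume r: "r \<in> GG"
    have rs: "inv r \<otimes> s \<in> GG" using r s by simp
    note c = conv_integrand[OF h k rs]
    have "haar (\<lambda>t\<in>GG. f r * h (inv r \<otimes> t) * k (inv t \<otimes> s)) =
      haar (\<lambda>t\<in>GG. f r * (\<lambda>t\<in>GG. (\<lambda>t\<in>GG. h t * k (inv t \<otimes> (inv r \<otimes> s))) (inv r \<otimes> t)) t)"
      using r s by (simp add: inv_mult_group m_assoc inv_mult_cancel mult.assoc cong: restrict_cong)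
    also have "\<dots> = f r * conv h k (inv r \<otimes> s)"
      using haar_smult[OF cont_left[OF c, of "inv r"]] haar_left[OF c, of "inv r"] r rs by (simp add: conv_apply)
    finally show "haar (\<lambda>t\<in>GG. f r * h (inv r \<otimes> t) * k (inv t \<otimes> s)) = f r * conv h k (inv r \<otimes> s)" .
  qed
  finally show "conv (conv f h) k s = conv f (conv h k) s" .
qed (use f h k in simp_all)

lemma inv_cnj_inv_cnj: "f \<in> CF ==> inv_cnj (inv_cnj f) = f"
  by (rule cont_eqI) (simp_all add: inv_cnj_apply)

lemma inv_cnj_conv:
  assumes f: "f \<in> CF" and h: "h \<in> CF"
  shows "inv_cnj (conv f h) = conv (inv_cnj h) (inv_cnj f)"
proof (rule cont_eqI)
  fix s assume s: "s \<in> GG"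
  have si: "inv s \<in> GG" using s by simp
  have c: "(\<lambda>t\<in>GG. inv_cnj h t * inv_cnj f (inv t \<otimes> s)) \<in> CF" using f h s by (simp add: conv_integrand)
  have "inv_cnj (conv f h) s = haar (\<lambda>t\<in>GG. cnj (f t * h (inv t \<otimes> inv s)))"
    using haar_cnj[OF conv_integrand[OF f h si]] s by (simp add: inv_cnj_apply conv_apply cong: restrict_cong)
  also have "\<dots> = haar (\<lambda>t\<in>GG. (\<lambda>t\<in>GG. inv_cnj h t * inv_cnj f (inv t \<otimes> s)) (s \<otimes> t))"
    using s by (simp add: inv_cnj_apply inv_mult_group m_assoc inv_mult_cancel mult.commute cong: restrict_cong)
  also have "\<dots> = conv (inv_cnj h) (inv_cnj f) s"
    using haar_left[OF c s] s by (simp add: conv_apply)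
  finally show "inv_cnj (conv f h) s = conv (inv_cnj h) (inv_cnj f) s" .
qed (use f h in simp_all)

lemma inv_cnj_add: "f \<in> CF ==> h \<in> CF ==> inv_cnj (\<lambda>x\<in>GG. f x + h x) = (\<lambda>x\<in>GG. inv_cnj f x + inv_cnj h x)"
  by (rule cont_eqI) (simp_all add: inv_cnj_apply)

lemma inv_cnj_smult: "f \<in> CF ==> inv_cnj (\<lambda>x\<in>GG. c * f x) = (\<lambda>x\<in>GG. cnj c * inv_cnj f x)"
  by (rule cont_eqI) (simp_all add: inv_cnj_apply)

end

section \<open>Unitary representations\<close>

locale unitary_rep = pro_group G T + hilbert H for G :: "('g, 'm) monoid_scheme" (structure) and T and H :: "'h hilbert" +
  fixes v :: "'g \<Rightarrow> 'h \<Rightarrow> 'h"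
  assumes unitary_rep: "v \<in> unitary_reps G T H"
begin

lemma v_unitary: "g \<in> GG ==> v g \<in> carrier (unitary_group H)"
  using unitary_rep by (auto simp: unitary_reps_def hom_def)

lemma v_BO [simp]: "g \<in> GG ==> v g \<in> BB"
  using v_unitary unitaryD(1) by blast

lemma v_ip: "g \<in> GG ==> x \<in> HH ==> y \<in> HH ==> ip (v g x) (v g y) = ip x y"
  using v_unitary unitaryD(2) by blast

lemma v_hn: "g \<in> GG ==> x \<in> HH ==> hn (v g x) = hn x"
  by (simp add: hnorm_def v_ip)

lemma v_mult: "g \<in> GG ==> h \<in> GG ==> x \<in> HH ==> v (g \<otimes> h) x = v g (v h x)"
  using unitary_rep by (simp add: unitary_reps_def hom_def compose_eq)

text \<open>\<open>v \<one>\<close> is an idempotent isometry: it sends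
  \<open>v \<one> x - x\<close> to zero, and an isometry has no kernel.\<close>

lemma v_one: assumes x: "x \<in> HH" shows "v \<one> x = x"
proof (rule eqI_dist)
  have "hn (v \<one> x \<ominus>\<^bsub>H\<^esub> x) = hn (v \<one> (v \<one> x \<ominus>\<^bsub>H\<^esub> x))" using x by (simp add: v_hn)
  also have "\<dots> = hn (v (\<one> \<otimes> \<one>) x \<ominus>\<^bsub>H\<^esub> v \<one> x)" using x v_mult[of \<one> \<one> x] by (simp add: BO_diff)
  finally show "hn (v \<one> x \<ominus>\<^bsub>H\<^esub> x) \<le> 0" using x by (simp add: diff_self)
qed (use x in simp_all)

lemma v_inv_cancel: "g \<in> GG ==> x \<in> HH ==> v (inv g) (v g x) = x" "g \<in> GG ==> x \<in> HH ==> v g (v (inv g) x) = x"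
  by (simp_all add: v_mult[symmetric] v_one)

lemma v_inv: "g \<in> GG ==> x \<in> HH ==> y \<in> HH ==> ip (v g x) y = ip x (v (inv g) y)"
  using v_ip[of g x "v (inv g) y"] by (simp add: v_inv_cancel)

lemma v_small:
  assumes x: "x \<in> HH" and e: "e > 0"
  shows "\<exists>N\<in>NN. \<forall>n\<in>N. hn (v n x \<ominus>\<^bsub>H\<^esub> x) < e"
proof -
  have "continuous_map T (norm_topology H hn) (\<lambda>g. v g x)" using unitary_rep x by (simp add: unitary_reps_def)
  then obtain U where U: "openin T U" "\<one> \<in> U" "\<forall>y\<in>U. hn (v y x \<ominus>\<^bsub>H\<^esub> v \<one> x) < e"
    unfolding continuous_map_norm_topology using e by (metis one_closed topspace_T)
  then obtain N where "N \<in> NN" "N \<subseteq> U" using small_normal by blast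
  then show ?thesis using U(3) x by (auto simp: v_one)
qed

lemma v_close:
  assumes N: "N \<in> NN" and n: "\<forall>n\<in>N. hn (v n x \<ominus>\<^bsub>H\<^esub> x) \<le> e"
    and g: "g \<in> GG" "h \<in> GG" "N #> g = N #> h" and x: "x \<in> HH"
  shows "hn (v g x \<ominus>\<^bsub>H\<^esub> v h x) \<le> e"
proof -
  have "N #> (inv h \<otimes> g) = N #> \<one>" using coset_mult[OF N, of "inv h" g "inv h" h] g by simp
  then have m: "inv h \<otimes> g \<in> N" using r_coset_eq_iff[OF NN_subgroup[OF N], of "inv h \<otimes> g" \<one>] g by simp
  have "hn (v g x \<ominus>\<^bsub>H\<^esub> v h x) = hn (v (inv h) (v g x \<ominus>\<^bsub>H\<^esub> v h x))" using g x by (simp add: v_hn)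
  also have "\<dots> = hn (v (inv h \<otimes> g) x \<ominus>\<^bsub>H\<^esub> x)" using g x by (simp add: BO_diff v_mult v_inv_cancel)
  finally show ?thesis using n m by simp
qed

definition coef :: "'h \<Rightarrow> 'h \<Rightarrow> 'g \<Rightarrow> complex" where "coef x y = (\<lambda>s\<in>GG. ip (v s x) y)"

lemma coef_cont [simp]:
  assumes x: "x \<in> HH" and y: "y \<in> HH" shows "coef x y \<in> CF"
proof (rule cont_funsI)
  fix e :: real assume e: "e > 0"
  define d where "d = e / (hn y + 1)"
  have d: "d > 0" using e y by (simp add: d_def add_nonneg_pos)
  obtain N where N: "N \<in> NN" "\<forall>n\<in>N. hn (v n x \<ominus>\<^bsub>H\<^esub> x) < d" using v_small[OF x d] by blast
  have "osc N (coef x y) e"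
  proof (rule oscI)
    fix g h assume g: "g \<in> GG" "h \<in> GG" "N #> g = N #> h"
    have "hn (v g x \<ominus>\<^bsub>H\<^esub> v h x) \<le> d" using v_close[OF N(1) _ g x, of d] N(2) by fastforce
    then have "hn (v g x \<ominus>\<^bsub>H\<^esub> v h x) * hn y \<le> d * (hn y + 1)"
      using y d by (intro mult_mono) auto
    moreover have "d * (hn y + 1) = e" using y by (simp add: d_def add_nonneg_eq_0_iff)
    ultimately show "cmod (coef x y g - coef x y h) \<le> e"
      using Cauchy_Schwarz[of "v g x \<ominus>\<^bsub>H\<^esub> v h x" y] g x y by (simp add: coef_def)
  qed
  then show "\<exists>N\<in>NN. osc N (coef x y) e" using N(1) by blast
qed (simp add: coef_def)

lemma coef_apply: "s \<in> GG ==> coef x y s = ip (v s x) y"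
  by (simp add: coef_def)

lemma coef_bound: "s \<in> GG ==> x \<in> HH ==> y \<in> HH ==> cmod (coef x y s) \<le> hn x * hn y"
  using Cauchy_Schwarz[of "v s x" y] by (simp add: coef_apply v_hn)

abbreviation vf where "vf \<equiv> integrated_form G T H v"

lemma form_cont: "f \<in> CF ==> x \<in> HH ==> y \<in> HH ==> (\<lambda>s\<in>GG. f s * ip (v s x) y) \<in> CF"
  using cont_mult[OF _ coef_cont, of f x y] by (simp add: coef_apply cong: restrict_cong)

text \<open>A dominating function in place of a constant covers the L1 estimate and, for constant
  \<open>h\<close>, the supremum estimate.\<close>

lemma form_bound:
  assumes f: "f \<in> CF" and h: "h \<in> CF" and le: "\<And>s. s \<in> GG ==> cmod (f s) \<le> Re (h s)"
    and x: "x \<in> HH" and y: "y \<in> HH"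
  shows "cmod (haar (\<lambda>s\<in>GG. f s * ip (v s x) y)) \<le> Re (haar h) * hn x * hn y"
proof -
  let ?c = "complex_of_real (hn x * hn y)"
  have "cmod (haar (\<lambda>s\<in>GG. f s * ip (v s x) y)) \<le> Re (haar (\<lambda>s\<in>GG. ?c * h s))"
  proof (rule haar_le[OF form_cont[OF f x y] cont_smult[OF h]])
    fix s assume s: "s \<in> GG"
    have "cmod (f s) * cmod (ip (v s x) y) \<le> Re (h s) * (hn x * hn y)"
      using le[OF s] coef_bound[OF s x y] s order_trans[OF norm_ge_zero le[OF s]]
      by (intro mult_mono) (auto simp: coef_apply)
    then show "cmod ((\<lambda>s\<in>GG. f s * ip (v s x) y) s) \<le> Re ((\<lambda>s\<in>GG. ?c * h s) s)"
      using s by (simp add: norm_mult mult.commute)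
  qed
  then show ?thesis unfolding haar_smult[OF h] by (simp add: mult.assoc mult.left_commute mult.commute)
qed

text \<open>The weak integral exists by \<open>form_to_operator\<close> and is unique by
  \<open>BO_eqI2\<close>; this resolves the \<open>THE\<close> in
  \<open>integrated_form\<close>.\<close>

lemma vf:
  assumes f: "f \<in> CF"
  shows "vf f \<in> BB"
    and "\<And>x y. x \<in> HH ==> y \<in> HH ==> ip (vf f x) y = haar (\<lambda>s\<in>GG. f s * ip (v s x) y)"
proof -
  obtain B where B: "\<forall>s\<in>GG. cmod (f s) \<le> B" using cont_bounded[OF f] by blast
  obtain S where S: "S \<in> bounded_maps H hn"
    "\<And>x y. x \<in> HH ==> y \<in> HH ==> ip (S x) y = haar (\<lambda>s\<in>GG. f s * ip (v s x) y)"
  proof (rule form_to_operator[of "\<lambda>x y. haar (\<lambda>s\<in>GG. f s * ip (v s x) y)" B])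
    fix x y z assume x: "x \<in> HH" and y: "y \<in> HH" and z: "z \<in> HH"
    show "haar (\<lambda>s\<in>GG. f s * ip (v s (x \<oplus>\<^bsub>H\<^esub> y)) z) = haar (\<lambda>s\<in>GG. f s * ip (v s x) z) + haar (\<lambda>s\<in>GG. f s * ip (v s y) z)"
      using haar_add[OF form_cont[OF f x z] form_cont[OF f y z]] x y z
      by (simp add: BO_add distrib_left cong: restrict_cong)
    show "haar (\<lambda>s\<in>GG. f s * ip (v s x) (y \<oplus>\<^bsub>H\<^esub> z)) = haar (\<lambda>s\<in>GG. f s * ip (v s x) y) + haar (\<lambda>s\<in>GG. f s * ip (v s x) z)"
      using haar_add[OF form_cont[OF f x y] form_cont[OF f x z]] x y z
      by (simp add: distrib_left cong: restrict_cong)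
  next
    fix c x y assume x: "x \<in> HH" and y: "y \<in> HH"
    show "haar (\<lambda>s\<in>GG. f s * ip (v s (c \<odot>\<^bsub>H\<^esub> x)) y) = c * haar (\<lambda>s\<in>GG. f s * ip (v s x) y)"
      using haar_smult[OF form_cont[OF f x y], of c] x y by (simp add: BO_smult mult.left_commute cong: restrict_cong)
    show "haar (\<lambda>s\<in>GG. f s * ip (v s x) (c \<odot>\<^bsub>H\<^esub> y)) = cnj c * haar (\<lambda>s\<in>GG. f s * ip (v s x) y)"
      using haar_smult[OF form_cont[OF f x y], of "cnj c"] x y by (simp add: mult.left_commute cong: restrict_cong)
    show "cmod (haar (\<lambda>s\<in>GG. f s * ip (v s x) y)) \<le> B * hn x * hn y"
      using form_bound[OF f cont_const[of "of_real B"] _ x y] B by (simp add: haar_const)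
  qed (use that in blast)
  have "vf f \<in> BB \<and> (\<forall>x\<in>HH. \<forall>y\<in>HH. ip (vf f x) y = haar (\<lambda>s\<in>GG. f s * ip (v s x) y))"
    unfolding integrated_form_def
  proof (rule theI[of _ S])
    show "S \<in> BB \<and> (\<forall>x\<in>HH. \<forall>y\<in>HH. ip (S x) y = haar (\<lambda>s\<in>GG. f s * ip (v s x) y))"
      using S by (simp add: carrier_BO)
    fix S' assume "S' \<in> BB \<and> (\<forall>x\<in>HH. \<forall>y\<in>HH. ip (S' x) y = haar (\<lambda>s\<in>GG. f s * ip (v s x) y))"
    then show "S' = S" using S by (intro BO_eqI2) (simp_all add: carrier_BO)
  qed
  then show "vf f \<in> BB"
    "\<And>x y. x \<in> HH ==> y \<in> HH ==> ip (vf f x) y = haar (\<lambda>s\<in>GG. f s * ip (v s x) y)" by blast+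
qed

lemma vf_eqI:
  assumes "f \<in> CF" "S \<in> BB"
    "\<And>x y. x \<in> HH ==> y \<in> HH ==> haar (\<lambda>s\<in>GG. f s * ip (v s x) y) = ip (S x) y"
  shows "vf f = S"
  by (rule BO_eqI2) (use assms vf in simp_all)

lemma vf_bound_L1:
  assumes f: "f \<in> CF" and h: "h \<in> CF" and le: "\<And>s. s \<in> GG ==> cmod (f s) \<le> Re (h s)"
  shows "opn (vf f) \<le> Re (haar h)"
proof (rule opn_le_form[OF vf(1)[OF f]])
  show "Re (haar h) \<ge> 0" using haar_le[OF f h le] norm_ge_zero order_trans by blast
qed (simp add: vf(2)[OF f] form_bound[OF f h le])

lemma vf_bound:
  assumes f: "f \<in> CF" and le: "\<And>s. s \<in> GG ==> cmod (f s) \<le> B"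
  shows "opn (vf f) \<le> B"
  using vf_bound_L1[OF f cont_const[of "of_real B"]] le by (simp add: haar_const)

lemma vf_add:
  assumes f: "f \<in> CF" and h: "h \<in> CF"
  shows "vf (\<lambda>x\<in>GG. f x + h x) = (\<lambda>x\<in>HH. vf f x \<oplus>\<^bsub>H\<^esub> vf h x)"
proof (rule vf_eqI)
  fix x y assume x: "x \<in> HH" and y: "y \<in> HH"
  show "haar (\<lambda>s\<in>GG. (\<lambda>x\<in>GG. f x + h x) s * ip (v s x) y) = ip ((\<lambda>x\<in>HH. vf f x \<oplus>\<^bsub>H\<^esub> vf h x) x) y"
    using haar_add[OF form_cont[OF f x y] form_cont[OF h x y]] x y vf(1)[OF f] vf(1)[OF h]
    by (simp add: vf(2)[OF f] vf(2)[OF h] distrib_right cong: restrict_cong)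
qed (use f h vf(1) in simp_all)

lemma vf_smult:
  assumes f: "f \<in> CF"
  shows "vf (\<lambda>x\<in>GG. c * f x) = (\<lambda>x\<in>HH. c \<odot>\<^bsub>H\<^esub> vf f x)"
proof (rule vf_eqI)
  fix x y assume x: "x \<in> HH" and y: "y \<in> HH"
  show "haar (\<lambda>s\<in>GG. (\<lambda>x\<in>GG. c * f x) s * ip (v s x) y) = ip ((\<lambda>x\<in>HH. c \<odot>\<^bsub>H\<^esub> vf f x) x) y"
    using haar_smult[OF form_cont[OF f x y], of c] x y vf(1)[OF f]
    by (simp add: vf(2)[OF f] mult.assoc cong: restrict_cong)
qed (use f vf(1) in simp_all)

text \<open>Substitution of \<open>g \<otimes> t\<close> for \<open>s\<close>. It is how
  \<open>v\<close> is later read off from its integrated form.\<close>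

lemma vf_left:
  assumes f: "f \<in> CF" and g: "g \<in> GG" and x: "x \<in> HH"
  shows "vf (\<lambda>s\<in>GG. f (inv g \<otimes> s)) x = v g (vf f x)"
proof (rule ip_ext)
  have c: "(\<lambda>s\<in>GG. f (inv g \<otimes> s)) \<in> CF" using f g by simp
  then show "vf (\<lambda>s\<in>GG. f (inv g \<otimes> s)) x \<in> HH" "v g (vf f x) \<in> HH" using vf(1) f g x by simp_all
  fix y assume y: "y \<in> HH"
  have "ip (vf (\<lambda>s\<in>GG. f (inv g \<otimes> s)) x) y = haar (\<lambda>s\<in>GG. f (inv g \<otimes> s) * ip (v s x) y)"
    using vf(2)[OF c x y] by (simp cong: restrict_cong)
  also have "\<dots> = haar (\<lambda>t\<in>GG. (\<lambda>s\<in>GG. f (inv g \<otimes> s) * ip (v s x) y) (g \<otimes> t))"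
    using haar_left[OF form_cont[OF c x y] g] g by (simp cong: restrict_cong)
  also have "\<dots> = haar (\<lambda>t\<in>GG. f t * ip (v t x) (v (inv g) y))"
    using g x y by (simp add: inv_mult_cancel v_mult v_inv[OF g] cong: restrict_cong)
  also have "\<dots> = ip (v g (vf f x)) y" using vf[OF f] g x y by (simp add: v_inv)
  finally show "ip (vf (\<lambda>s\<in>GG. f (inv g \<otimes> s)) x) y = ip (v g (vf f x)) y" .
qed

lemma vf_right:
  assumes f: "f \<in> CF" and g: "g \<in> GG" and x: "x \<in> HH"
  shows "vf (\<lambda>s\<in>GG. f (s \<otimes> inv g)) x = vf f (v g x)"
proof (rule ip_ext)
  have c: "(\<lambda>s\<in>GG. f (s \<otimes> inv g)) \<in> CF" using f g by simp
  then show "vf (\<lambda>s\<in>GG. f (s \<otimes> inv g)) x \<in> HH" "vf f (v g x) \<in> HH" using vf(1) f g x by simp_all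
  fix y assume y: "y \<in> HH"
  have "ip (vf (\<lambda>s\<in>GG. f (s \<otimes> inv g)) x) y = haar (\<lambda>s\<in>GG. f (s \<otimes> inv g) * ip (v s x) y)"
    using vf(2)[OF c x y] by (simp cong: restrict_cong)
  also have "\<dots> = haar (\<lambda>t\<in>GG. (\<lambda>s\<in>GG. f (s \<otimes> inv g) * ip (v s x) y) (t \<otimes> g))"
    using haar_right[OF form_cont[OF c x y] g] g by (simp cong: restrict_cong)
  also have "\<dots> = haar (\<lambda>t\<in>GG. f t * ip (v t (v g x)) y)"
    using g x y by (simp add: m_assoc v_mult cong: restrict_cong)
  also have "\<dots> = ip (vf f (v g x)) y" using vf[OF f] g x y by simp
  finally show "ip (vf (\<lambda>s\<in>GG. f (s \<otimes> inv g)) x) y = ip (vf f (v g x)) y" .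
qed

text \<open>After Fubini the inner integral is the integrated form of a left translate of
  \<open>h\<close>, to which \<open>vf_left\<close> applies.\<close>

lemma vf_conv:
  assumes f: "f \<in> CF" and h: "h \<in> CF"
  shows "vf (conv f h) = compose (HH) (vf f) (vf h)"
proof (rule vf_eqI)
  fix x y assume x: "x \<in> HH" and y: "y \<in> HH"
  have u: "unif2 (\<lambda>s t. f t * h (inv t \<otimes> s) * coef x y s)"
    using f h coef_cont[OF x y] by (intro unif2_mult unif2_comp resp_intros)
  have "haar (\<lambda>s\<in>GG. conv f h s * ip (v s x) y) = haar (\<lambda>s\<in>GG. haar (\<lambda>t\<in>GG. f t * h (inv t \<otimes> s) * coef x y s))"
  proof (rule arg_cong[where f = haar], rule restrict_ext)
    fix s assume s: "s \<in> GG"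
    show "conv f h s * ip (v s x) y = haar (\<lambda>t\<in>GG. f t * h (inv t \<otimes> s) * coef x y s)"
      using haar_smult_right[OF conv_integrand[OF f h s], of "coef x y s"] s
      by (simp add: conv_apply coef_apply cong: restrict_cong)
  qed
  also have "\<dots> = haar (\<lambda>t\<in>GG. haar (\<lambda>s\<in>GG. f t * h (inv t \<otimes> s) * coef x y s))"
    by (rule haar_Fubini[OF u])
  also have "\<dots> = haar (\<lambda>t\<in>GG. f t * ip (v t (vf h x)) y)"
  proof (rule arg_cong[where f = haar], rule restrict_ext)
    fix t assume t: "t \<in> GG"
    have c: "(\<lambda>s\<in>GG. h (inv t \<otimes> s)) \<in> CF" using h t by simp
    have "haar (\<lambda>s\<in>GG. f t * h (inv t \<otimes> s) * coef x y s) = f t * haar (\<lambda>s\<in>GG. (\<lambda>s\<in>GG. h (inv t \<otimes> s)) s * ip (v s x) y)"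
      using haar_smult[OF form_cont[OF c x y], of "f t"] by (simp add: coef_apply mult.assoc cong: restrict_cong)
    also have "\<dots> = f t * ip (v t (vf h x)) y"
      using vf(2)[OF c x y] vf_left[OF h t x] by simp
    finally show "haar (\<lambda>s\<in>GG. f t * h (inv t \<otimes> s) * coef x y s) = f t * ip (v t (vf h x)) y" .
  qed
  also have "\<dots> = ip (compose (HH) (vf f) (vf h) x) y"
    using vf[OF f] vf(1)[OF h] x y by (simp add: compose_eq)
  finally show "haar (\<lambda>s\<in>GG. conv f h s * ip (v s x) y) = ip (compose (HH) (vf f) (vf h) x) y" .
qed (use f h vf(1) in simp_all)

lemma vf_star:
  assumes f: "f \<in> CF" shows "vf (inv_cnj f) = star BO (vf f)"
proof (rule star_BO_eqI[symmetric])
  fix x y assume x: "x \<in> HH" and y: "y \<in> HH"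
  note c = form_cont[OF inv_cnj_cont[OF f] y x]
  have "ip x (vf (inv_cnj f) y) = cnj (haar (\<lambda>s\<in>GG. inv_cnj f s * ip (v s y) x))"
    using ip_cnj[of "vf (inv_cnj f) y" x] vf[OF inv_cnj_cont[OF f]] x y by simp
  also have "\<dots> = haar (\<lambda>s\<in>GG. cnj (inv_cnj f s * ip (v s y) x))"
    using haar_cnj[OF c] by (simp cong: restrict_cong)
  also have "\<dots> = haar (\<lambda>s\<in>GG. (\<lambda>s\<in>GG. f s * ip (v s x) y) (inv s))"
  proof (rule arg_cong[where f = haar], rule restrict_ext)
    fix s assume s: "s \<in> GG"
    have "cnj (ip (v s y) x) = ip (v (inv s) x) y"
      using ip_cnj[of "v s y" x] v_inv[of "inv s" x y] s x y by simp
    then show "cnj (inv_cnj f s * ip (v s y) x) = (\<lambda>s\<in>GG. f s * ip (v s x) y) (inv s)"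
      using s by (simp add: inv_cnj_apply)
  qed
  also have "\<dots> = ip (vf f x) y" using haar_inv[OF form_cont[OF f x y]] vf(2)[OF f x y] by simp
  finally show "ip (vf f x) y = ip x (vf (inv_cnj f) y)" by simp
qed (use f vf(1) in simp_all)

end

lemma null_by_bound:
  fixes x y :: "nat \<Rightarrow> real"
  assumes "\<And>n. norm (x n) \<le> y n" "y \<longlonglongrightarrow> 0" shows "x \<longlonglongrightarrow> 0"
  by (rule Lim_null_comparison[OF always_eventually[OF allI[OF assms(1)]] assms(2)])

section \<open>Completions of seminormed star algebras\<close>

text \<open>These axioms hold for the universal norm and for operator norms alike and pass to
  completions by taking limits; with completeness and definiteness added, they suffice for
  \<open>star_hom_contractive\<close>.\<close>

locale seminormed_star_algebra = seminormed_module A "anorm A" for A :: "'a star_algebra" (structure) +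
  assumes mult_closed [simp, intro]: "\<lbrakk>a \<in> carrier A; b \<in> carrier A\<rbrakk> \<Longrightarrow> a \<otimes> b \<in> carrier A"
    and star_closed [simp, intro]: "a \<in> carrier A ==> star A a \<in> carrier A"
    and mult_assoc: "\<lbrakk>a \<in> carrier A; b \<in> carrier A; c \<in> carrier A\<rbrakk> \<Longrightarrow> (a \<otimes> b) \<otimes> c = a \<otimes> (b \<otimes> c)"
    and add_mult: "\<lbrakk>a \<in> carrier A; b \<in> carrier A; c \<in> carrier A\<rbrakk> \<Longrightarrow> (a \<oplus> b) \<otimes> c = a \<otimes> c \<oplus> b \<otimes> c"
    and mult_add: "\<lbrakk>a \<in> carrier A; b \<in> carrier A; c \<in> carrier A\<rbrakk> \<Longrightarrow> a \<otimes> (b \<oplus> c) = a \<otimes> b \<oplus> a \<otimes> c"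
    and smult_mult: "\<lbrakk>a \<in> carrier A; b \<in> carrier A\<rbrakk> \<Longrightarrow> (k \<odot> a) \<otimes> b = k \<odot> (a \<otimes> b)"
    and mult_smult: "\<lbrakk>a \<in> carrier A; b \<in> carrier A\<rbrakk> \<Longrightarrow> a \<otimes> (k \<odot> b) = k \<odot> (a \<otimes> b)"
    and star_add: "\<lbrakk>a \<in> carrier A; b \<in> carrier A\<rbrakk> \<Longrightarrow> star A (a \<oplus> b) = star A a \<oplus> star A b"
    and star_smult: "a \<in> carrier A ==> star A (k \<odot> a) = cnj k \<odot> star A a"
    and star_mult: "\<lbrakk>a \<in> carrier A; b \<in> carrier A\<rbrakk> \<Longrightarrow> star A (a \<otimes> b) = star A b \<otimes> star A a"
    and star_star [simp]: "a \<in> carrier A ==> star A (star A a) = a"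
    and norm_mult_le: "\<lbrakk>a \<in> carrier A; b \<in> carrier A\<rbrakk> \<Longrightarrow> anorm A (a \<otimes> b) \<le> anorm A a * anorm A b"
    and norm_star [simp]: "a \<in> carrier A ==> anorm A (star A a) = anorm A a"
begin

abbreviation AA where "AA \<equiv> carrier A"

abbreviation nm where "nm \<equiv> anorm A"

lemma mult_diff: "\<lbrakk>a \<in> AA; b \<in> AA; c \<in> AA\<rbrakk> \<Longrightarrow> a \<otimes> (b \<ominus> c) = a \<otimes> b \<ominus> a \<otimes> c"
  by (simp add: diff_eq mult_add mult_smult)

lemma diff_mult: "\<lbrakk>a \<in> AA; b \<in> AA; c \<in> AA\<rbrakk> \<Longrightarrow> (a \<ominus> b) \<otimes> c = a \<otimes> c \<ominus> b \<otimes> c"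
  by (simp add: diff_eq add_mult smult_mult)

lemma star_diff: "\<lbrakk>a \<in> AA; b \<in> AA\<rbrakk> \<Longrightarrow> star A (a \<ominus> b) = star A a \<ominus> star A b"
  by (simp add: diff_eq star_add star_smult)

lemma mult_diff_bound:
  assumes "a \<in> AA" "b \<in> AA" "a' \<in> AA" "b' \<in> AA"
  shows "nm (a \<otimes> b \<ominus> a' \<otimes> b') \<le> nm a * nm (b \<ominus> b') + nm (a \<ominus> a') * nm b'"
proof -
  have "a \<otimes> b \<ominus> a' \<otimes> b' = a \<otimes> (b \<ominus> b') \<oplus> (a \<ominus> a') \<otimes> b'"
    using assms by (simp add: mult_diff diff_mult diff_add_diff)
  moreover have "nm (a \<otimes> (b \<ominus> b') \<oplus> (a \<ominus> a') \<otimes> b') \<le> nm (a \<otimes> (b \<ominus> b')) + nm ((a \<ominus> a') \<otimes> b')"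
    using assms by (intro nrm_add) auto
  ultimately show ?thesis using norm_mult_le[of a "b \<ominus> b'"] norm_mult_le[of "a \<ominus> a'" b'] assms by simp
qed

section \<open>Cauchy sequences and their classes\<close>

abbreviation CS where "CS \<equiv> cauchy_seqs A"
abbreviation cls where "cls \<equiv> cauchy_class A"

lemma CS_D [simp]: "V \<in> CS ==> V n \<in> AA"
  by (simp add: cauchy_seqs_def)

lemma CS_cauchy: "V \<in> CS ==> e > 0 ==> \<exists>M. \<forall>m\<ge>M. \<forall>n\<ge>M. nm (V m \<ominus> V n) < e"
  unfolding cauchy_seqs_def by blast

lemma CS_I: "(\<And>n. V n \<in> AA) ==> (\<And>e. e > 0 ==> \<exists>M. \<forall>m\<ge>M. \<forall>n\<ge>M. nm (V m \<ominus> V n) < e) ==> V \<in> CS"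
  unfolding cauchy_seqs_def by blast

lemma const_CS [simp]: "a \<in> AA ==> (\<lambda>n. a) \<in> CS"
  by (rule CS_I) simp_all

text \<open>Counterpart of \<open>cont_comb\<close> for Cauchy sequences.\<close>

lemma CS_comb:
  assumes V: "V \<in> CS" and W: "W \<in> CS" and Y: "\<And>n. Y n \<in> AA" and K: "K \<ge> 0"
    and bd: "\<And>m n. nm (Y m \<ominus> Y n) \<le> K * (nm (V m \<ominus> V n) + nm (W m \<ominus> W n))"
  shows "Y \<in> CS"
proof (rule CS_I[OF Y])
  fix e :: real assume e: "e > 0"
  define d where "d = e / (K + 1) / 2"
  have K1: "K + 1 \<noteq> 0" using K by linarith
  have d: "d > 0" using e K by (simp add: d_def)
  have d2: "2 * d = e / (K + 1)" unfolding d_def by (rule mult_2[THEN trans, OF field_sum_of_halves])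
  obtain M1 where M1: "\<forall>m\<ge>M1. \<forall>n\<ge>M1. nm (V m \<ominus> V n) < d" using CS_cauchy[OF V d] by blast
  obtain M2 where M2: "\<forall>m\<ge>M2. \<forall>n\<ge>M2. nm (W m \<ominus> W n) < d" using CS_cauchy[OF W d] by blast
  have "nm (Y m \<ominus> Y n) < e" if "m \<ge> max M1 M2" "n \<ge> max M1 M2" for m n
  proof -
    have "nm (V m \<ominus> V n) + nm (W m \<ominus> W n) < 2 * d" 
      using M1[rule_format, of m n] M2[rule_format, of m n] that by simp
    moreover have "nm (V m \<ominus> V n) + nm (W m \<ominus> W n) \<ge> 0" using V W by (simp add: nrm_nonneg)
    ultimately have "K * (nm (V m \<ominus> V n) + nm (W m \<ominus> W n)) < (K + 1) * (2 * d)"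
      using K by (intro mult_strict_mono') auto
    also have "(K + 1) * (2 * d) = e" unfolding d2 using K1 by simp
    finally show ?thesis using bd[of m n] by linarith
  qed
  then show "\<exists>M. \<forall>m\<ge>M. \<forall>n\<ge>M. nm (Y m \<ominus> Y n) < e" by blast
qed

lemma CS_bounded: assumes V: "V \<in> CS" obtains B where "B > 0" "\<And>n. nm (V n) \<le> B"
proof -
  obtain M where M: "\<forall>m\<ge>M. \<forall>n\<ge>M. nm (V m \<ominus> V n) < 1" using CS_cauchy[OF V, of 1] by auto
  define B where "B = (\<Sum>i\<le>M. nm (V i)) + 1"
  have s: "nm (V i) \<le> B - 1" if "i \<le> M" for i
    unfolding B_def using that V member_le_sum[of i "{..M}" "\<lambda>i. nm (V i)"] by (simp add: nrm_nonneg)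
  have "nm (V n) \<le> B" for n
  proof (cases "n \<le> M")
    case False
    then have "nm (V n \<ominus> V M) < 1" using M by simp
    then show ?thesis using nrm_triangle_rev[of "V n" "V M"] s[of M] V by simp
  qed (use s[of n] in simp)
  moreover have "B > 0" unfolding B_def using V by (simp add: add_nonneg_pos sum_nonneg nrm_nonneg)
  ultimately show thesis using that by blast
qed

lemma add_CS [simp]:
  assumes V: "V \<in> CS" and W: "W \<in> CS" shows "(\<lambda>n. V n \<oplus> W n) \<in> CS"
proof (rule CS_comb[OF V W, where K = 1])
  fix m n
  show "nm ((V m \<oplus> W m) \<ominus> (V n \<oplus> W n)) \<le> 1 * (nm (V m \<ominus> V n) + nm (W m \<ominus> W n))"
    using nrm_add[of "V m \<ominus> V n" "W m \<ominus> W n"] V W by (simp add: add_diff_add)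
qed (use V W in simp_all)

lemma smult_CS [simp]:
  assumes V: "V \<in> CS" shows "(\<lambda>n. c \<odot> V n) \<in> CS"
proof (rule CS_comb[OF V V, where K = "cmod c"])
  fix m n
  have "nm (c \<odot> V m \<ominus> c \<odot> V n) = cmod c * nm (V m \<ominus> V n)"
    using V by (simp add: smult_diff[symmetric] nrm_smult)
  then show "nm (c \<odot> V m \<ominus> c \<odot> V n) \<le> cmod c * (nm (V m \<ominus> V n) + nm (V m \<ominus> V n))"
    using V by (simp add: distrib_left nrm_nonneg)
qed (use V in simp_all)

lemma star_CS [simp]:
  assumes V: "V \<in> CS" shows "(\<lambda>n. star A (V n)) \<in> CS"
proof (rule CS_comb[OF V V, where K = 1])
  fix m n
  show "nm (star A (V m) \<ominus> star A (V n)) \<le> 1 * (nm (V m \<ominus> V n) + nm (V m \<ominus> V n))"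
    using V by (simp add: star_diff[symmetric] nrm_nonneg)
qed (use V in simp_all)

lemma mult_CS [simp]:
  assumes V: "V \<in> CS" and W: "W \<in> CS" shows "(\<lambda>n. V n \<otimes> W n) \<in> CS"
proof -
  obtain B where B: "B > 0" "\<And>n. nm (V n) \<le> B" using CS_bounded V by blast
  obtain D where D: "D > 0" "\<And>n. nm (W n) \<le> D" using CS_bounded W by blast
  show ?thesis
  proof (rule CS_comb[OF V W, where K = "B + D"])
    fix m n
    have "nm (V m \<otimes> W m \<ominus> V n \<otimes> W n) \<le> nm (V m) * nm (W m \<ominus> W n) + nm (V m \<ominus> V n) * nm (W n)"
      using V W by (intro mult_diff_bound) auto
    also have "\<dots> \<le> (B + D) * nm (W m \<ominus> W n) + nm (V m \<ominus> V n) * (B + D)"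
      using B(1) D(1) B(2)[of m] D(2)[of n] V W
      by (intro add_mono mult_right_mono mult_left_mono) (auto simp: nrm_nonneg)
    finally show "nm (V m \<otimes> W m \<ominus> V n \<otimes> W n) \<le> (B + D) * (nm (V m \<ominus> V n) + nm (W m \<ominus> W n))"
      by (simp add: algebra_simps)
  qed (use B D V W in simp_all)
qed

lemma cls_eqI:
  assumes V: "V \<in> CS" and W: "W \<in> CS" and n: "(\<lambda>n. nm (V n \<ominus> W n)) \<longlonglongrightarrow> 0"
  shows "cls V = cls W"
proof -
  have sub: "cls V \<subseteq> cls W" if V: "V \<in> CS" and W: "W \<in> CS" and n: "(\<lambda>n. nm (V n \<ominus> W n)) \<longlonglongrightarrow> 0" for V W
  proof
    fix U assume "U \<in> cls V"
    then have U: "U \<in> CS" "(\<lambda>n. nm (V n \<ominus> U n)) \<longlonglongrightarrow> 0" by (simp_all add: cauchy_class_def)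
    have "(\<lambda>n. nm (V n \<ominus> W n) + nm (V n \<ominus> U n)) \<longlonglongrightarrow> 0"
      using tendsto_add[OF n U(2)] by simp
    moreover have "norm (nm (W n \<ominus> U n)) \<le> nm (V n \<ominus> W n) + nm (V n \<ominus> U n)" for n
      using nrm_diff_triangle[of "W n" "V n" "U n"] nrm_diff_swap[of "W n" "V n"] V W U(1) by (simp add: nrm_nonneg)
    ultimately have "(\<lambda>n. nm (W n \<ominus> U n)) \<longlonglongrightarrow> 0"
      by (rule null_by_bound[rotated])
    then show "U \<in> cls W" using U by (simp add: cauchy_class_def)
  qed
  have "(\<lambda>n. nm (W n \<ominus> V n)) \<longlonglongrightarrow> 0" using n nrm_diff_swap V W by simp
  then show ?thesis using sub[OF V W n] sub[OF W V] by blast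
qed

lemma cls_self: "V \<in> CS ==> V \<in> cls V"
  by (simp add: cauchy_class_def)

lemma cls_eqD: "V \<in> CS ==> W \<in> CS ==> cls V = cls W ==> (\<lambda>n. nm (V n \<ominus> W n)) \<longlonglongrightarrow> 0"
  using cls_self[of W] by (metis (mono_tags, lifting) cauchy_class_def mem_Collect_eq)

lemma cauchy_rep_cls:
  assumes V: "V \<in> CS" shows "cauchy_rep (cls V) \<in> CS" "cls (cauchy_rep (cls V)) = cls V"
proof -
  have "cauchy_rep (cls V) \<in> cls V" 
    unfolding cauchy_rep_def using someI[of "\<lambda>W. W \<in> cls V" V] cls_self[OF V] by blast
  then show c: "cauchy_rep (cls V) \<in> CS" "cls (cauchy_rep (cls V)) = cls V"
    using cls_eqI[OF V, of "cauchy_rep (cls V)"] by (simp_all add: cauchy_class_def)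
qed

text \<open>The operations of \<open>completion\<close> act on representatives chosen by
  \<open>cauchy_rep\<close>; this estimate replaces the chosen representatives by given ones. For
  products the constant \<open>K\<close> comes from bounds on the sequences.\<close>

lemma cls_comb:
  assumes "V \<in> CS" "V' \<in> CS" "W \<in> CS" "W' \<in> CS" and Y: "Y \<in> CS" "Z \<in> CS"
    and "cls V = cls V'" "cls W = cls W'"
    and bd: "\<And>n. nm (Y n \<ominus> Z n) \<le> K * (nm (V n \<ominus> V' n) + nm (W n \<ominus> W' n))"
  shows "cls Y = cls Z"
proof (rule cls_eqI[OF Y])
  show "(\<lambda>n. nm (Y n \<ominus> Z n)) \<longlonglongrightarrow> 0"
  proof (rule null_by_bound)
    show "norm (nm (Y n \<ominus> Z n)) \<le> K * (nm (V n \<ominus> V' n) + nm (W n \<ominus> W' n))" for n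
      using bd[of n] Y by (simp add: nrm_nonneg)
    have "(\<lambda>n. nm (V n \<ominus> V' n) + nm (W n \<ominus> W' n)) \<longlonglongrightarrow> 0"
      using tendsto_add[OF cls_eqD[OF assms(1,2,7)] cls_eqD[OF assms(3,4,8)]] by simp
    then show "(\<lambda>n. K * (nm (V n \<ominus> V' n) + nm (W n \<ominus> W' n))) \<longlonglongrightarrow> 0"
      by (rule tendsto_mult_right_zero)
  qed
qed

section \<open>The completion as a Banach star algebra\<close>

abbreviation C where "C \<equiv> completion A"

lemma carrier_C: "carrier C = cls ` CS"
  by (simp add: completion_def)

lemma cls_carrier [simp]: "V \<in> CS ==> cls V \<in> carrier C"
  by (simp add: carrier_C)

lemma C_cases: assumes "a \<in> carrier C" obtains V where "V \<in> CS" "a = cls V"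
  using assms by (auto simp: carrier_C)

lemma zero_C: "\<zero>\<^bsub>C\<^esub> = cls (\<lambda>n. \<zero>)"
  by (simp add: completion_def)

lemma add_C [simp]:
  assumes V: "V \<in> CS" and W: "W \<in> CS" shows "cls V \<oplus>\<^bsub>C\<^esub> cls W = cls (\<lambda>n. V n \<oplus> W n)"
proof -
  note r = cauchy_rep_cls[OF V] cauchy_rep_cls[OF W]
  have "cls (\<lambda>n. cauchy_rep (cls V) n \<oplus> cauchy_rep (cls W) n) = cls (\<lambda>n. V n \<oplus> W n)"
  proof (rule cls_comb[OF r(1) V r(3) W _ _ r(2) r(4), where K = 1])
    fix n
    show "nm ((cauchy_rep (cls V) n \<oplus> cauchy_rep (cls W) n) \<ominus> (V n \<oplus> W n))
      \<le> 1 * (nm (cauchy_rep (cls V) n \<ominus> V n) + nm (cauchy_rep (cls W) n \<ominus> W n))"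
      using nrm_add[of "cauchy_rep (cls V) n \<ominus> V n" "cauchy_rep (cls W) n \<ominus> W n"] r(1,3) V W
      by (simp add: add_diff_add)
  qed (use r V W in simp_all)
  then show ?thesis by (simp add: completion_def)
qed

lemma smult_C [simp]:
  assumes V: "V \<in> CS" shows "c \<odot>\<^bsub>C\<^esub> cls V = cls (\<lambda>n. c \<odot> V n)"
proof -
  note r = cauchy_rep_cls[OF V]
  have "cls (\<lambda>n. c \<odot> cauchy_rep (cls V) n) = cls (\<lambda>n. c \<odot> V n)"
  proof (rule cls_comb[OF r(1) V r(1) V _ _ r(2) r(2), where K = "cmod c"])
    fix n
    have "nm (c \<odot> cauchy_rep (cls V) n \<ominus> c \<odot> V n) = cmod c * nm (cauchy_rep (cls V) n \<ominus> V n)"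
      using r(1) V by (simp add: smult_diff[symmetric] nrm_smult)
    then show "nm (c \<odot> cauchy_rep (cls V) n \<ominus> c \<odot> V n)
      \<le> cmod c * (nm (cauchy_rep (cls V) n \<ominus> V n) + nm (cauchy_rep (cls V) n \<ominus> V n))"
      using r(1) V by (simp add: distrib_left nrm_nonneg)
  qed (use r V in simp_all)
  then show ?thesis by (simp add: completion_def)
qed

lemma star_C [simp]:
  assumes V: "V \<in> CS" shows "star C (cls V) = cls (\<lambda>n. star A (V n))"
proof -
  note r = cauchy_rep_cls[OF V]
  have "cls (\<lambda>n. star A (cauchy_rep (cls V) n)) = cls (\<lambda>n. star A (V n))"
  proof (rule cls_comb[OF r(1) V r(1) V _ _ r(2) r(2), where K = 1])
    fix n
    show "nm (star A (cauchy_rep (cls V) n) \<ominus> star A (V n))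
      \<le> 1 * (nm (cauchy_rep (cls V) n \<ominus> V n) + nm (cauchy_rep (cls V) n \<ominus> V n))"
      using r(1) V by (simp add: star_diff[symmetric] nrm_nonneg)
  qed (use r V in simp_all)
  then show ?thesis by (simp add: completion_def)
qed

lemma mult_C [simp]:
  assumes V: "V \<in> CS" and W: "W \<in> CS" shows "cls V \<otimes>\<^bsub>C\<^esub> cls W = cls (\<lambda>n. V n \<otimes> W n)"
proof -
  note r = cauchy_rep_cls[OF V] cauchy_rep_cls[OF W]
  let ?V = "cauchy_rep (cls V)" and ?W = "cauchy_rep (cls W)"
  obtain B where B: "B > 0" "\<And>n. nm (?V n) \<le> B" using CS_bounded r(1) by blast
  obtain D where D: "D > 0" "\<And>n. nm (W n) \<le> D" using CS_bounded W by blast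
  have "cls (\<lambda>n. ?V n \<otimes> ?W n) = cls (\<lambda>n. V n \<otimes> W n)"
  proof (rule cls_comb[OF r(1) V r(3) W _ _ r(2) r(4), where K = "B + D"])
    fix n
    have "nm (?V n \<otimes> ?W n \<ominus> V n \<otimes> W n) \<le> nm (?V n) * nm (?W n \<ominus> W n) + nm (?V n \<ominus> V n) * nm (W n)"
      using r V W by (intro mult_diff_bound) auto
    also have "\<dots> \<le> (B + D) * nm (?W n \<ominus> W n) + nm (?V n \<ominus> V n) * (B + D)"
      using B(1) D(1) B(2)[of n] D(2)[of n] r(1,3) V W
      by (intro add_mono mult_right_mono mult_left_mono) (auto simp: nrm_nonneg)
    finally show "nm (?V n \<otimes> ?W n \<ominus> V n \<otimes> W n) \<le> (B + D) * (nm (?V n \<ominus> V n) + nm (?W n \<ominus> W n))"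
      by (simp add: algebra_simps)
  qed (use r V W in simp_all)
  then show ?thesis by (simp add: completion_def)
qed

lemma norm_convergent:
  assumes V: "V \<in> CS" shows "convergent (\<lambda>n. nm (V n))"
proof -
  have "Cauchy (\<lambda>n. nm (V n))"
  proof (rule metric_CauchyI)
    fix e :: real assume "e > 0"
    then obtain M where "\<forall>m\<ge>M. \<forall>n\<ge>M. nm (V m \<ominus> V n) < e" using CS_cauchy V by blast
    then show "\<exists>M. \<forall>m\<ge>M. \<forall>n\<ge>M. dist (nm (V m)) (nm (V n)) < e"
      using nrm_triangle_rev[OF CS_D[OF V] CS_D[OF V]] unfolding dist_real_def by (meson le_less_trans)
  qed
  then show ?thesis by (rule Cauchy_convergent)
qed

text \<open>The norm of \<open>completion\<close> is a limit along a chosen representative, but any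
  two representatives differ by a null sequence.\<close>

lemma norm_C_tendsto:
  assumes V: "V \<in> CS" shows "(\<lambda>n. nm (V n)) \<longlonglongrightarrow> anorm C (cls V)"
proof -
  note r = cauchy_rep_cls[OF V]
  let ?V = "cauchy_rep (cls V)"
  have l: "(\<lambda>n. nm (?V n)) \<longlonglongrightarrow> anorm C (cls V)"
    using norm_convergent[OF r(1)] by (simp add: completion_def convergent_LIMSEQ_iff)
  have "(\<lambda>n. nm (?V n \<ominus> V n)) \<longlonglongrightarrow> 0" using cls_eqD[OF r(1) V r(2)] .
  moreover have "norm (nm (V n) - nm (?V n)) \<le> nm (?V n \<ominus> V n)" for n
    using nrm_triangle_rev[of "?V n" "V n"] r(1) V by simp
  ultimately have "(\<lambda>n. nm (V n) - nm (?V n)) \<longlonglongrightarrow> 0"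
    by (rule null_by_bound[rotated])
  then show ?thesis using tendsto_add[OF _ l, of "\<lambda>n. nm (V n) - nm (?V n)" 0] by simp
qed

lemma complex_module_C: "complex_module C"
proof (rule complex_module.intro, rule complex_moduleI)
  fix a b assume ab: "a \<in> carrier C" "b \<in> carrier C"
  then obtain V W where VW: "V \<in> CS" "W \<in> CS" "a = cls V" "b = cls W" by (metis C_cases)
  then show "a \<oplus>\<^bsub>C\<^esub> b \<in> carrier C" "a \<oplus>\<^bsub>C\<^esub> b = b \<oplus>\<^bsub>C\<^esub> a"
    by (simp_all add: M.a_comm)
  show "k \<odot>\<^bsub>C\<^esub> (a \<oplus>\<^bsub>C\<^esub> b) = k \<odot>\<^bsub>C\<^esub> a \<oplus>\<^bsub>C\<^esub> k \<odot>\<^bsub>C\<^esub> b" for k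
    using VW by (simp add: smult_add_right)
  fix c assume "c \<in> carrier C"
  then obtain U where "U \<in> CS" "c = cls U" by (rule C_cases)
  then show "(a \<oplus>\<^bsub>C\<^esub> b) \<oplus>\<^bsub>C\<^esub> c = a \<oplus>\<^bsub>C\<^esub> (b \<oplus>\<^bsub>C\<^esub> c)"
    using VW by (simp add: M.a_assoc)
next
  fix a k l assume "a \<in> carrier C"
  then obtain V where V: "V \<in> CS" "a = cls V" by (rule C_cases)
  then show "k \<odot>\<^bsub>C\<^esub> a \<in> carrier C" "\<zero>\<^bsub>C\<^esub> \<oplus>\<^bsub>C\<^esub> a = a" "(k * l) \<odot>\<^bsub>C\<^esub> a = k \<odot>\<^bsub>C\<^esub> (l \<odot>\<^bsub>C\<^esub> a)"
    "1 \<odot>\<^bsub>C\<^esub> a = a" "0 \<odot>\<^bsub>C\<^esub> a = \<zero>\<^bsub>C\<^esub>" "(k + l) \<odot>\<^bsub>C\<^esub> a = k \<odot>\<^bsub>C\<^esub> a \<oplus>\<^bsub>C\<^esub> l \<odot>\<^bsub>C\<^esub> a"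
    by (simp_all add: zero_C smult_add)
qed (simp add: zero_C)

sublocale CM: complex_module C by (rule complex_module_C)

lemma norm_C_le:
  assumes V: "V \<in> CS" and "\<And>n. n \<ge> M ==> nm (V n) \<le> B" shows "anorm C (cls V) \<le> B"
  by (rule LIMSEQ_le_const2[OF norm_C_tendsto[OF V]]) (use assms in blast)

lemma seminormed_star_algebra_C: "seminormed_star_algebra C"
proof (intro seminormed_star_algebra.intro seminormed_module.intro complex_module_C
    seminormed_module_axioms.intro seminormed_star_algebra_axioms.intro)
  fix a b assume ab: "a \<in> carrier C" "b \<in> carrier C"
  then obtain V W where VW: "V \<in> CS" "W \<in> CS" "a = cls V" "b = cls W" by (metis C_cases)
  show "anorm C (a \<oplus>\<^bsub>C\<^esub> b) \<le> anorm C a + anorm C b"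
  proof (rule LIMSEQ_le)
    show "(\<lambda>n. nm (V n \<oplus> W n)) \<longlonglongrightarrow> anorm C (a \<oplus>\<^bsub>C\<^esub> b)" using VW norm_C_tendsto[of "\<lambda>n. V n \<oplus> W n"] by simp
    show "(\<lambda>n. nm (V n) + nm (W n)) \<longlonglongrightarrow> anorm C a + anorm C b" using VW by (intro tendsto_add) (simp_all add: norm_C_tendsto)
  qed (use VW nrm_add in auto)
  show "anorm C (a \<otimes>\<^bsub>C\<^esub> b) \<le> anorm C a * anorm C b"
  proof (rule LIMSEQ_le)
    show "(\<lambda>n. nm (V n \<otimes> W n)) \<longlonglongrightarrow> anorm C (a \<otimes>\<^bsub>C\<^esub> b)" using VW norm_C_tendsto[of "\<lambda>n. V n \<otimes> W n"] by simp
    show "(\<lambda>n. nm (V n) * nm (W n)) \<longlonglongrightarrow> anorm C a * anorm C b" using VW by (intro tendsto_mult) (simp_all add: norm_C_tendsto)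
  qed (use VW norm_mult_le in auto)
  show "a \<otimes>\<^bsub>C\<^esub> b \<in> carrier C" "star C (a \<oplus>\<^bsub>C\<^esub> b) = star C a \<oplus>\<^bsub>C\<^esub> star C b"
    "star C (a \<otimes>\<^bsub>C\<^esub> b) = star C b \<otimes>\<^bsub>C\<^esub> star C a"
    "(k \<odot>\<^bsub>C\<^esub> a) \<otimes>\<^bsub>C\<^esub> b = k \<odot>\<^bsub>C\<^esub> (a \<otimes>\<^bsub>C\<^esub> b)" "a \<otimes>\<^bsub>C\<^esub> (k \<odot>\<^bsub>C\<^esub> b) = k \<odot>\<^bsub>C\<^esub> (a \<otimes>\<^bsub>C\<^esub> b)" for k
    using VW by (simp_all add: star_add star_mult smult_mult mult_smult)
  fix c assume "c \<in> carrier C"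
  then obtain U where "U \<in> CS" "c = cls U" by (rule C_cases)
  then show "(a \<otimes>\<^bsub>C\<^esub> b) \<otimes>\<^bsub>C\<^esub> c = a \<otimes>\<^bsub>C\<^esub> (b \<otimes>\<^bsub>C\<^esub> c)"
    "(a \<oplus>\<^bsub>C\<^esub> b) \<otimes>\<^bsub>C\<^esub> c = a \<otimes>\<^bsub>C\<^esub> c \<oplus>\<^bsub>C\<^esub> b \<otimes>\<^bsub>C\<^esub> c" "a \<otimes>\<^bsub>C\<^esub> (b \<oplus>\<^bsub>C\<^esub> c) = a \<otimes>\<^bsub>C\<^esub> b \<oplus>\<^bsub>C\<^esub> a \<otimes>\<^bsub>C\<^esub> c"
    using VW by (simp_all add: mult_assoc add_mult mult_add)
next
  fix a k assume "a \<in> carrier C"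
  then obtain V where V: "V \<in> CS" "a = cls V" by (rule C_cases)
  have "(\<lambda>n. nm (k \<odot> V n)) \<longlonglongrightarrow> anorm C (k \<odot>\<^bsub>C\<^esub> a)" using V norm_C_tendsto[of "\<lambda>n. k \<odot> V n"] by simp
  moreover have "(\<lambda>n. nm (k \<odot> V n)) \<longlonglongrightarrow> cmod k * anorm C a"
    using tendsto_mult_left[OF norm_C_tendsto[OF V(1)], of "cmod k"] V by (simp add: nrm_smult)
  ultimately show "anorm C (k \<odot>\<^bsub>C\<^esub> a) = cmod k * anorm C a" by (rule LIMSEQ_unique)
  have "(\<lambda>n. nm (star A (V n))) \<longlonglongrightarrow> anorm C (star C a)" using V norm_C_tendsto[of "\<lambda>n. star A (V n)"] by simp
  moreover have "(\<lambda>n. nm (star A (V n))) \<longlonglongrightarrow> anorm C a" using norm_C_tendsto[OF V(1)] V by simp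
  ultimately show "anorm C (star C a) = anorm C a" by (rule LIMSEQ_unique)
  show "star C a \<in> carrier C" "star C (k \<odot>\<^bsub>C\<^esub> a) = cnj k \<odot>\<^bsub>C\<^esub> star C a" "star C (star C a) = a"
    using V by (simp_all add: star_smult)
qed

lemma norm_C_definite: assumes "a \<in> carrier C" "anorm C a = 0" shows "a = \<zero>\<^bsub>C\<^esub>"
proof -
  obtain V where V: "V \<in> CS" "a = cls V" using C_cases assms(1) by blast
  then have "(\<lambda>n. nm (V n)) \<longlonglongrightarrow> 0" using norm_C_tendsto[of V] assms(2) by simp
  then show ?thesis unfolding zero_C V(2) using V by (intro cls_eqI) simp_all
qed

abbreviation emb where "emb \<equiv> completion_embedding A"

lemma emb: "a \<in> AA ==> emb a \<in> carrier C" "emb a = cls (\<lambda>n. a)"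
  by (simp_all add: completion_embedding_def)

lemma norm_emb: "a \<in> AA ==> anorm C (emb a) = nm a"
  using norm_C_tendsto[of "\<lambda>n. a"] LIMSEQ_unique[OF tendsto_const] by (fastforce simp: emb)

lemma emb_ops:
  "a \<in> AA ==> b \<in> AA ==> emb (a \<oplus> b) = emb a \<oplus>\<^bsub>C\<^esub> emb b"
  "a \<in> AA ==> b \<in> AA ==> emb (a \<otimes> b) = emb a \<otimes>\<^bsub>C\<^esub> emb b"
  "a \<in> AA ==> emb (k \<odot> a) = k \<odot>\<^bsub>C\<^esub> emb a"
  "a \<in> AA ==> emb (star A a) = star C (emb a)"
  "emb \<zero> = \<zero>\<^bsub>C\<^esub>"
  by (simp_all add: emb zero_C)

lemma emb_diff: "a \<in> AA ==> b \<in> AA ==> emb (a \<ominus> b) = emb a \<ominus>\<^bsub>C\<^esub> emb b"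
  by (simp add: diff_eq emb_ops CM.diff_eq emb(1))

lemma cls_diff: "V \<in> CS ==> W \<in> CS ==> cls V \<ominus>\<^bsub>C\<^esub> cls W = cls (\<lambda>n. V n \<ominus> W n)"
  by (simp add: CM.diff_eq diff_eq)

lemma diff_CS: "V \<in> CS ==> W \<in> CS ==> (\<lambda>n. V n \<ominus> W n) \<in> CS"
  using add_CS[of V "\<lambda>n. (-1) \<odot> W n"] by (simp add: diff_eq)

lemma cls_limit:
  assumes V: "V \<in> CS" and e: "e > 0" shows "\<exists>M. \<forall>n\<ge>M. anorm C (emb (V n) \<ominus>\<^bsub>C\<^esub> cls V) \<le> e"
proof -
  obtain M where M: "\<forall>m\<ge>M. \<forall>n\<ge>M. nm (V m \<ominus> V n) < e" using CS_cauchy[OF V e] by blast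
  have "anorm C (emb (V n) \<ominus>\<^bsub>C\<^esub> cls V) \<le> e" if "n \<ge> M" for n
  proof -
    have c: "(\<lambda>k. V n \<ominus> V k) \<in> CS" using diff_CS[OF const_CS V] V by simp
    have "anorm C (cls (\<lambda>k. V n \<ominus> V k)) \<le> e"
      by (rule norm_C_le[OF c, of M]) (use M that less_imp_le in blast)
    then show ?thesis using V by (simp add: emb cls_diff)
  qed
  then show ?thesis by blast
qed

lemma emb_dense: assumes "a \<in> carrier C" "e > 0" shows "\<exists>b\<in>AA. anorm C (emb b \<ominus>\<^bsub>C\<^esub> a) < e"
proof -
  obtain V where V: "V \<in> CS" "a = cls V" using C_cases assms(1) by blast
  obtain M where "\<forall>n\<ge>M. anorm C (emb (V n) \<ominus>\<^bsub>C\<^esub> cls V) \<le> e/2" using cls_limit[OF V(1), of "e/2"] assms(2) by auto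
  then have "anorm C (emb (V M) \<ominus>\<^bsub>C\<^esub> a) < e" using assms(2) V by fastforce
  then show ?thesis using V by (intro bexI[of _ "V M"]) auto
qed

end

locale banach_star_algebra = seminormed_star_algebra +
  assumes definite: "a \<in> carrier A ==> anorm A a = 0 ==> a = \<zero>"
    and complete: "\<And>u. (\<And>n. u n \<in> carrier A) ==>
      (\<And>e. e > 0 ==> \<exists>N. \<forall>m\<ge>N. \<forall>n\<ge>N. anorm A (u m \<ominus> u n) < e) ==> \<exists>x\<in>carrier A. tends u x"
begin

sublocale normed_module A "anorm A"
  by unfold_locales (rule definite)

end

context seminormed_star_algebra
begin

text \<open>Diagonal argument: the \<open>k\<close>-th class is approximated by an embedded element
  \<open>V k\<close> with error \<open>1/(k+1)\<close>; these elements form a Cauchy sequence, and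
  its class is the limit.\<close>

theorem banach_C: "banach_star_algebra C"
proof (intro banach_star_algebra.intro banach_star_algebra_axioms.intro)
  show sn: "seminormed_star_algebra C" by (rule seminormed_star_algebra_C)
  then interpret S: seminormed_star_algebra C .
  show "a = \<zero>\<^bsub>C\<^esub>" if "a \<in> carrier C" "anorm C a = 0" for a using norm_C_definite that .
  fix u :: "nat \<Rightarrow> (nat \<Rightarrow> 'a) set" assume u: "\<And>n. u n \<in> carrier C"
    and c: "\<And>e. e > 0 ==> \<exists>N. \<forall>m\<ge>N. \<forall>n\<ge>N. anorm C (u m \<ominus>\<^bsub>C\<^esub> u n) < e"
  have "\<forall>k::nat. \<exists>b\<in>AA. anorm C (emb b \<ominus>\<^bsub>C\<^esub> u k) < inverse (real (Suc k))" using emb_dense[OF u] by simp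
  then obtain V where V: "\<And>k. V k \<in> AA" "\<And>k. anorm C (emb (V k) \<ominus>\<^bsub>C\<^esub> u k) < inverse (real (Suc k))" by metis
  have VC: "V \<in> CS"
  proof (rule CS_I[OF V(1)])
    fix e :: real assume e: "e > 0"
    obtain N where N: "\<forall>m\<ge>N. \<forall>n\<ge>N. anorm C (u m \<ominus>\<^bsub>C\<^esub> u n) < e/3" using c[of "e/3"] e by auto
    obtain K where K: "inverse (real (Suc K)) < e/3" using reals_Archimedean[of "e/3"] e by auto
    have "nm (V m \<ominus> V n) < e" if mn: "m \<ge> max N K" "n \<ge> max N K" for m n
    proof -
      have i: "inverse (real (Suc j)) \<le> inverse (real (Suc K))" if "j \<ge> K" for j
        using that by (intro le_imp_inverse_le) auto
      have "nm (V m \<ominus> V n) = anorm C (emb (V m) \<ominus>\<^bsub>C\<^esub> emb (V n))"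
        using V(1) by (simp add: norm_emb[symmetric] emb_diff)
      also have "\<dots> \<le> anorm C (emb (V m) \<ominus>\<^bsub>C\<^esub> u m) + anorm C (u m \<ominus>\<^bsub>C\<^esub> emb (V n))"
        using u V emb by (intro S.nrm_diff_triangle) auto
      also have "anorm C (u m \<ominus>\<^bsub>C\<^esub> emb (V n)) \<le> anorm C (u m \<ominus>\<^bsub>C\<^esub> u n) + anorm C (u n \<ominus>\<^bsub>C\<^esub> emb (V n))"
        using u V emb by (intro S.nrm_diff_triangle) auto
      also have "anorm C (u n \<ominus>\<^bsub>C\<^esub> emb (V n)) = anorm C (emb (V n) \<ominus>\<^bsub>C\<^esub> u n)"
        using u V emb by (intro S.nrm_diff_swap) auto
      finally show ?thesis using V(2)[of m] V(2)[of n] N[rule_format, of m n] K i[of m] i[of n] mn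
        unfolding max.bounded_iff by linarith
    qed
    then show "\<exists>M. \<forall>m\<ge>M. \<forall>n\<ge>M. nm (V m \<ominus> V n) < e" by blast
  qed
  have "S.tends u (cls V)"
    unfolding S.tends_def
  proof (rule LIMSEQ_I)
    fix e :: real assume e: "e > 0"
    obtain M where M: "\<forall>n\<ge>M. anorm C (emb (V n) \<ominus>\<^bsub>C\<^esub> cls V) \<le> e/2" using cls_limit[OF VC, of "e/2"] e by auto
    obtain K where K: "inverse (real (Suc K)) < e/2" using reals_Archimedean[of "e/2"] e by auto
    have "norm (anorm C (u n \<ominus>\<^bsub>C\<^esub> cls V) - 0) < e" if n: "n \<ge> max M K" for n
    proof -
      have i: "inverse (real (Suc n)) \<le> inverse (real (Suc K))" using n by (intro le_imp_inverse_le) auto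
      have "anorm C (u n \<ominus>\<^bsub>C\<^esub> cls V) \<le> anorm C (u n \<ominus>\<^bsub>C\<^esub> emb (V n)) + anorm C (emb (V n) \<ominus>\<^bsub>C\<^esub> cls V)"
        using u V emb VC by (intro S.nrm_diff_triangle) auto
      also have "anorm C (u n \<ominus>\<^bsub>C\<^esub> emb (V n)) = anorm C (emb (V n) \<ominus>\<^bsub>C\<^esub> u n)"
        using u V emb by (intro S.nrm_diff_swap) auto
      finally have "anorm C (u n \<ominus>\<^bsub>C\<^esub> cls V) < e" using V(2)[of n] M[rule_format, of n] K i n
        unfolding max.bounded_iff by linarith
      then show ?thesis using u[of n] VC by (simp add: S.nrm_nonneg)
    qed
    then show "\<exists>N. \<forall>n\<ge>N. norm (anorm C (u n \<ominus>\<^bsub>C\<^esub> cls V) - 0) < e" by blast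
  qed
  then show "\<exists>x\<in>carrier C. seminormed_module.tends C (anorm C) u x" by (rule bexI) (simp add: VC)
qed

end

lemma star_homsD:
  assumes "\<phi> \<in> star_homs A B"
  shows "\<phi> \<in> extensional (carrier A)" "\<And>x. x \<in> carrier A ==> \<phi> x \<in> carrier B"
    "\<And>x y. x \<in> carrier A ==> y \<in> carrier A ==> \<phi> (x \<oplus>\<^bsub>A\<^esub> y) = \<phi> x \<oplus>\<^bsub>B\<^esub> \<phi> y"
    "\<And>x c. x \<in> carrier A ==> \<phi> (c \<odot>\<^bsub>A\<^esub> x) = c \<odot>\<^bsub>B\<^esub> \<phi> x"
    "\<And>x y. x \<in> carrier A ==> y \<in> carrier A ==> \<phi> (x \<otimes>\<^bsub>A\<^esub> y) = \<phi> x \<otimes>\<^bsub>B\<^esub> \<phi> y"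
    "\<And>x. x \<in> carrier A ==> \<phi> (star A x) = star B (\<phi> x)"
  using assms by (auto simp: star_homs_def linear_maps_def PiE_iff)

lemma star_homsI:
  assumes "\<phi> \<in> extensional (carrier A)" "\<And>x. x \<in> carrier A ==> \<phi> x \<in> carrier B"
    "\<And>x y. x \<in> carrier A ==> y \<in> carrier A ==> \<phi> (x \<oplus>\<^bsub>A\<^esub> y) = \<phi> x \<oplus>\<^bsub>B\<^esub> \<phi> y"
    "\<And>x c. x \<in> carrier A ==> \<phi> (c \<odot>\<^bsub>A\<^esub> x) = c \<odot>\<^bsub>B\<^esub> \<phi> x"
    "\<And>x y. x \<in> carrier A ==> y \<in> carrier A ==> \<phi> (x \<otimes>\<^bsub>A\<^esub> y) = \<phi> x \<otimes>\<^bsub>B\<^esub> \<phi> y"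
    "\<And>x. x \<in> carrier A ==> \<phi> (star A x) = star B (\<phi> x)"
  shows "\<phi> \<in> star_homs A B"
  using assms by (auto simp: star_homs_def linear_maps_def extensional_def)

lemma bounded_between_star_hom:
  assumes "\<phi> \<in> star_homs A B" and "\<And>a. a \<in> carrier A ==> nB (\<phi> a) \<le> anorm A a"
  shows "bounded_between A (anorm A) B nB \<phi>"
  using star_homsD[OF assms(1)] assms(2) unfolding bounded_between_def by (auto intro!: exI[of _ 1])

context banach_star_algebra
begin

text \<open>Solves \<open>2 y - y\<^sup>2 = x\<close>, that is \<open>1 - x = (1 - y)\<^sup>2\<close> in the unitization.\<close>

lemma square_root_exists:
  assumes x: "x \<in> AA" "star A x = x" "nm x \<le> q * q" and q: "0 \<le> q" "q < 1"
  shows "\<exists>y\<in>AA. star A y = y \<and> 2 \<odot> y = x \<oplus> y \<otimes> y"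
proof -
  \<comment> \<open>Fixed point iteration for \<open>y = (x + y^2)/2\<close>, started at zero; all
    iterates stay self-adjoint of norm at most \<open>q\<close>.\<close>
  define Y where "Y = rec_nat \<zero> (\<lambda>_ y. (1/2) \<odot> (x \<oplus> y \<otimes> y))"
  have Y0: "Y 0 = \<zero>" and YS: "Y (Suc n) = (1/2) \<odot> (x \<oplus> Y n \<otimes> Y n)" for n by (simp_all add: Y_def)
  have star0: "star A \<zero> = \<zero>" using star_smult[of \<zero> 0] by simp
  have Y: "Y n \<in> AA \<and> star A (Y n) = Y n \<and> nm (Y n) \<le> q" for n
  proof (induction n)
    case 0 then show ?case using q star0 by (simp add: Y0)
  next
    case (Suc n)
    have "nm (Y n \<otimes> Y n) \<le> nm (Y n) * nm (Y n)" using Suc norm_mult_le by blast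
    also have "\<dots> \<le> q * q" using Suc q by (intro mult_mono) (auto simp: nrm_nonneg)
    finally have "nm (x \<oplus> Y n \<otimes> Y n) \<le> q * q + q * q"
      using nrm_add[of x "Y n \<otimes> Y n"] x Suc by auto
    moreover have "q * q \<le> q * 1" using q by (intro mult_left_mono) auto
    ultimately show ?case using Suc x by (simp add: YS nrm_smult star_smult star_add star_mult)
  qed
  \<comment> \<open>On the ball of radius \<open>q\<close> the iteration contracts by the factor
    \<open>q\<close>: the factor one half compensates the two terms in the difference of
    squares.\<close>
  have step: "nm (Y (Suc n) \<ominus> Y n) \<le> q ^ n" for n
  proof (induction n)
    case 0
    then show ?case using Y[of "Suc 0"] q by (simp add: Y0)
  next
    case (Suc n)
    have "Y (Suc (Suc n)) \<ominus> Y (Suc n) = (1/2) \<odot> (x \<oplus> Y (Suc n) \<otimes> Y (Suc n)) \<ominus> (1/2) \<odot> (x \<oplus> Y n \<otimes> Y n)"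
      by (rule arg_cong2[OF YS[of "Suc n"] YS[of n]])
    also have "\<dots> = (1/2) \<odot> ((x \<oplus> Y (Suc n) \<otimes> Y (Suc n)) \<ominus> (x \<oplus> Y n \<otimes> Y n))"
      using Y x by (intro smult_diff[symmetric]) auto
    finally have "Y (Suc (Suc n)) \<ominus> Y (Suc n) = (1/2) \<odot> ((x \<oplus> Y (Suc n) \<otimes> Y (Suc n)) \<ominus> (x \<oplus> Y n \<otimes> Y n))" .
    then have "nm (Y (Suc (Suc n)) \<ominus> Y (Suc n)) = 1/2 * nm (Y (Suc n) \<otimes> Y (Suc n) \<ominus> Y n \<otimes> Y n)"
      using Y x by (simp add: nrm_smult add_diff_add)
    also have "nm (Y (Suc n) \<otimes> Y (Suc n) \<ominus> Y n \<otimes> Y n) \<le>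
      nm (Y (Suc n)) * nm (Y (Suc n) \<ominus> Y n) + nm (Y (Suc n) \<ominus> Y n) * nm (Y n)"
      using Y by (intro mult_diff_bound) auto
    also have "\<dots> \<le> q * q ^ n + q ^ n * q"
      using Y Suc q by (intro add_mono mult_mono) (auto simp: nrm_nonneg)
    finally show ?case by simp
  qed
  have far: "nm (Y (n + k) \<ominus> Y n) \<le> q ^ n * (1 - q ^ k) / (1 - q)" for n k
  proof (induction k)
    case 0 then show ?case using Y by simp
  next
    case (Suc k)
    have "nm (Y (n + Suc k) \<ominus> Y n) \<le> nm (Y (Suc (n + k)) \<ominus> Y (n + k)) + nm (Y (n + k) \<ominus> Y n)"
      using Y nrm_diff_triangle by simp
    also have "\<dots> \<le> q ^ (n + k) + q ^ n * (1 - q ^ k) / (1 - q)" using step[of "n + k"] Suc by simp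
    also have "\<dots> = q ^ n * (1 - q ^ Suc k) / (1 - q)" using q by (simp add: field_simps power_add)
    finally show ?case .
  qed
  have "\<exists>N. \<forall>m\<ge>N. \<forall>n\<ge>N. nm (Y m \<ominus> Y n) < e" if e: "e > 0" for e
  proof -
    have "(\<lambda>n. q ^ n) \<longlonglongrightarrow> 0" using q by (intro LIMSEQ_realpow_zero)
    then obtain N where N: "\<forall>n\<ge>N. norm (q ^ n - 0) < e * (1 - q) / 2"
      using LIMSEQ_D[of "\<lambda>n. q ^ n" 0 "e * (1 - q) / 2"] e q by auto
    have w: "nm (Y m \<ominus> Y N) < e/2" if "m \<ge> N" for m
    proof -
      obtain k where k: "m = N + k" using \<open>m \<ge> N\<close> le_Suc_ex by blast
      have "q ^ N * (1 - q ^ k) \<le> q ^ N * 1" using q by (intro mult_left_mono) auto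
      then have "q ^ N * (1 - q ^ k) / (1 - q) \<le> q ^ N / (1 - q)" using q by (simp add: divide_right_mono)
      also have "\<dots> < e/2" using N[rule_format, of N] q by (simp add: field_simps)
      finally show ?thesis using far[of N k] unfolding k by linarith
    qed
    have "nm (Y m \<ominus> Y n) < e" if "m \<ge> N" "n \<ge> N" for m n
      using w[OF that(1)] w[OF that(2)] nrm_diff_triangle[of "Y m" "Y N" "Y n"] nrm_diff_swap[of "Y N" "Y n"] Y by simp
    then show ?thesis by blast
  qed
  then obtain y where y: "y \<in> AA" "tends Y y" using complete[of Y] Y by blast
  have lim: "(\<lambda>n. nm (Y n \<ominus> y)) \<longlonglongrightarrow> 0" using y(2) by (simp add: tends_def)
  have "nm (star A y \<ominus> y) \<le> 0"
  proof (rule LIMSEQ_le_const)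
    show "(\<lambda>n. nm (Y n \<ominus> y) + nm (Y n \<ominus> y)) \<longlonglongrightarrow> 0" using tendsto_add[OF lim lim] by simp
    have "nm (star A y \<ominus> y) \<le> nm (Y n \<ominus> y) + nm (Y n \<ominus> y)" for n
    proof -
      have "nm (star A y \<ominus> Y n) = nm (star A (y \<ominus> Y n))" using Y[of n] y by (simp add: star_diff)
      also have "\<dots> = nm (Y n \<ominus> y)" using Y[of n] y by (simp add: nrm_diff_swap)
      finally show ?thesis using nrm_diff_triangle[of "star A y" "Y n" y] Y[of n] y by simp
    qed
    then show "\<exists>N. \<forall>n\<ge>N. nm (star A y \<ominus> y) \<le> nm (Y n \<ominus> y) + nm (Y n \<ominus> y)" by blast
  qed
  then have sy: "star A y = y" using y by (intro eqI_dist) auto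
  let ?z = "(1/2) \<odot> (x \<oplus> y \<otimes> y)"
  have "nm (y \<ominus> ?z) \<le> 0"
  proof (rule LIMSEQ_le_const)
    have "(\<lambda>n. nm (Y (Suc n) \<ominus> y) + 1/2 * (q * nm (Y n \<ominus> y) + nm (Y n \<ominus> y) * nm y)) \<longlonglongrightarrow> 0 + 1/2 * (q * 0 + 0 * nm y)"
      using lim LIMSEQ_Suc[OF lim] by (intro tendsto_intros)
    then show "(\<lambda>n. nm (Y (Suc n) \<ominus> y) + 1/2 * (q * nm (Y n \<ominus> y) + nm (Y n \<ominus> y) * nm y)) \<longlonglongrightarrow> 0" by simp
    have "nm (y \<ominus> ?z) \<le> nm (Y (Suc n) \<ominus> y) + 1/2 * (q * nm (Y n \<ominus> y) + nm (Y n \<ominus> y) * nm y)" for n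
    proof -
      have "Y (Suc n) \<ominus> ?z = (1/2) \<odot> ((x \<oplus> Y n \<otimes> Y n) \<ominus> (x \<oplus> y \<otimes> y))"
        using Y[of n] x y by (simp only: YS smult_diff M.a_closed mult_closed)
      then have "nm (Y (Suc n) \<ominus> ?z) = 1/2 * nm (Y n \<otimes> Y n \<ominus> y \<otimes> y)"
        using Y[of n] x y by (simp add: nrm_smult add_diff_add)
      also have "nm (Y n \<otimes> Y n \<ominus> y \<otimes> y) \<le> nm (Y n) * nm (Y n \<ominus> y) + nm (Y n \<ominus> y) * nm y"
        using Y y by (intro mult_diff_bound) auto
      also have "\<dots> \<le> q * nm (Y n \<ominus> y) + nm (Y n \<ominus> y) * nm y"
        using Y[of n] y by (intro add_mono mult_right_mono) (auto simp: nrm_nonneg)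
      finally have "nm (Y (Suc n) \<ominus> ?z) \<le> 1/2 * (q * nm (Y n \<ominus> y) + nm (Y n \<ominus> y) * nm y)" by simp
      moreover have "nm (y \<ominus> ?z) \<le> nm (y \<ominus> Y (Suc n)) + nm (Y (Suc n) \<ominus> ?z)"
        using Y[of "Suc n"] x y by (intro nrm_diff_triangle) auto
      moreover have "nm (y \<ominus> Y (Suc n)) = nm (Y (Suc n) \<ominus> y)"
        using Y[of "Suc n"] y by (intro nrm_diff_swap) auto
      ultimately show ?thesis by linarith
    qed
    then show "\<exists>N. \<forall>n\<ge>N. nm (y \<ominus> ?z) \<le> nm (Y (Suc n) \<ominus> y) + 1/2 * (q * nm (Y n \<ominus> y) + nm (Y n \<ominus> y) * nm y)" by blast
  qed
  then have "y = ?z" using x y by (intro eqI_dist) auto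
  then have "2 \<odot> y = 2 \<odot> ?z" by simp
  also have "\<dots> = x \<oplus> y \<otimes> y" using x y by simp
  finally show ?thesis using y sy by blast
qed

text \<open>For \<open>nm b < 1\<close> solve
  \<open>2 \<odot> y = star A b \<otimes> b \<oplus> y \<otimes> y\<close> with \<open>y\<close>
  self-adjoint. With \<open>u = \<pi> y \<xi>\<close> this gives
  \<open>\<parallel>\<xi>\<parallel>^2 - \<parallel>\<pi> b \<xi>\<parallel>^2 = \<parallel>\<xi> -
  u\<parallel>^2\<close>, which is nonnegative; scaling does the rest.\<close>

theorem star_hom_contractive:
  assumes "hilbert_space H" and \<pi>: "\<pi> \<in> star_homs A (bounded_ops H)" and a: "a \<in> AA"
  shows "op_norm H (hnorm H) (\<pi> a) \<le> nm a"
proof -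
  interpret H: hilbert H by unfold_locales fact
  note h = star_homsD[OF \<pi>]
  have main: "H.hn (\<pi> b \<xi>) \<le> H.hn \<xi>" if b: "b \<in> AA" "nm b < 1" and \<xi>: "\<xi> \<in> carrier H" for b \<xi>
  proof -
    let ?x = "star A b \<otimes> b"
    have "nm ?x \<le> nm b * nm b" using norm_mult_le[of "star A b" b] b by simp
    then obtain y where y: "y \<in> AA" "star A y = y" "2 \<odot> y = ?x \<oplus> y \<otimes> y"
      using square_root_exists[of ?x "nm b"] b by (auto simp: star_mult nrm_nonneg)
    have Y: "\<pi> y \<in> carrier H.BO" "\<pi> b \<in> carrier H.BO" using h(2) y b by auto
    let ?u = "\<pi> y \<xi>"
    have u: "?u \<in> carrier H" using Y \<xi> by simp
    have sa: "H.ip (\<pi> y \<eta>) \<zeta> = H.ip \<eta> (\<pi> y \<zeta>)" if "\<eta> \<in> carrier H" "\<zeta> \<in> carrier H" for \<eta> \<zeta>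
      using H.star_BO(2)[OF Y(1) that] h(6)[OF y(1)] y(2) by simp
    have e1: "\<pi> (2 \<odot> y) \<xi> = 2 \<odot>\<^bsub>H\<^esub> ?u" using h(4)[OF y(1), of 2] \<xi> by simp
    have e2: "\<pi> (?x \<oplus> y \<otimes> y) \<xi> = \<pi> ?x \<xi> \<oplus>\<^bsub>H\<^esub> \<pi> y ?u"
      using h(3)[of ?x "y \<otimes> y"] h(5)[of y y] y(1) b \<xi> by (simp add: compose_eq)
    have e: "2 \<odot>\<^bsub>H\<^esub> ?u = \<pi> ?x \<xi> \<oplus>\<^bsub>H\<^esub> \<pi> y ?u" using e1 e2 unfolding y(3) by metis
    have px: "\<pi> ?x \<xi> \<in> carrier H" using h(2)[of ?x] b \<xi> by simp
    have "H.ip (\<pi> ?x \<xi>) \<xi> = H.ip (star H.BO (\<pi> b) (\<pi> b \<xi>)) \<xi>"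
      using h(5)[of "star A b" b] h(6)[of b] b \<xi> by (simp add: compose_eq)
    also have "\<dots> = H.ip (\<pi> b \<xi>) (\<pi> b \<xi>)"
    proof -
      have s: "star H.BO (\<pi> b) \<in> carrier H.BO" using H.star_BO Y by blast
      have "H.ip (star H.BO (\<pi> b) (\<pi> b \<xi>)) \<xi> = H.ip (\<pi> b \<xi>) (star H.BO (star H.BO (\<pi> b)) \<xi>)"
        using H.star_BO(2)[OF s] Y \<xi> by simp
      then show ?thesis using H.star_star_BO Y by simp
    qed
    finally have x1: "H.ip (\<pi> ?x \<xi>) \<xi> = H.ip (\<pi> b \<xi>) (\<pi> b \<xi>)" .
    have "2 * H.ip ?u \<xi> = H.ip (\<pi> ?x \<xi>) \<xi> + H.ip ?u ?u"
      using arg_cong[OF e, of "\<lambda>z. H.ip z \<xi>"] px u \<xi> Y sa[of ?u \<xi>] by simp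
    then have "2 * Re (H.ip ?u \<xi>) = (H.hn (\<pi> b \<xi>))\<^sup>2 + (H.hn ?u)\<^sup>2"
      using x1 u Y \<xi> by (simp add: H.hn_power2 complex_eq_iff)
    moreover have "(H.hn (\<xi> \<ominus>\<^bsub>H\<^esub> ?u))\<^sup>2 = (H.hn \<xi>)\<^sup>2 + (H.hn ?u)\<^sup>2 - 2 * Re (H.ip ?u \<xi>)"
    proof -
      have "Re (H.ip \<xi> ?u) = Re (H.ip ?u \<xi>)" using H.ip_cnj[OF u \<xi>] by simp
      then show ?thesis using u \<xi> by (simp add: H.hn_power2)
    qed
    ultimately have "(H.hn (\<pi> b \<xi>))\<^sup>2 \<le> (H.hn \<xi>)\<^sup>2" using zero_le_power2[of "H.hn (\<xi> \<ominus>\<^bsub>H\<^esub> ?u)"] by linarith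
    then show ?thesis using \<xi> H.hn_nonneg power2_le_imp_le by blast
  qed
  show ?thesis
  proof (rule H.opn_le)
    fix \<xi> assume \<xi>: "\<xi> \<in> carrier H"
    show "H.hn (\<pi> a \<xi>) \<le> nm a * H.hn \<xi>"
    proof (rule field_le_epsilon)
      fix e :: real assume e: "e > 0"
      \<comment> \<open>Slightly more than \<open>nm a\<close>, so that the scaled element has norm
        less than 1 even if \<open>nm a = 0\<close>; the surplus contributes at most
        \<open>e\<close> at \<open>\<xi>\<close>.\<close>
      define t where "t = nm a + e / (H.hn \<xi> + 1)"
      have p: "e / (H.hn \<xi> + 1) > 0" using e \<xi> by (simp add: add_nonneg_pos)
      have t: "t > 0" "nm a < t" using p nrm_nonneg[OF a] by (auto simp: t_def)
      let ?b = "complex_of_real (1/t) \<odot> a"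
      have b: "?b \<in> AA" "nm ?b < 1" using a t by (simp_all add: nrm_smult norm_divide)
      have "H.hn (\<pi> ?b \<xi>) = H.hn (\<pi> a \<xi>) / t"
        using h(2,4)[OF a] \<xi> t by (simp add: H.nrm_smult norm_divide)
      then have "H.hn (\<pi> a \<xi>) \<le> t * H.hn \<xi>" using main[OF b \<xi>] t by (simp add: divide_le_eq mult.commute)
      also have "\<dots> = nm a * H.hn \<xi> + e * (H.hn \<xi> / (H.hn \<xi> + 1))" by (simp add: t_def distrib_right)
      also have "e * (H.hn \<xi> / (H.hn \<xi> + 1)) \<le> e * 1"
        using e \<xi> by (intro mult_left_mono) (auto simp: divide_le_eq add_nonneg_pos)
      finally show "H.hn (\<pi> a \<xi>) \<le> nm a * H.hn \<xi> + e" by simp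
    qed
  qed (use a in \<open>simp add: nrm_nonneg\<close>)
qed

end

section \<open>Transporting representations to other Hilbert spaces\<close>

lemma hilbert_spaceI:
  fixes H :: "'a hilbert"
  assumes nm: "normed_module H (hnorm H)"
    and "\<And>x y z. x \<in> carrier H ==> y \<in> carrier H ==> z \<in> carrier H ==> hinner H (x \<oplus>\<^bsub>H\<^esub> y) z = hinner H x z + hinner H y z"
    and "\<And>c x y. x \<in> carrier H ==> y \<in> carrier H ==> hinner H (c \<odot>\<^bsub>H\<^esub> x) y = c * hinner H x y"
    and "\<And>x y. x \<in> carrier H ==> y \<in> carrier H ==> hinner H y x = cnj (hinner H x y)"
    and "\<And>x. x \<in> carrier H ==> hinner H x x \<in> \<real>\<^sub>\<ge>\<^sub>0"
    and "\<And>x. x \<in> carrier H ==> hinner H x x = 0 ==> x = \<zero>\<^bsub>H\<^esub>"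
    and c: "\<And>u. (\<And>n. u n \<in> carrier H) ==> (\<And>e. e > 0 ==> \<exists>N. \<forall>m\<ge>N. \<forall>n\<ge>N. hnorm H (u m \<ominus>\<^bsub>H\<^esub> u n) < e) ==>
      \<exists>x\<in>carrier H. (\<lambda>n. hnorm H (u n \<ominus>\<^bsub>H\<^esub> x)) \<longlonglongrightarrow> 0"
  shows "hilbert_space H"
proof -
  interpret N: normed_module H "hnorm H" by fact
  have "Metric_space.mcomplete (carrier H) (norm_dist H (hnorm H))"
    unfolding N.mcomplete_iff N.tends_def
  proof (intro allI impI)
    fix u :: "nat \<Rightarrow> 'a" assume "(\<forall>n. u n \<in> carrier H) \<and> (\<forall>e>0. \<exists>N. \<forall>m\<ge>N. \<forall>n\<ge>N. hnorm H (u m \<ominus>\<^bsub>H\<^esub> u n) < e)"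
    then have "\<And>n. u n \<in> carrier H" "\<And>e. e > 0 ==> \<exists>N. \<forall>m\<ge>N. \<forall>n\<ge>N. hnorm H (u m \<ominus>\<^bsub>H\<^esub> u n) < e" by blast+
    then show "\<exists>x\<in>carrier H. (\<lambda>n. hnorm H (u n \<ominus>\<^bsub>H\<^esub> x)) \<longlonglongrightarrow> 0" by (rule c)
  qed
  then show ?thesis unfolding hilbert_space_def by (intro conjI ballI allI impI N.module assms(2-6))
qed

context hilbert
begin

lemma orthogonal_closed:
  assumes Z: "Z \<subseteq> HH" shows "closed_subspace {x \<in> HH. \<forall>z\<in>Z. ip x z = 0}"
proof (rule closed_subspaceI)
  fix x assume x: "x \<in> HH" and c: "\<And>e. e > 0 ==> \<exists>y\<in>{x \<in> HH. \<forall>z\<in>Z. ip x z = 0}. hn (y \<ominus> x) < e"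
  have "ip x z = 0" if z: "z \<in> Z" for z
  proof (rule zero_if_arbitrarily_small)
    fix e :: real assume "e > 0"
    then obtain y where y: "y \<in> HH" "ip y z = 0" "hn (y \<ominus> x) < e" using c z by blast
    have zc: "z \<in> HH" using z Z by blast
    have "cmod (ip x z) = cmod (ip (y \<ominus> x) z)" using x y zc by simp
    also have "\<dots> \<le> hn (y \<ominus> x) * hn z" using x y zc by (intro Cauchy_Schwarz) auto
    also have "\<dots> \<le> e * hn z" using y zc by (intro mult_right_mono) auto
    finally show "cmod (ip x z) \<le> hn z * e" by (simp add: mult.commute)
  qed
  then show "x \<in> {x \<in> HH. \<forall>z\<in>Z. ip x z = 0}" using x by blast
qed (use Z in \<open>auto simp: subset_iff\<close>)

text \<open>Renames the vectors of a closed subspace along an injection. The point is the change of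
  type: \<open>universal_norm\<close> sees only spaces whose vectors are functions on the
  group.\<close>

definition transport :: "'h set \<Rightarrow> ('h \<Rightarrow> 'k) \<Rightarrow> 'k hilbert" where
  "transport K J = \<lparr>carrier = J ` K, monoid.mult = (\<lambda>a b. a), monoid.one = J \<zero>, ring.zero = J \<zero>,
     ring.add = (\<lambda>a b. J (inv_into K J a \<oplus> inv_into K J b)), module.smult = (\<lambda>c a. J (c \<odot> inv_into K J a)),
     hinner = (\<lambda>a b. ip (inv_into K J a) (inv_into K J b))\<rparr>"

lemma closed_subspaceD:
  assumes "closed_subspace K"
  shows "x \<in> K ==> x \<in> HH" "\<zero> \<in> K" "x \<in> K ==> y \<in> K ==> x \<oplus> y \<in> K" "x \<in> K ==> c \<odot> x \<in> K"
  using assms unfolding closed_subspace_def by blast+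

lemma closed_subspace_diff: "closed_subspace K ==> x \<in> K ==> y \<in> K ==> x \<ominus> y \<in> K"
  by (simp add: diff_eq closed_subspaceD)

context
  fixes K and J :: "'h \<Rightarrow> 'k"
  assumes K: "closed_subspace K" and J: "inj_on J K"
begin

lemmas K_mem = closed_subspaceD[OF K] and K_diff = closed_subspace_diff[OF K]

lemma transport_simps:
  "carrier (transport K J) = J ` K" "\<zero>\<^bsub>transport K J\<^esub> = J \<zero>"
  "x \<in> K ==> y \<in> K ==> J x \<oplus>\<^bsub>transport K J\<^esub> J y = J (x \<oplus> y)"
  "x \<in> K ==> c \<odot>\<^bsub>transport K J\<^esub> J x = J (c \<odot> x)"
  "x \<in> K ==> y \<in> K ==> hinner (transport K J) (J x) (J y) = ip x y"
  "x \<in> K ==> hnorm (transport K J) (J x) = hn x"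
  using J by (simp_all add: transport_def hnorm_def)

lemma complex_module_transport: "complex_module (transport K J)"
proof (rule complex_module.intro, rule complex_moduleI)
  fix a b assume "a \<in> carrier (transport K J)" "b \<in> carrier (transport K J)"
  then obtain x y where xy: "x \<in> K" "y \<in> K" "a = J x" "b = J y" by (auto simp: transport_simps)
  show "a \<oplus>\<^bsub>transport K J\<^esub> b \<in> carrier (transport K J)" "a \<oplus>\<^bsub>transport K J\<^esub> b = b \<oplus>\<^bsub>transport K J\<^esub> a"
    "c \<odot>\<^bsub>transport K J\<^esub> (a \<oplus>\<^bsub>transport K J\<^esub> b) = c \<odot>\<^bsub>transport K J\<^esub> a \<oplus>\<^bsub>transport K J\<^esub> c \<odot>\<^bsub>transport K J\<^esub> b" for c
    using xy K_mem by (simp_all add: transport_simps M.a_comm smult_add_right)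
  fix c assume "c \<in> carrier (transport K J)"
  then obtain z where "z \<in> K" "c = J z" by (auto simp: transport_simps)
  then show "(a \<oplus>\<^bsub>transport K J\<^esub> b) \<oplus>\<^bsub>transport K J\<^esub> c = a \<oplus>\<^bsub>transport K J\<^esub> (b \<oplus>\<^bsub>transport K J\<^esub> c)"
    using xy K_mem by (simp add: transport_simps M.a_assoc)
next
  fix a k l assume "a \<in> carrier (transport K J)"
  then obtain x where x: "x \<in> K" "a = J x" by (auto simp: transport_simps)
  then show "k \<odot>\<^bsub>transport K J\<^esub> a \<in> carrier (transport K J)" "\<zero>\<^bsub>transport K J\<^esub> \<oplus>\<^bsub>transport K J\<^esub> a = a"
    "(k * l) \<odot>\<^bsub>transport K J\<^esub> a = k \<odot>\<^bsub>transport K J\<^esub> (l \<odot>\<^bsub>transport K J\<^esub> a)"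
    "1 \<odot>\<^bsub>transport K J\<^esub> a = a" "0 \<odot>\<^bsub>transport K J\<^esub> a = \<zero>\<^bsub>transport K J\<^esub>"
    "(k + l) \<odot>\<^bsub>transport K J\<^esub> a = k \<odot>\<^bsub>transport K J\<^esub> a \<oplus>\<^bsub>transport K J\<^esub> l \<odot>\<^bsub>transport K J\<^esub> a"
    using K_mem by (simp_all add: transport_simps smult_add)
qed (simp add: transport_simps K_mem)

lemma transport_diff: "x \<in> K ==> y \<in> K ==> J x \<ominus>\<^bsub>transport K J\<^esub> J y = J (x \<ominus> y)"
  using complex_module.diff_eq[OF complex_module_transport, of "J x" "J y"] K_mem
  by (simp add: transport_simps diff_eq)

lemma hilbert_space_transport: "hilbert_space (transport K J)"
proof (rule hilbert_spaceI)
  show "normed_module (transport K J) (hnorm (transport K J))"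
  proof (intro normed_module.intro seminormed_module.intro complex_module_transport seminormed_module_axioms.intro normed_module_axioms.intro)
    fix a b assume "a \<in> carrier (transport K J)" "b \<in> carrier (transport K J)"
    then obtain x y where "x \<in> K" "y \<in> K" "a = J x" "b = J y" by (auto simp: transport_simps)
    then show "hnorm (transport K J) (a \<oplus>\<^bsub>transport K J\<^esub> b) \<le> hnorm (transport K J) a + hnorm (transport K J) b"
      using K_mem nrm_add by (simp add: transport_simps)
  next
    fix a c assume "a \<in> carrier (transport K J)"
    then obtain x where "x \<in> K" "a = J x" by (auto simp: transport_simps)
    then show "hnorm (transport K J) (c \<odot>\<^bsub>transport K J\<^esub> a) = cmod c * hnorm (transport K J) a"
      using K_mem nrm_smult by (simp add: transport_simps)
  next
    fix a assume "a \<in> carrier (transport K J)" "hnorm (transport K J) a = 0"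
    then obtain x where x: "x \<in> K" "a = J x" "hn x = 0" by (auto simp: transport_simps)
    then have "x = \<zero>" using K_mem(1) nrm_definite by blast
    then show "a = \<zero>\<^bsub>transport K J\<^esub>" using x by (simp add: transport_simps)
  qed
next
  fix u :: "nat \<Rightarrow> 'k" assume u: "\<And>n. u n \<in> carrier (transport K J)"
    and c: "\<And>e. e > 0 ==> \<exists>N. \<forall>m\<ge>N. \<forall>n\<ge>N. hnorm (transport K J) (u m \<ominus>\<^bsub>transport K J\<^esub> u n) < e"
  have "\<forall>n. \<exists>x\<in>K. u n = J x" using u by (auto simp: transport_simps)
  then obtain w where w: "\<And>n. w n \<in> K" "\<And>n. u n = J (w n)" by metis
  have nw: "hnorm (transport K J) (u m \<ominus>\<^bsub>transport K J\<^esub> u n) = hn (w m \<ominus> w n)" for m n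
    using w K_diff by (simp add: transport_diff transport_simps)
  obtain x where x: "x \<in> HH" "tends w x"
    using complete[of w] w(1) K_mem c unfolding nw by blast
  have "\<exists>y\<in>K. hn (y \<ominus> x) < e" if e: "e > 0" for e
  proof -
    obtain N where "\<forall>n\<ge>N. norm (hn (w n \<ominus> x) - 0) < e"
      using LIMSEQ_D[OF x(2)[unfolded tends_def] e] by blast
    then have "\<bar>hn (w N \<ominus> x)\<bar> < e" by simp
    then have "hn (w N \<ominus> x) < e" by linarith
    then show ?thesis using w(1) by blast
  qed
  then have xK: "x \<in> K" using K x(1) unfolding closed_subspace_def by blast
  have "hnorm (transport K J) (u n \<ominus>\<^bsub>transport K J\<^esub> J x) = hn (w n \<ominus> x)" for n
    using w xK K_diff by (simp add: transport_diff transport_simps)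
  then show "\<exists>a\<in>carrier (transport K J). (\<lambda>n. hnorm (transport K J) (u n \<ominus>\<^bsub>transport K J\<^esub> a)) \<longlonglongrightarrow> 0"
    using x(2) xK by (intro bexI[of _ "J x"]) (simp_all add: tends_def transport_simps)
next
  fix a b assume ab: "a \<in> carrier (transport K J)" "b \<in> carrier (transport K J)"
  then obtain x y where xy: "x \<in> K" "y \<in> K" "a = J x" "b = J y" by (auto simp: transport_simps)
  then show "hinner (transport K J) b a = cnj (hinner (transport K J) a b)"
    using K_mem ip_cnj[of x y] by (simp add: transport_simps)
  show "hinner (transport K J) (c \<odot>\<^bsub>transport K J\<^esub> a) b = c * hinner (transport K J) a b" for c
    using xy K_mem by (simp add: transport_simps)
  fix c assume "c \<in> carrier (transport K J)"
  then obtain z where "z \<in> K" "c = J z" by (auto simp: transport_simps)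
  then show "hinner (transport K J) (a \<oplus>\<^bsub>transport K J\<^esub> b) c = hinner (transport K J) a c + hinner (transport K J) b c"
    using xy K_mem by (simp add: transport_simps)
next
  fix a assume "a \<in> carrier (transport K J)"
  then obtain x where x: "x \<in> K" "a = J x" by (auto simp: transport_simps)
  then show "hinner (transport K J) a a \<in> \<real>\<^sub>\<ge>\<^sub>0"
    using K_mem(1) ip_self[of x] by (simp add: transport_simps nonneg_Reals_of_real_iff)
  assume "hinner (transport K J) a a = 0"
  then show "a = \<zero>\<^bsub>transport K J\<^esub>" using x K_mem(1) ip_self_zero[of x] by (simp add: transport_simps)
qed

lemma transport_BO:
  assumes S: "S \<in> BB" and inv: "\<And>x. x \<in> K ==> S x \<in> K"
  shows "(\<lambda>a\<in>J ` K. J (S (inv_into K J a))) \<in> carrier (bounded_ops (transport K J))"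
proof -
  interpret L: hilbert "transport K J" by unfold_locales (rule hilbert_space_transport)
  show ?thesis
  proof (rule L.BO_I[where c = "opn S"])
    fix a b assume "a \<in> carrier (transport K J)" "b \<in> carrier (transport K J)"
    then obtain x y where "x \<in> K" "y \<in> K" "a = J x" "b = J y" by (auto simp: transport_simps)
    then show "(\<lambda>a\<in>J ` K. J (S (inv_into K J a))) (a \<oplus>\<^bsub>transport K J\<^esub> b) =
      (\<lambda>a\<in>J ` K. J (S (inv_into K J a))) a \<oplus>\<^bsub>transport K J\<^esub> (\<lambda>a\<in>J ` K. J (S (inv_into K J a))) b"
      using K_mem inv S J by (simp add: transport_simps BO_add)
  next
    fix a c assume "a \<in> carrier (transport K J)"
    then obtain x where x: "x \<in> K" "a = J x" by (auto simp: transport_simps)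
    then show "(\<lambda>a\<in>J ` K. J (S (inv_into K J a))) (c \<odot>\<^bsub>transport K J\<^esub> a) = c \<odot>\<^bsub>transport K J\<^esub> (\<lambda>a\<in>J ` K. J (S (inv_into K J a))) a"
      using K_mem inv S J by (simp add: transport_simps BO_smult)
    show "hnorm (transport K J) ((\<lambda>a\<in>J ` K. J (S (inv_into K J a))) a) \<le> opn S * hnorm (transport K J) a"
      "(\<lambda>a\<in>J ` K. J (S (inv_into K J a))) a \<in> carrier (transport K J)"
      using x K_mem(1) inv S J BO_bound by (simp_all add: transport_simps)
  qed (simp add: transport_simps)
qed

end

end

locale pro_hilbert = pro_group G T + hilbert H for G :: "('g, 'm) monoid_scheme" (structure) and T and H :: "'h hilbert"
begin

text \<open>Strong continuity is required at \<open>\<one>\<close> only; elsewhere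
  \<open>v h x - v g x\<close> equals \<open>v g\<close> applied to
  \<open>v (inv g \<otimes> h) x - x\<close>, and \<open>v g\<close> is isometric.\<close>

lemma unitary_repsI:
  assumes ext: "v \<in> extensional GG" and B: "\<And>g. g \<in> GG ==> v g \<in> BB"
    and m: "\<And>g h x. g \<in> GG ==> h \<in> GG ==> x \<in> HH ==> v (g \<otimes> h) x = v g (v h x)"
    and one: "\<And>x. x \<in> HH ==> v \<one> x = x"
    and iso: "\<And>g x y. g \<in> GG ==> x \<in> HH ==> y \<in> HH ==> ip (v g x) (v g y) = ip x y"
    and small: "\<And>x e. x \<in> HH ==> e > 0 ==> \<exists>N\<in>NN. \<forall>n\<in>N. hn (v n x \<ominus>\<^bsub>H\<^esub> x) < e"
  shows "v \<in> unitary_reps G T H"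
proof -
  have U: "v g \<in> carrier (unitary_group H)" if g: "g \<in> GG" for g
  proof (rule unitaryI[OF B[OF g] B[of "inv g"]])
    show "v g (v (inv g) x) = x" "v (inv g) (v g x) = x" if "x \<in> HH" for x
      using that g m[of g "inv g" x] m[of "inv g" g x] one by simp_all
  qed (use g iso in simp_all)
  have "v (g \<otimes> h) = compose (HH) (v g) (v h)" if "g \<in> GG" "h \<in> GG" for g h
    using that B m by (intro BO_eqI) (simp_all add: compose_eq)
  then have hom: "v \<in> hom G (unitary_group H)" using U by (simp add: hom_def)
  have "continuous_map T (norm_topology H hn) (\<lambda>g. v g x)" if x: "x \<in> HH" for x
    unfolding continuous_map_norm_topology
  proof (intro conjI ballI allI impI)
    show "(\<lambda>g. v g x) \<in> topspace T \<rightarrow> HH" using B x by simp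
    fix g and e :: real assume g: "g \<in> topspace T" and e: "e > 0"
    obtain N where N: "N \<in> NN" "\<forall>n\<in>N. hn (v n x \<ominus>\<^bsub>H\<^esub> x) < e" using small[OF x e] by blast
    let ?U = "{h \<in> GG. N #> g = N #> h}"
    have "openin T ?U" by (rule coset_union_open[OF N(1)]) auto
    moreover have "hn (v h x \<ominus>\<^bsub>H\<^esub> v g x) < e" if h: "h \<in> ?U" for h
    proof -
      have gh: "g \<in> GG" "h \<in> GG" "N #> h = N #> g" using g h by auto
      have "N #> (inv g \<otimes> h) = N #> \<one>" using coset_mult[OF N(1), of "inv g" h "inv g" g] gh by simp
      then have n: "inv g \<otimes> h \<in> N" using r_coset_eq_iff[OF NN_subgroup[OF N(1)], of "inv g \<otimes> h" \<one>] gh by simp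
      have "v h x = v g (v (inv g \<otimes> h) x)" using m[of g "inv g \<otimes> h" x] gh x by (simp add: inv_mult_cancel)
      then have "v h x \<ominus>\<^bsub>H\<^esub> v g x = v g (v (inv g \<otimes> h) x \<ominus>\<^bsub>H\<^esub> x)" using gh x B by (simp add: BO_diff)
      then have "hn (v h x \<ominus>\<^bsub>H\<^esub> v g x) = hn (v (inv g \<otimes> h) x \<ominus>\<^bsub>H\<^esub> x)"
        using gh x B iso by (simp add: hnorm_def)
      then show ?thesis using N(2) n by simp
    qed
    ultimately show "\<exists>U. openin T U \<and> g \<in> U \<and> (\<forall>y\<in>U. hn (v y x \<ominus>\<^bsub>H\<^esub> v g x) < e)"
      using g by (intro exI[of _ ?U]) auto
  qed
  then show ?thesis using ext hom by (simp add: unitary_reps_def)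
qed

text \<open>Multiplicativity, isometry and continuity are assumed on \<open>K\<close> alone: in
  \<open>un_sharp\<close> the operators attached to cosets are known to obey the group law just on
  the vectors fixed by \<open>N\<close>.\<close>

lemma transport_rep:
  fixes J :: "'h \<Rightarrow> 'k"
  assumes K: "closed_subspace K" and J: "inj_on J K"
    and U: "\<And>g. g \<in> GG ==> U g \<in> BB" and UK: "\<And>g x. g \<in> GG ==> x \<in> K ==> U g x \<in> K"
    and m: "\<And>g h x. g \<in> GG ==> h \<in> GG ==> x \<in> K ==> U (g \<otimes> h) x = U g (U h x)"
    and one: "\<And>x. x \<in> K ==> U \<one> x = x"
    and iso: "\<And>g x y. g \<in> GG ==> x \<in> K ==> y \<in> K ==> ip (U g x) (U g y) = ip x y"
    and small: "\<And>x e. x \<in> K ==> e > 0 ==> \<exists>N\<in>NN. \<forall>n\<in>N. hn (U n x \<ominus>\<^bsub>H\<^esub> x) < e"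
  defines "w \<equiv> (\<lambda>g\<in>GG. \<lambda>a\<in>J ` K. J (U g (inv_into K J a)))"
  shows "w \<in> unitary_reps G T (transport K J)"
    and "\<And>f x y. f \<in> CF ==> x \<in> K ==> y \<in> K ==>
      hinner (transport K J) (integrated_form G T (transport K J) w f (J x)) (J y) = haar (\<lambda>s\<in>GG. f s * ip (U s x) y)"
proof -
  note ts = transport_simps[OF K J] and td = transport_diff[OF K J] and Kd = closed_subspace_diff[OF K]
  have hs: "hilbert_space (transport K J)" by (rule hilbert_space_transport[OF K J])
  interpret L: pro_hilbert G T "transport K J"
    by (intro pro_hilbert.intro pro_group_axioms hilbert.intro hs)
  have wJ: "w g (J x) = J (U g x)" if "g \<in> GG" "x \<in> K" for g x using that J by (simp add: w_def)
  show rep: "w \<in> unitary_reps G T (transport K J)"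
  proof (rule L.unitary_repsI)
    show "w g \<in> carrier L.BO" if "g \<in> GG" for g
      using transport_BO[OF K J U[OF that] UK[OF that]] that by (simp add: w_def)
    fix a assume "a \<in> carrier (transport K J)"
    then obtain x where x: "x \<in> K" "a = J x" by (auto simp: ts)
    then show "w \<one> a = a" using wJ one by simp
    show "w (g \<otimes> h) a = w g (w h a)" if "g \<in> GG" "h \<in> GG" for g h using that x wJ UK m by simp
    show "\<exists>N\<in>NN. \<forall>n\<in>N. L.hn (w n a \<ominus>\<^bsub>transport K J\<^esub> a) < e" if e: "e > 0" for e
    proof -
      obtain N where N: "N \<in> NN" "\<forall>n\<in>N. hn (U n x \<ominus>\<^bsub>H\<^esub> x) < e" using small[OF x(1) e] by blast
      have "L.hn (w n a \<ominus>\<^bsub>transport K J\<^esub> a) = hn (U n x \<ominus>\<^bsub>H\<^esub> x)" if "n \<in> N" for n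
        using NN_mem[OF N(1) that] x UK Kd by (simp add: wJ td ts)
      then show ?thesis using N by (intro bexI[of _ N]) auto
    qed
    fix b g assume "b \<in> carrier (transport K J)" and g: "g \<in> GG"
    then obtain y where "y \<in> K" "b = J y" by (auto simp: ts)
    then show "L.ip (w g a) (w g b) = L.ip a b" using x g UK iso by (simp add: wJ ts)
  qed (simp add: w_def)
  interpret W: unitary_rep G T "transport K J" w
    by (intro unitary_rep.intro unitary_rep_axioms.intro pro_group_axioms hilbert.intro hs rep)
  fix f x y assume f: "f \<in> CF" and x: "x \<in> K" and y: "y \<in> K"
  have "L.ip (W.vf f (J x)) (J y) = haar (\<lambda>s\<in>GG. f s * L.ip (w s (J x)) (J y))"
    using x y by (intro W.vf(2)[OF f]) (simp_all add: ts)
  then show "L.ip (W.vf f (J x)) (J y) = haar (\<lambda>s\<in>GG. f s * ip (U s x) y)"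
    using x y UK by (simp add: wJ ts cong: restrict_cong)
qed

end

section \<open>The universal norm\<close>

context pro_group
begin

abbreviation un where "un \<equiv> universal_norm G T"

lemma unitary_rep_intro: "hilbert_space K ==> v \<in> unitary_reps G T K ==> unitary_rep G T K v"
  by (intro unitary_rep.intro unitary_rep_axioms.intro pro_group_axioms hilbert.intro)

text \<open>The zero space carries a representation, so the supremum in
  \<open>universal_norm\<close> is over a nonempty set and \<open>cSup_least\<close>
  applies.\<close>

lemma trivial_rep_exists: "\<exists>(K :: ('g \<Rightarrow> complex) hilbert) v. hilbert_space K \<and> v \<in> unitary_reps G T K"
proof -
  define z where "z = (\<lambda>_::'g. 0::complex)"
  define K :: "('g \<Rightarrow> complex) hilbert" where "K = \<lparr>carrier = {z}, monoid.mult = (\<lambda>a b. z), monoid.one = z, ring.zero = z, ring.add = (\<lambda>a b. z),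
    module.smult = (\<lambda>c a. z), hinner = (\<lambda>a b. 0)\<rparr>"
  have s: "carrier K = {z}" "\<zero>\<^bsub>K\<^esub> = z" "a \<oplus>\<^bsub>K\<^esub> b = z" "c \<odot>\<^bsub>K\<^esub> a = z" "hinner K a b = 0" "hnorm K a = 0" for a b c
    by (simp_all add: K_def hnorm_def)
  have cm: "complex_module K" by (rule complex_module.intro, rule complex_moduleI) (simp_all add: s)
  have d: "a \<ominus>\<^bsub>K\<^esub> b = z" if "a \<in> carrier K" "b \<in> carrier K" for a b
    using complex_module.diff_eq[OF cm that] by (simp add: s)
  have hs: "hilbert_space K"
  proof (rule hilbert_spaceI)
    show "normed_module K (hnorm K)"
      by (intro normed_module.intro seminormed_module.intro cm seminormed_module_axioms.intro normed_module_axioms.intro)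
        (simp_all add: s)
    show "\<exists>x\<in>carrier K. (\<lambda>n. hnorm K (u n \<ominus>\<^bsub>K\<^esub> x)) \<longlonglongrightarrow> 0" for u :: "nat \<Rightarrow> 'g \<Rightarrow> complex"
      by (simp add: s)
  qed (simp_all add: s)
  interpret L: pro_hilbert G T K by (intro pro_hilbert.intro pro_group_axioms hilbert.intro hs)
  have "(\<lambda>g\<in>GG. \<lambda>x\<in>carrier K. x) \<in> unitary_reps G T K"
    by (rule L.unitary_repsI) (use carrier_NN L.id_BO in \<open>auto simp: s\<close>)
  then show ?thesis using hs by blast
qed

lemma un_least:
  assumes "\<And>(K :: ('g \<Rightarrow> complex) hilbert) v. hilbert_space K ==> v \<in> unitary_reps G T K ==>
    op_norm K (hnorm K) (integrated_form G T K v f) \<le> c"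
  shows "un f \<le> c"
  unfolding universal_norm_def by (rule cSup_least) (use trivial_rep_exists assms in blast)+

text \<open>The supremum of \<open>cmod (f s)\<close> bounds the set in
  \<open>universal_norm\<close> from above, so its \<open>Sup\<close> is a genuine supremum.\<close>

lemma un_upper:
  fixes K :: "('g \<Rightarrow> complex) hilbert"
  assumes f: "f \<in> CF" and K: "hilbert_space K" "v \<in> unitary_reps G T K"
  shows "op_norm K (hnorm K) (integrated_form G T K v f) \<le> un f"
proof -
  obtain B where B: "\<And>s. s \<in> GG ==> cmod (f s) \<le> B" using cont_bounded[OF f] by blast
  have "op_norm L (hnorm L) (integrated_form G T L w f) \<le> B"
    if "hilbert_space L" "w \<in> unitary_reps G T L" for L :: "('g \<Rightarrow> complex) hilbert" and w
    using unitary_rep.vf_bound[OF unitary_rep_intro[OF that] f B] .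
  then show ?thesis unfolding universal_norm_def
    by (intro cSup_upper bdd_aboveI[of _ B]) (use K in blast)+
qed

lemma un_nonneg: assumes f: "f \<in> CF" shows "un f \<ge> 0"
proof -
  obtain K :: "('g \<Rightarrow> complex) hilbert" and w where Kw: "hilbert_space K" "w \<in> unitary_reps G T K"
    using trivial_rep_exists by blast
  interpret W: unitary_rep G T K w by (rule unitary_rep_intro[OF Kw])
  show ?thesis using W.opn_nonneg[OF W.vf(1)[OF f]] un_upper[OF f Kw] by linarith
qed

end

context unitary_rep
begin

text \<open>The universal norm only involves representations on spaces of functions on \<open>G\<close>; the cyclic
  subspace of an arbitrary representation generated by \<open>x\<close> embeds there by matrix coefficients.\<close>

theorem vf_le_un:
  assumes f: "f \<in> CF" shows "opn (vf f) \<le> un f"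
proof -
  interpret PH: pro_hilbert G T H by (intro pro_hilbert.intro pro_group_axioms hilbert_axioms)
  have bound: "hn (vf f x) \<le> un f * hn x" if x: "x \<in> HH" for x
  proof -
    \<comment> \<open>\<open>Z\<close> is the orthogonal complement of the orbit of
      \<open>x\<close>, and its complement \<open>K\<close> the closed cyclic subspace.\<close>
    define Z where "Z = {z \<in> HH. \<forall>g\<in>GG. ip z (v g x) = 0}"
    define K where "K = {y \<in> HH. \<forall>z\<in>Z. ip y z = 0}"
    define J where "J y = (\<lambda>g\<in>GG. ip y (v g x))" for y
    have Zs: "Z \<subseteq> HH" by (auto simp: Z_def)
    have K: "closed_subspace K" unfolding K_def by (rule orthogonal_closed[OF Zs])
    have J: "inj_on J K"
    proof (rule inj_onI)
      fix y y' assume y: "y \<in> K" "y' \<in> K" "J y = J y'"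
      have yc: "y \<in> HH" "y' \<in> HH" using y by (auto simp: K_def)
      have "ip y (v g x) = ip y' (v g x)" if "g \<in> GG" for g using fun_cong[OF y(3), of g] that by (simp add: J_def)
      \<comment> \<open>Vectors with equal coefficients differ by an element of both
        \<open>Z\<close> and its complement \<open>K\<close>.\<close>
      then have "y \<ominus>\<^bsub>H\<^esub> y' \<in> Z" using yc x by (simp add: Z_def)
      moreover have "y \<ominus>\<^bsub>H\<^esub> y' \<in> K" using closed_subspace_diff[OF K] y by simp
      ultimately have "ip (y \<ominus>\<^bsub>H\<^esub> y') (y \<ominus>\<^bsub>H\<^esub> y') = 0" by (simp add: K_def)
      then show "y = y'" using yc ip_self_zero[of "y \<ominus>\<^bsub>H\<^esub> y'"] diff_eq_zero[of y y'] by simp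
    qed
    have vZ: "v g z \<in> Z" if "g \<in> GG" "z \<in> Z" for g z
    proof -
      have "ip (v g z) (v h x) = 0" if h: "h \<in> GG" for h
      proof -
        have "ip (v g z) (v h x) = ip z (v (inv g \<otimes> h) x)" using v_inv[of g z "v h x"] v_mult[of "inv g" h x] that \<open>g \<in> GG\<close> \<open>z \<in> Z\<close> x Zs by auto
        then show ?thesis using \<open>z \<in> Z\<close> \<open>g \<in> GG\<close> h by (simp add: Z_def)
      qed
      then show ?thesis using that Zs by (auto simp: Z_def)
    qed
    have vK: "v g y \<in> K" if "g \<in> GG" "y \<in> K" for g y
      using v_inv[of g y] vZ[of "inv g"] Zs that by (auto simp: K_def subset_iff)
    have xK: "x \<in> K"
    proof -
      have "ip x z = 0" if z: "z \<in> Z" for z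
      proof -
        have "ip z (v \<one> x) = 0" using z one_closed unfolding Z_def by blast
        then show ?thesis using ip_cnj[of z x] x z Zs v_one[OF x] by auto
      qed
      then show ?thesis using x by (simp add: K_def)
    qed
    have Kc: "y \<in> HH" if "y \<in> K" for y using that by (simp add: K_def)
    define w where "w = (\<lambda>g\<in>GG. \<lambda>a\<in>J ` K. J (v g (inv_into K J a)))"
    have hs: "hilbert_space (transport K J)" by (rule hilbert_space_transport[OF K J])
    have tr: "w \<in> unitary_reps G T (transport K J)"
      "\<And>y z. y \<in> K ==> z \<in> K ==> hinner (transport K J) (integrated_form G T (transport K J) w f (J y)) (J z) = haar (\<lambda>s\<in>GG. f s * ip (v s y) z)"
      unfolding w_def using PH.transport_rep[OF K J v_BO vK] Kc v_mult v_one v_ip v_small f by simp_all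
    interpret W: unitary_rep G T "transport K J" w by (rule unitary_rep_intro[OF hs tr(1)])
    have fx: "vf f x \<in> HH" using vf(1)[OF f] x by simp
    have fK: "vf f x \<in> K"
    proof -
      have "ip (vf f x) z = 0" if z: "z \<in> Z" for z
      proof -
        have "ip (v s x) z = 0" if "s \<in> GG" for s
          using z that ip_cnj[of z "v s x"] x by (auto simp: Z_def)
        then have "(\<lambda>s\<in>GG. f s * ip (v s x) z) = (\<lambda>s\<in>GG. 0)" by (intro restrict_ext) simp
        then show ?thesis using vf(2)[OF f x, of z] z Zs haar_const[of 0] by auto
      qed
      then show ?thesis using fx by (simp add: K_def)
    qed
    note ts = transport_simps[OF K J]
    \<comment> \<open>Since \<open>vf f x\<close> lies in \<open>K\<close>, it may be tested against
      itself inside the transported space, where \<open>un_upper\<close> applies.\<close>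
    have "cmod (ip (vf f x) (vf f x)) = cmod (W.ip (W.vf f (J x)) (J (vf f x)))"
      using tr(2)[OF xK fK] vf(2)[OF f x fx] by simp
    also have "\<dots> \<le> W.opn (W.vf f) * W.hn (J x) * W.hn (J (vf f x))"
      using W.BO_ip_bound[OF W.vf(1)[OF f], of "J x" "J (vf f x)"] xK fK by (simp add: ts)
    also have "\<dots> \<le> un f * hn x * hn (vf f x)"
      using un_upper[OF f hs tr(1)] x fx by (simp add: ts xK fK mult_right_mono)
    finally have "(hn (vf f x))\<^sup>2 \<le> un f * hn x * hn (vf f x)" using fx by (simp add: ip_self norm_power)
    then have m: "hn (vf f x) * hn (vf f x) \<le> (un f * hn x) * hn (vf f x)" by (simp add: power2_eq_square)
    show ?thesis
    proof (cases "hn (vf f x) = 0")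
      case True
      have "0 \<le> un f" using W.opn_nonneg[OF W.vf(1)[OF f]] un_upper[OF f hs tr(1)] by linarith
      then show ?thesis using True x by simp
    next
      case False
      then show ?thesis using m fx hn_nonneg[OF fx] by (simp add: mult_le_cancel_right)
    qed
  qed
  show ?thesis by (rule opn_le[OF bound un_nonneg[OF f]])
qed

end

context pro_group
begin

lemma un_L1:
  assumes "f \<in> CF" "h \<in> CF" "\<And>s. s \<in> GG ==> cmod (f s) \<le> Re (h s)" shows "un f \<le> Re (haar h)"
  by (rule un_least) (rule unitary_rep.vf_bound_L1[OF unitary_rep_intro assms])

lemma un_bound:
  assumes "f \<in> CF" "\<And>s. s \<in> GG ==> cmod (f s) \<le> B" shows "un f \<le> B"
  by (rule un_least) (rule unitary_rep.vf_bound[OF unitary_rep_intro assms])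

abbreviation P where "P \<equiv> convolution_algebra G T"

lemma P_simps [simp]:
  "carrier P = CF" "f \<otimes>\<^bsub>P\<^esub> h = conv f h" "\<zero>\<^bsub>P\<^esub> = (\<lambda>s\<in>GG. 0)" "f \<oplus>\<^bsub>P\<^esub> h = (\<lambda>s\<in>GG. f s + h s)"
  "c \<odot>\<^bsub>P\<^esub> f = (\<lambda>s\<in>GG. c * f s)" "star P f = inv_cnj f" "anorm P = un"
  by (simp_all add: convolution_algebra_def conv_def inv_cnj_def)

lemma complex_module_P: "complex_module P"
proof (rule complex_module.intro, rule complex_moduleI)
  fix f c d assume "f \<in> carrier P"
  then have f: "f \<in> CF" by simp
  show "\<zero>\<^bsub>P\<^esub> \<oplus>\<^bsub>P\<^esub> f = f" "1 \<odot>\<^bsub>P\<^esub> f = f" using f by (simp_all cong: restrict_cong add: extensional_restrict cont_ext)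
qed (auto intro!: restrict_ext simp: algebra_simps)

lemma seminormed_star_algebra_P: "seminormed_star_algebra P"
proof (intro seminormed_star_algebra.intro seminormed_module.intro complex_module_P
    seminormed_module_axioms.intro seminormed_star_algebra_axioms.intro)
  fix f h assume "f \<in> carrier P" "h \<in> carrier P"
  then have f: "f \<in> CF" and h: "h \<in> CF" by simp_all
  show "anorm P (f \<oplus>\<^bsub>P\<^esub> h) \<le> anorm P f + anorm P h"
    unfolding P_simps
  proof (rule un_least)
    fix K :: "('g \<Rightarrow> complex) hilbert" and v assume K: "hilbert_space K" "v \<in> unitary_reps G T K"
    interpret W: unitary_rep G T K v by (rule unitary_rep_intro[OF K])
    show "W.opn (W.vf (\<lambda>s\<in>GG. f s + h s)) \<le> un f + un h"
      using W.vf_add[OF f h] W.add_BO(2)[OF W.vf(1)[OF f] W.vf(1)[OF h]] un_upper[OF f K] un_upper[OF h K] by simp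
  qed
  show "anorm P (f \<otimes>\<^bsub>P\<^esub> h) \<le> anorm P f * anorm P h"
    unfolding P_simps
  proof (rule un_least)
    fix K :: "('g \<Rightarrow> complex) hilbert" and v assume K: "hilbert_space K" "v \<in> unitary_reps G T K"
    interpret W: unitary_rep G T K v by (rule unitary_rep_intro[OF K])
    have "W.opn (W.vf (conv f h)) \<le> W.opn (W.vf f) * W.opn (W.vf h)"
      using W.vf_conv[OF f h] W.compose_BO(2)[OF W.vf(1)[OF f] W.vf(1)[OF h]] by simp
    also have "\<dots> \<le> un f * un h"
      using un_upper[OF f K] un_upper[OF h K] un_nonneg[OF f] W.opn_nonneg[OF W.vf(1)[OF h]] by (intro mult_mono)
    finally show "W.opn (W.vf (conv f h)) \<le> un f * un h" .
  qed
  show "f \<otimes>\<^bsub>P\<^esub> h \<in> carrier P" using f h by simp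
  show "(k \<odot>\<^bsub>P\<^esub> f) \<otimes>\<^bsub>P\<^esub> h = k \<odot>\<^bsub>P\<^esub> (f \<otimes>\<^bsub>P\<^esub> h)" "f \<otimes>\<^bsub>P\<^esub> (k \<odot>\<^bsub>P\<^esub> h) = k \<odot>\<^bsub>P\<^esub> (f \<otimes>\<^bsub>P\<^esub> h)" for k
    using f h by (simp_all add: conv_smult_left conv_smult_right)
  show "star P (f \<oplus>\<^bsub>P\<^esub> h) = star P f \<oplus>\<^bsub>P\<^esub> star P h" "star P (f \<otimes>\<^bsub>P\<^esub> h) = star P h \<otimes>\<^bsub>P\<^esub> star P f"
    using f h by (simp_all add: inv_cnj_add inv_cnj_conv)
  fix k assume "k \<in> carrier P"
  then have k: "k \<in> CF" by simp
  show "(f \<otimes>\<^bsub>P\<^esub> h) \<otimes>\<^bsub>P\<^esub> k = f \<otimes>\<^bsub>P\<^esub> (h \<otimes>\<^bsub>P\<^esub> k)" "(f \<oplus>\<^bsub>P\<^esub> h) \<otimes>\<^bsub>P\<^esub> k = f \<otimes>\<^bsub>P\<^esub> k \<oplus>\<^bsub>P\<^esub> h \<otimes>\<^bsub>P\<^esub> k"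
    "f \<otimes>\<^bsub>P\<^esub> (h \<oplus>\<^bsub>P\<^esub> k) = f \<otimes>\<^bsub>P\<^esub> h \<oplus>\<^bsub>P\<^esub> f \<otimes>\<^bsub>P\<^esub> k"
    using f h k by (simp_all add: conv_assoc conv_add_left conv_add_right)
next
  fix f k assume "f \<in> carrier P"
  then have f: "f \<in> CF" by simp
  show "star P f \<in> carrier P" "star P (k \<odot>\<^bsub>P\<^esub> f) = cnj k \<odot>\<^bsub>P\<^esub> star P f" "star P (star P f) = f"
    using f by (simp_all add: inv_cnj_smult inv_cnj_inv_cnj)
  have s: "un (\<lambda>s\<in>GG. k * f s) \<le> cmod k * un f" if f: "f \<in> CF" for k f
  proof (rule un_least)
    fix K :: "('g \<Rightarrow> complex) hilbert" and v assume K: "hilbert_space K" "v \<in> unitary_reps G T K"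
    interpret W: unitary_rep G T K v by (rule unitary_rep_intro[OF K])
    show "W.opn (W.vf (\<lambda>s\<in>GG. k * f s)) \<le> cmod k * un f"
      using W.vf_smult[OF f, of k] W.smult_BO(2)[OF W.vf(1)[OF f], of k] un_upper[OF f K] by (simp add: mult_left_mono)
  qed
  have "un (\<lambda>s\<in>GG. k * f s) = cmod k * un f"
  proof (cases "k = 0")
    case True
    then show ?thesis using s[OF f, of k] un_nonneg[OF cont_smult[OF f, of k]] by simp
  next
    case False
    have "(\<lambda>s\<in>GG. (1/k) * (\<lambda>s\<in>GG. k * f s) s) = f"
      using False f by (intro cont_eqI cont_smult) simp_all
    then have "un f \<le> cmod (1/k) * un (\<lambda>s\<in>GG. k * f s)" using s[OF cont_smult[OF f, of k], of "1/k"] by simp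
    then have "cmod k * un f \<le> un (\<lambda>s\<in>GG. k * f s)" using False by (simp add: norm_divide field_simps)
    then show ?thesis using s[OF f, of k] by simp
  qed
  then show "anorm P (k \<odot>\<^bsub>P\<^esub> f) = cmod k * anorm P f" by simp
  have st: "un (inv_cnj f) \<le> un f" if f: "f \<in> CF" for f
  proof (rule un_least)
    fix K :: "('g \<Rightarrow> complex) hilbert" and v assume K: "hilbert_space K" "v \<in> unitary_reps G T K"
    interpret W: unitary_rep G T K v by (rule unitary_rep_intro[OF K])
    show "W.opn (W.vf (inv_cnj f)) \<le> un f"
      using W.vf_star[OF f] W.opn_star[OF W.vf(1)[OF f]] un_upper[OF f K] by simp
  qed
  show "anorm P (star P f) = anorm P f"
    using st[OF f] st[OF inv_cnj_cont[OF f]] f by (simp add: inv_cnj_inv_cnj)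
qed

end

section \<open>Extending contractions to completions\<close>

text \<open>Translations are linear contractions without being multiplicative, so products and stars
  are left to \<open>ext_mult\<close> and \<open>ext_star\<close>, which assume
  compatibility.\<close>

locale contraction = P: seminormed_star_algebra P + Q: seminormed_star_algebra Q
  for P :: "'a star_algebra" and Q :: "'b star_algebra" +
  fixes \<theta> :: "'a \<Rightarrow> 'b"
  assumes \<theta>_closed: "a \<in> carrier P ==> \<theta> a \<in> carrier Q"
    and \<theta>_add: "a \<in> carrier P ==> b \<in> carrier P ==> \<theta> (a \<oplus>\<^bsub>P\<^esub> b) = \<theta> a \<oplus>\<^bsub>Q\<^esub> \<theta> b"
    and \<theta>_smult: "a \<in> carrier P ==> \<theta> (c \<odot>\<^bsub>P\<^esub> a) = c \<odot>\<^bsub>Q\<^esub> \<theta> a"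
    and \<theta>_le: "a \<in> carrier P ==> anorm Q (\<theta> a) \<le> anorm P a"
begin

lemma \<theta>_diff: "a \<in> carrier P ==> b \<in> carrier P ==> \<theta> (a \<ominus>\<^bsub>P\<^esub> b) = \<theta> a \<ominus>\<^bsub>Q\<^esub> \<theta> b"
  by (simp add: P.diff_eq Q.diff_eq \<theta>_add \<theta>_smult \<theta>_closed)

lemma \<theta>_CS: assumes V: "V \<in> P.CS" shows "(\<lambda>n. \<theta> (V n)) \<in> Q.CS"
proof (rule Q.CS_I)
  show "\<theta> (V n) \<in> carrier Q" for n using V \<theta>_closed by simp
  fix e :: real assume "e > 0"
  then obtain M where M: "\<forall>m\<ge>M. \<forall>n\<ge>M. anorm P (V m \<ominus>\<^bsub>P\<^esub> V n) < e" using P.CS_cauchy V by blast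
  have "anorm Q (\<theta> (V m) \<ominus>\<^bsub>Q\<^esub> \<theta> (V n)) \<le> anorm P (V m \<ominus>\<^bsub>P\<^esub> V n)" for m n
    using \<theta>_le[of "V m \<ominus>\<^bsub>P\<^esub> V n"] V by (simp add: \<theta>_diff)
  then show "\<exists>M. \<forall>m\<ge>M. \<forall>n\<ge>M. anorm Q (\<theta> (V m) \<ominus>\<^bsub>Q\<^esub> \<theta> (V n)) < e"
    using M le_less_trans by blast
qed

definition ext :: "(nat \<Rightarrow> 'a) set \<Rightarrow> (nat \<Rightarrow> 'b) set" where
  "ext = (\<lambda>a\<in>carrier P.C. Q.cls (\<lambda>n. \<theta> (cauchy_rep a n)))"

lemma ext_cls: assumes V: "V \<in> P.CS" shows "ext (P.cls V) = Q.cls (\<lambda>n. \<theta> (V n))"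
proof -
  note r = P.cauchy_rep_cls[OF V]
  have "Q.cls (\<lambda>n. \<theta> (cauchy_rep (P.cls V) n)) = Q.cls (\<lambda>n. \<theta> (V n))"
  proof (rule Q.cls_eqI[OF \<theta>_CS[OF r(1)] \<theta>_CS[OF V]], rule null_by_bound)
    show "(\<lambda>n. anorm P (cauchy_rep (P.cls V) n \<ominus>\<^bsub>P\<^esub> V n)) \<longlonglongrightarrow> 0" by (rule P.cls_eqD[OF r(1) V r(2)])
    show "norm (anorm Q (\<theta> (cauchy_rep (P.cls V) n) \<ominus>\<^bsub>Q\<^esub> \<theta> (V n))) \<le> anorm P (cauchy_rep (P.cls V) n \<ominus>\<^bsub>P\<^esub> V n)" for n
      using \<theta>_le[of "cauchy_rep (P.cls V) n \<ominus>\<^bsub>P\<^esub> V n"] r(1) V \<theta>_closed by (simp add: \<theta>_diff Q.nrm_nonneg)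
  qed
  then show ?thesis using V by (simp add: ext_def)
qed

lemma ext_extensional [simp]: "ext \<in> extensional (carrier P.C)"
  by (simp add: ext_def)

lemma ext_closed [simp]: "a \<in> carrier P.C ==> ext a \<in> carrier Q.C"
  by (metis P.C_cases Q.cls_carrier \<theta>_CS ext_cls)

lemma ext_add: assumes "a \<in> carrier P.C" "b \<in> carrier P.C" shows "ext (a \<oplus>\<^bsub>P.C\<^esub> b) = ext a \<oplus>\<^bsub>Q.C\<^esub> ext b"
proof -
  obtain V W where VW: "V \<in> P.CS" "W \<in> P.CS" "a = P.cls V" "b = P.cls W" using P.C_cases assms by metis
  then show ?thesis using \<theta>_CS by (simp add: ext_cls \<theta>_add)
qed

lemma ext_smult: assumes "a \<in> carrier P.C" shows "ext (c \<odot>\<^bsub>P.C\<^esub> a) = c \<odot>\<^bsub>Q.C\<^esub> ext a"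
proof -
  obtain V where V: "V \<in> P.CS" "a = P.cls V" using P.C_cases assms by metis
  then show ?thesis using \<theta>_CS by (simp add: ext_cls \<theta>_smult)
qed

lemma ext_le: assumes "a \<in> carrier P.C" shows "anorm Q.C (ext a) \<le> anorm P.C a"
proof -
  obtain V where V: "V \<in> P.CS" "a = P.cls V" using P.C_cases assms by metis
  have "anorm Q.C (Q.cls (\<lambda>n. \<theta> (V n))) \<le> anorm P.C (P.cls V)"
    by (rule LIMSEQ_le[OF Q.norm_C_tendsto[OF \<theta>_CS[OF V(1)]] P.norm_C_tendsto[OF V(1)]])
      (use \<theta>_le V in simp)
  then show ?thesis using V by (simp add: ext_cls)
qed

lemma ext_emb: "a \<in> carrier P ==> ext (P.emb a) = Q.emb (\<theta> a)"
  using ext_cls[of "\<lambda>n. a"] by (simp add: P.emb Q.emb \<theta>_closed)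

lemma ext_mult:
  assumes "\<And>a b. a \<in> carrier P ==> b \<in> carrier P ==> \<theta> (a \<otimes>\<^bsub>P\<^esub> b) = \<theta> a \<otimes>\<^bsub>Q\<^esub> \<theta> b"
    and "a \<in> carrier P.C" "b \<in> carrier P.C" shows "ext (a \<otimes>\<^bsub>P.C\<^esub> b) = ext a \<otimes>\<^bsub>Q.C\<^esub> ext b"
proof -
  obtain V W where VW: "V \<in> P.CS" "W \<in> P.CS" "a = P.cls V" "b = P.cls W" using P.C_cases assms(2,3) by metis
  then show ?thesis using \<theta>_CS by (simp add: ext_cls assms(1))
qed

lemma ext_star:
  assumes "\<And>a. a \<in> carrier P ==> \<theta> (star P a) = star Q (\<theta> a)"
    and "a \<in> carrier P.C" shows "ext (star P.C a) = star Q.C (ext a)"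
proof -
  obtain V where V: "V \<in> P.CS" "a = P.cls V" using P.C_cases assms(2) by metis
  then show ?thesis using \<theta>_CS by (simp add: ext_cls assms(1))
qed

end

section \<open>Multipliers\<close>

lemma bounded_maps_iff:
  "f \<in> bounded_maps V nrm \<longleftrightarrow> f \<in> extensional (carrier V) \<and> (\<forall>x\<in>carrier V. f x \<in> carrier V) \<and>
     (\<forall>x\<in>carrier V. \<forall>y\<in>carrier V. f (x \<oplus>\<^bsub>V\<^esub> y) = f x \<oplus>\<^bsub>V\<^esub> f y) \<and>
     (\<forall>c. \<forall>x\<in>carrier V. f (c \<odot>\<^bsub>V\<^esub> x) = c \<odot>\<^bsub>V\<^esub> f x) \<and> (\<exists>c. \<forall>x\<in>carrier V. nrm (f x) \<le> c * nrm x)"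
  unfolding bounded_maps_def linear_maps_def PiE_iff by blast

lemma bounded_mapsI:
  assumes "f \<in> extensional (carrier V)" "\<And>x. x \<in> carrier V ==> f x \<in> carrier V"
    "\<And>x y. x \<in> carrier V ==> y \<in> carrier V ==> f (x \<oplus>\<^bsub>V\<^esub> y) = f x \<oplus>\<^bsub>V\<^esub> f y"
    "\<And>c x. x \<in> carrier V ==> f (c \<odot>\<^bsub>V\<^esub> x) = c \<odot>\<^bsub>V\<^esub> f x"
    "\<And>x. x \<in> carrier V ==> nrm (f x) \<le> c * nrm x"
  shows "f \<in> bounded_maps V nrm"
  unfolding bounded_maps_iff by (intro conjI ballI allI exI[of _ c] assms)

lemma bounded_mapsD:
  assumes "f \<in> bounded_maps V nrm"
  shows "f \<in> extensional (carrier V)" "\<And>x. x \<in> carrier V ==> f x \<in> carrier V"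
    "\<And>x y. x \<in> carrier V ==> y \<in> carrier V ==> f (x \<oplus>\<^bsub>V\<^esub> y) = f x \<oplus>\<^bsub>V\<^esub> f y"
    "\<And>c x. x \<in> carrier V ==> f (c \<odot>\<^bsub>V\<^esub> x) = c \<odot>\<^bsub>V\<^esub> f x"
    "\<exists>c. \<forall>x\<in>carrier V. nrm (f x) \<le> c * nrm x"
  using assms unfolding bounded_maps_iff by blast+

context seminormed_star_algebra
begin

abbreviation MA where "MA \<equiv> multiplier_algebra A"

lemma multipliersD:
  assumes "m \<in> multipliers A"
  shows "fst m \<in> bounded_maps A nm" "snd m \<in> bounded_maps A nm"
    "\<And>a b. a \<in> AA ==> b \<in> AA ==> fst m (a \<otimes> b) = fst m a \<otimes> b"
    "\<And>a b. a \<in> AA ==> b \<in> AA ==> snd m (a \<otimes> b) = a \<otimes> snd m b"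
    "\<And>a b. a \<in> AA ==> b \<in> AA ==> snd m a \<otimes> b = a \<otimes> fst m b"
  using assms unfolding multipliers_def by auto

lemma multipliersI:
  assumes "L \<in> bounded_maps A nm" "R \<in> bounded_maps A nm"
    "\<And>a b. a \<in> AA ==> b \<in> AA ==> L (a \<otimes> b) = L a \<otimes> b"
    "\<And>a b. a \<in> AA ==> b \<in> AA ==> R (a \<otimes> b) = a \<otimes> R b"
    "\<And>a b. a \<in> AA ==> b \<in> AA ==> R a \<otimes> b = a \<otimes> L b"
  shows "(L, R) \<in> multipliers A"
  using assms unfolding multipliers_def by auto

lemma multiplier_closed [simp]:
  "m \<in> multipliers A ==> a \<in> AA ==> fst m a \<in> AA"
  "m \<in> multipliers A ==> a \<in> AA ==> snd m a \<in> AA"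
  by (rule bounded_mapsD(2)[OF multipliersD(1)] bounded_mapsD(2)[OF multipliersD(2)]; assumption)+

lemma multiplier_linear:
  assumes "m \<in> multipliers A"
  shows "a \<in> AA ==> b \<in> AA ==> fst m (a \<oplus> b) = fst m a \<oplus> fst m b"
    "a \<in> AA ==> fst m (c \<odot> a) = c \<odot> fst m a"
    "a \<in> AA ==> b \<in> AA ==> snd m (a \<oplus> b) = snd m a \<oplus> snd m b"
    "a \<in> AA ==> snd m (c \<odot> a) = c \<odot> snd m a"
proof -
  note L = multipliersD(1)[OF assms] and R = multipliersD(2)[OF assms]
  show "a \<in> AA ==> b \<in> AA ==> fst m (a \<oplus> b) = fst m a \<oplus> fst m b" by (rule bounded_mapsD(3)[OF L])
  show "a \<in> AA ==> fst m (c \<odot> a) = c \<odot> fst m a" by (rule bounded_mapsD(4)[OF L])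
  show "a \<in> AA ==> b \<in> AA ==> snd m (a \<oplus> b) = snd m a \<oplus> snd m b" by (rule bounded_mapsD(3)[OF R])
  show "a \<in> AA ==> snd m (c \<odot> a) = c \<odot> snd m a" by (rule bounded_mapsD(4)[OF R])
qed

lemma MA_simps [simp]:
  "carrier MA = multipliers A"
  "m \<otimes>\<^bsub>MA\<^esub> m' = (compose (AA) (fst m) (fst m'), compose (AA) (snd m') (snd m))"
  "m \<oplus>\<^bsub>MA\<^esub> m' = (\<lambda>a\<in>AA. fst m a \<oplus> fst m' a, \<lambda>a\<in>AA. snd m a \<oplus> snd m' a)"
  "c \<odot>\<^bsub>MA\<^esub> m = (\<lambda>a\<in>AA. c \<odot> fst m a, \<lambda>a\<in>AA. c \<odot> snd m a)"
  "star MA m = (\<lambda>a\<in>AA. star A (snd m (star A a)), \<lambda>a\<in>AA. star A (fst m (star A a)))"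
  by (simp_all add: multiplier_algebra_def case_prod_unfold)

lemma compose_bounded:
  assumes f: "f \<in> bounded_maps A nm" and g: "g \<in> bounded_maps A nm"
  shows "compose (AA) f g \<in> bounded_maps A nm"
proof -
  obtain c where c: "\<And>x. x \<in> AA ==> nm (f x) \<le> c * nm x" using bounded_mapsD(5)[OF f] by blast
  obtain d where d: "\<And>x. x \<in> AA ==> nm (g x) \<le> d * nm x" using bounded_mapsD(5)[OF g] by blast
  note F = bounded_mapsD[OF f] and G = bounded_mapsD[OF g]
  show ?thesis
  proof (rule bounded_mapsI[where c = "\<bar>c\<bar> * d"])
    fix x assume x: "x \<in> AA"
    have "nm (f (g x)) \<le> c * nm (g x)" using c G(2) x by blast
    also have "\<dots> \<le> \<bar>c\<bar> * nm (g x)" using G(2) x by (intro mult_right_mono) (auto simp: nrm_nonneg)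
    also have "\<dots> \<le> \<bar>c\<bar> * (d * nm x)" using d x by (intro mult_left_mono) auto
    finally show "nm (compose (AA) f g x) \<le> \<bar>c\<bar> * d * nm x" using x by (simp add: compose_eq mult.assoc)
  qed (use F G in \<open>simp_all add: compose_eq\<close>)
qed

lemma add_bounded:
  assumes f: "f \<in> bounded_maps A nm" and g: "g \<in> bounded_maps A nm"
  shows "(\<lambda>a\<in>AA. f a \<oplus> g a) \<in> bounded_maps A nm"
proof -
  obtain c where c: "\<And>x. x \<in> AA ==> nm (f x) \<le> c * nm x" using bounded_mapsD(5)[OF f] by blast
  obtain d where d: "\<And>x. x \<in> AA ==> nm (g x) \<le> d * nm x" using bounded_mapsD(5)[OF g] by blast
  note F = bounded_mapsD[OF f] and G = bounded_mapsD[OF g]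
  show ?thesis
  proof (rule bounded_mapsI[where c = "c + d"])
    fix x assume x: "x \<in> AA"
    show "nm ((\<lambda>a\<in>AA. f a \<oplus> g a) x) \<le> (c + d) * nm x"
      using nrm_add[of "f x" "g x"] c[OF x] d[OF x] F(2) G(2) x by (simp add: distrib_right)
  qed (use F(2-4) G(2-4) in \<open>simp_all add: M.a_ac smult_add_right\<close>)
qed

lemma smult_bounded:
  assumes f: "f \<in> bounded_maps A nm"
  shows "(\<lambda>a\<in>AA. k \<odot> f a) \<in> bounded_maps A nm"
proof -
  obtain c where c: "\<And>x. x \<in> AA ==> nm (f x) \<le> c * nm x" using bounded_mapsD(5)[OF f] by blast
  note F = bounded_mapsD[OF f]
  show ?thesis
  proof (rule bounded_mapsI[where c = "cmod k * c"])
    fix x assume x: "x \<in> AA"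
    show "nm ((\<lambda>a\<in>AA. k \<odot> f a) x) \<le> cmod k * c * nm x"
      using c[OF x] F(2) x by (simp add: nrm_smult mult.assoc mult_left_mono)
  qed (use F(2-4) in \<open>simp_all add: smult_add_right mult.commute\<close>)
qed

lemma star_bounded:
  assumes f: "f \<in> bounded_maps A nm"
  shows "(\<lambda>a\<in>AA. star A (f (star A a))) \<in> bounded_maps A nm"
proof -
  obtain c where c: "\<And>x. x \<in> AA ==> nm (f x) \<le> c * nm x" using bounded_mapsD(5)[OF f] by blast
  note F = bounded_mapsD[OF f]
  show ?thesis
  proof (rule bounded_mapsI[where c = c])
    fix x assume x: "x \<in> AA"
    show "nm ((\<lambda>a\<in>AA. star A (f (star A a))) x) \<le> c * nm x"
      using c[of "star A x"] F(2) x by simp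
  qed (use F(2-4) in \<open>simp_all add: star_add star_smult\<close>)
qed

lemma MA_closed:
  assumes m: "m \<in> multipliers A" and m': "m' \<in> multipliers A"
  shows "m \<otimes>\<^bsub>MA\<^esub> m' \<in> multipliers A" "m \<oplus>\<^bsub>MA\<^esub> m' \<in> multipliers A" "c \<odot>\<^bsub>MA\<^esub> m \<in> multipliers A" "star MA m \<in> multipliers A"
proof -
  note D = multipliersD[OF m] and D' = multipliersD[OF m']
  show "m \<otimes>\<^bsub>MA\<^esub> m' \<in> multipliers A" unfolding MA_simps
    by (rule multipliersI) (use D D' m m' in \<open>simp_all add: compose_bounded compose_eq\<close>)
  show "m \<oplus>\<^bsub>MA\<^esub> m' \<in> multipliers A" unfolding MA_simps
    by (rule multipliersI) (use D D' m m' in \<open>simp_all add: add_bounded add_mult mult_add\<close>)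
  show "c \<odot>\<^bsub>MA\<^esub> m \<in> multipliers A" unfolding MA_simps
    by (rule multipliersI) (use D m in \<open>simp_all add: smult_bounded smult_mult mult_smult\<close>)
  show "star MA m \<in> multipliers A" unfolding MA_simps
  proof (rule multipliersI)
    fix a b assume a: "a \<in> AA" and b: "b \<in> AA"
    show "(\<lambda>a\<in>AA. star A (snd m (star A a))) (a \<otimes> b) = (\<lambda>a\<in>AA. star A (snd m (star A a))) a \<otimes> b"
      "(\<lambda>a\<in>AA. star A (fst m (star A a))) (a \<otimes> b) = a \<otimes> (\<lambda>a\<in>AA. star A (fst m (star A a))) b"
      using a b m D(3,4) by (simp_all add: star_mult)
    have "star A (fst m (star A a)) \<otimes> b = star A (star A b \<otimes> fst m (star A a))" using a b m by (simp add: star_mult)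
    also have "\<dots> = star A (snd m (star A b) \<otimes> star A a)" using a b D(5)[of "star A b" "star A a"] by simp
    also have "\<dots> = a \<otimes> star A (snd m (star A b))" using a b m by (simp add: star_mult)
    finally show "(\<lambda>a\<in>AA. star A (fst m (star A a))) a \<otimes> b = a \<otimes> (\<lambda>a\<in>AA. star A (snd m (star A a))) b"
      using a b by simp
  qed (use D in \<open>simp_all add: star_bounded\<close>)
qed

abbreviation me where "me \<equiv> multiplier_embedding A"

lemma me_mult: assumes a: "a \<in> AA" shows "me a \<in> multipliers A"
  unfolding multiplier_embedding_def
proof (rule multipliersI)
  show "(\<lambda>b\<in>AA. a \<otimes> b) \<in> bounded_maps A nm"
    by (rule bounded_mapsI[where c = "nm a"]) (use a norm_mult_le in \<open>simp_all add: mult_add mult_smult\<close>)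
  show "(\<lambda>b\<in>AA. b \<otimes> a) \<in> bounded_maps A nm"
  proof (rule bounded_mapsI[where c = "nm a"])
    show "nm ((\<lambda>b\<in>AA. b \<otimes> a) x) \<le> nm a * nm x" if "x \<in> AA" for x
      using norm_mult_le[OF that a] that by (simp add: mult.commute[of "nm a"])
  qed (use a in \<open>simp_all add: add_mult smult_mult\<close>)
qed (use a in \<open>simp_all add: mult_assoc\<close>)

lemma me_apply: "b \<in> AA ==> fst (me a) b = a \<otimes> b" "b \<in> AA ==> snd (me a) b = b \<otimes> a"
  by (simp_all add: multiplier_embedding_def)

text \<open>The algebra is an ideal in its multiplier algebra; an extension of a homomorphism is
  therefore known on \<open>m\<close> times an embedded element.\<close>

lemma mult_me: assumes m: "m \<in> multipliers A" and a: "a \<in> AA" shows "m \<otimes>\<^bsub>MA\<^esub> me a = me (fst m a)"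
proof -
  note D = multipliersD[OF m]
  have "compose (AA) (fst m) (fst (me a)) = (\<lambda>b\<in>AA. fst m a \<otimes> b)"
    "compose (AA) (snd (me a)) (snd m) = (\<lambda>b\<in>AA. b \<otimes> fst m a)"
    unfolding compose_def using a m D(3,5) by (auto intro!: restrict_ext simp: me_apply)
  then show ?thesis by (simp add: multiplier_embedding_def)
qed

lemma extension_mult:
  assumes \<psi>: "\<psi> \<in> star_homs MA B" and e: "\<And>a. a \<in> AA ==> \<psi> (me a) = \<phi> a"
    and m: "m \<in> multipliers A" and a: "a \<in> AA"
  shows "\<psi> m \<otimes>\<^bsub>B\<^esub> \<phi> a = \<phi> (fst m a)"
  using star_homsD(5)[OF \<psi>, of m "me a"] mult_me[OF m a] me_mult[OF a] e m a by simp

text \<open>By \<open>extension_mult\<close> two extensions agree after right multiplication by any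
  \<open>\<phi> a\<close>; assumption \<open>u\<close> says that such multiplications separate the
  elements of \<open>B\<close>.\<close>

lemma multiplier_extensionI:
  assumes \<psi>: "\<psi> \<in> star_homs MA B" and e: "\<And>a. a \<in> AA ==> \<psi> (me a) = \<phi> a"
    and u: "\<And>m x y. m \<in> multipliers A ==> x \<in> carrier B ==> y \<in> carrier B ==>
      (\<And>a. a \<in> AA ==> x \<otimes>\<^bsub>B\<^esub> \<phi> a = y \<otimes>\<^bsub>B\<^esub> \<phi> a) ==> x = y"
  shows "multiplier_extension A B \<phi> = \<psi>"
  unfolding multiplier_extension_def
proof (rule the_equality)
  show "\<psi> \<in> star_homs MA B \<and> (\<forall>a\<in>AA. \<psi> (me a) = \<phi> a)" using \<psi> e by blast
  fix \<psi>' assume \<psi>': "\<psi>' \<in> star_homs MA B \<and> (\<forall>a\<in>AA. \<psi>' (me a) = \<phi> a)"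
  show "\<psi>' = \<psi>"
  proof (rule extensionalityI[of _ "multipliers A"])
    fix m assume m: "m \<in> multipliers A"
    show "\<psi>' m = \<psi> m"
    proof (rule u[OF m])
      show "\<psi>' m \<in> carrier B" "\<psi> m \<in> carrier B" using \<psi>' \<psi> m star_homsD(2)[of _ MA B m] by auto
      show "\<psi>' m \<otimes>\<^bsub>B\<^esub> \<phi> a = \<psi> m \<otimes>\<^bsub>B\<^esub> \<phi> a" if "a \<in> AA" for a
        using extension_mult[OF _ _ m that, of \<psi>' B \<phi>] extension_mult[OF \<psi> e m that] \<psi>' by simp
    qed
  qed (use \<psi> \<psi>' star_homsD(1)[of _ MA B] in auto)
qed

text \<open>For a unital quotient the extension is \<open>m \<mapsto> \<phi> (m a\<^sub>0)\<close> where \<open>\<phi> a\<^sub>0\<close> is the unit.\<close>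

lemma extension_unital:
  assumes B: "seminormed_star_algebra B" and \<phi>: "\<phi> \<in> star_homs A B" and surj: "\<phi> ` AA = carrier B"
    and i: "i \<in> carrier B" "\<And>b. b \<in> carrier B ==> i \<otimes>\<^bsub>B\<^esub> b = b" "\<And>b. b \<in> carrier B ==> b \<otimes>\<^bsub>B\<^esub> i = b"
  shows "multiplier_extension A B \<phi> \<in> star_homs MA B"
    "\<And>m a. m \<in> multipliers A ==> a \<in> AA ==> multiplier_extension A B \<phi> m \<otimes>\<^bsub>B\<^esub> \<phi> a = \<phi> (fst m a)"
proof -
  interpret B: seminormed_star_algebra B by fact
  note h = star_homsD[OF \<phi>]
  obtain a0 where a0: "a0 \<in> AA" "\<phi> a0 = i" using i(1) surj by (metis imageE)
  have si: "star B i = i"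
  proof -
    have "i = star B (star B i)" using i(1) by simp
    also have "\<dots> = star B (i \<otimes>\<^bsub>B\<^esub> star B i)" using i by simp
    also have "\<dots> = star B (star B i) \<otimes>\<^bsub>B\<^esub> star B i" using i(1) by (intro B.star_mult) auto
    also have "\<dots> = star B i" using i by simp
    finally show ?thesis by simp
  qed
  define \<psi> where "\<psi> = (\<lambda>m\<in>multipliers A. \<phi> (fst m a0))"
  \<comment> \<open>Since \<open>\<phi> a0\<close> is the unit, \<open>a0\<close> can be inserted on
    the left under \<open>\<phi>\<close>; the double centralizer identity then lets
    \<open>fst m\<close> and \<open>snd m\<close> be exchanged.\<close>
  have key: "\<phi> (fst m a0) \<otimes>\<^bsub>B\<^esub> \<phi> a = \<phi> (fst m a)" if m: "m \<in> multipliers A" and a: "a \<in> AA" for m a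
  proof -
    note D = multipliersD[OF m]
    have "\<phi> (fst m a0) \<otimes>\<^bsub>B\<^esub> \<phi> a = i \<otimes>\<^bsub>B\<^esub> \<phi> (fst m a0 \<otimes> a)" using h(2,5) m a a0 i by simp
    also have "\<dots> = \<phi> (a0 \<otimes> fst m (a0 \<otimes> a))" using h(5)[of a0 "fst m a0 \<otimes> a"] m a a0 D(3) by simp
    also have "a0 \<otimes> fst m (a0 \<otimes> a) = snd m a0 \<otimes> (a0 \<otimes> a)" using D(5) a a0 by simp
    also have "\<phi> \<dots> = \<phi> (snd m a0) \<otimes>\<^bsub>B\<^esub> \<phi> a" using h(2,5) m a a0 i by simp
    also have "\<dots> = \<phi> (snd m a0 \<otimes> a)" using h(5) m a a0 by simp
    also have "\<dots> = \<phi> (a0 \<otimes> fst m a)" using D(5) a a0 by simp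
    also have "\<dots> = \<phi> (fst m a)" using h(2,5) m a a0 i by simp
    finally show ?thesis .
  qed
  have hom: "\<psi> \<in> star_homs MA B"
  proof (rule star_homsI)
    fix m m' assume "m \<in> carrier MA" "m' \<in> carrier MA"
    then have m: "m \<in> multipliers A" and m': "m' \<in> multipliers A" by simp_all
    note cl = MA_closed[OF m m', unfolded MA_simps]
    show "\<psi> (m \<oplus>\<^bsub>MA\<^esub> m') = \<psi> m \<oplus>\<^bsub>B\<^esub> \<psi> m'" using cl m m' a0 h(3) by (simp add: \<psi>_def)
    show "\<psi> (m \<otimes>\<^bsub>MA\<^esub> m') = \<psi> m \<otimes>\<^bsub>B\<^esub> \<psi> m'" using cl m m' a0 key[OF m, of "fst m' a0"] by (simp add: \<psi>_def compose_eq)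
  next
    fix m c assume "m \<in> carrier MA"
    then have m: "m \<in> multipliers A" by simp
    note cl = MA_closed[OF m m, unfolded MA_simps]
    note D = multipliersD[OF m]
    show "\<psi> m \<in> carrier B" using m a0 h(2) by (simp add: \<psi>_def)
    show "\<psi> (c \<odot>\<^bsub>MA\<^esub> m) = c \<odot>\<^bsub>B\<^esub> \<psi> m" using cl m a0 h(4) by (simp add: \<psi>_def)
    have "\<phi> (snd m (star A a0)) = \<phi> (snd m (star A a0)) \<otimes>\<^bsub>B\<^esub> \<phi> a0" using m a0 h(2) i by simp
    also have "\<dots> = \<phi> (star A a0 \<otimes> fst m a0)" using h(5)[of "snd m (star A a0)" a0] m a0 D(5) by simp
    also have "\<dots> = \<phi> (fst m a0)" using h(2,5,6) m a0 i si by simp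
    finally show "\<psi> (star MA m) = star B (\<psi> m)" using cl m a0 h(6) by (simp add: \<psi>_def)
  qed (simp add: \<psi>_def)
  have me: "\<psi> (me a) = \<phi> a" if "a \<in> AA" for a
    using that me_mult a0 h(2,5) i by (simp add: \<psi>_def me_apply)
  have eq: "multiplier_extension A B \<phi> = \<psi>"
  proof (rule multiplier_extensionI[OF hom me])
    fix m x y assume x: "x \<in> carrier B" and y: "y \<in> carrier B"
      and c: "\<And>a. a \<in> AA ==> x \<otimes>\<^bsub>B\<^esub> \<phi> a = y \<otimes>\<^bsub>B\<^esub> \<phi> a"
    show "x = y" using c[OF a0(1)] x y a0(2) i by simp
  qed
  show "multiplier_extension A B \<phi> \<in> star_homs MA B" using hom eq by simp
  show "multiplier_extension A B \<phi> m \<otimes>\<^bsub>B\<^esub> \<phi> a = \<phi> (fst m a)" if "m \<in> multipliers A" "a \<in> AA" for m a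
    using key that eq by (simp add: \<psi>_def)
qed

lemma bounded_between_map: assumes "f \<in> bounded_maps A nm" shows "bounded_between A nm A nm f"
proof -
  obtain c where c: "\<And>x. x \<in> AA ==> nm (f x) \<le> c * nm x" using bounded_mapsD(5)[OF assms] by blast
  have "nm (f x) \<le> (\<bar>c\<bar> + 1) * nm x" if x: "x \<in> AA" for x
    using order_trans[OF c[OF x] mult_right_mono[OF _ nrm_nonneg[OF x], of c "\<bar>c\<bar> + 1"]] by simp
  then show ?thesis using bounded_mapsD(2-4)[OF assms] unfolding bounded_between_def
    by (auto intro!: exI[of _ "\<bar>c\<bar> + 1"])
qed

lemma bounded_between_mult:
  assumes a: "a \<in> AA"
  shows "bounded_between A nm A nm (\<lambda>b. a \<otimes> b)" "bounded_between A nm A nm (\<lambda>b. b \<otimes> a)"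
proof -
  have "nm (a \<otimes> b) \<le> (nm a + 1) * nm b" "nm (b \<otimes> a) \<le> (nm a + 1) * nm b" if b: "b \<in> AA" for b
    using norm_mult_le[OF a b] norm_mult_le[OF b a] nrm_nonneg[OF b] by (simp_all add: algebra_simps)
  moreover have "nm a + 1 > 0" using nrm_nonneg[OF a] by linarith
  ultimately have "\<exists>c>0. \<forall>x\<in>AA. nm (a \<otimes> x) \<le> c * nm x" "\<exists>c>0. \<forall>x\<in>AA. nm (x \<otimes> a) \<le> c * nm x" by blast+
  then show "bounded_between A nm A nm (\<lambda>b. a \<otimes> b)" "bounded_between A nm A nm (\<lambda>b. b \<otimes> a)"
    using a unfolding bounded_between_def by (simp_all add: mult_add mult_smult add_mult smult_mult)
qed

end

context banach_star_algebra
begin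

lemma bounded_maps_eq_closed:
  assumes "f \<in> bounded_maps A nm" "g \<in> bounded_maps A nm"
  shows "closed_subspace {a \<in> AA. f a = g a}"
  by (rule equalizer_closed[OF normed_module_axioms bounded_between_map bounded_between_map]) fact+

end

section \<open>The group algebra\<close>

context pro_group
begin

sublocale P: seminormed_star_algebra P by (rule seminormed_star_algebra_P)

abbreviation Cs where "Cs \<equiv> group_cstar G T"
abbreviation CC where "CC \<equiv> carrier Cs"

lemma Cs_completion: "P.C = Cs"
  by (simp add: group_cstar_def)

sublocale A: banach_star_algebra Cs
  using P.banach_C by (simp only: Cs_completion)

abbreviation \<iota> where "\<iota> \<equiv> completion_embedding P"

lemma iota_closed [simp]: "f \<in> CF ==> \<iota> f \<in> CC"
  using P.emb(1)[of f] by (simp add: Cs_completion)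

lemma iota_ops:
  "f \<in> CF ==> h \<in> CF ==> \<iota> (\<lambda>s\<in>GG. f s + h s) = \<iota> f \<oplus>\<^bsub>Cs\<^esub> \<iota> h"
  "f \<in> CF ==> h \<in> CF ==> \<iota> (conv f h) = \<iota> f \<otimes>\<^bsub>Cs\<^esub> \<iota> h"
  "f \<in> CF ==> \<iota> (\<lambda>s\<in>GG. c * f s) = c \<odot>\<^bsub>Cs\<^esub> \<iota> f"
  "f \<in> CF ==> \<iota> (inv_cnj f) = star Cs (\<iota> f)"
  "\<iota> (\<lambda>s\<in>GG. 0) = \<zero>\<^bsub>Cs\<^esub>"
  using P.emb_ops(1,2)[of f h] P.emb_ops(3)[of f c] P.emb_ops(4)[of f] P.emb_ops(5) by (simp_all add: Cs_completion)

lemma norm_iota: "f \<in> CF ==> anorm Cs (\<iota> f) = un f"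
  using P.norm_emb[of f] by (simp add: Cs_completion)

lemma cont_diff [simp]: "f \<in> CF ==> h \<in> CF ==> (\<lambda>s\<in>GG. f s - h s) \<in> CF"
  using cont_add[of f "\<lambda>s\<in>GG. (-1) * h s"] cont_smult[of h "-1"] by (simp cong: restrict_cong)

lemma iota_diff: "f \<in> CF ==> h \<in> CF ==> \<iota> (\<lambda>s\<in>GG. f s - h s) = \<iota> f \<ominus>\<^bsub>Cs\<^esub> \<iota> h"
proof -
  assume f: "f \<in> CF" and h: "h \<in> CF"
  have "(\<lambda>s\<in>GG. f s - h s) = (\<lambda>s\<in>GG. f s + (\<lambda>s\<in>GG. (-1) * h s) s)" by (rule restrict_ext) simp
  then have "\<iota> (\<lambda>s\<in>GG. f s - h s) = \<iota> f \<oplus>\<^bsub>Cs\<^esub> (-1) \<odot>\<^bsub>Cs\<^esub> \<iota> h"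
    using iota_ops(1)[OF f cont_smult[OF h, of "-1"]] iota_ops(3)[OF h, of "-1"] by (simp only:)
  then show ?thesis using f h by (simp add: A.diff_eq)
qed

lemma iota_dense: "a \<in> CC ==> e > 0 ==> \<exists>f\<in>CF. anorm Cs (\<iota> f \<ominus>\<^bsub>Cs\<^esub> a) < e"
  using P.emb_dense[of a e] by (simp add: Cs_completion)

lemma closed_subspace_iota:
  assumes "A.closed_subspace S" "\<And>f. f \<in> CF ==> \<iota> f \<in> S" shows "S = CC"
proof -
  have "a \<in> S" if a: "a \<in> CC" for a
  proof -
    have "\<exists>y\<in>S. anorm Cs (y \<ominus>\<^bsub>Cs\<^esub> a) < e" if "e > 0" for e
      using iota_dense[OF a that] assms(2) by blast
    then show ?thesis using assms(1) a unfolding A.closed_subspace_def by blast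
  qed
  then show ?thesis using assms(1) unfolding A.closed_subspace_def by blast
qed

lemma bounded_maps_eqI:
  assumes f: "f \<in> bounded_maps Cs (anorm Cs)" and g: "g \<in> bounded_maps Cs (anorm Cs)"
    and e: "\<And>h. h \<in> CF ==> f (\<iota> h) = g (\<iota> h)"
  shows "f = g"
proof -
  have "{a \<in> CC. f a = g a} = CC"
    by (rule closed_subspace_iota[OF A.bounded_maps_eq_closed[OF f g]]) (use e in simp)
  then show ?thesis using bounded_mapsD(1)[OF f] bounded_mapsD(1)[OF g] by (intro extensionalityI[of f "CC"]) auto
qed

section \<open>Translations and the canonical unitaries\<close>

definition lt :: "'g \<Rightarrow> ('g \<Rightarrow> complex) \<Rightarrow> 'g \<Rightarrow> complex" where "lt g f = (\<lambda>s\<in>GG. f (inv g \<otimes> s))"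
definition rt :: "'g \<Rightarrow> ('g \<Rightarrow> complex) \<Rightarrow> 'g \<Rightarrow> complex" where "rt g f = (\<lambda>s\<in>GG. f (s \<otimes> inv g))"

lemma lt_cont [simp]: "f \<in> CF ==> g \<in> GG ==> lt g f \<in> CF" and rt_cont [simp]: "f \<in> CF ==> g \<in> GG ==> rt g f \<in> CF"
  by (simp_all add: lt_def rt_def)

lemma lt_apply: "s \<in> GG ==> lt g f s = f (inv g \<otimes> s)" and rt_apply: "s \<in> GG ==> rt g f s = f (s \<otimes> inv g)"
  by (simp_all add: lt_def rt_def)

lemma lt_lt: "f \<in> CF ==> g \<in> GG ==> h \<in> GG ==> lt g (lt h f) = lt (g \<otimes> h) f"
  by (rule cont_eqI) (simp_all add: lt_apply inv_mult_group m_assoc)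

text \<open>In every representation the translate acts as \<open>vf f\<close> followed by the
  isometry \<open>v g\<close>, so its norm does not exceed that of \<open>vf f\<close>.\<close>

lemma un_lt: assumes f: "f \<in> CF" and g: "g \<in> GG" shows "un (lt g f) \<le> un f"
proof (rule un_least)
  fix K :: "('g \<Rightarrow> complex) hilbert" and v assume K: "hilbert_space K" "v \<in> unitary_reps G T K"
  interpret W: unitary_rep G T K v by (rule unitary_rep_intro[OF K])
  have "W.opn (W.vf (lt g f)) \<le> W.opn (W.vf f)"
    by (rule W.opn_le) (use W.BO_bound[OF W.vf(1)[OF f]] W.vf_left[OF f g] W.vf(1)[OF f] g W.v_hn W.opn_nonneg in \<open>simp_all add: lt_def\<close>)
  then show "W.opn (W.vf (lt g f)) \<le> un f" using un_upper[OF f K] by linarith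
qed

lemma un_rt: assumes f: "f \<in> CF" and g: "g \<in> GG" shows "un (rt g f) \<le> un f"
proof (rule un_least)
  fix K :: "('g \<Rightarrow> complex) hilbert" and v assume K: "hilbert_space K" "v \<in> unitary_reps G T K"
  interpret W: unitary_rep G T K v by (rule unitary_rep_intro[OF K])
  have "W.opn (W.vf (rt g f)) \<le> W.opn (W.vf f)"
  proof (rule W.opn_le)
    fix x assume x: "x \<in> carrier K"
    have "W.hn (W.vf f (v g x)) \<le> W.opn (W.vf f) * W.hn (v g x)" using W.BO_bound[OF W.vf(1)[OF f]] g x by simp
    then show "W.hn (W.vf (rt g f) x) \<le> W.opn (W.vf f) * W.hn x"
      using W.vf_right[OF f g x] W.v_hn[OF g x] by (simp add: rt_def)
  qed (rule W.opn_nonneg[OF W.vf(1)[OF f]])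
  then show "W.opn (W.vf (rt g f)) \<le> un f" using un_upper[OF f K] by linarith
qed

lemma contraction_lt: "g \<in> GG ==> contraction P P (lt g)"
  by unfold_locales (simp_all add: un_lt, simp_all add: lt_def cong: restrict_cong)

lemma contraction_rt: "g \<in> GG ==> contraction P P (rt g)"
  by unfold_locales (simp_all add: un_rt, simp_all add: rt_def cong: restrict_cong)

definition Lm where "Lm g = contraction.ext P P (lt g)"
definition Rm where "Rm g = contraction.ext P P (rt g)"

lemma Lm:
  assumes g: "g \<in> GG"
  shows "Lm g \<in> bounded_maps Cs (anorm Cs)" "\<And>f. f \<in> CF ==> Lm g (\<iota> f) = \<iota> (lt g f)"
    "\<And>a. a \<in> CC ==> anorm Cs (Lm g a) \<le> anorm Cs a"
proof -
  interpret c: contraction P P "lt g" by (rule contraction_lt[OF g])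
  note e = c.ext_closed[unfolded Cs_completion] c.ext_add[unfolded Cs_completion] c.ext_smult[unfolded Cs_completion]
    c.ext_le[unfolded Cs_completion] c.ext_emb c.ext_extensional[unfolded Cs_completion]
  show "Lm g \<in> bounded_maps Cs (anorm Cs)" unfolding Lm_def
    by (rule bounded_mapsI[where c = 1]) (use e in simp_all)
  show "\<And>f. f \<in> CF ==> Lm g (\<iota> f) = \<iota> (lt g f)" "\<And>a. a \<in> CC ==> anorm Cs (Lm g a) \<le> anorm Cs a"
    unfolding Lm_def using e by simp_all
qed

lemma Rm:
  assumes g: "g \<in> GG"
  shows "Rm g \<in> bounded_maps Cs (anorm Cs)" "\<And>f. f \<in> CF ==> Rm g (\<iota> f) = \<iota> (rt g f)"
proof -
  interpret c: contraction P P "rt g" by (rule contraction_rt[OF g])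
  note e = c.ext_closed[unfolded Cs_completion] c.ext_add[unfolded Cs_completion] c.ext_smult[unfolded Cs_completion]
    c.ext_le[unfolded Cs_completion] c.ext_emb c.ext_extensional[unfolded Cs_completion]
  show "Rm g \<in> bounded_maps Cs (anorm Cs)" unfolding Rm_def
    by (rule bounded_mapsI[where c = 1]) (use e in simp_all)
  show "\<And>f. f \<in> CF ==> Rm g (\<iota> f) = \<iota> (rt g f)"
    unfolding Rm_def using e by simp_all
qed

lemma lt_conv: assumes f: "f \<in> CF" and h: "h \<in> CF" and g: "g \<in> GG" shows "lt g (conv f h) = conv (lt g f) h"
proof (rule cont_eqI)
  fix s assume s: "s \<in> GG"
  have gs: "inv g \<otimes> s \<in> GG" using g s by simp
  have c: "(\<lambda>t\<in>GG. lt g f t * h (inv t \<otimes> s)) \<in> CF" using f h g s by (simp add: conv_integrand)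
  have "lt g (conv f h) s = haar (\<lambda>t\<in>GG. (\<lambda>t\<in>GG. lt g f t * h (inv t \<otimes> s)) (g \<otimes> t))"
    using s g gs by (simp add: lt_apply conv_apply inv_mult_cancel inv_mult_group m_assoc cong: restrict_cong)
  also have "\<dots> = conv (lt g f) h s" using haar_left[OF c g] s by (simp add: conv_apply)
  finally show "lt g (conv f h) s = conv (lt g f) h s" .
qed (use f h g in simp_all)

lemma rt_conv: assumes f: "f \<in> CF" and h: "h \<in> CF" and g: "g \<in> GG" shows "rt g (conv f h) = conv f (rt g h)"
proof (rule cont_eqI)
  fix s assume s: "s \<in> GG"
  show "rt g (conv f h) s = conv f (rt g h) s"
    using s g by (simp add: rt_apply conv_apply m_assoc cong: restrict_cong)
qed (use f h g in simp_all)

lemma rt_conv_lt: assumes f: "f \<in> CF" and h: "h \<in> CF" and g: "g \<in> GG" shows "conv (rt g f) h = conv f (lt g h)"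
proof (rule cont_eqI)
  fix s assume s: "s \<in> GG"
  have c: "(\<lambda>t\<in>GG. rt g f t * h (inv t \<otimes> s)) \<in> CF" using f h g s by (simp add: conv_integrand)
  have "conv (rt g f) h s = haar (\<lambda>t\<in>GG. (\<lambda>t\<in>GG. rt g f t * h (inv t \<otimes> s)) (t \<otimes> g))"
    using haar_right[OF c g] s by (simp add: conv_apply)
  also have "\<dots> = conv f (lt g h) s"
    using s g by (simp add: conv_apply rt_apply lt_apply m_assoc inv_mult_group cong: restrict_cong)
  finally show "conv (rt g f) h s = conv f (lt g h) s" .
qed (use f h g in simp_all)

text \<open>Density is used in one variable at a time: first in \<open>b\<close> with
  \<open>a\<close> a continuous function, then in \<open>a\<close> for arbitrary \<open>b\<close>;
  hence the two kinds of boundedness assumptions.\<close>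

lemma bilinear_eqI:
  fixes F F' defines "bb \<equiv> bounded_between Cs (anorm Cs) Cs (anorm Cs)"
  assumes "\<And>b. b \<in> CC ==> bb (\<lambda>a. F a b)" "\<And>b. b \<in> CC ==> bb (\<lambda>a. F' a b)"
    and "\<And>f. f \<in> CF ==> bb (F (\<iota> f))" "\<And>f. f \<in> CF ==> bb (F' (\<iota> f))"
    and "\<And>f h. f \<in> CF ==> h \<in> CF ==> F (\<iota> f) (\<iota> h) = F' (\<iota> f) (\<iota> h)"
    and a: "a \<in> CC" and b: "b \<in> CC"
  shows "F a b = F' a b"
proof -
  note eq = A.equalizer_closed[OF A.normed_module_axioms, folded bb_def]
  have "F (\<iota> f) b = F' (\<iota> f) b" if f: "f \<in> CF" for f
  proof -
    have "{b \<in> CC. F (\<iota> f) b = F' (\<iota> f) b} = CC"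
      by (rule closed_subspace_iota[OF eq[OF assms(4,5)[OF f]]]) (use assms(6) f in simp)
    then show ?thesis using b by blast
  qed
  then have "{a \<in> CC. F a b = F' a b} = CC"
    by (intro closed_subspace_iota[OF eq[OF assms(2,3)[OF b]]]) simp
  then show ?thesis using a by blast
qed

lemma Lm_Rm_multiplier: assumes g: "g \<in> GG" shows "(Lm g, Rm g) \<in> multipliers Cs"
proof (rule A.multipliersI[OF Lm(1)[OF g] Rm(1)[OF g]])
  note L = Lm[OF g] and R = Rm[OF g] and l = A.bounded_between_map[OF Lm(1)[OF g]] and r = A.bounded_between_map[OF Rm(1)[OF g]]
    and ml = A.bounded_between_mult(1) and mr = A.bounded_between_mult(2) and comp = bounded_between_comp
  note Lc = bounded_mapsD(2)[OF L(1)] and Rc = bounded_mapsD(2)[OF R(1)]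
  fix a b assume a: "a \<in> CC" and b: "b \<in> CC"
  show "Lm g (a \<otimes>\<^bsub>Cs\<^esub> b) = Lm g a \<otimes>\<^bsub>Cs\<^esub> b"
    by (rule bilinear_eqI[OF comp[OF mr l] comp[OF l mr] comp[OF ml l] ml[OF Lc] _ a b])
      (use g in \<open>simp_all add: iota_ops(2)[symmetric] L(2) lt_conv\<close>)
  show "Rm g (a \<otimes>\<^bsub>Cs\<^esub> b) = a \<otimes>\<^bsub>Cs\<^esub> Rm g b"
    by (rule bilinear_eqI[OF comp[OF mr r] mr[OF Rc] comp[OF ml r] comp[OF r ml] _ a b])
      (use g in \<open>simp_all add: iota_ops(2)[symmetric] R(2) rt_conv\<close>)
  show "Rm g a \<otimes>\<^bsub>Cs\<^esub> b = a \<otimes>\<^bsub>Cs\<^esub> Lm g b"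
    by (rule bilinear_eqI[OF comp[OF r mr] mr[OF Lc] ml[OF Rc] comp[OF l ml] _ a b])
      (use g in \<open>simp_all add: iota_ops(2)[symmetric] L(2) R(2) rt_conv_lt\<close>)
qed

text \<open>Convolution with a point mass is a translation, and a bounded map is determined by its
  values on the dense image of \<open>\<iota>\<close>; so the \<open>THE\<close> in
  \<open>measure_multiplier\<close> can only mean the extended translations.\<close>

lemma canonical_unitary_eq: assumes g: "g \<in> GG" shows "canonical_unitary G T g = (Lm g, Rm g)"
proof -
  have l: "(\<lambda>s\<in>GG. point_mass T g (\<lambda>t\<in>GG. f (inv t \<otimes> s))) = lt g f" if f: "f \<in> CF" for f
    unfolding lt_def
  proof (rule restrict_ext)
    fix s assume s: "s \<in> GG"
    have "(\<lambda>t\<in>GG. f (inv t \<otimes> s)) \<in> CF"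
      using cont_inv[OF cont_right[OF f s]] by (simp cong: restrict_cong)
    then show "point_mass T g (\<lambda>t\<in>GG. f (inv t \<otimes> s)) = f (inv g \<otimes> s)" using g by (simp add: point_mass_def)
  qed
  have r: "(\<lambda>s\<in>GG. point_mass T g (\<lambda>t\<in>GG. f (s \<otimes> inv t))) = rt g f" if f: "f \<in> CF" for f
    unfolding rt_def
  proof (rule restrict_ext)
    fix s assume s: "s \<in> GG"
    have "(\<lambda>t\<in>GG. f (s \<otimes> inv t)) \<in> CF"
      using cont_inv[OF cont_left[OF f s]] by (simp cong: restrict_cong)
    then show "point_mass T g (\<lambda>t\<in>GG. f (s \<otimes> inv t)) = f (s \<otimes> inv g)" using g by (simp add: point_mass_def)
  qed
  show ?thesis unfolding canonical_unitary_def measure_multiplier_def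
  proof (rule the_equality)
    show "(Lm g, Rm g) \<in> multipliers Cs \<and>
      (\<forall>f\<in>CF. fst (Lm g, Rm g) (\<iota> f) = \<iota> (\<lambda>s\<in>GG. point_mass T g (\<lambda>t\<in>GG. f (inv t \<otimes> s))) \<and>
        snd (Lm g, Rm g) (\<iota> f) = \<iota> (\<lambda>s\<in>GG. point_mass T g (\<lambda>t\<in>GG. f (s \<otimes> inv t))))"
      using Lm_Rm_multiplier[OF g] Lm(2)[OF g] Rm(2)[OF g] by (simp add: l r)
    fix m assume m: "m \<in> multipliers Cs \<and>
      (\<forall>f\<in>CF. fst m (\<iota> f) = \<iota> (\<lambda>s\<in>GG. point_mass T g (\<lambda>t\<in>GG. f (inv t \<otimes> s))) \<and>
        snd m (\<iota> f) = \<iota> (\<lambda>s\<in>GG. point_mass T g (\<lambda>t\<in>GG. f (s \<otimes> inv t))))"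
    have "fst m = Lm g"
      by (rule bounded_maps_eqI) (use m Lm[OF g] l in \<open>simp_all add: A.multipliersD\<close>)
    moreover have "snd m = Rm g"
      by (rule bounded_maps_eqI) (use m Rm[OF g] r in \<open>simp_all add: A.multipliersD\<close>)
    ultimately show "m = (Lm g, Rm g)" by (simp add: prod_eq_iff)
  qed
qed

section \<open>Approximate units\<close>

text \<open>The index normalises the mass to 1. In the group algebra \<open>\<iota> (eM N)\<close>
  is a central projection of norm at most 1, and these projections form an approximate unit as
  \<open>N\<close> shrinks.\<close>

definition eM :: "'g set \<Rightarrow> 'g \<Rightarrow> complex" where
  "eM N = (\<lambda>s\<in>GG. if s \<in> N then of_nat (card (rcosets N)) else 0)"

lemma NN_rcoset: "N \<in> NN ==> N \<in> rcosets N"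
  using coset_in[of N \<one>] coset_mult_one[of N] subgroup.subset[OF NN_subgroup[of N]] by simp

lemma eM_osc: "N \<in> NN ==> osc N (eM N) 0"
  by (rule oscI) (simp add: eM_def coset_mem_iff[OF _ NN_rcoset])

lemma eM_cont [simp]: "N \<in> NN ==> eM N \<in> CF"
  by (rule invariant_cont[OF _ _ eM_osc]) (simp_all add: eM_def)

lemma haar_eM: assumes N: "N \<in> NN" shows "haar (eM N) = 1"
proof -
  let ?n = "of_nat (card (rcosets N)) :: complex"
  have "(\<Sum>C\<in>rcosets N. eM N (rep C)) = (\<Sum>C\<in>rcosets N. if C = N then ?n else 0)"
    using rep[OF N] coset_mem_iff[OF N NN_rcoset[OF N]] by (intro sum.cong refl) (simp add: eM_def)
  also have "\<dots> = ?n" using NN_rcoset[OF N] NN_finite[OF N] by simp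
  finally have "avg N (eM N) = 1" using card_rcosets_pos[OF N] by (simp add: avg_def)
  then show ?thesis using haar_invariant[OF N eM_cont[OF N] eM_osc[OF N]] by simp
qed

text \<open>\<open>eM N\<close> is a probability density carried by \<open>N\<close>, so only the
  values on \<open>N\<close> enter the mean.\<close>

lemma eM_haar:
  assumes N: "N \<in> NN" and \<phi>: "\<phi> \<in> CF" and k: "\<And>m. m \<in> N ==> cmod (\<phi> m - k) \<le> e"
  shows "cmod (haar (\<lambda>t\<in>GG. eM N t * \<phi> t) - k) \<le> e"
proof -
  have c: "(\<lambda>t\<in>GG. eM N t * \<phi> t) \<in> CF" using N \<phi> by simp
  have e: "(\<lambda>t\<in>GG. eM N t * \<phi> t - (\<lambda>t\<in>GG. k * eM N t) t) = (\<lambda>t\<in>GG. (\<lambda>t\<in>GG. eM N t * \<phi> t) t + (\<lambda>t\<in>GG. (-k) * eM N t) t)"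
    by (rule restrict_ext) simp
  let ?d = "\<lambda>t\<in>GG. (\<lambda>t\<in>GG. eM N t * \<phi> t) t + (\<lambda>t\<in>GG. (-k) * eM N t) t"
  have "haar ?d = haar (\<lambda>t\<in>GG. eM N t * \<phi> t) - k"
    using haar_add[OF c cont_smult[OF eM_cont[OF N], of "-k"]] haar_smult[OF eM_cont[OF N], of "-k"] haar_eM[OF N] by simp
  moreover have "cmod (haar ?d) \<le> Re (haar (\<lambda>t\<in>GG. of_real e * eM N t))"
  proof (rule haar_le[OF cont_add[OF c cont_smult[OF eM_cont[OF N]]] cont_smult[OF eM_cont[OF N]]])
    fix t assume t: "t \<in> GG"
    show "cmod (?d t) \<le> Re ((\<lambda>t\<in>GG. of_real e * eM N t) t)"
    proof (cases "t \<in> N")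
      case True
      then have "?d t = of_nat (card (rcosets N)) * (\<phi> t - k)" using t by (simp add: eM_def algebra_simps)
      then show ?thesis 
        using mult_right_mono[OF k[OF True], of "real (card (rcosets N))"] t True
        by (simp add: norm_mult eM_def mult.commute)
    qed (use t in \<open>simp add: eM_def\<close>)
  qed
  ultimately show ?thesis using haar_smult[OF eM_cont[OF N], of "of_real e"] haar_eM[OF N] by simp
qed

lemma un_eM: assumes N: "N \<in> NN" shows "un (eM N) \<le> 1"
  using un_L1[OF eM_cont[OF N] eM_cont[OF N]] haar_eM[OF N] by (simp add: eM_def)

lemma N_inv: "N \<in> NN ==> m \<in> GG ==> inv m \<in> N \<longleftrightarrow> m \<in> N"
  using subgroup.m_inv_closed[OF NN_subgroup, of N m] subgroup.m_inv_closed[OF NN_subgroup, of N "inv m"] by auto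

lemma inv_cnj_eM: "N \<in> NN ==> inv_cnj (eM N) = eM N"
  by (rule cont_eqI) (simp_all add: inv_cnj_apply, simp add: eM_def N_inv)

lemma eM_conv_close:
  assumes N: "N \<in> NN" and f: "f \<in> CF" "osc N f e" and s: "s \<in> GG"
  shows "cmod (conv (eM N) f s - f s) \<le> e"
proof -
  have c: "(\<lambda>t\<in>GG. f (inv t \<otimes> s)) \<in> CF" using cont_inv[OF cont_right[OF f(1) s]] by (simp cong: restrict_cong)
  have "cmod (haar (\<lambda>t\<in>GG. eM N t * (\<lambda>t\<in>GG. f (inv t \<otimes> s)) t) - f s) \<le> e"
  proof (rule eM_haar[OF N c])
    fix m assume m: "m \<in> N"
    have mG: "m \<in> GG" "inv m \<in> N" using NN_mem[OF N m] N_inv[OF N] m by auto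
    show "cmod ((\<lambda>t\<in>GG. f (inv t \<otimes> s)) m - f s) \<le> e"
      using oscD[OF f(2), of "inv m \<otimes> s" s] coset_mem(1)[OF N mG(2) s] mG s by simp
  qed
  then show ?thesis using s by (simp add: conv_apply cong: restrict_cong)
qed

lemma eM_conv_invariant:
  assumes N: "N \<in> NN" and f: "f \<in> CF" "osc N f 0" shows "conv (eM N) f = f"
  by (rule cont_eqI) (use eM_conv_close[OF N f] N f in simp_all)

text \<open>Normality makes the projection central: the substitutions bring in a conjugation by
  \<open>s\<close> and an inversion inside \<open>eM N\<close>, and \<open>N\<close> is stable under
  both.\<close>

lemma eM_commute: assumes N: "N \<in> NN" and f: "f \<in> CF" shows "conv (eM N) f = conv f (eM N)"
proof (rule cont_eqI)
  fix s assume s: "s \<in> GG"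
  have si: "inv s \<in> GG" using s by simp
  have conj: "s \<otimes> t \<otimes> inv s \<in> N \<longleftrightarrow> t \<in> N" if t: "t \<in> GG" for t
  proof -
    have "N #> (s \<otimes> t \<otimes> inv s) = N \<longleftrightarrow> N #> t = N"
    proof -
      have "t \<in> N ==> s \<otimes> t \<otimes> inv s \<in> N" using normal.inv_op_closed2[OF NN_normal[OF N]] s by blast
      moreover have "s \<otimes> t \<otimes> inv s \<in> N ==> t \<in> N"
        using normal.inv_op_closed1[OF NN_normal[OF N] s, of "s \<otimes> t \<otimes> inv s"] s t by (simp add: m_assoc inv_mult_cancel)
      ultimately show ?thesis using coset_mem_iff[OF N NN_rcoset[OF N]] s t by auto
    qed
    then show ?thesis using coset_mem_iff[OF N NN_rcoset[OF N]] s t by simp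
  qed
  let ?\<phi> = "\<lambda>t\<in>GG. eM N t * f (inv t \<otimes> s)"
  have c: "?\<phi> \<in> CF" using N f s by (simp add: conv_integrand)
  let ?\<phi>' = "\<lambda>t\<in>GG. ?\<phi> (s \<otimes> t)"
  have c': "?\<phi>' \<in> CF" using c s by (rule cont_left)
  let ?\<eta> = "\<lambda>t\<in>GG. eM N t * f (s \<otimes> t)"
  have c2: "?\<eta> \<in> CF" using cont_mult[OF eM_cont[OF N] cont_left[OF f s]] by (simp cong: restrict_cong)
  have "conv (eM N) f s = haar ?\<phi>" using s by (simp add: conv_apply)
  also have "\<dots> = haar ?\<phi>'" using haar_left[OF c s] by simp
  also have "\<dots> = haar (\<lambda>t\<in>GG. ?\<phi>' (t \<otimes> inv s))" using haar_right[OF c' si] by simp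
  also have "\<dots> = haar (\<lambda>t\<in>GG. ?\<eta> (inv t))"
  proof (rule arg_cong[where f = haar], rule restrict_ext)
    fix t assume t: "t \<in> GG"
    have "eM N (s \<otimes> (t \<otimes> inv s)) = eM N (inv t)"
      using conj[OF t] N_inv[OF N t] s t by (simp add: eM_def m_assoc)
    then show "?\<phi>' (t \<otimes> inv s) = ?\<eta> (inv t)" using s t by (simp add: inv_mult_group m_assoc)
  qed
  also have "\<dots> = haar ?\<eta>" by (rule haar_inv[OF c2])
  also have "\<dots> = haar (\<lambda>t\<in>GG. (\<lambda>t\<in>GG. f t * eM N (inv t \<otimes> s)) (s \<otimes> t))"
  proof (rule arg_cong[where f = haar], rule restrict_ext)
    fix t assume t: "t \<in> GG"
    have "eM N (inv (s \<otimes> t) \<otimes> s) = eM N t" using s t N_inv[OF N t] by (simp add: eM_def inv_mult_group m_assoc)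
    then show "eM N t * f (s \<otimes> t) = (\<lambda>t\<in>GG. f t * eM N (inv t \<otimes> s)) (s \<otimes> t)" using s t by simp
  qed
  also have "\<dots> = conv f (eM N) s"
    using haar_left[OF conv_integrand[OF f eM_cont[OF N] s] s] s by (simp add: conv_apply)
  finally show "conv (eM N) f s = conv f (eM N) s" .
qed (use N f in simp_all)

lemma eM_absorb': "N \<in> NN ==> M \<in> NN ==> M \<subseteq> N ==> conv (eM M) (eM N) = eM N"
  by (rule eM_conv_invariant) (simp_all add: osc_refine[OF eM_osc])

text \<open>Clear for \<open>\<iota> f\<close> with \<open>f\<close> of small oscillation; since
  \<open>\<iota> (eM M)\<close> has norm at most 1, replacing \<open>a\<close> by a nearby
  \<open>\<iota> f\<close> costs two further errors, uniformly in \<open>M\<close>.\<close>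

lemma approximate_unit:
  assumes a: "a \<in> CC" and e: "e > 0"
  shows "\<exists>N\<in>NN. \<forall>M\<in>NN. M \<subseteq> N \<longrightarrow> anorm Cs (\<iota> (eM M) \<otimes>\<^bsub>Cs\<^esub> a \<ominus>\<^bsub>Cs\<^esub> a) < e"
proof -
  obtain f where f: "f \<in> CF" "anorm Cs (\<iota> f \<ominus>\<^bsub>Cs\<^esub> a) < e/4" using iota_dense[OF a, of "e/4"] e by auto
  obtain N where N: "N \<in> NN" "osc N f (e/4)" using cont_osc[OF f(1), of "e/4"] e by auto
  have "anorm Cs (\<iota> (eM M) \<otimes>\<^bsub>Cs\<^esub> a \<ominus>\<^bsub>Cs\<^esub> a) < e" if M: "M \<in> NN" "M \<subseteq> N" for M
  proof -
    let ?p = "\<iota> (eM M)" and ?f = "\<iota> f"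
    have o: "osc M f (e/4)" using osc_refine[OF N(2) N(1) M] .
    have c: "?p \<in> CC" "?f \<in> CC" using M f by simp_all
    have "?p \<otimes>\<^bsub>Cs\<^esub> ?f \<ominus>\<^bsub>Cs\<^esub> ?f = \<iota> (\<lambda>s\<in>GG. conv (eM M) f s - f s)" using M f by (simp add: iota_diff iota_ops)
    then have 1: "anorm Cs (?p \<otimes>\<^bsub>Cs\<^esub> ?f \<ominus>\<^bsub>Cs\<^esub> ?f) \<le> e/4"
      using un_bound[of "\<lambda>s\<in>GG. conv (eM M) f s - f s" "e/4"] eM_conv_close[OF M(1) f(1) o] M f by (simp add: norm_iota)
    have "anorm Cs (?p \<otimes>\<^bsub>Cs\<^esub> a \<ominus>\<^bsub>Cs\<^esub> ?p \<otimes>\<^bsub>Cs\<^esub> ?f) \<le> anorm Cs ?p * anorm Cs (a \<ominus>\<^bsub>Cs\<^esub> ?f)"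
      using A.norm_mult_le[of ?p "a \<ominus>\<^bsub>Cs\<^esub> ?f"] a c by (simp add: A.mult_diff)
    also have "\<dots> \<le> 1 * anorm Cs (a \<ominus>\<^bsub>Cs\<^esub> ?f)"
      using un_eM[OF M(1)] M a c by (intro mult_right_mono) (auto simp: norm_iota A.nrm_nonneg)
    finally have 2: "anorm Cs (?p \<otimes>\<^bsub>Cs\<^esub> a \<ominus>\<^bsub>Cs\<^esub> ?p \<otimes>\<^bsub>Cs\<^esub> ?f) < e/4" using f(2) A.nrm_diff_swap[OF a c(2)] by simp
    have "anorm Cs (?p \<otimes>\<^bsub>Cs\<^esub> a \<ominus>\<^bsub>Cs\<^esub> a) \<le> anorm Cs (?p \<otimes>\<^bsub>Cs\<^esub> a \<ominus>\<^bsub>Cs\<^esub> ?p \<otimes>\<^bsub>Cs\<^esub> ?f) + anorm Cs (?p \<otimes>\<^bsub>Cs\<^esub> ?f \<ominus>\<^bsub>Cs\<^esub> a)"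
      using a c by (intro A.nrm_diff_triangle) auto
    also have "anorm Cs (?p \<otimes>\<^bsub>Cs\<^esub> ?f \<ominus>\<^bsub>Cs\<^esub> a) \<le> anorm Cs (?p \<otimes>\<^bsub>Cs\<^esub> ?f \<ominus>\<^bsub>Cs\<^esub> ?f) + anorm Cs (?f \<ominus>\<^bsub>Cs\<^esub> a)"
      using a c by (intro A.nrm_diff_triangle) auto
    finally show ?thesis using 1 2 f(2) e by linarith
  qed
  then show ?thesis using N(1) by blast
qed

text \<open>Membership is asked only where the coefficient is nonzero. In
  \<open>average_principle\<close> the weights vanish off \<open>N\<close>, and nothing is known
  about the terms there.\<close>

lemma subspace_sum:
  assumes S: "A.closed_subspace S" and I: "finite I" and F: "\<And>i. i \<in> I ==> c i \<noteq> 0 ==> \<iota> (F i) \<in> S" and FC: "\<And>i. i \<in> I ==> F i \<in> CF"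
  shows "\<iota> (\<lambda>x\<in>GG. \<Sum>i\<in>I. c i * F i x) \<in> S"
  using I F FC
proof (induction I)
  case empty
  then show ?case using S unfolding A.closed_subspace_def by (simp add: iota_ops)
next
  case (insert i I)
  have Fi: "F i \<in> CF" using insert.prems by simp
  have a: "(\<lambda>x\<in>GG. c i * F i x) \<in> CF" "(\<lambda>x\<in>GG. \<Sum>i\<in>I. c i * F i x) \<in> CF"
    using insert by (auto intro: cont_sum)
  have "(\<lambda>x\<in>GG. \<Sum>i\<in>insert i I. c i * F i x) = (\<lambda>x\<in>GG. (\<lambda>x\<in>GG. c i * F i x) x + (\<lambda>x\<in>GG. \<Sum>i\<in>I. c i * F i x) x)"
    using insert by (intro restrict_ext) simp
  then have e: "\<iota> (\<lambda>x\<in>GG. \<Sum>i\<in>insert i I. c i * F i x) = c i \<odot>\<^bsub>Cs\<^esub> \<iota> (F i) \<oplus>\<^bsub>Cs\<^esub> \<iota> (\<lambda>x\<in>GG. \<Sum>i\<in>I. c i * F i x)"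
    using iota_ops(1)[OF a] iota_ops(3)[OF Fi, of "c i"] by (simp only:)
  have "c i \<odot>\<^bsub>Cs\<^esub> \<iota> (F i) \<in> S"
  proof (cases "c i = 0")
    case True
    then show ?thesis using S Fi unfolding A.closed_subspace_def by simp
  next
    case False
    then show ?thesis using S insert.prems(1)[of i] unfolding A.closed_subspace_def by simp
  qed
  moreover have "\<iota> (\<lambda>x\<in>GG. \<Sum>i\<in>I. c i * F i x) \<in> S" using insert by simp
  ultimately show ?case unfolding e using S unfolding A.closed_subspace_def by blast
qed

text \<open>Uniform approximation suffices because \<open>un_bound\<close> bounds the universal norm
  by the supremum.\<close>

lemma closed_subspace_limit:
  assumes S: "A.closed_subspace S" and f: "f \<in> CF"
    and ap: "\<And>e. e > 0 ==> \<exists>h\<in>CF. \<iota> h \<in> S \<and> (\<forall>s\<in>GG. cmod (h s - f s) \<le> e)"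
  shows "\<iota> f \<in> S"
proof -
  have "\<exists>y\<in>S. anorm Cs (y \<ominus>\<^bsub>Cs\<^esub> \<iota> f) < e" if e: "e > 0" for e
  proof -
    obtain h where h: "h \<in> CF" "\<iota> h \<in> S" "\<forall>s\<in>GG. cmod (h s - f s) \<le> e/2" using ap[of "e/2"] e by auto
    have "un (\<lambda>s\<in>GG. h s - f s) \<le> e/2" by (rule un_bound) (use h f in simp_all)
    then have "anorm Cs (\<iota> h \<ominus>\<^bsub>Cs\<^esub> \<iota> f) < e" using h f e by (simp add: iota_diff[symmetric] norm_iota)
    then show ?thesis using h(2) by blast
  qed
  then show ?thesis using S f unfolding A.closed_subspace_def by simp
qed

text \<open>Locally constant functions are linear combinations of translates of the \<open>eM M\<close>.\<close>

lemma density_principle: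
  assumes S: "A.closed_subspace S" and N: "N \<in> NN"
    and e: "\<And>g M. g \<in> GG ==> M \<in> NN ==> M \<subseteq> N ==> \<iota> (lt g (eM M)) \<in> S"
  shows "S = CC"
proof (rule closed_subspace_iota[OF S], rule closed_subspace_limit[OF S])
  fix f and d :: real assume f: "f \<in> CF" and d: "d > 0"
  obtain M0 where M0: "M0 \<in> NN" "osc M0 f d" using cont_osc[OF f d] by blast
  define M where "M = M0 \<inter> N"
  have M: "M \<in> NN" "M \<subseteq> N" unfolding M_def using Int_NN M0 N by auto
  have o: "osc M f d" using osc_refine[OF M0(2,1) M(1)] by (simp add: M_def)
  let ?n = "of_nat (card (rcosets M)) :: complex"
  \<comment> \<open>The translate of \<open>eM M\<close> by \<open>rep C\<close> is
    \<open>?n\<close> times the indicator function of \<open>C\<close>, hence the division by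
    \<open>?n\<close>.\<close>
  let ?h = "\<lambda>x\<in>GG. \<Sum>C\<in>rcosets M. f (rep C) / ?n * lt (rep C) (eM M) x"
  have n: "?n \<noteq> 0" using card_rcosets_pos[OF M(1)] by simp
  have lc: "lt (rep C) (eM M) \<in> CF" if "C \<in> rcosets M" for C using rep(1)[OF M(1) that] M by simp
  have "?h = step M f" unfolding step_def
  proof (rule restrict_ext)
    fix x assume x: "x \<in> GG"
    have Cx: "M #> x \<in> rcosets M" using coset_in[OF M(1) x] .
    have "(\<Sum>C\<in>rcosets M. f (rep C) / ?n * lt (rep C) (eM M) x) = (\<Sum>C\<in>rcosets M. if C = M #> x then f (rep C) else 0)"
    proof (rule sum.cong[OF refl])
      fix C assume C: "C \<in> rcosets M"
      have r: "rep C \<in> GG" "M #> rep C = C" using rep[OF M(1) C] by auto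
      have "inv (rep C) \<otimes> x \<in> M \<longleftrightarrow> C = M #> x"
      proof
        assume m: "inv (rep C) \<otimes> x \<in> M"
        have "M #> (rep C \<otimes> (inv (rep C) \<otimes> x)) = M #> rep C" by (rule coset_mem(2)[OF M(1) m r(1)])
        then show "C = M #> x" using r x by (simp add: inv_mult_cancel)
      next
        assume "C = M #> x"
        then have "M #> (inv (rep C) \<otimes> x) = M #> (inv (rep C) \<otimes> rep C)" using r x by (intro coset_mult[OF M(1)]) auto
        then show "inv (rep C) \<otimes> x \<in> M"
          using r_coset_eq_iff[OF NN_subgroup[OF M(1)], of "inv (rep C) \<otimes> x" \<one>] r x by simp
      qed
      then show "f (rep C) / ?n * lt (rep C) (eM M) x = (if C = M #> x then f (rep C) else 0)"
        using x r n by (simp add: lt_apply eM_def)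
    qed
    then show "(\<Sum>C\<in>rcosets M. f (rep C) / ?n * lt (rep C) (eM M) x) = f (rep (M #> x))"
      using Cx NN_finite[OF M(1)] by simp
  qed
  moreover have "\<iota> ?h \<in> S"
    by (rule subspace_sum[OF S NN_finite[OF M(1)]]) (use e rep(1)[OF M(1)] M lc in blast)+
  ultimately show "\<exists>h\<in>CF. \<iota> h \<in> S \<and> (\<forall>s\<in>GG. cmod (h s - f s) \<le> d)"
    using step_cont[OF M(1), of f] step_close[OF M(1) o] by (auto simp: norm_minus_commute intro!: bexI[of _ "step M f"])
qed

text \<open>Formally \<open>e\<^sub>N h - h\<close> is the mean of the elements
  \<open>u\<^sub>m h - h\<close> over \<open>m\<close> in \<open>N\<close>. It is approximated
  uniformly by a finite sum over the cosets of a smaller \<open>M\<close>, in which terms sampled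
  outside \<open>N\<close> have weight zero.\<close>

lemma average_principle:
  assumes S: "A.closed_subspace S" and h: "h \<in> CF" and N: "N \<in> NN"
    and e: "\<And>m. m \<in> N ==> \<iota> (lt m h) \<ominus>\<^bsub>Cs\<^esub> \<iota> h \<in> S"
  shows "\<iota> (conv (eM N) h) \<ominus>\<^bsub>Cs\<^esub> \<iota> h \<in> S"
proof -
  have eh: "conv (eM N) h \<in> CF" using N h by simp
  have "\<iota> (\<lambda>s\<in>GG. conv (eM N) h s - h s) \<in> S"
  proof (rule closed_subspace_limit[OF S cont_diff[OF eh h]])
    fix d :: real assume d: "d > 0"
    let ?c = "real (card (rcosets N))"
    have c: "?c > 0" using card_rcosets_pos[OF N] by simp
    \<comment> \<open>\<open>eM N\<close> takes values up to \<open>?c\<close>, which multiplies the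
      oscillation of \<open>h\<close>.\<close>
    obtain M0 where M0: "M0 \<in> NN" "osc M0 h (d / ?c)" using cont_osc[OF h, of "d / ?c"] d c by auto
    define M where "M = M0 \<inter> N"
    have M: "M \<in> NN" "M \<subseteq> N" unfolding M_def using Int_NN M0 N by auto
    have o: "osc M h (d / ?c)" using osc_refine[OF M0(2,1) M(1)] by (simp add: M_def)
    let ?n = "of_nat (card (rcosets M)) :: complex"
    let ?F = "\<lambda>C. \<lambda>s\<in>GG. lt (rep C) h s - h s"
    let ?h = "\<lambda>x\<in>GG. \<Sum>C\<in>rcosets M. eM N (rep C) / ?n * ?F C x"
    have FC: "?F C \<in> CF" if "C \<in> rcosets M" for C using rep(1)[OF M(1) that] h by simp
    have "\<iota> ?h \<in> S"
    proof (rule subspace_sum[OF S NN_finite[OF M(1)]])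
      fix C assume C: "C \<in> rcosets M" and nz: "eM N (rep C) / ?n \<noteq> 0"
      have r: "rep C \<in> GG" using rep(1)[OF M(1) C] .
      then have "rep C \<in> N" using nz by (auto simp: eM_def split: if_splits)
      then show "\<iota> (?F C) \<in> S" using e[of "rep C"] r h by (simp add: iota_diff)
    qed (rule FC)
    moreover have "?h \<in> CF" by (rule cont_sum[OF NN_finite[OF M(1)] FC])
    moreover have "cmod (?h s - (\<lambda>s\<in>GG. conv (eM N) h s - h s) s) \<le> d" if s: "s \<in> GG" for s
    proof -
      let ?\<phi> = "\<lambda>t\<in>GG. eM N t * h (inv t \<otimes> s)"
      \<comment> \<open>The integrand of the difference at \<open>s\<close>: subtracting
        \<open>h s\<close> times \<open>eM N\<close> subtracts \<open>h s\<close> from the integral,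
        as \<open>eM N\<close> has mass 1.\<close>
      let ?\<chi> = "\<lambda>t\<in>GG. ?\<phi> t + (\<lambda>t\<in>GG. (- h s) * eM N t) t"
      have p: "?\<phi> \<in> CF" using N h s by (simp add: conv_integrand)
      have x: "?\<chi> \<in> CF" using cont_add[OF p cont_smult[OF eM_cont[OF N]]] .
      have hx: "haar ?\<chi> = conv (eM N) h s - h s"
        using haar_add[OF p cont_smult[OF eM_cont[OF N], of "- h s"]] haar_smult[OF eM_cont[OF N], of "- h s"] haar_eM[OF N] s
        by (simp add: conv_apply)
      have "osc M ?\<chi> d"
      proof (rule oscI)
        fix t t' assume t: "t \<in> GG" "t' \<in> GG" "M #> t = M #> t'"
        have en: "eM N t = eM N t'" using oscD[OF eM_osc[OF N] t(1,2) coset_refine[OF N M t]] by simp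
        have i: "M #> (inv t \<otimes> s) = M #> (inv t' \<otimes> s)"
          using coset_inv[OF M(1) t] t s by (intro coset_mult[OF M(1)]) auto
        have "?\<chi> t - ?\<chi> t' = eM N t * (h (inv t \<otimes> s) - h (inv t' \<otimes> s))" using t en by (simp add: algebra_simps)
        moreover have "cmod (h (inv t \<otimes> s) - h (inv t' \<otimes> s)) \<le> d / ?c" using oscD[OF o _ _ i] t s by simp
        moreover have "cmod (eM N t) \<le> ?c" using t by (simp add: eM_def)
        ultimately have "cmod (?\<chi> t - ?\<chi> t') \<le> ?c * (d / ?c)" using d c by (simp add: norm_mult mult_mono del: times_divide_eq_right)
        then show "cmod (?\<chi> t - ?\<chi> t') \<le> d" using c by simp
      qed
      then have "cmod (haar ?\<chi> - avg M ?\<chi>) \<le> d" by (rule haar_approx[OF x M(1)])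
      moreover have "avg M ?\<chi> = ?h s"
        unfolding avg_def using s rep(1)[OF M(1)]
        by (simp add: sum_divide_distrib lt_apply algebra_simps diff_divide_distrib cong: sum.cong)
      ultimately show ?thesis using hx s by (simp add: norm_minus_commute)
    qed
    ultimately show "\<exists>k\<in>CF. \<iota> k \<in> S \<and> (\<forall>s\<in>GG. cmod (k s - (\<lambda>s\<in>GG. conv (eM N) h s - h s) s) \<le> d)" by blast
  qed
  then show ?thesis using iota_diff[OF eh h] by simp
qed

lemma Lm_closed [simp]: "g \<in> GG ==> a \<in> CC ==> Lm g a \<in> CC"
  using bounded_mapsD(2)[OF Lm(1)] by blast

lemma Lm_mult: assumes g: "g \<in> GG" and h: "h \<in> GG" and a: "a \<in> CC" shows "Lm (g \<otimes> h) a = Lm g (Lm h a)"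
proof -
  have gh: "g \<otimes> h \<in> GG" using g h by simp
  have "Lm (g \<otimes> h) = compose (CC) (Lm g) (Lm h)"
    by (rule bounded_maps_eqI[OF Lm(1)[OF gh] A.compose_bounded[OF Lm(1)[OF g] Lm(1)[OF h]]])
      (use g h in \<open>simp add: compose_eq Lm(2) lt_lt\<close>)
  then show ?thesis using a by (simp add: compose_eq)
qed

lemma Lm_one: assumes a: "a \<in> CC" shows "Lm \<one> a = a"
proof -
  have i: "(\<lambda>a\<in>CC. a) \<in> bounded_maps Cs (anorm Cs)" by (rule bounded_mapsI[where c = 1]) simp_all
  have "lt \<one> f = f" if "f \<in> CF" for f by (rule cont_eqI) (use that in \<open>simp_all add: lt_apply\<close>)
  then have "Lm \<one> = (\<lambda>a\<in>CC. a)" by (intro bounded_maps_eqI[OF Lm(1) i]) (simp_all add: Lm(2))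
  then show ?thesis using a by simp
qed

lemma lt_small:
  assumes f: "f \<in> CF" and N: "N \<in> NN" "osc N f e" and n: "n \<in> N" shows "un (\<lambda>s\<in>GG. lt n f s - f s) \<le> e"
proof (rule un_bound)
  have nG: "n \<in> GG" "inv n \<in> N" using NN_mem[OF N(1) n] N_inv[OF N(1)] n by auto
  then show "(\<lambda>s\<in>GG. lt n f s - f s) \<in> CF" using f by simp
  fix s assume s: "s \<in> GG"
  show "cmod ((\<lambda>s\<in>GG. lt n f s - f s) s) \<le> e"
    using oscD[OF N(2), of "inv n \<otimes> s" s] coset_mem(1)[OF N(1) nG(2) s] nG s by (simp add: lt_apply)
qed

end

section \<open>Nondegenerate representations of the group algebra\<close>

locale nondegenerate_rep = pro_group G T + hilbert H for G :: "('g, 'm) monoid_scheme" (structure) and T and H :: "'h hilbert" +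
  fixes \<pi>
  assumes nondegenerate: "\<pi> \<in> nondegenerate_reps (group_cstar G T) H"
begin

lemma \<pi>_hom: "\<pi> \<in> star_homs Cs BO"
  using nondegenerate by (simp add: nondegenerate_reps_def)

lemmas \<pi>_ops = star_homsD[OF \<pi>_hom]

lemma \<pi>_BO [simp]: "a \<in> CC ==> \<pi> a \<in> BB"
  by (rule \<pi>_ops(2))

lemma \<pi>_contractive: "a \<in> CC ==> opn (\<pi> a) \<le> anorm Cs a"
  by (rule A.star_hom_contractive[OF hilbert_space \<pi>_hom])

lemma \<pi>_bounded: "bounded_between Cs (anorm Cs) BO opn \<pi>"
  using bounded_between_star_hom[OF \<pi>_hom] \<pi>_contractive by blast

lemma \<pi>_mult: "a \<in> CC ==> b \<in> CC ==> x \<in> HH ==> \<pi> (a \<otimes>\<^bsub>Cs\<^esub> b) x = \<pi> a (\<pi> b x)"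
  by (simp add: \<pi>_ops(5) compose_eq)

lemma \<pi>_add: "a \<in> CC ==> b \<in> CC ==> x \<in> HH ==> \<pi> (a \<oplus>\<^bsub>Cs\<^esub> b) x = \<pi> a x \<oplus>\<^bsub>H\<^esub> \<pi> b x"
  by (simp add: \<pi>_ops(3))

lemma \<pi>_smult: "a \<in> CC ==> x \<in> HH ==> \<pi> (c \<odot>\<^bsub>Cs\<^esub> a) x = c \<odot>\<^bsub>H\<^esub> \<pi> a x"
  by (simp add: \<pi>_ops(4))

lemma \<pi>_diff: "a \<in> CC ==> b \<in> CC ==> x \<in> HH ==> \<pi> (a \<ominus>\<^bsub>Cs\<^esub> b) x = \<pi> a x \<ominus>\<^bsub>H\<^esub> \<pi> b x"
  by (simp add: A.diff_eq diff_eq \<pi>_add \<pi>_smult)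

lemma \<pi>_minus: "a \<in> CC ==> b \<in> CC ==> \<pi> (a \<ominus>\<^bsub>Cs\<^esub> b) = \<pi> a \<ominus>\<^bsub>BO\<^esub> \<pi> b"
  using \<pi>_ops by (simp add: A.diff_eq B.diff_eq)

lemma \<pi>_star: "a \<in> CC ==> x \<in> HH ==> y \<in> HH ==> ip (\<pi> a x) y = ip x (\<pi> (star Cs a) y)"
  by (simp add: \<pi>_ops(6) star_BO(2))

lemma total:
  assumes K: "closed_subspace K" and e: "\<And>a x. a \<in> CC ==> x \<in> HH ==> \<pi> a x \<in> K"
  shows "K = HH"
  by (rule closed_span_total[OF _ K, of "{\<pi> a \<xi> | a \<xi>. a \<in> CC \<and> \<xi> \<in> HH}"])
    (use nondegenerate e in \<open>auto simp: nondegenerate_reps_def\<close>)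

lemma total_eq:
  assumes S: "S \<in> BB" and S': "S' \<in> BB"
    and e: "\<And>a x. a \<in> CC ==> x \<in> HH ==> S (\<pi> a x) = S' (\<pi> a x)"
  shows "S = S'"
proof (rule BO_eqI[OF S S'])
  fix x assume x: "x \<in> HH"
  have "{x \<in> HH. S x = S' x} = HH"
    by (rule total[OF closed_subspace_BO_eq[OF S S']]) (use e in simp)
  then show "S x = S' x" using x by blast
qed

lemma total_zero:
  assumes w: "w \<in> HH" and z: "\<And>a x. a \<in> CC ==> x \<in> HH ==> ip (\<pi> a x) w = 0"
  shows "w = \<zero>\<^bsub>H\<^esub>"
proof -
  have "{x \<in> HH. \<forall>z\<in>{w}. ip x z = 0} = HH"
    by (rule total[OF orthogonal_closed]) (use w z in simp_all)
  then have "ip w w = 0" using w by blast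
  then show ?thesis using w ip_self_zero by blast
qed

text \<open>Limits are taken along a filter, since the subgroups need not have a cofinal
  sequence.\<close>

definition small :: "'g set filter" where "small = (INF N\<in>NN. principal {M \<in> NN. M \<subseteq> N})"

lemma eventually_small: "eventually \<phi> small \<longleftrightarrow> (\<exists>N\<in>NN. \<forall>M\<in>NN. M \<subseteq> N \<longrightarrow> \<phi> M)"
proof -
  have "\<exists>K\<in>NN. {M \<in> NN. M \<subseteq> K} \<subseteq> {M \<in> NN. M \<subseteq> N} \<inter> {M \<in> NN. M \<subseteq> N'}" if "N \<in> NN" "N' \<in> NN" for N N'
    using Int_NN[OF that] by (rule bexI[rotated]) blast
  then have "eventually \<phi> small \<longleftrightarrow> (\<exists>N\<in>NN. eventually \<phi> (principal {M \<in> NN. M \<subseteq> N}))"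
    unfolding small_def using carrier_NN by (intro eventually_INF_base) auto
  then show ?thesis unfolding eventually_principal by blast
qed

lemma small_ne_bot: "small \<noteq> bot"
  unfolding trivial_limit_def eventually_small by blast

lemma eventually_NN: "eventually (\<lambda>M. M \<in> NN) small"
  unfolding eventually_small using carrier_NN by blast

abbreviation p where "p M \<equiv> \<pi> (\<iota> (eM M))"

text \<open>The extension of \<open>\<pi>\<close> maps \<open>m\<close> to the weak limit of \<open>\<pi> (m e\<^sub>M)\<close>, where \<open>e\<^sub>M\<close> is the
  normalised indicator function of \<open>M\<close>.\<close>

lemma extension_operator:
  assumes m: "m \<in> multipliers Cs"
  shows "\<exists>S\<in>BB. \<forall>a\<in>CC. \<forall>x\<in>HH. S (\<pi> a x) = \<pi> (fst m a) x"
proof -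
  note D = A.multipliersD[OF m]
  obtain k where k: "k > 0" "\<And>a. a \<in> CC ==> anorm Cs (fst m a) \<le> k * anorm Cs a"
    using A.bounded_between_map[OF D(1)] unfolding bounded_between_def by blast
  define t where "t M = \<pi> (fst m (\<iota> (eM M)))" for M
  have tB: "t M \<in> BB" if "M \<in> NN" for M unfolding t_def using that m by simp
  have tk: "cmod (ip (t M x) y) \<le> k * hn x * hn y" if M: "M \<in> NN" and x: "x \<in> HH" and y: "y \<in> HH" for M x y
  proof -
    have ic: "\<iota> (eM M) \<in> CC" using M by simp
    have "opn (t M) \<le> k * anorm Cs (\<iota> (eM M))"
      unfolding t_def using order_trans[OF \<pi>_contractive k(2)[OF ic]] ic m by simp
    also have "\<dots> \<le> k * 1" using un_eM[OF M] k M by (intro mult_left_mono) (auto simp: norm_iota)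
    finally have "opn (t M) * hn x * hn y \<le> k * hn x * hn y" using x y by (intro mult_right_mono) auto
    then show ?thesis using BO_ip_bound[OF tB[OF M] x y] by linarith
  qed
  \<comment> \<open>As \<open>fst m\<close> turns \<open>e\<^sub>M a\<close> into
    \<open>fst m\<close> of \<open>e\<^sub>M\<close> times \<open>a\<close>, the approximate unit
    property makes \<open>t M\<close> converge to the expected value on vectors
    \<open>\<pi> a x\<close>.\<close>
  have lim: "((\<lambda>M. ip (t M (\<pi> a x)) y) \<longlongrightarrow> ip (\<pi> (fst m a) x) y) small"
    if a: "a \<in> CC" and x: "x \<in> HH" and y: "y \<in> HH" for a x y
  proof (rule tendstoI)
    fix e :: real assume e: "e > 0"
    define c where "c = k * hn x * hn y + 1"
    have c: "c > 0" using k x y by (simp add: c_def add_nonneg_pos)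
    obtain N where N: "N \<in> NN" "\<forall>M\<in>NN. M \<subseteq> N \<longrightarrow> anorm Cs (\<iota> (eM M) \<otimes>\<^bsub>Cs\<^esub> a \<ominus>\<^bsub>Cs\<^esub> a) < e / c"
      using approximate_unit[OF a, of "e / c"] e c by auto
    have "dist (ip (t M (\<pi> a x)) y) (ip (\<pi> (fst m a) x) y) < e" if M: "M \<in> NN" "M \<subseteq> N" for M
    proof -
      have ic: "\<iota> (eM M) \<in> CC" using M by simp
      let ?b = "\<iota> (eM M) \<otimes>\<^bsub>Cs\<^esub> a \<ominus>\<^bsub>Cs\<^esub> a"
      have b: "?b \<in> CC" using ic a by simp
      have "fst m ?b = fst m (\<iota> (eM M)) \<otimes>\<^bsub>Cs\<^esub> a \<ominus>\<^bsub>Cs\<^esub> fst m a"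
        using ic a m D(3)[OF ic a] by (simp add: A.diff_eq A.multiplier_linear[OF m])
      then have "ip (t M (\<pi> a x)) y - ip (\<pi> (fst m a) x) y = ip (\<pi> (fst m ?b) x) y"
        using ic a x y m by (simp add: t_def \<pi>_diff \<pi>_mult)
      then have "dist (ip (t M (\<pi> a x)) y) (ip (\<pi> (fst m a) x) y) \<le> opn (\<pi> (fst m ?b)) * hn x * hn y"
        using BO_ip_bound[of "\<pi> (fst m ?b)" x y] b m x y by (simp add: dist_norm)
      also have "\<dots> \<le> (k * anorm Cs ?b) * hn x * hn y"
        using order_trans[OF \<pi>_contractive k(2)[OF b]] b m x y by (intro mult_right_mono) simp_all
      also have "\<dots> \<le> c * anorm Cs ?b" using A.nrm_nonneg[OF b] by (simp add: c_def algebra_simps)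
      also have "\<dots> < e" using N(2) M c by (simp add: pos_less_divide_eq mult.commute)
      finally show ?thesis .
    qed
    then show "eventually (\<lambda>M. dist (ip (t M (\<pi> a x)) y) (ip (\<pi> (fst m a) x) y) < e) small"
      unfolding eventually_small using N(1) by blast
  qed
  \<comment> \<open>The vectors on which all weak limits exist. They form a closed subspace
    containing every \<open>\<pi> a x\<close>, hence are everything by nondegeneracy.\<close>
  let ?K = "{x \<in> HH. \<forall>y\<in>HH. \<exists>l. ((\<lambda>M. ip (t M x) y) \<longlongrightarrow> l) small}"
  have ev: "(g \<longlongrightarrow> l) small" if "(f \<longlongrightarrow> l) small" "\<And>M. M \<in> NN ==> f M = g M" for f g :: "'g set \<Rightarrow> complex" and l
    by (rule Lim_transform_eventually[OF that(1) eventually_mono[OF eventually_NN]]) (rule that(2))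
  have add: "((\<lambda>M. ip (t M (x \<oplus>\<^bsub>H\<^esub> x')) y) \<longlongrightarrow> l + l') small"
    if "((\<lambda>M. ip (t M x) y) \<longlongrightarrow> l) small" "((\<lambda>M. ip (t M x') y) \<longlongrightarrow> l') small" "x \<in> HH" "x' \<in> HH" "y \<in> HH" for x x' y l l'
    by (rule ev[OF tendsto_add[OF that(1,2)]]) (use that tB in \<open>simp add: BO_add\<close>)
  have sm: "((\<lambda>M. ip (t M (c \<odot>\<^bsub>H\<^esub> x)) y) \<longlongrightarrow> c * l) small"
    if "((\<lambda>M. ip (t M x) y) \<longlongrightarrow> l) small" "x \<in> HH" "y \<in> HH" for x y c l
    by (rule ev[OF tendsto_mult_left[OF that(1)]]) (use that tB in \<open>simp add: BO_smult\<close>)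
  have "?K = HH"
  proof (rule total, rule closed_subspaceI)
    have "((\<lambda>M. ip (t M \<zero>\<^bsub>H\<^esub>) y) \<longlongrightarrow> 0) small" if "y \<in> HH" for y
      by (rule ev[OF tendsto_const]) (use tB that in simp)
    then show "\<zero>\<^bsub>H\<^esub> \<in> ?K" using M.zero_closed by blast
    fix x assume x: "x \<in> HH" and c: "\<And>e. e > 0 ==> \<exists>z\<in>?K. hn (z \<ominus>\<^bsub>H\<^esub> x) < e"
    have "\<exists>l. ((\<lambda>M. ip (t M x) y) \<longlongrightarrow> l) small" if y: "y \<in> HH" for y
    proof -
      \<comment> \<open>Cauchy criterion with four quarters of \<open>e\<close>: the uniform bound
        \<open>tk\<close> replaces \<open>x\<close> by a nearby \<open>z\<close> of
        \<open>?K\<close> for both subgroups, and the limit at \<open>z\<close> links the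
        two.\<close>
      have "\<exists>P. eventually P small \<and> (\<forall>M M'. P M \<and> P M' \<longrightarrow> dist (ip (t M x) y) (ip (t M' x) y) < e)" if e: "e > 0" for e
      proof -
        define d where "d = k * hn y + 1"
        have d: "d > 0" using k y by (simp add: d_def add_nonneg_pos)
        obtain z where z: "z \<in> ?K" "hn (z \<ominus>\<^bsub>H\<^esub> x) < e / 4 / d" using c[of "e / 4 / d"] e d by auto
        obtain l where l: "((\<lambda>M. ip (t M z) y) \<longlongrightarrow> l) small" using z(1) y by blast
        have "dist (ip (t M x) y) (ip (t M' x) y) < e"
          if M: "M \<in> NN" "M' \<in> NN" "dist (ip (t M z) y) l < e / 4" "dist (ip (t M' z) y) l < e / 4" for M M'
        proof -
          have n: "dist (ip (t M z) y) (ip (t M x) y) < e / 4" if M: "M \<in> NN" for M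
          proof -
            have zx: "z \<ominus>\<^bsub>H\<^esub> x \<in> HH" using z x by simp
            have "dist (ip (t M z) y) (ip (t M x) y) = cmod (ip (t M (z \<ominus>\<^bsub>H\<^esub> x)) y)"
              using BO_diff[OF tB[OF M]] BO_closed[OF tB[OF M]] z x y by (simp add: dist_norm)
            also have "\<dots> \<le> k * hn (z \<ominus>\<^bsub>H\<^esub> x) * hn y" by (rule tk[OF M zx y])
            also have "\<dots> \<le> d * hn (z \<ominus>\<^bsub>H\<^esub> x)" using hn_nonneg[OF zx] by (simp add: d_def algebra_simps del: hn_nonneg)
            also have "\<dots> < e / 4" using z(2) d by (simp add: field_simps)
            finally show ?thesis .
          qed
          have t: "dist a b < e" if "dist a' a < e / 4" "dist b' b < e / 4" "dist a' l < e / 4" "dist b' l < e / 4" for a b a' b' :: complex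
            using that dist_triangle[of a b a'] dist_triangle[of a' b l] dist_triangle[of l b b'] dist_commute[of a' a] dist_commute[of b' l] by linarith
          show ?thesis by (rule t[OF n[OF M(1)] n[OF M(2)] M(3,4)])
        qed
        moreover have "eventually (\<lambda>M. M \<in> NN \<and> dist (ip (t M z) y) l < e / 4) small"
          using tendstoD[OF l, of "e / 4"] e eventually_NN by (simp add: eventually_conj)
        ultimately show ?thesis by blast
      qed
      then have "cauchy_filter (filtermap (\<lambda>M. ip (t M x) y) small)" unfolding cauchy_filter_metric_filtermap by blast
      from cauchy_filter_complete_converges[OF this complete_UNIV] show ?thesis
        using small_ne_bot by (auto simp: filterlim_def filtermap_bot_iff)
    qed
    then show "x \<in> ?K" using x by blast
  next
    fix a x assume a: "a \<in> CC" and x: "x \<in> HH"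
    then show "\<pi> a x \<in> ?K" using lim[OF a x] by auto
  next
    fix x x' assume x: "x \<in> ?K" and x': "x' \<in> ?K"
    show "x \<oplus>\<^bsub>H\<^esub> x' \<in> ?K" using add x x' by (simp, blast)
  next
    fix c x assume "x \<in> ?K"
    then show "c \<odot>\<^bsub>H\<^esub> x \<in> ?K" using sm by (simp, blast)
  qed auto
  then have "\<forall>x\<in>HH. \<forall>y\<in>HH. \<exists>l. ((\<lambda>M. ip (t M x) y) \<longlongrightarrow> l) small" by blast
  then obtain L where L: "\<And>x y. x \<in> HH ==> y \<in> HH ==> ((\<lambda>M. ip (t M x) y) \<longlongrightarrow> L x y) small" by metis
  note un = tendsto_unique[OF small_ne_bot]
  obtain S where S: "S \<in> bounded_maps H hn" "\<And>x y. x \<in> HH ==> y \<in> HH ==> ip (S x) y = L x y"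
  proof (rule form_to_operator[of L k])
    fix x y z c assume x: "x \<in> HH" and y: "y \<in> HH" and z: "z \<in> HH"
    show "L (x \<oplus>\<^bsub>H\<^esub> y) z = L x z + L y z" by (rule un[OF L add[OF L L]]) (use x y z in simp_all)
    show "L (c \<odot>\<^bsub>H\<^esub> x) y = c * L x y" by (rule un[OF L sm[OF L]]) (use x y in simp_all)
    show "L x (y \<oplus>\<^bsub>H\<^esub> z) = L x y + L x z"
      by (rule un[OF L ev[OF tendsto_add[OF L L]]]) (use x y z tB in simp_all)
    show "L x (c \<odot>\<^bsub>H\<^esub> y) = cnj c * L x y"
      by (rule un[OF L ev[OF tendsto_mult_left[OF L]]]) (use x y tB in simp_all)
    show "cmod (L x y) \<le> k * hn x * hn y"
      by (rule tendsto_upperbound[OF tendsto_norm[OF L[OF x y]] eventually_mono[OF eventually_NN] small_ne_bot]) (rule tk[OF _ x y])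
  qed (rule that)
  have SB: "S \<in> BB" using S(1) by (simp add: carrier_BO)
  have "S (\<pi> a x) = \<pi> (fst m a) x" if a: "a \<in> CC" and x: "x \<in> HH" for a x
  proof (rule ip_ext)
    fix y assume y: "y \<in> HH"
    have ax: "\<pi> a x \<in> HH" using a x by simp
    show "ip (S (\<pi> a x)) y = ip (\<pi> (fst m a) x) y"
      unfolding S(2)[OF ax y] by (rule un[OF L[OF ax y] lim[OF a x y]])
  qed (use a x m SB in simp_all)
  then show ?thesis using SB by blast
qed

abbreviation \<psi> where "\<psi> \<equiv> multiplier_extension Cs BO \<pi>"

text \<open>By \<open>extension_operator\<close> the candidate is prescribed on the vectors
  \<open>\<pi> a x\<close>, and the algebraic identities are checked there with
  \<open>total_eq\<close>. This resolves the \<open>THE\<close> in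
  \<open>multiplier_extension\<close> for nondegenerate representations.\<close>

lemma \<psi>:
  shows "\<And>m. m \<in> multipliers Cs ==> \<psi> m \<in> BB"
    "\<And>m a x. m \<in> multipliers Cs ==> a \<in> CC ==> x \<in> HH ==> \<psi> m (\<pi> a x) = \<pi> (fst m a) x"
proof -
  define E where "E = (\<lambda>m\<in>multipliers Cs. SOME S. S \<in> BB \<and> (\<forall>a\<in>CC. \<forall>x\<in>HH. S (\<pi> a x) = \<pi> (fst m a) x))"
  have E: "E m \<in> BB \<and> (\<forall>a\<in>CC. \<forall>x\<in>HH. E m (\<pi> a x) = \<pi> (fst m a) x)" if m: "m \<in> multipliers Cs" for m
    using someI_ex[of "\<lambda>S. S \<in> BB \<and> (\<forall>a\<in>CC. \<forall>x\<in>HH. S (\<pi> a x) = \<pi> (fst m a) x)"]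
      extension_operator[OF m] m by (auto simp: E_def)
  have EB: "E m \<in> BB" and Ea: "\<And>a x. a \<in> CC ==> x \<in> HH ==> E m (\<pi> a x) = \<pi> (fst m a) x"
    if "m \<in> multipliers Cs" for m using E[OF that] by blast+
  have hom: "E \<in> star_homs A.MA BO"
  proof (rule star_homsI)
    fix m m' assume "m \<in> carrier A.MA" "m' \<in> carrier A.MA"
    then have m: "m \<in> multipliers Cs" and m': "m' \<in> multipliers Cs" by simp_all
    note cl = A.MA_closed[OF m m']
    show "E (m \<oplus>\<^bsub>A.MA\<^esub> m') = E m \<oplus>\<^bsub>BO\<^esub> E m'"
    proof (rule total_eq)
      show "E m \<oplus>\<^bsub>BO\<^esub> E m' \<in> BB" using EB m m' by simp
      fix a x assume a: "a \<in> CC" and x: "x \<in> HH"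
      show "E (m \<oplus>\<^bsub>A.MA\<^esub> m') (\<pi> a x) = (E m \<oplus>\<^bsub>BO\<^esub> E m') (\<pi> a x)"
        using Ea[OF cl(2) a x] Ea[OF m a x] Ea[OF m' a x] a x m m' by (simp add: \<pi>_add)
    qed (rule EB[OF cl(2)])
    show "E (m \<otimes>\<^bsub>A.MA\<^esub> m') = E m \<otimes>\<^bsub>BO\<^esub> E m'"
    proof (rule total_eq)
      show "E m \<otimes>\<^bsub>BO\<^esub> E m' \<in> BB" using EB m m' by simp
      fix a x assume a: "a \<in> CC" and x: "x \<in> HH"
      show "E (m \<otimes>\<^bsub>A.MA\<^esub> m') (\<pi> a x) = (E m \<otimes>\<^bsub>BO\<^esub> E m') (\<pi> a x)"
        using Ea[OF cl(1) a x] Ea[OF m' a x] Ea[OF m, of "fst m' a" x] a x m m' by (simp add: compose_eq)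
    qed (rule EB[OF cl(1)])
  next
    fix m c assume "m \<in> carrier A.MA"
    then have m: "m \<in> multipliers Cs" by simp
    note cl = A.MA_closed[OF m m]
    show "E m \<in> BB" using EB m by simp
    show "E (c \<odot>\<^bsub>A.MA\<^esub> m) = c \<odot>\<^bsub>BO\<^esub> E m"
    proof (rule total_eq)
      show "c \<odot>\<^bsub>BO\<^esub> E m \<in> BB" using EB m by simp
      fix a x assume a: "a \<in> CC" and x: "x \<in> HH"
      show "E (c \<odot>\<^bsub>A.MA\<^esub> m) (\<pi> a x) = (c \<odot>\<^bsub>BO\<^esub> E m) (\<pi> a x)"
        using Ea[OF cl(3) a x] Ea[OF m a x] a x m by (simp add: \<pi>_smult)
    qed (rule EB[OF cl(3)])
    have sB: "star BO (E m) \<in> BB" using star_BO(1)[OF EB[OF m]] .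
    show "E (star A.MA m) = star BO (E m)"
    proof (rule total_eq[OF EB[OF cl(4)] sB])
      fix b y assume b: "b \<in> CC" and y: "y \<in> HH"
      let ?w = "E (star A.MA m) (\<pi> b y) \<ominus>\<^bsub>H\<^esub> star BO (E m) (\<pi> b y)"
      have c: "E (star A.MA m) (\<pi> b y) \<in> HH" "star BO (E m) (\<pi> b y) \<in> HH" "\<pi> b y \<in> HH"
        using EB[OF cl(4)] sB b y by simp_all
      \<comment> \<open>Adjoints are compared by testing against the vectors
        \<open>\<pi> a x\<close>: the star of \<open>m\<close> brings in \<open>snd m\<close>, and
        the double centralizer identity turns it back into \<open>fst m\<close>.\<close>
      have "?w = \<zero>\<^bsub>H\<^esub>"
      proof (rule total_zero)
        fix a x assume a: "a \<in> CC" and x: "x \<in> HH"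
        have sb: "star Cs b \<in> CC" "snd m (star Cs b) \<in> CC" using b m by simp_all
        have "ip (\<pi> a x) (E (star A.MA m) (\<pi> b y)) = ip (\<pi> a x) (\<pi> (star Cs (snd m (star Cs b))) y)"
          using Ea[OF cl(4) b y] b by simp
        also have "\<dots> = ip (\<pi> (snd m (star Cs b)) (\<pi> a x)) y" using \<pi>_star[OF sb(2), of "\<pi> a x" y] a x y by simp
        also have "\<pi> (snd m (star Cs b)) (\<pi> a x) = \<pi> (snd m (star Cs b) \<otimes>\<^bsub>Cs\<^esub> a) x" using sb a x by (simp add: \<pi>_mult)
        also have "snd m (star Cs b) \<otimes>\<^bsub>Cs\<^esub> a = star Cs b \<otimes>\<^bsub>Cs\<^esub> fst m a" using A.multipliersD(5)[OF m sb(1) a] .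
        also have "\<pi> \<dots> x = \<pi> (star Cs b) (E m (\<pi> a x))" using Ea[OF m a x] sb a x m by (simp add: \<pi>_mult)
        also have "ip \<dots> y = ip (E m (\<pi> a x)) (\<pi> b y)" using \<pi>_star[OF sb(1), of "E m (\<pi> a x)" y] EB[OF m] a b x y by simp
        also have "\<dots> = ip (\<pi> a x) (star BO (E m) (\<pi> b y))" using star_BO(2)[OF EB[OF m], of "\<pi> a x" "\<pi> b y"] a x b y by simp
        finally show "ip (\<pi> a x) ?w = 0" using c a x by simp
      qed (use c in simp)
      then show "E (star A.MA m) (\<pi> b y) = star BO (E m) (\<pi> b y)" using c diff_eq_zero by blast
    qed
  qed (simp add: E_def)
  have me: "E (A.me b) = \<pi> b" if b: "b \<in> CC" for b
  proof (rule total_eq[OF EB[OF A.me_mult[OF b]] \<pi>_BO[OF b]])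
    fix a x assume "a \<in> CC" "x \<in> HH"
    then show "E (A.me b) (\<pi> a x) = \<pi> b (\<pi> a x)" using Ea[OF A.me_mult[OF b]] b by (simp add: A.me_apply \<pi>_mult)
  qed
  have "\<psi> = E"
  proof (rule A.multiplier_extensionI[OF hom me])
    fix m S S' assume S: "S \<in> BB" "S' \<in> BB" and e: "\<And>a. a \<in> CC ==> S \<otimes>\<^bsub>BO\<^esub> \<pi> a = S' \<otimes>\<^bsub>BO\<^esub> \<pi> a"
    show "S = S'"
    proof (rule total_eq[OF S])
      fix a x assume a: "a \<in> CC" and x: "x \<in> HH"
      show "S (\<pi> a x) = S' (\<pi> a x)" using fun_cong[OF e[OF a], of x] x by (simp add: compose_eq)
    qed
  qed
  then show "\<And>m. m \<in> multipliers Cs ==> \<psi> m \<in> BB"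
    "\<And>m a x. m \<in> multipliers Cs ==> a \<in> CC ==> x \<in> HH ==> \<psi> m (\<pi> a x) = \<pi> (fst m a) x"
    using EB Ea by simp_all
qed

section \<open>The corresponding unitary representation\<close>

abbreviation v where "v \<equiv> corresponding_rep G T H \<pi>"

lemma v:
  assumes g: "g \<in> GG"
  shows "v g \<in> BB" "\<And>a x. a \<in> CC ==> x \<in> HH ==> v g (\<pi> a x) = \<pi> (Lm g a) x"
  using \<psi>[OF Lm_Rm_multiplier[OF g]] g by (simp_all add: corresponding_rep_def canonical_unitary_eq)

lemma v_extensional: "v \<in> extensional GG"
  by (simp add: corresponding_rep_def)

lemma v_mult: assumes "g \<in> GG" "h \<in> GG" "x \<in> HH" shows "v (g \<otimes> h) x = v g (v h x)"
proof -
  have "v (g \<otimes> h) = compose (HH) (v g) (v h)"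
    by (rule total_eq) (use assms v in \<open>simp_all add: compose_eq Lm_mult\<close>)
  then show ?thesis using assms by (simp add: compose_eq)
qed

lemma v_one: assumes "x \<in> HH" shows "v \<one> x = x"
proof -
  have "v \<one> = (\<lambda>x\<in>HH. x)"
    by (rule total_eq) (use v in \<open>simp_all add: Lm_one\<close>)
  then show ?thesis using assms by simp
qed

text \<open>The kernel is closed because \<open>g \<mapsto> \<pi> (u\<^sub>g f) \<xi>\<close> is uniformly continuous for \<open>f \<in> C(G)\<close>.\<close>

lemma kernel_closed: "closedin T {g \<in> GG. \<forall>x\<in>HH. v g x = x}"
proof -
  let ?K = "{g \<in> GG. \<forall>x\<in>HH. v g x = x}"
  have fixed: "\<pi> (\<iota> (lt g f)) = \<pi> (\<iota> f)" if g: "g \<in> ?K" and f: "f \<in> CF" for g f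
    by (rule BO_eqI) (use v(2)[of g "\<iota> f"] g f in \<open>simp_all add: Lm(2)\<close>)
  have "openin T (GG - ?K)"
  proof (subst openin_subopen, intro ballI)
    fix g assume g: "g \<in> GG - ?K"
    then have gG: "g \<in> GG" by simp
    \<comment> \<open>If \<open>\<pi>\<close> could not see the translation by \<open>g\<close> on
      continuous functions, density and nondegeneracy would make \<open>v g\<close> the
      identity.\<close>
    have "\<exists>f\<in>CF. \<pi> (\<iota> (lt g f)) \<noteq> \<pi> (\<iota> f)"
    proof (rule ccontr)
      assume c: "\<not> ?thesis"
      have "{a \<in> CC. \<pi> (Lm g a) = \<pi> a} = CC"
        by (rule closed_subspace_iota[OF A.equalizer_closed[OF normed_module_BO bounded_between_comp[OF A.bounded_between_map[OF Lm(1)[OF gG]] \<pi>_bounded] \<pi>_bounded]])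
          (use c gG in \<open>simp add: Lm(2)\<close>)
      then have "\<pi> (Lm g a) = \<pi> a" if "a \<in> CC" for a using that by blast
      then have "v g = (\<lambda>x\<in>HH. x)" by (intro total_eq[OF v(1)[OF gG] id_BO]) (simp add: v(2) gG)
      then show False using g by simp
    qed
    then obtain f where f: "f \<in> CF" and ne: "\<pi> (\<iota> (lt g f)) \<noteq> \<pi> (\<iota> f)" by blast
    have lg: "lt g f \<in> CF" using f gG by simp
    define r where "r = opn (\<pi> (\<iota> (lt g f)) \<ominus>\<^bsub>BO\<^esub> \<pi> (\<iota> f))"
    have "r > 0" using ne f lg B.eqI_dist[of "\<pi> (\<iota> (lt g f))" "\<pi> (\<iota> f)"] unfolding r_def by force
    then obtain N where N: "N \<in> NN" "osc N (lt g f) (r / 2)" using cont_osc[OF lg, of "r / 2"] by auto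
    let ?W = "{h \<in> GG. N #> g = N #> h}"
    have "openin T ?W" by (rule coset_union_open[OF N(1)]) auto
    moreover have "h \<notin> ?K" if h: "h \<in> ?W" for h
    proof
      assume hK: "h \<in> ?K"
      define n where "n = h \<otimes> inv g"
      have n: "n \<in> N" using r_coset_eq_iff[OF NN_subgroup[OF N(1)] _ gG, of h] h by (simp add: n_def)
      have nG: "n \<in> GG" using NN_mem[OF N(1) n] .
      have nh: "lt n (lt g f) = lt h f" using lt_lt[OF f nG gG] h gG by (simp add: n_def m_assoc)
      \<comment> \<open>An element \<open>h\<close> of the kernel in the same coset of
        \<open>N\<close> as \<open>g\<close> gives
        \<open>\<pi> (\<iota> (lt h f)) = \<pi> (\<iota> f)\<close>, so \<open>r\<close> would be
        bounded by the oscillation \<open>r / 2\<close>.\<close>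
      have "r = opn (\<pi> (\<iota> (lt n (lt g f)) \<ominus>\<^bsub>Cs\<^esub> \<iota> (lt g f)))"
        using B.nrm_diff_swap[of "\<pi> (\<iota> (lt g f))" "\<pi> (\<iota> (lt h f))"] lg f h
        unfolding r_def nh fixed[OF hK f, symmetric] by (simp add: \<pi>_minus)
      also have "\<dots> \<le> anorm Cs (\<iota> (lt n (lt g f)) \<ominus>\<^bsub>Cs\<^esub> \<iota> (lt g f))" using lg nG by (intro \<pi>_contractive) simp
      also have "\<dots> \<le> r / 2" using lt_small[OF lg N n] lg nG by (simp add: iota_diff[symmetric] norm_iota)
      finally show False using \<open>r > 0\<close> by simp
    qed
    ultimately show "\<exists>W. openin T W \<and> g \<in> W \<and> W \<subseteq> GG - ?K" using gG by (intro exI[of _ ?W]) blast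
  qed
  then show ?thesis by (simp add: closedin_def Collect_restrict)
qed

text \<open>Triviality of \<open>v\<close> on \<open>M\<close> means that \<open>\<pi>\<close> kills
  every \<open>u\<^sub>m h - h\<close>; by \<open>average_principle\<close> it kills
  \<open>e\<^sub>M h - h\<close> too, so \<open>p M\<close> acts as the identity on all vectors
  \<open>\<pi> a x\<close>.\<close>

lemma trivial_on_N:
  assumes N: "N \<in> NN" and t: "\<And>n x. n \<in> N ==> x \<in> HH ==> v n x = x"
    and M: "M \<in> NN" "M \<subseteq> N" and x: "x \<in> HH"
  shows "p M x = x"
proof -
  let ?e = "\<iota> (eM M)"
  have ec: "?e \<in> CC" using M by simp
  note S = A.equalizer_closed[OF normed_module_BO \<pi>_bounded A.bounded_between_zero[OF normed_module_BO]]
  have key: "\<pi> (?e \<otimes>\<^bsub>Cs\<^esub> \<iota> h) = \<pi> (\<iota> h)" if h: "h \<in> CF" for h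
  proof -
    have "\<iota> (conv (eM M) h) \<ominus>\<^bsub>Cs\<^esub> \<iota> h \<in> {a \<in> CC. \<pi> a = \<zero>\<^bsub>BO\<^esub>}"
    proof (rule average_principle[OF S h M(1)])
      fix m assume m: "m \<in> M"
      have mG: "m \<in> GG" using NN_mem[OF M(1) m] .
      have "\<pi> (\<iota> (lt m h) \<ominus>\<^bsub>Cs\<^esub> \<iota> h) = \<zero>\<^bsub>BO\<^esub>"
      proof (rule BO_eqI)
        fix y assume y: "y \<in> HH"
        have "\<pi> (\<iota> (lt m h)) y = \<pi> (\<iota> h) y" using v(2)[OF mG, of "\<iota> h" y] t[of m "\<pi> (\<iota> h) y"] m M h y mG by (auto simp: Lm(2))
        then show "\<pi> (\<iota> (lt m h) \<ominus>\<^bsub>Cs\<^esub> \<iota> h) y = \<zero>\<^bsub>BO\<^esub> y" using h mG y diff_self[of "\<pi> (\<iota> h) y"] by (simp add: \<pi>_diff)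
      qed (use h mG in simp_all)
      then show "\<iota> (lt m h) \<ominus>\<^bsub>Cs\<^esub> \<iota> h \<in> {a \<in> CC. \<pi> a = \<zero>\<^bsub>BO\<^esub>}" using h mG by simp
    qed
    then have z: "\<pi> (?e \<otimes>\<^bsub>Cs\<^esub> \<iota> h \<ominus>\<^bsub>Cs\<^esub> \<iota> h) = \<zero>\<^bsub>BO\<^esub>" using M h by (simp add: iota_ops)
    show ?thesis
    proof (rule BO_eqI)
      fix y assume y: "y \<in> HH"
      show "\<pi> (?e \<otimes>\<^bsub>Cs\<^esub> \<iota> h) y = \<pi> (\<iota> h) y"
        by (rule diff_eq_zero) (use fun_cong[OF z, of y] ec h y in \<open>simp_all add: \<pi>_diff\<close>)
    qed (use ec h in simp_all)
  qed
  have "{a \<in> CC. \<pi> (?e \<otimes>\<^bsub>Cs\<^esub> a) = \<pi> a} = CC"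
    by (rule closed_subspace_iota[OF A.equalizer_closed[OF normed_module_BO bounded_between_comp[OF A.bounded_between_mult(1)[OF ec] \<pi>_bounded] \<pi>_bounded]])
      (use key in simp)
  then have "\<pi> (?e \<otimes>\<^bsub>Cs\<^esub> a) = \<pi> a" if "a \<in> CC" for a using that by blast
  then have "p M = (\<lambda>x\<in>HH. x)"
    by (intro total_eq) (use ec in \<open>simp_all add: \<pi>_mult[symmetric]\<close>)
  then show ?thesis using x by simp
qed

end

section \<open>Integrated representations\<close>

context hilbert
begin

lemma seminormed_star_algebra_BO: "seminormed_star_algebra BO"
proof -
  have "seminormed_module BO (anorm BO)" using normed_module_BO by (simp add: normed_module_def)
  then show ?thesis
  proof (rule seminormed_star_algebra.intro, unfold_locales)
    fix S S' assume S: "S \<in> BB" and S': "S' \<in> BB"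
    have st: "star BO S \<in> BB" "star BO S' \<in> BB" using star_BO(1) S S' by blast+
    show "S \<otimes>\<^bsub>BO\<^esub> S' \<in> BB" "anorm BO (S \<otimes>\<^bsub>BO\<^esub> S') \<le> anorm BO S * anorm BO S'" using S S' by simp_all
    show "star BO S \<in> BB" "star BO (star BO S) = S" "anorm BO (star BO S) = anorm BO S"
      using S star_BO(1) star_star_BO opn_star_eq by simp_all
    show "(k \<odot>\<^bsub>BO\<^esub> S) \<otimes>\<^bsub>BO\<^esub> S' = k \<odot>\<^bsub>BO\<^esub> (S \<otimes>\<^bsub>BO\<^esub> S')" for k
      by (rule BO_eqI) (use S S' in \<open>simp_all add: compose_eq\<close>)
    show "S \<otimes>\<^bsub>BO\<^esub> (k \<odot>\<^bsub>BO\<^esub> S') = k \<odot>\<^bsub>BO\<^esub> (S \<otimes>\<^bsub>BO\<^esub> S')" for k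
      by (rule BO_eqI) (use S S' in \<open>simp_all add: compose_eq BO_smult\<close>)
    show "star BO (S \<oplus>\<^bsub>BO\<^esub> S') = star BO S \<oplus>\<^bsub>BO\<^esub> star BO S'"
      by (rule star_BO_eqI) (use S S' st in \<open>simp_all add: star_BO(2)\<close>)
    show "star BO (k \<odot>\<^bsub>BO\<^esub> S) = cnj k \<odot>\<^bsub>BO\<^esub> star BO S" for k
      by (rule star_BO_eqI) (use S st in \<open>simp_all add: star_BO(2)\<close>)
    show "star BO (S \<otimes>\<^bsub>BO\<^esub> S') = star BO S' \<otimes>\<^bsub>BO\<^esub> star BO S"
      by (rule star_BO_eqI) (use S S' st in \<open>simp_all add: star_BO(2) compose_eq\<close>)
    fix R assume R: "R \<in> BB"
    show "(S \<otimes>\<^bsub>BO\<^esub> S') \<otimes>\<^bsub>BO\<^esub> R = S \<otimes>\<^bsub>BO\<^esub> (S' \<otimes>\<^bsub>BO\<^esub> R)"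
      "(S \<oplus>\<^bsub>BO\<^esub> S') \<otimes>\<^bsub>BO\<^esub> R = S \<otimes>\<^bsub>BO\<^esub> R \<oplus>\<^bsub>BO\<^esub> S' \<otimes>\<^bsub>BO\<^esub> R"
      "S \<otimes>\<^bsub>BO\<^esub> (S' \<oplus>\<^bsub>BO\<^esub> R) = S \<otimes>\<^bsub>BO\<^esub> S' \<oplus>\<^bsub>BO\<^esub> S \<otimes>\<^bsub>BO\<^esub> R"
      by (rule BO_eqI; use S S' R in \<open>simp add: compose_eq BO_add\<close>)+
  qed
qed

text \<open>The limit is formed pointwise, and its linearity is read off from inner products.
  Completeness is what allows an integrated form to extend to the group algebra with operators as
  values.\<close>

theorem banach_BO: "banach_star_algebra BO"
proof (rule banach_star_algebra.intro[OF seminormed_star_algebra_BO], rule banach_star_algebra_axioms.intro)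
  show "S = \<zero>\<^bsub>BO\<^esub>" if "S \<in> BB" "anorm BO S = 0" for S
    using B.nrm_definite that by simp
  fix u :: "nat \<Rightarrow> 'h \<Rightarrow> 'h" assume u: "\<And>n. u n \<in> BB"
    and c: "\<And>e. e > 0 ==> \<exists>N. \<forall>m\<ge>N. \<forall>n\<ge>N. anorm BO (u m \<ominus>\<^bsub>BO\<^esub> u n) < e"
  have d: "hn (u m x \<ominus> u n x) \<le> opn (u m \<ominus>\<^bsub>BO\<^esub> u n) * hn x" if x: "x \<in> HH" for m n x
    using BO_bound[of "u m \<ominus>\<^bsub>BO\<^esub> u n" x] u x by (simp add: B.diff_eq diff_eq)
  have "\<exists>y. y \<in> HH \<and> tends (\<lambda>n. u n x) y" if x: "x \<in> HH" for x
  proof -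
    have "\<exists>N. \<forall>m\<ge>N. \<forall>n\<ge>N. hn (u m x \<ominus> u n x) < e" if e: "e > 0" for e
    proof -
      have p: "hn x + 1 > 0" using hn_nonneg[OF x] by linarith
      then obtain N where N: "\<forall>m\<ge>N. \<forall>n\<ge>N. opn (u m \<ominus>\<^bsub>BO\<^esub> u n) < e / (hn x + 1)" using c[of "e / (hn x + 1)"] e by auto
      have "hn (u m x \<ominus> u n x) < e" if "m \<ge> N" "n \<ge> N" for m n
      proof -
        have l: "opn (u m \<ominus>\<^bsub>BO\<^esub> u n) * (hn x + 1) < e" using N that p by (simp add: pos_less_divide_eq)
        have "opn (u m \<ominus>\<^bsub>BO\<^esub> u n) \<ge> 0" using u by (intro opn_nonneg) auto
        then show ?thesis using d[OF x, of m n] l by (simp add: algebra_simps)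
      qed
      then show ?thesis by blast
    qed
    then show ?thesis by (rule complete[of "\<lambda>n. u n x", rotated]) (use u x in auto)
  qed
  then obtain L where L: "\<And>x. x \<in> HH ==> L x \<in> HH" "\<And>x. x \<in> HH ==> tends (\<lambda>n. u n x) (L x)"
    by metis
  have lim: "(\<lambda>n. ip (u n x) z) \<longlonglongrightarrow> ip (L x) z" if "x \<in> HH" "z \<in> HH" for x z
    using tends_ip[OF L(2)] L(1) u that by simp
  have near: "hn (u n x \<ominus> L x) \<le> e * hn x" if N: "\<forall>m\<ge>N. \<forall>n\<ge>N. opn (u m \<ominus>\<^bsub>BO\<^esub> u n) < e" and n: "n \<ge> N" and x: "x \<in> HH" for N n x e
  proof (rule LIMSEQ_le_const)
    show "(\<lambda>m. e * hn x + hn (u m x \<ominus> L x)) \<longlonglongrightarrow> e * hn x"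
      using tendsto_add[OF tendsto_const L(2)[OF x, unfolded tends_def], of "e * hn x"] by simp
    have "hn (u n x \<ominus> L x) \<le> e * hn x + hn (u m x \<ominus> L x)" if "m \<ge> N" for m
    proof -
      have "opn (u n \<ominus>\<^bsub>BO\<^esub> u m) * hn x \<le> e * hn x"
        by (rule mult_right_mono[OF less_imp_le hn_nonneg[OF x]]) (use N n that in blast)
      then show ?thesis using d[OF x, of n m] nrm_diff_triangle[of "u n x" "u m x" "L x"] L(1) u x by simp
    qed
    then show "\<exists>M. \<forall>m\<ge>M. hn (u n x \<ominus> L x) \<le> e * hn x + hn (u m x \<ominus> L x)" by blast
  qed
  obtain N where N: "\<forall>m\<ge>N. \<forall>n\<ge>N. opn (u m \<ominus>\<^bsub>BO\<^esub> u n) < 1" using c[of 1] by auto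
  let ?L = "restrict L (HH)"
  have LB: "?L \<in> BB"
  proof (rule BO_I[where c = "opn (u N) + 1"])
    fix x assume x: "x \<in> HH"
    show "?L (k \<odot> x) = k \<odot> ?L x" for k
    proof (rule ip_ext)
      fix z assume z: "z \<in> HH"
      show "ip (?L (k \<odot> x)) z = ip (k \<odot> ?L x) z"
        using LIMSEQ_unique[OF lim[of "k \<odot> x" z]] tendsto_mult_left[OF lim[OF x z], of k] x z u L(1)
        by (simp add: BO_smult)
    qed (use x L(1) in simp_all)
    show "?L (x \<oplus> y) = ?L x \<oplus> ?L y" if y: "y \<in> HH" for y
    proof (rule ip_ext)
      fix z assume z: "z \<in> HH"
      show "ip (?L (x \<oplus> y)) z = ip (?L x \<oplus> ?L y) z"
        using LIMSEQ_unique[OF lim[of "x \<oplus> y" z]] tendsto_add[OF lim[OF x z] lim[OF y z]] x y z u L(1)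
        by (simp add: BO_add)
    qed (use x y L(1) in simp_all)
    have "hn (L x) \<le> hn (u N x) + hn (u N x \<ominus> L x)"
      using nrm_triangle_rev[of "u N x" "L x"] u L(1) x by simp
    also have "\<dots> \<le> (opn (u N) + 1) * hn x" using BO_bound[of "u N" x] near[OF N _ x, of N] u x by (simp add: distrib_right)
    finally show "hn (?L x) \<le> (opn (u N) + 1) * hn x" using x by simp
  qed (use L(1) in simp_all)
  have "B.tends u ?L" unfolding B.tends_def
  proof (rule LIMSEQ_I)
    fix e :: real assume e: "e > 0"
    obtain N where N: "\<forall>m\<ge>N. \<forall>n\<ge>N. opn (u m \<ominus>\<^bsub>BO\<^esub> u n) < e / 2" using c[of "e / 2"] e by auto
    have "opn (u n \<ominus>\<^bsub>BO\<^esub> ?L) \<le> e / 2" if "n \<ge> N" for n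
    proof (rule opn_le)
      fix x assume x: "x \<in> HH"
      show "hn ((u n \<ominus>\<^bsub>BO\<^esub> ?L) x) \<le> e / 2 * hn x"
        using near[OF N that x] u LB L(1) x by (simp add: B.diff_eq diff_eq)
    qed (use e in simp)
    moreover have "opn (u n \<ominus>\<^bsub>BO\<^esub> ?L) \<ge> 0" for n using u LB by (intro opn_nonneg) auto
    ultimately have "norm (opn (u n \<ominus>\<^bsub>BO\<^esub> ?L) - 0) < e" if "n \<ge> N" for n using that e by fastforce
    then show "\<exists>N. \<forall>n\<ge>N. norm (opn (u n \<ominus>\<^bsub>BO\<^esub> ?L) - 0) < e" by blast
  qed
  then show "\<exists>S\<in>BB. seminormed_module.tends BO (anorm BO) u S" using LB by auto
qed

end

lemma (in banach_star_algebra) emb_bij: "inj_on emb (AA)" "emb ` AA = carrier C"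
proof -
  show "inj_on emb (AA)"
  proof (rule inj_onI)
    fix a b assume a: "a \<in> AA" "b \<in> AA" "emb a = emb b"
    have "nm (a \<ominus> b) = 0" using norm_emb[of "a \<ominus> b"] a norm_emb[of "\<zero>"] emb_diff[of a b] emb_diff[of b b] by simp
    then show "a = b" using a nrm_definite[of "a \<ominus> b"] diff_eq_zero[of a b] by simp
  qed
  have "cls V \<in> emb ` AA" if V: "V \<in> CS" for V
  proof -
    obtain x where x: "x \<in> AA" "tends V x" using complete[of V] V CS_cauchy[OF V] by auto
    have "cls V = emb x" using cls_eqI[OF V const_CS[OF x(1)]] x by (simp add: tends_def emb)
    then show ?thesis using x by blast
  qed
  then show "emb ` AA = carrier C" using emb by (auto simp: carrier_C)
qed

text \<open>\<open>ext\<close> takes values in the completion of the target; for a complete target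
  the inverse of the embedding brings them back (\<open>emb_bij\<close>).\<close>

lemma (in contraction) lift:
  assumes "banach_star_algebra Q"
  obtains \<phi> where "\<And>a. a \<in> carrier P ==> \<phi> (P.emb a) = \<theta> a" "\<And>a. a \<in> carrier P.C ==> anorm Q (\<phi> a) \<le> anorm P.C a"
    "(\<And>a b. a \<in> carrier P ==> b \<in> carrier P ==> \<theta> (a \<otimes>\<^bsub>P\<^esub> b) = \<theta> a \<otimes>\<^bsub>Q\<^esub> \<theta> b) ==>
      (\<And>a. a \<in> carrier P ==> \<theta> (star P a) = star Q (\<theta> a)) ==> \<phi> \<in> star_homs P.C Q"
proof -
  interpret Q: banach_star_algebra Q by fact
  define \<phi> where "\<phi> = (\<lambda>a\<in>carrier P.C. inv_into (carrier Q) Q.emb (ext a))"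
  have \<phi>: "\<phi> a \<in> carrier Q" "Q.emb (\<phi> a) = ext a" if "a \<in> carrier P.C" for a
    using that ext_closed[OF that] inv_into_into[of "ext a" Q.emb "carrier Q"] f_inv_into_f[of "ext a" Q.emb "carrier Q"] Q.emb_bij(2)
    by (simp_all add: \<phi>_def)
  have eq: "\<phi> a = b" if "a \<in> carrier P.C" "b \<in> carrier Q" "ext a = Q.emb b" for a b
    using inj_onD[OF Q.emb_bij(1)] \<phi>[OF that(1)] that by simp
  note cl = banach_star_algebra.axioms(1)[OF P.banach_C]
  interpret PC: seminormed_star_algebra P.C by (rule cl)
  show ?thesis
  proof (rule that)
    show "\<phi> (P.emb a) = \<theta> a" if "a \<in> carrier P" for a by (rule eq) (use that \<theta>_closed in \<open>simp_all add: P.emb ext_emb[symmetric]\<close>)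
    show "anorm Q (\<phi> a) \<le> anorm P.C a" if "a \<in> carrier P.C" for a using ext_le[OF that] Q.norm_emb[OF \<phi>(1)[OF that]] \<phi>(2)[OF that] by simp
    assume m: "\<And>a b. a \<in> carrier P ==> b \<in> carrier P ==> \<theta> (a \<otimes>\<^bsub>P\<^esub> b) = \<theta> a \<otimes>\<^bsub>Q\<^esub> \<theta> b"
      "\<And>a. a \<in> carrier P ==> \<theta> (star P a) = star Q (\<theta> a)"
    show "\<phi> \<in> star_homs P.C Q"
    proof (rule star_homsI)
      fix a assume a: "a \<in> carrier P.C"
      show "\<phi> a \<in> carrier Q" by (rule \<phi>(1)[OF a])
      show "\<phi> (k \<odot>\<^bsub>P.C\<^esub> a) = k \<odot>\<^bsub>Q\<^esub> \<phi> a" for k using a \<phi>[OF a] ext_smult[OF a, of k] Q.emb_ops(3)[of "\<phi> a" k] by (intro eq) simp_all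
      show "\<phi> (star P.C a) = star Q (\<phi> a)" using a \<phi>[OF a] ext_star[OF m(2) a] Q.emb_ops(4)[of "\<phi> a"] by (intro eq) simp_all
      fix b assume b: "b \<in> carrier P.C"
      show "\<phi> (a \<oplus>\<^bsub>P.C\<^esub> b) = \<phi> a \<oplus>\<^bsub>Q\<^esub> \<phi> b" using a b \<phi>[OF a] \<phi>[OF b] ext_add[OF a b] Q.emb_ops(1)[of "\<phi> a" "\<phi> b"] by (intro eq) simp_all
      show "\<phi> (a \<otimes>\<^bsub>P.C\<^esub> b) = \<phi> a \<otimes>\<^bsub>Q\<^esub> \<phi> b" using a b \<phi>[OF a] \<phi>[OF b] ext_mult[OF m(1) a b] Q.emb_ops(2)[of "\<phi> a" "\<phi> b"] by (intro eq) simp_all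
    qed (simp add: \<phi>_def)
  qed
qed

context unitary_rep
begin

lemma vf_eM_fixed:
  assumes N: "N \<in> NN" and x: "x \<in> HH" and t: "\<And>n. n \<in> N ==> v n x = x" shows "vf (eM N) x = x"
proof (rule ip_ext)
  fix y assume y: "y \<in> HH"
  have "cmod (haar (\<lambda>t\<in>GG. eM N t * coef x y t) - ip x y) \<le> 0"
    by (rule eM_haar[OF N coef_cont[OF x y]]) (use t NN_mem[OF N] in \<open>simp add: coef_apply\<close>)
  then show "ip (vf (eM N) x) y = ip x y" using vf(2)[OF eM_cont[OF N] x y] by (simp add: coef_apply cong: restrict_cong)
qed (use x vf(1)[OF eM_cont[OF N]] in simp_all)

text \<open>\<open>vf_le_un\<close> is precisely the contractivity that lets \<open>vf\<close>
  extend from functions to the completion.\<close>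

theorem integrated_rep:
  obtains \<pi> where "\<pi> \<in> star_homs Cs BO" "\<And>f. f \<in> CF ==> \<pi> (\<iota> f) = vf f"
proof -
  interpret c: contraction P BO vf
    by (intro contraction.intro contraction_axioms.intro P.seminormed_star_algebra_axioms seminormed_star_algebra_BO)
      (simp_all add: vf vf_add vf_smult vf_le_un)
  obtain \<pi> where p: "\<And>a. a \<in> carrier P ==> \<pi> (P.emb a) = vf a"
    "(\<And>a b. a \<in> carrier P ==> b \<in> carrier P ==> vf (a \<otimes>\<^bsub>P\<^esub> b) = vf a \<otimes>\<^bsub>BO\<^esub> vf b) ==>
      (\<And>a. a \<in> carrier P ==> vf (star P a) = star BO (vf a)) ==> \<pi> \<in> star_homs P.C BO"
    using c.lift[OF banach_BO] by metis
  show ?thesis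
    by (rule that[of \<pi>]) (use p in \<open>simp_all add: Cs_completion vf_conv vf_star\<close>)
qed

end

context pro_group
begin

text \<open>On \<open>\<iota> f\<close> the norm is a supremum over integrated representations, and
  a general \<open>b\<close> is approximated by such an element. This reduces contractivity of
  homomorphisms into the group algebra to \<open>star_hom_contractive\<close>.\<close>

lemma norm_le_of_reps:
  assumes b: "b \<in> CC"
    and h: "\<And>(K :: ('g \<Rightarrow> complex) hilbert) \<pi>. hilbert_space K ==> \<pi> \<in> star_homs Cs (bounded_ops K) ==> op_norm K (hnorm K) (\<pi> b) \<le> c"
  shows "anorm Cs b \<le> c"
proof (rule field_le_epsilon)
  fix e :: real assume e: "e > 0"
  obtain f where f: "f \<in> CF" "anorm Cs (\<iota> f \<ominus>\<^bsub>Cs\<^esub> b) < e/2" using iota_dense[OF b, of "e/2"] e by auto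
  have "un f \<le> c + e/2"
  proof (rule un_least)
    fix K :: "('g \<Rightarrow> complex) hilbert" and v assume K: "hilbert_space K" "v \<in> unitary_reps G T K"
    interpret W: unitary_rep G T K v by (rule unitary_rep_intro[OF K])
    obtain \<pi> where \<pi>: "\<pi> \<in> star_homs Cs W.BO" "\<And>f. f \<in> CF ==> \<pi> (\<iota> f) = W.vf f" using W.integrated_rep by blast
    note P = star_homsD[OF \<pi>(1)]
    have "\<pi> (\<iota> f \<ominus>\<^bsub>Cs\<^esub> b) = \<pi> (\<iota> f) \<ominus>\<^bsub>W.BO\<^esub> \<pi> b" using P f b by (simp add: A.diff_eq W.B.diff_eq)
    then have "W.opn (W.vf f \<ominus>\<^bsub>W.BO\<^esub> \<pi> b) < e/2"
      using A.star_hom_contractive[OF K(1) \<pi>(1), of "\<iota> f \<ominus>\<^bsub>Cs\<^esub> b"] f b \<pi>(2) by simp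
    then show "W.opn (W.vf f) \<le> c + e/2"
      using W.B.nrm_triangle_rev[of "W.vf f" "\<pi> b"] h[OF K(1) \<pi>(1)] W.vf(1)[OF f(1)] P(2)[OF b] by simp
  qed
  then show "anorm Cs b \<le> c + e"
    using f A.nrm_triangle_rev[of "\<iota> f" b] b by (simp add: norm_iota)
qed

lemma star_hom_into_contractive:
  assumes "banach_star_algebra B" and \<phi>: "\<phi> \<in> star_homs B Cs" and b: "b \<in> carrier B"
  shows "anorm Cs (\<phi> b) \<le> anorm B b"
proof (rule norm_le_of_reps)
  note h = star_homsD[OF \<phi>]
  interpret B: banach_star_algebra B by fact
  show "\<phi> b \<in> CC" using h(2) b .
  fix K :: "('g \<Rightarrow> complex) hilbert" and \<pi> assume K: "hilbert_space K" and \<pi>: "\<pi> \<in> star_homs Cs (bounded_ops K)"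
  note p = star_homsD[OF \<pi>]
  have "(\<lambda>b\<in>carrier B. \<pi> (\<phi> b)) \<in> star_homs B (bounded_ops K)"
    by (rule star_homsI) (use h p in simp_all)
  then show "op_norm K (hnorm K) (\<pi> (\<phi> b)) \<le> anorm B b" using B.star_hom_contractive[OF K] b by fastforce
qed

end

section \<open>Quotients by normal subgroups of finite index\<close>

locale finite_quotient = pro_group G T for G :: "('g, 'm) monoid_scheme" (structure) and T +
  fixes N assumes N: "N \<in> finite_index_normal G T"
begin

abbreviation Q where "Q \<equiv> G Mod N"
abbreviation QQ where "QQ \<equiv> carrier Q"
abbreviation D where "D \<equiv> discrete_topology (carrier (G Mod N))"
abbreviation q where "q x \<equiv> N #> x"

lemmas normal = NN_normal[OF N]

lemma carrier_Q: "QQ = rcosets N"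
  by (simp add: FactGroup_def)

lemma q_closed [simp]: "x \<in> GG ==> q x \<in> QQ"
  using coset_in[OF N] by (simp add: carrier_Q)

lemma q_rep: "C \<in> QQ ==> rep C \<in> GG" "C \<in> QQ ==> q (rep C) = C"
  using rep[OF N] by (simp_all add: carrier_Q)

lemma q_mult:
  assumes "x \<in> GG" "y \<in> GG" shows "q x \<otimes>\<^bsub>Q\<^esub> q y = q (x \<otimes> y)" "q x <#> q y = q (x \<otimes> y)"
  using normal.rcos_sum[OF normal assms] by simp_all

lemma q_one: "\<one>\<^bsub>Q\<^esub> = q \<one>" "n \<in> N ==> q n = q \<one>" "q \<one> = N"
  using coset_mult_one[OF subgroup.subset[OF NN_subgroup[OF N]]] coset_mem(1)[OF N, of n \<one>] NN_mem[OF N, of n]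
  by (simp_all add: FactGroup_def)

lemma group_Q: "group Q"
  by (rule normal.factorgroup_is_group[OF normal])

lemma q_inv: assumes "x \<in> GG" shows "inv\<^bsub>Q\<^esub> (q x) = q (inv x)"
  by (rule group.inv_equality[OF group_Q]) (use assms q_mult[of "inv x" x] q_one in simp_all)

text \<open>The trivial subgroup of a finite discrete group has finite index and lies in every
  neighbourhood of the identity. Everything proved for \<open>G\<close> thereby becomes available
  for the quotient, under the prefix \<open>F\<close>.\<close>

lemma pro_group_Q: "pro_group Q D" and trivial_NN: "{\<one>\<^bsub>Q\<^esub>} \<in> finite_index_normal Q D"
proof -
  interpret Q: group Q by (rule group_Q)
  have fin: "finite (QQ)" using NN_finite[OF N] by (simp add: carrier_Q)
  have "rcosets\<^bsub>Q\<^esub> {\<one>\<^bsub>Q\<^esub>} \<subseteq> Pow (QQ)"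
    using Q.rcosets_subset_PowG[OF Q.triv_subgroup] .
  then have "finite (rcosets\<^bsub>Q\<^esub> {\<one>\<^bsub>Q\<^esub>})" using fin finite_subset by blast
  then show t: "{\<one>\<^bsub>Q\<^esub>} \<in> finite_index_normal Q D"
    using Q.one_is_normal q_closed[OF one_closed] q_one(3) by (simp add: finite_index_normal_def)
  have pd: "prod_topology D D = discrete_topology (QQ \<times> QQ)"
  proof -
    have "openin (prod_topology D D) {(a, b)}" if "a \<in> QQ" "b \<in> QQ" for a b
      using openin_prod_Times_iff[of D D "{a}" "{b}"] that by simp
    then have "discrete_topology (QQ \<times> QQ) = prod_topology D D"
      unfolding discrete_topology_unique by auto
    then show ?thesis by (rule sym)
  qed
  have "topological_group Q D" unfolding topological_group_def pd
    using Q.is_group Q.m_closed by (auto simp: continuous_map_def)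
  then show "pro_group Q D"
    by (intro pro_group.intro group_Q pro_group_axioms.intro)
      (use fin t in \<open>auto simp: compact_space_discrete_topology\<close>)
qed

sublocale F: pro_group Q D by (rule pro_group_Q)

lemma CF_Q: "k \<in> extensional (QQ) ==> k \<in> F.CF"
  by (simp add: cont_funs_def)

text \<open>Identifies functions on the quotient with functions on \<open>G\<close> constant on
  cosets. It respects convolution and involution (\<open>sharp_ops\<close>), and
  \<open>un_sharp\<close> with \<open>un_\<theta>\<close> makes it isometric for the universal
  norms.\<close>

definition sharp :: "('g set \<Rightarrow> complex) \<Rightarrow> 'g \<Rightarrow> complex" where "sharp k = (\<lambda>s\<in>GG. k (q s))"

lemma sharp_osc: "osc N (sharp k) 0"
  by (rule oscI) (simp add: sharp_def)

lemma sharp_cont [simp]: "sharp k \<in> CF"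
  by (rule invariant_cont[OF N _ sharp_osc]) (simp add: sharp_def)

lemma sharp_apply [simp]: "s \<in> GG ==> sharp k s = k (q s)"
  by (simp add: sharp_def)

lemma sharp_inj: assumes "k \<in> F.CF" "l \<in> F.CF" "sharp k = sharp l" shows "k = l"
proof (rule F.cont_eqI[OF assms(1,2)])
  fix C assume C: "C \<in> QQ"
  show "k C = l C" using fun_cong[OF assms(3), of "rep C"] q_rep[OF C] by simp
qed

text \<open>Pulling back and integrating over \<open>G\<close> is a left invariant normalised
  functional on the quotient, so \<open>functional_unique\<close> applies there.\<close>

lemma haar_sharp: assumes k: "k \<in> F.CF" shows "haar (sharp k) = F.haar k"
proof -
  have r: "sharp (\<lambda>C\<in>QQ. \<phi> C) = (\<lambda>s\<in>GG. \<phi> (q s))" for \<phi> by (simp add: sharp_def cong: restrict_cong)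
  have "haar (sharp k) = F.haar0 k"
  proof (rule F.functional_unique[where \<mu> = "\<lambda>k. haar (sharp k)" and K = 1])
    show "F.functional (\<lambda>k. haar (sharp k))" unfolding F.functional_def
      using haar_add[OF sharp_cont sharp_cont] haar_smult[OF sharp_cont] by (simp add: r cong: restrict_cong)
    show "haar (sharp (\<lambda>x\<in>QQ. 1)) = 1" using haar_const[of 1] by (simp add: r)
    show "cmod (haar (sharp f)) \<le> 1 * B" if "f \<in> F.CF" "\<And>x. x \<in> QQ ==> cmod (f x) \<le> B" for f B
      using haar_bound[of "sharp f" B] that by simp
    fix g f assume g: "g \<in> QQ"
    show "haar (sharp (\<lambda>x\<in>QQ. f (g \<otimes>\<^bsub>Q\<^esub> x))) = haar (sharp f)"
      using haar_left[OF sharp_cont[of f] q_rep(1)[OF g]] q_rep[OF g] q_mult[of "rep g"] by (simp add: r cong: restrict_cong)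
  qed (rule k)
  then show ?thesis using F.haar_haar0[OF k] by simp
qed

lemma haar_F: "\<phi> \<in> CF ==> (\<And>s. s \<in> GG ==> \<phi> s = k (q s)) ==> F.haar (\<lambda>C\<in>QQ. k C) = haar \<phi>"
proof -
  assume "\<phi> \<in> CF" "\<And>s. s \<in> GG ==> \<phi> s = k (q s)"
  then have "sharp (\<lambda>C\<in>QQ. k C) = \<phi>" by (intro cont_eqI) simp_all
  then show ?thesis using haar_sharp[of "\<lambda>C\<in>QQ. k C"] CF_Q by simp
qed

lemma sharp_ops:
  "sharp (\<lambda>C\<in>QQ. k C + l C) = (\<lambda>s\<in>GG. sharp k s + sharp l s)"
  "sharp (\<lambda>C\<in>QQ. c * k C) = (\<lambda>s\<in>GG. c * sharp k s)"
  "sharp (F.inv_cnj k) = inv_cnj (sharp k)"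
  "sharp (F.conv k l) = conv (sharp k) (sharp l)"
proof -
  show "sharp (\<lambda>C\<in>QQ. k C + l C) = (\<lambda>s\<in>GG. sharp k s + sharp l s)"
    "sharp (\<lambda>C\<in>QQ. c * k C) = (\<lambda>s\<in>GG. c * sharp k s)"
    by (simp_all add: sharp_def cong: restrict_cong)
  show "sharp (F.inv_cnj k) = inv_cnj (sharp k)"
    by (rule cont_eqI) (simp_all add: inv_cnj_apply F.inv_cnj_apply q_inv)
  show "sharp (F.conv k l) = conv (sharp k) (sharp l)"
  proof (rule cont_eqI)
    fix s assume s: "s \<in> GG"
    have "F.haar (\<lambda>C\<in>QQ. k C * l (inv\<^bsub>Q\<^esub> C \<otimes>\<^bsub>Q\<^esub> q s)) = haar (\<lambda>t\<in>GG. sharp k t * sharp l (inv t \<otimes> s))"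
      by (rule haar_F) (use s in \<open>simp_all add: conv_integrand q_inv q_mult\<close>)
    then show "sharp (F.conv k l) s = conv (sharp k) (sharp l) s" using s by (simp add: conv_apply F.conv_apply)
  qed simp_all
qed

section \<open>Averaging over cosets and descending to the quotient\<close>

abbreviation e where "e \<equiv> eM N"

lemma e_cont [simp]: "e \<in> CF"
  by (rule eM_cont[OF N])

lemma e_e: "conv e e = e"
  by (rule eM_absorb'[OF N N subset_refl])

lemma e_sharp: "conv e (sharp k) = sharp k"
  by (rule eM_conv_invariant[OF N sharp_cont sharp_osc])

text \<open>Once \<open>e\<close> is moved to the right by \<open>eM_commute\<close>, the variable
  occurs only inside \<open>e\<close>, which is constant on cosets.\<close>

lemma e_osc: assumes f: "f \<in> CF" shows "osc N (conv e f) 0"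
proof (rule oscI)
  fix x y assume x: "x \<in> GG" "y \<in> GG" "q x = q y"
  have "e (inv t \<otimes> x) = e (inv t \<otimes> y)" if t: "t \<in> GG" for t
    using oscD[OF eM_osc[OF N], of "inv t \<otimes> x" "inv t \<otimes> y"] coset_mult[OF N, of "inv t" x "inv t" y] x t by simp
  then show "cmod (conv e f x - conv e f y) \<le> 0"
    using x unfolding eM_commute[OF N f] by (simp add: conv_apply cong: restrict_cong)
qed

text \<open>By \<open>sharp_\<theta>\<close> the pullback of \<open>\<theta> f\<close> is
  \<open>conv e f\<close>, the mean of \<open>f\<close> over cosets. This is \<open>kappa\<close>
  before completion.\<close>

definition \<theta> :: "('g \<Rightarrow> complex) \<Rightarrow> 'g set \<Rightarrow> complex" where "\<theta> f = (\<lambda>C\<in>QQ. conv e f (rep C))"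

lemma \<theta>_cont [simp]: "\<theta> f \<in> F.CF"
  by (rule CF_Q) (simp add: \<theta>_def)

lemma sharp_\<theta>: assumes f: "f \<in> CF" shows "sharp (\<theta> f) = conv e f"
proof (rule cont_eqI)
  fix s assume s: "s \<in> GG"
  show "sharp (\<theta> f) s = conv e f s"
    using oscD[OF e_osc[OF f] q_rep(1)[OF q_closed[OF s]] s] q_rep(2)[OF q_closed[OF s]] s by (simp add: \<theta>_def)
qed (use f in simp_all)

lemma \<theta>_eqI: "f \<in> CF ==> k \<in> F.CF ==> conv e f = sharp k ==> \<theta> f = k"
  by (rule sharp_inj) (simp_all add: sharp_\<theta>)

lemma \<theta>_sharp: "k \<in> F.CF ==> \<theta> (sharp k) = k"
  by (rule \<theta>_eqI) (simp_all add: e_sharp)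

lemma \<theta>_ops:
  assumes f: "f \<in> CF" and h: "h \<in> CF"
  shows "\<theta> (\<lambda>s\<in>GG. f s + h s) = (\<lambda>C\<in>QQ. \<theta> f C + \<theta> h C)"
    "\<theta> (\<lambda>s\<in>GG. c * f s) = (\<lambda>C\<in>QQ. c * \<theta> f C)"
    "\<theta> (conv f h) = F.conv (\<theta> f) (\<theta> h)"
    "\<theta> (inv_cnj f) = F.inv_cnj (\<theta> f)"
proof -
  show "\<theta> (\<lambda>s\<in>GG. f s + h s) = (\<lambda>C\<in>QQ. \<theta> f C + \<theta> h C)"
    by (rule \<theta>_eqI) (use f h in \<open>simp_all add: sharp_ops sharp_\<theta> conv_add_right\<close>)
  show "\<theta> (\<lambda>s\<in>GG. c * f s) = (\<lambda>C\<in>QQ. c * \<theta> f C)"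
    by (rule \<theta>_eqI) (use f in \<open>simp_all add: sharp_ops sharp_\<theta> conv_smult_right\<close>)
  have "conv (conv e f) (conv e h) = conv f (conv e (conv e h))"
    using f h by (simp add: eM_commute[OF N f] conv_assoc)
  also have "\<dots> = conv (conv f e) h" using f h conv_assoc[of e e h] by (simp add: e_e conv_assoc)
  also have "\<dots> = conv e (conv f h)" using f h by (simp add: eM_commute[OF N f, symmetric] conv_assoc)
  finally have "conv e (conv f h) = conv (conv e f) (conv e h)" by (rule sym)
  then show "\<theta> (conv f h) = F.conv (\<theta> f) (\<theta> h)"
    by (intro \<theta>_eqI) (use f h in \<open>simp_all add: sharp_ops sharp_\<theta>\<close>)
  show "\<theta> (inv_cnj f) = F.inv_cnj (\<theta> f)"
    by (rule \<theta>_eqI) (use f in \<open>simp_all add: sharp_ops sharp_\<theta> inv_cnj_conv inv_cnj_eM[OF N] eM_commute[OF N]\<close>)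
qed

lemma \<theta>_lt: assumes f: "f \<in> CF" and g: "g \<in> GG" shows "\<theta> (lt g f) = F.lt (q g) (\<theta> f)"
proof (rule \<theta>_eqI)
  have "conv e (lt g f) = conv (lt g f) e" by (rule eM_commute[OF N]) (use f g in simp)
  also have "\<dots> = lt g (conv e f)" using f g by (simp add: lt_conv[symmetric] eM_commute[OF N])
  also have "\<dots> = sharp (F.lt (q g) (\<theta> f))"
  proof (rule cont_eqI)
    fix s assume s: "s \<in> GG"
    show "lt g (conv e f) s = sharp (F.lt (q g) (\<theta> f)) s"
      using s g fun_cong[OF sharp_\<theta>[OF f], of "inv g \<otimes> s"] by (simp add: lt_apply F.lt_apply q_inv q_mult)
  qed (use f g in simp_all)
  finally show "conv e (lt g f) = sharp (F.lt (q g) (\<theta> f))" .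
qed (use f g in simp_all)

end

section \<open>Universal norms on the group and on the quotient\<close>

context finite_quotient
begin

text \<open>Representations of the quotient inflate to \<open>G\<close>. There \<open>e\<close> acts
  as the identity (\<open>vf_eM_fixed\<close>), so \<open>f\<close> and \<open>conv e f\<close> have
  the same integrated form, which is that of \<open>\<theta> f\<close>.\<close>

lemma un_\<theta>: assumes f: "f \<in> CF" shows "F.un (\<theta> f) \<le> un f"
proof (rule F.un_least)
  fix K :: "('g set \<Rightarrow> complex) hilbert" and w assume K: "hilbert_space K" "w \<in> unitary_reps Q D K"
  interpret W: unitary_rep Q D K w by (rule F.unitary_rep_intro[OF K])
  interpret PH: pro_hilbert G T K by (intro pro_hilbert.intro pro_group_axioms W.hilbert_axioms)
  define v where "v = (\<lambda>g\<in>GG. w (q g))"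
  have v: "v \<in> unitary_reps G T K"
  proof (rule PH.unitary_repsI)
    fix g h x assume g: "g \<in> GG" and h: "h \<in> GG" and x: "x \<in> carrier K"
    show "v (g \<otimes> h) x = v g (v h x)" using g h x W.v_mult[of "q g" "q h" x] by (simp add: v_def q_mult)
  next
    fix g x y assume "g \<in> GG" "x \<in> carrier K" "y \<in> carrier K"
    then show "W.ip (v g x) (v g y) = W.ip x y" by (simp add: v_def W.v_ip)
  next
    show "v \<one> x = x" if "x \<in> carrier K" for x using that W.v_one[of x] q_one by (simp add: v_def)
    have "v n x = x" if "x \<in> carrier K" "n \<in> N" for n x
      using that W.v_one[of x] q_one NN_mem[OF N] by (simp add: v_def)
    then show "\<exists>N\<in>NN. \<forall>n\<in>N. W.hn (v n x \<ominus>\<^bsub>K\<^esub> x) < e" if "x \<in> carrier K" "e > 0" for x and e :: real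
      using that N by (intro bexI[of _ N]) (simp_all add: W.diff_self)
  qed (simp_all add: v_def)
  interpret V: unitary_rep G T K v by (rule unitary_rep_intro[OF K(1) v])
  have ve: "V.vf e z = z" if z: "z \<in> carrier K" for z
    by (rule V.vf_eM_fixed[OF N z]) (use NN_mem[OF N] W.v_one[OF z] q_one in \<open>simp add: v_def\<close>)
  have "W.vf (\<theta> f) = V.vf f"
  proof (rule W.vf_eqI[OF \<theta>_cont V.vf(1)[OF f]])
    fix x y assume x: "x \<in> carrier K" and y: "y \<in> carrier K"
    have ec: "conv e f \<in> CF" using f by simp
    have "F.haar (\<lambda>C\<in>QQ. \<theta> f C * W.ip (w C x) y) = haar (\<lambda>s\<in>GG. conv e f s * W.ip (v s x) y)"
    proof (rule haar_F)
      show "(\<lambda>s\<in>GG. conv e f s * W.ip (v s x) y) \<in> CF" by (rule V.form_cont[OF ec x y])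
      fix s assume s: "s \<in> GG"
      then show "(\<lambda>s\<in>GG. conv e f s * W.ip (v s x) y) s = \<theta> f (q s) * W.ip (w (q s) x) y"
        using fun_cong[OF sharp_\<theta>[OF f], of s] by (simp add: v_def)
    qed
    also have "\<dots> = W.ip (V.vf (conv e f) x) y" by (rule V.vf(2)[OF ec x y, symmetric])
    also have "\<dots> = W.ip (V.vf f x) y" using V.vf_conv[OF e_cont f] x ve[of "V.vf f x"] V.vf(1)[OF f] by (simp add: compose_eq)
    finally show "F.haar (\<lambda>C\<in>QQ. \<theta> f C * W.ip (w C x) y) = W.ip (V.vf f x) y" .
  qed
  then show "W.opn (W.vf (\<theta> f)) \<le> un f" using V.vf_le_un[OF f] by simp
qed

text \<open>The vectors fixed by \<open>N\<close> carry a representation of the quotient, and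
  \<open>e\<close> acts as a self-adjoint contraction into them. As \<open>sharp k\<close> absorbs
  \<open>e\<close> on both sides, its form is controlled by that subspace.\<close>

lemma un_sharp: assumes k: "k \<in> F.CF" shows "un (sharp k) \<le> F.un k"
proof (rule un_least)
  fix H :: "('g \<Rightarrow> complex) hilbert" and v assume H: "hilbert_space H" "v \<in> unitary_reps G T H"
  interpret V: unitary_rep G T H v by (rule unitary_rep_intro[OF H])
  interpret PH: pro_hilbert Q D H by (intro pro_hilbert.intro pro_group_Q V.hilbert_axioms)
  define K where "K = {x \<in> carrier H. \<forall>n\<in>N. v n x = x}"
  have Kv: "v n x = x" if "x \<in> K" "n \<in> N" for x n using that unfolding K_def by blast
  have KI: "x \<in> K" if "x \<in> carrier H" "\<And>n. n \<in> N ==> v n x = x" for x using that unfolding K_def by blast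
  have K: "V.closed_subspace K"
  proof (rule V.closed_subspaceI)
    fix x assume x: "x \<in> carrier H" and c: "\<And>e. e > 0 ==> \<exists>y\<in>K. V.hn (y \<ominus>\<^bsub>H\<^esub> x) < e"
    have "v n x = x" if n: "n \<in> N" for n
    proof -
      have "V.closed_subspace {x \<in> carrier H. v n x = (\<lambda>x\<in>carrier H. x) x}"
        by (rule V.closed_subspace_BO_eq) (use NN_mem[OF N n] in simp_all)
      moreover have "\<exists>y\<in>{x \<in> carrier H. v n x = (\<lambda>x\<in>carrier H. x) x}. V.hn (y \<ominus>\<^bsub>H\<^esub> x) < d" if "d > 0" for d
        using c[OF that] n unfolding K_def by fastforce
      ultimately have "x \<in> {x \<in> carrier H. v n x = (\<lambda>x\<in>carrier H. x) x}" using x unfolding V.closed_subspace_def by blast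
      then show ?thesis using x by simp
    qed
    then show "x \<in> K" by (rule KI[OF x])
  qed (use NN_mem[OF N] in \<open>auto simp: K_def V.BO_add V.BO_smult\<close>)
  have Kc [simp]: "x \<in> carrier H" if "x \<in> K" for x using V.closed_subspaceD(1)[OF K that] .
  have vq: "v s x = v t x" if s: "s \<in> GG" and t: "t \<in> GG" and st: "q s = q t" and x: "x \<in> K" for s t x
  proof -
    have "q (inv t \<otimes> s) = N" using coset_mult[OF N, of "inv t" s "inv t" t] s t st q_one by simp
    then have "inv t \<otimes> s \<in> N" using coset_mem_iff[OF N NN_rcoset[OF N]] s t by simp
    then have "v (t \<otimes> (inv t \<otimes> s)) x = v t x" using V.v_mult[of t "inv t \<otimes> s" x] s t x Kv[OF x] by simp
    then show ?thesis using s t by (simp add: inv_mult_cancel)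
  qed
  \<comment> \<open>On \<open>K\<close> the choice of representative is immaterial by
    \<open>vq\<close>, and the group law for \<open>U\<close> is claimed just there.\<close>
  define U where "U C = v (rep C)" for C
  have U: "U (q s) x = v s x" if "s \<in> GG" "x \<in> K" for s x
    unfolding U_def using vq[OF q_rep(1) _ _ that(2)] q_rep(2) that by simp
  have UK: "U C x \<in> K" if C: "C \<in> QQ" and x: "x \<in> K" for C x
  proof -
    have "v n (v (rep C) x) = v (rep C) x" if n: "n \<in> N" for n
      using vq[of "n \<otimes> rep C" "rep C" x] V.v_mult[of n "rep C" x] coset_mem(1)[OF N n q_rep(1)[OF C]] q_rep(1)[OF C] NN_mem[OF N n] x by simp
    then show ?thesis unfolding U_def by (intro KI V.BO_closed[OF V.v_BO[OF q_rep(1)[OF C]] Kc[OF x]])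
  qed
  define w where "w = (\<lambda>C\<in>QQ. \<lambda>a\<in>(\<lambda>x. x) ` K. U C (inv_into K (\<lambda>x. x) a))"
  \<comment> \<open>Transport along the identity only cuts the space down to
    \<open>K\<close>.\<close>
  have J: "inj_on (\<lambda>x. x) K" by simp
  have m: "U (C \<otimes>\<^bsub>Q\<^esub> C') x = U C (U C' x)" if "C \<in> QQ" "C' \<in> QQ" "x \<in> K" for C C' x
  proof -
    have "U (q (rep C \<otimes> rep C')) x = U C (U C' x)"
      using that q_rep(1) V.v_mult[of "rep C" "rep C'" x] by (simp add: U) (simp add: U_def)
    then show ?thesis using q_mult(1)[of "rep C" "rep C'"] q_rep that by simp
  qed
  have one: "U \<one>\<^bsub>Q\<^esub> x = x" if "x \<in> K" for x using U[OF one_closed that] V.v_one[of x] that q_one by simp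
  have tr: "w \<in> unitary_reps Q D (V.transport K (\<lambda>x. x))"
    "\<And>y z. y \<in> K ==> z \<in> K ==> hinner (V.transport K (\<lambda>x. x)) (integrated_form Q D (V.transport K (\<lambda>x. x)) w k y) z = F.haar (\<lambda>C\<in>QQ. k C * V.ip (U C y) z)"
    unfolding w_def
  proof -
    have sm: "\<exists>M\<in>F.NN. \<forall>n\<in>M. V.hn (U n x \<ominus>\<^bsub>H\<^esub> x) < d" if "x \<in> K" "d > 0" for x d
      using that one trivial_NN by (intro bexI[of _ "{\<one>\<^bsub>Q\<^esub>}"]) (simp_all add: V.diff_self)
    have UB: "U C \<in> carrier V.BO" if "C \<in> QQ" for C using q_rep(1)[OF that] by (simp add: U_def)
    have iso: "V.ip (U C x) (U C y) = V.ip x y" if "C \<in> QQ" "x \<in> K" "y \<in> K" for C x y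
      using V.v_ip[of "rep C" x y] that q_rep(1) by (simp add: U_def)
    note t = PH.transport_rep[OF K J UB UK m one iso sm]
    show "(\<lambda>C\<in>QQ. \<lambda>a\<in>(\<lambda>x. x) ` K. U C (inv_into K (\<lambda>x. x) a)) \<in> unitary_reps Q D (V.transport K (\<lambda>x. x))"
      by (rule t(1))
    show "hinner (V.transport K (\<lambda>x. x)) (integrated_form Q D (V.transport K (\<lambda>x. x)) (\<lambda>C\<in>QQ. \<lambda>a\<in>(\<lambda>x. x) ` K. U C (inv_into K (\<lambda>x. x) a)) k y) z
        = F.haar (\<lambda>C\<in>QQ. k C * V.ip (U C y) z)" if "y \<in> K" "z \<in> K" for y z
      by (rule t(2)[OF _ _ _ _ _ _ _ _ _ _ _ _ k that])
  qed
  have hs: "hilbert_space (V.transport K (\<lambda>x. x))" by (rule V.hilbert_space_transport[OF K J])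
  interpret W: unitary_rep Q D "V.transport K (\<lambda>x. x)" w by (rule F.unitary_rep_intro[OF hs tr(1)])
  note ts = V.transport_simps[OF K J]
  have bound: "cmod (V.ip (V.vf (sharp k) x) y) \<le> F.un k * V.hn x * V.hn y" if x: "x \<in> K" and y: "y \<in> K" for x y
  proof -
    have "F.haar (\<lambda>C\<in>QQ. k C * V.ip (U C x) y) = haar (\<lambda>s\<in>GG. sharp k s * V.ip (v s x) y)"
      by (rule haar_F[OF V.form_cont]) (use x y U in simp_all)
    then have "cmod (V.ip (V.vf (sharp k) x) y) = cmod (W.ip (W.vf k x) y)"
      using V.vf(2)[OF sharp_cont] tr(2)[OF x y] x y by simp
    also have "\<dots> \<le> W.opn (W.vf k) * V.hn x * V.hn y"
      using W.BO_ip_bound[OF W.vf(1)[OF k], of x y] x y by (simp add: ts)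
    also have "\<dots> \<le> F.un k * V.hn x * V.hn y"
      using W.vf_le_un[OF k] x y by (intro mult_right_mono) simp_all
    finally show ?thesis .
  qed
  let ?E = "V.vf e"
  have EB: "?E \<in> carrier V.BO" by (rule V.vf(1)) simp
  have E: "?E x \<in> K" "V.hn (?E x) \<le> V.hn x" if x: "x \<in> carrier H" for x
  proof -
    have "v n (?E x) = ?E x" if n: "n \<in> N" for n
    proof -
      have nG: "n \<in> GG" by (rule NN_mem[OF N n])
      have "lt n e = e"
      proof (rule cont_eqI)
        fix s assume s: "s \<in> GG"
        have "q (inv n \<otimes> s) = q s" using coset_mem(1)[OF N _ s, of "inv n"] N_inv[OF N nG] n by simp
        then show "lt n e s = e s" using coset_mem_iff[OF N NN_rcoset[OF N]] nG s by (simp add: lt_apply eM_def)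
      qed (use nG in simp_all)
      then show ?thesis using V.vf_left[OF e_cont nG x] by (simp add: lt_def)
    qed
    then show "?E x \<in> K" by (intro KI V.BO_closed[OF EB x])
    have "V.opn ?E \<le> 1" using V.vf_le_un[OF e_cont] un_eM[OF N] by linarith
    then show "V.hn (?E x) \<le> V.hn x" using V.BO_bound[OF EB x] mult_right_mono[of "V.opn ?E" 1 "V.hn x"] x by simp
  qed
  have Est: "star V.BO ?E = ?E" using V.vf_star[OF e_cont] by (simp add: inv_cnj_eM[OF N])
  have un0: "F.un k \<ge> 0" by (rule F.un_nonneg[OF k])
  show "V.opn (V.vf (sharp k)) \<le> F.un k"
  proof (rule V.opn_le_form[OF V.vf(1)[OF sharp_cont] un0])
    fix x y assume x: "x \<in> carrier H" and y: "y \<in> carrier H"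
    let ?S = "V.vf (sharp k)"
    have SB: "?S \<in> carrier V.BO" by (rule V.vf(1)[OF sharp_cont])
    have "?S x = ?E (?S x)" using fun_cong[OF V.vf_conv[OF e_cont sharp_cont, of k], of x] x by (simp add: e_sharp compose_eq)
    moreover have "?S x = ?S (?E x)"
      using fun_cong[OF V.vf_conv[OF sharp_cont e_cont, of k], of x] x by (simp add: e_sharp eM_commute[OF N sharp_cont, symmetric] compose_eq)
    ultimately have "V.ip (?S x) y = V.ip (?S (?E x)) (?E y)"
      using V.star_BO(2)[OF EB _ y, of "?S (?E x)"] Est SB EB x by simp
    then have "cmod (V.ip (?S x) y) \<le> F.un k * V.hn (?E x) * V.hn (?E y)" using bound[OF E(1)[OF x] E(1)[OF y]] by simp
    also have "\<dots> \<le> F.un k * V.hn x * V.hn y"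
      using un0 E[OF x] E[OF y] x EB y by (intro mult_mono) (simp_all add: mult_left_mono)
    finally show "cmod (V.ip (?S x) y) \<le> F.un k * V.hn x * V.hn y" .
  qed
qed

end

section \<open>Existence and uniqueness of \<open>kappa\<close>\<close>

context finite_quotient
begin

text \<open>Keeps the identity of the quotient from being rewritten to the set \<open>N\<close>, so
  that \<open>unit\<close> and the facts about it keep matching.\<close>

declare one_FactGroup [simp del]

lemma contraction_\<theta>: "contraction P F.P \<theta>"
  by unfold_locales (simp_all add: \<theta>_ops un_\<theta>)

lemma contraction_sharp: "contraction F.P P sharp"
  by unfold_locales (simp_all add: sharp_ops un_sharp)

definition \<kappa> where "\<kappa> = contraction.ext P F.P \<theta>"

text \<open>The delta function at the identity, multiplied by the order of the quotient since Haar
  measure has mass 1; it is the unit of the algebra of the finite group.\<close>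

abbreviation unit where "unit \<equiv> F.\<iota> (F.eM {\<one>\<^bsub>Q\<^esub>})"

text \<open>The extension of \<open>sharp\<close> is a right inverse because
  \<open>\<theta> (sharp k) = k\<close>, which gives surjectivity. In the other order it yields
  \<open>\<iota> e \<otimes> a\<close>, and its contractivity is the final estimate.\<close>

lemma \<kappa>:
  shows "\<kappa> \<in> star_homs Cs F.Cs" and "\<And>f. f \<in> CF ==> \<kappa> (\<iota> f) = F.\<iota> (\<theta> f)" and "\<kappa> ` CC = F.CC"
    and "\<And>a. a \<in> CC ==> anorm Cs (\<iota> e \<otimes>\<^bsub>Cs\<^esub> a) \<le> anorm F.Cs (\<kappa> a)"
proof -
  interpret c: contraction P F.P \<theta> by (rule contraction_\<theta>)
  interpret s: contraction F.P P sharp by (rule contraction_sharp)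
  note c = Cs_completion F.Cs_completion
  have "c.ext \<in> star_homs P.C F.P.C"
  proof (rule star_homsI)
    fix a assume a: "a \<in> carrier P.C"
    show "c.ext (star P.C a) = star F.P.C (c.ext a)" by (rule c.ext_star[OF _ a]) (simp add: \<theta>_ops)
    show "c.ext (a \<otimes>\<^bsub>P.C\<^esub> b) = c.ext a \<otimes>\<^bsub>F.P.C\<^esub> c.ext b" if b: "b \<in> carrier P.C" for b
      by (rule c.ext_mult[OF _ a b]) (simp add: \<theta>_ops)
  qed (simp_all only: c.ext_extensional c.ext_closed c.ext_add c.ext_smult)
  then show hom: "\<kappa> \<in> star_homs Cs F.Cs" unfolding \<kappa>_def c .
  show "\<And>f. f \<in> CF ==> \<kappa> (\<iota> f) = F.\<iota> (\<theta> f)" unfolding \<kappa>_def using c.ext_emb by simp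
  have inv: "\<kappa> (s.ext b) = b" if b: "b \<in> F.CC" for b
  proof -
    obtain V where V: "V \<in> F.P.CS" "b = F.P.cls V" using F.P.C_cases b unfolding c by blast
    have "\<theta> (sharp (V n)) = V n" for n using F.P.CS_D[OF V(1), of n] \<theta>_sharp by simp
    then show ?thesis unfolding \<kappa>_def V(2) s.ext_cls[OF V(1)] c.ext_cls[OF s.\<theta>_CS[OF V(1)]] by simp
  qed
  have sc: "s.ext b \<in> CC" if "b \<in> F.CC" for b using s.ext_closed[of b] that unfolding c .
  show "\<kappa> ` CC = F.CC" using star_homsD(2)[OF hom] inv sc by (auto simp: image_iff) metis
  fix a assume a: "a \<in> CC"
  obtain V where V: "V \<in> P.CS" "a = P.cls V" using P.C_cases a unfolding c by blast
  have "sharp (\<theta> (V n)) = conv e (V n)" for n using P.CS_D[OF V(1), of n] sharp_\<theta> by simp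
  then have "s.ext (\<kappa> a) = P.cls (\<lambda>n. conv e (V n))"
    unfolding \<kappa>_def V(2) c.ext_cls[OF V(1)] s.ext_cls[OF c.\<theta>_CS[OF V(1)]] by simp
  also have "\<dots> = \<iota> e \<otimes>\<^bsub>Cs\<^esub> a"
    using P.mult_C[OF P.const_CS[of e] V(1)] unfolding c V(2) by (simp add: P.emb)
  finally show "anorm Cs (\<iota> e \<otimes>\<^bsub>Cs\<^esub> a) \<le> anorm F.Cs (\<kappa> a)"
    using s.ext_le[of "\<kappa> a"] star_homsD(2)[OF hom a] unfolding c by simp
qed

lemma unit_closed [simp]: "unit \<in> F.CC"
  using F.eM_cont[OF trivial_NN] by simp

text \<open>The trivial subgroup lies in every \<open>M\<close>, so the approximate unit reaches it
  and the approximation becomes exact.\<close>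

lemma unit: "b \<in> F.CC ==> unit \<otimes>\<^bsub>F.Cs\<^esub> b = b" "b \<in> F.CC ==> b \<otimes>\<^bsub>F.Cs\<^esub> unit = b"
proof -
  have l: "unit \<otimes>\<^bsub>F.Cs\<^esub> b = b" if b: "b \<in> F.CC" for b
  proof (rule F.A.eqI_dist)
    show "anorm F.Cs (unit \<otimes>\<^bsub>F.Cs\<^esub> b \<ominus>\<^bsub>F.Cs\<^esub> b) \<le> 0"
    proof (rule field_le_epsilon)
      fix d :: real assume d: "d > 0"
      obtain M where M: "M \<in> F.NN" "\<forall>L\<in>F.NN. L \<subseteq> M \<longrightarrow> anorm F.Cs (F.\<iota> (F.eM L) \<otimes>\<^bsub>F.Cs\<^esub> b \<ominus>\<^bsub>F.Cs\<^esub> b) < d"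
        using F.approximate_unit[OF b d] by blast
      then show "anorm F.Cs (unit \<otimes>\<^bsub>F.Cs\<^esub> b \<ominus>\<^bsub>F.Cs\<^esub> b) \<le> 0 + d"
        using F.NN_one[OF M(1)] trivial_NN by fastforce
    qed
  qed (use b in simp_all)
  have st: "star F.Cs unit = unit"
    using F.iota_ops(4)[OF F.eM_cont[OF trivial_NN]] F.inv_cnj_eM[OF trivial_NN] by simp
  show "unit \<otimes>\<^bsub>F.Cs\<^esub> b = b" if "b \<in> F.CC" by (rule l[OF that])
  show "b \<otimes>\<^bsub>F.Cs\<^esub> unit = b" if b: "b \<in> F.CC"
  proof -
    have "star F.Cs (star F.Cs b \<otimes>\<^bsub>F.Cs\<^esub> star F.Cs unit) = b" if "star F.Cs b \<otimes>\<^bsub>F.Cs\<^esub> star F.Cs unit = star F.Cs b"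
      using that b by simp
    have "star F.Cs (b \<otimes>\<^bsub>F.Cs\<^esub> unit) = star F.Cs b" using F.A.star_mult[OF b unit_closed] st l[of "star F.Cs b"] b by simp
    then have "star F.Cs (star F.Cs (b \<otimes>\<^bsub>F.Cs\<^esub> unit)) = star F.Cs (star F.Cs b)" by simp
    then show ?thesis using F.A.star_star[of "b \<otimes>\<^bsub>F.Cs\<^esub> unit"] F.A.star_star[OF b] b by simp
  qed
qed

text \<open>Repeats the property under the \<open>THE\<close> of \<open>kappa\<close>;
  \<open>kappa_eq\<close> shows that \<open>\<kappa>\<close> is its only solution.\<close>

definition quotient_hom where
  "quotient_hom \<phi> \<longleftrightarrow> \<phi> \<in> star_homs Cs F.Cs \<and> \<phi> ` CC = F.CC \<and>
     (\<forall>g\<in>GG. multiplier_embedding F.Cs (multiplier_extension Cs F.Cs \<phi> (canonical_unitary G T g)) =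
       canonical_unitary Q D (g <# N))"

text \<open>The target has a unit, so \<open>extension_unital\<close> turns the canonical unitary
  into an element \<open>z\<close> with \<open>z\<close> times \<open>\<phi> a\<close> equal to
  \<open>\<phi> (Lm g a)\<close>. The condition on multipliers thus becomes an equation between
  bounded maps, to which density applies.\<close>

lemma quotient_hom_iff:
  assumes \<phi>: "\<phi> \<in> star_homs Cs F.Cs" "\<phi> ` CC = F.CC"
  shows "quotient_hom \<phi> \<longleftrightarrow> (\<forall>g\<in>GG. \<forall>a\<in>CC. \<phi> (Lm g a) = F.Lm (q g) (\<phi> a))"
proof -
  note E = A.extension_unital[OF F.A.seminormed_star_algebra_axioms \<phi> unit_closed unit]
  have "multiplier_embedding F.Cs (multiplier_extension Cs F.Cs \<phi> (canonical_unitary G T g)) = canonical_unitary Q D (g <# N)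
      \<longleftrightarrow> (\<forall>a\<in>CC. \<phi> (Lm g a) = F.Lm (q g) (\<phi> a))" if g: "g \<in> GG" for g
  proof -
    let ?C = "q g"
    define z where "z = multiplier_extension Cs F.Cs \<phi> (Lm g, Rm g)"
    have C: "?C \<in> QQ" using g by simp
    have m: "(Lm g, Rm g) \<in> multipliers Cs" by (rule Lm_Rm_multiplier[OF g])
    have z: "z \<in> F.CC" "\<And>a. a \<in> CC ==> z \<otimes>\<^bsub>F.Cs\<^esub> \<phi> a = \<phi> (Lm g a)"
      using star_homsD(2)[OF E(1), of "(Lm g, Rm g)"] E(2)[OF _ _ m] m by (simp_all add: z_def)
    have gN: "g <# N = ?C" using normal.coset_eq[OF normal] g by simp
    have "multiplier_embedding F.Cs z = (F.Lm ?C, F.Rm ?C) \<longleftrightarrow> (\<forall>a\<in>CC. \<phi> (Lm g a) = F.Lm ?C (\<phi> a))"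
    proof
      assume e: "multiplier_embedding F.Cs z = (F.Lm ?C, F.Rm ?C)"
      have "F.Lm ?C b = z \<otimes>\<^bsub>F.Cs\<^esub> b" if "b \<in> F.CC" for b
        using F.A.me_apply(1)[OF that, of z] unfolding e by simp
      then show "\<forall>a\<in>CC. \<phi> (Lm g a) = F.Lm ?C (\<phi> a)" using z(2) star_homsD(2)[OF \<phi>(1)] by simp
    next
      assume a: "\<forall>a\<in>CC. \<phi> (Lm g a) = F.Lm ?C (\<phi> a)"
      have l: "F.Lm ?C b = z \<otimes>\<^bsub>F.Cs\<^esub> b" if b: "b \<in> F.CC" for b
      proof -
        obtain a where "a \<in> CC" "b = \<phi> a" using b \<phi>(2) by blast
        then show ?thesis using a z(2) by simp
      qed
      note M = F.A.multipliersD[OF F.Lm_Rm_multiplier[OF C], unfolded fst_conv snd_conv]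
      \<comment> \<open>Evaluating the double centralizer identity at the unit recovers the right
        component from the left one.\<close>
      have r: "F.Rm ?C b = b \<otimes>\<^bsub>F.Cs\<^esub> z" if b: "b \<in> F.CC" for b
        using M(5)[OF b unit_closed] unit(2)[OF bounded_mapsD(2)[OF M(2) b]] l[OF unit_closed] unit(2)[OF z(1)] by simp
      have "F.Lm ?C = (\<lambda>b\<in>F.CC. z \<otimes>\<^bsub>F.Cs\<^esub> b)"
        by (rule extensionalityI[OF bounded_mapsD(1)[OF M(1)]]) (simp_all add: l)
      moreover have "F.Rm ?C = (\<lambda>b\<in>F.CC. b \<otimes>\<^bsub>F.Cs\<^esub> z)"
        by (rule extensionalityI[OF bounded_mapsD(1)[OF M(2)]]) (simp_all add: r)
      ultimately show "multiplier_embedding F.Cs z = (F.Lm ?C, F.Rm ?C)" by (simp add: multiplier_embedding_def)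
    qed
    then show ?thesis unfolding gN canonical_unitary_eq[OF g] F.canonical_unitary_eq[OF C] z_def .
  qed
  then show ?thesis using \<phi> by (simp add: quotient_hom_def)
qed

lemma hom_bounded: "\<phi> \<in> star_homs Cs F.Cs ==> bounded_between Cs (anorm Cs) F.Cs (anorm F.Cs) \<phi>"
  using bounded_between_star_hom F.star_hom_into_contractive[OF A.banach_star_algebra_axioms] by blast

lemma \<kappa>_quotient_hom: "quotient_hom \<kappa>"
  unfolding quotient_hom_iff[OF \<kappa>(1,3)]
proof (intro ballI)
  fix g a assume g: "g \<in> GG" and a: "a \<in> CC"
  let ?S = "{a \<in> CC. \<kappa> (Lm g a) = F.Lm (q g) (\<kappa> a)}"
  note \<kappa>_bounded = hom_bounded[OF \<kappa>(1)]
  have "?S = CC"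
  proof (rule closed_subspace_iota)
    show "A.closed_subspace ?S"
      by (rule A.equalizer_closed[OF F.A.normed_module_axioms]; rule bounded_between_comp)
        (rule A.bounded_between_map[OF Lm(1)[OF g]] F.A.bounded_between_map[OF F.Lm(1)[OF q_closed[OF g]]] \<kappa>_bounded)+
    show "\<iota> f \<in> ?S" if f: "f \<in> CF" for f
      using f g by (simp add: Lm(2) F.Lm(2) \<kappa>(2) \<theta>_lt)
  qed
  then show "\<kappa> (Lm g a) = F.Lm (q g) (\<kappa> a)" using a by blast
qed

text \<open>Elements \<open>m\<close> of \<open>M\<close> are trivial in the quotient, so
  \<open>\<phi>\<close> kills every \<open>u\<^sub>m f - f\<close> and, by averaging, every
  \<open>e\<^sub>M f - f\<close>; surjectivity then leaves only the unit as the value at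
  \<open>e\<^sub>M\<close>. Hence \<open>\<phi>\<close> is determined on the translates in
  \<open>density_principle\<close>.\<close>

lemma quotient_hom_eM:
  assumes \<phi>: "quotient_hom \<phi>" and g: "g \<in> GG" and M: "M \<in> NN" "M \<subseteq> N"
  shows "\<phi> (\<iota> (lt g (eM M))) = F.Lm (q g) unit"
proof -
  have h: "\<phi> \<in> star_homs Cs F.Cs" "\<phi> ` CC = F.CC" using \<phi> by (simp_all add: quotient_hom_def)
  have L: "\<phi> (Lm g a) = F.Lm (q g) (\<phi> a)" if "g \<in> GG" "a \<in> CC" for g a
    using \<phi> quotient_hom_iff[OF h] that by blast
  note k = star_homsD[OF h(1)]
  have dif: "\<phi> (a \<ominus>\<^bsub>Cs\<^esub> b) = \<phi> a \<ominus>\<^bsub>F.Cs\<^esub> \<phi> b" if "a \<in> CC" "b \<in> CC" for a b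
    using k that by (simp add: A.diff_eq F.A.diff_eq)
  let ?S = "{a \<in> CC. \<phi> a = \<zero>\<^bsub>F.Cs\<^esub>}" and ?e = "\<iota> (eM M)"
  have S: "A.closed_subspace ?S"
    by (rule A.equalizer_closed[OF F.A.normed_module_axioms hom_bounded[OF h(1)] A.bounded_between_zero[OF F.A.normed_module_axioms]])
  have ec: "?e \<in> CC" using M by simp
  have h1: "\<phi> ?e \<otimes>\<^bsub>F.Cs\<^esub> \<phi> (\<iota> f) = \<phi> (\<iota> f)" if f: "f \<in> CF" for f
  proof -
    have "\<iota> (conv (eM M) f) \<ominus>\<^bsub>Cs\<^esub> \<iota> f \<in> ?S"
    proof (rule average_principle[OF S f M(1)])
      fix m assume m: "m \<in> M"
      have mG: "m \<in> GG" and qm: "q m = \<one>\<^bsub>Q\<^esub>" using NN_mem[OF M(1) m] q_one m M(2) by auto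
      have "\<phi> (Lm m (\<iota> f)) = \<phi> (\<iota> f)" using L[OF mG, of "\<iota> f"] F.Lm_one k(2) f unfolding qm by simp
      then show "\<iota> (lt m f) \<ominus>\<^bsub>Cs\<^esub> \<iota> f \<in> ?S" using f mG k(2) by (simp add: dif Lm(2))
    qed
    then show ?thesis using F.A.diff_eq_zero[of "\<phi> (\<iota> (conv (eM M) f))" "\<phi> (\<iota> f)"] f M k(2,5) by (simp add: dif iota_ops)
  qed
  let ?S' = "{a \<in> CC. \<phi> ?e \<otimes>\<^bsub>F.Cs\<^esub> \<phi> a = \<phi> a}"
  have "?S' = CC"
  proof (rule closed_subspace_iota)
    show "A.closed_subspace ?S'"
      by (rule A.equalizer_closed[OF F.A.normed_module_axioms bounded_between_comp[OF hom_bounded[OF h(1)] F.A.bounded_between_mult(1)[OF k(2)[OF ec]]] hom_bounded[OF h(1)]])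
    show "\<iota> f \<in> ?S'" if "f \<in> CF" for f using h1[OF that] iota_closed[OF that] by blast
  qed
  moreover obtain a where a: "a \<in> CC" "\<phi> a = unit" using unit_closed unfolding h(2)[symmetric] by force
  ultimately have "a \<in> ?S'" by blast
  then have "\<phi> ?e = unit" using unit(2)[OF k(2)[OF ec]] a(2) by simp
  then show ?thesis using L[OF g ec] M g by (simp add: Lm(2))
qed

theorem kappa_eq: "kappa G T N = \<kappa>"
  unfolding kappa_def quotient_cstar_def
proof (rule the_equality, goal_cases)
  case 1
  show ?case using \<kappa>_quotient_hom unfolding quotient_hom_def by blast
next
  case (2 \<phi>)
  then have \<phi>: "quotient_hom \<phi>" unfolding quotient_hom_def by blast
  then have h: "\<phi> \<in> star_homs Cs F.Cs" by (simp add: quotient_hom_def)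
  have "{a \<in> CC. \<phi> a = \<kappa> a} = CC"
  proof (rule density_principle[OF A.equalizer_closed[OF F.A.normed_module_axioms hom_bounded[OF h] hom_bounded[OF \<kappa>(1)]] N])
    fix g M assume "g \<in> GG" "M \<in> NN" "M \<subseteq> N"
    then show "\<iota> (lt g (eM M)) \<in> {a \<in> CC. \<phi> a = \<kappa> a}"
      using quotient_hom_eM[OF \<phi>] quotient_hom_eM[OF \<kappa>_quotient_hom] by simp
  qed
  then show ?case by (intro extensionalityI[OF star_homsD(1)[OF h] star_homsD(1)[OF \<kappa>(1)]]) blast
qed

lemma \<kappa>_Lm: assumes "n \<in> N" "a \<in> CC" shows "\<kappa> (Lm n a) = \<kappa> a"
proof -
  have n: "n \<in> GG" "q n = \<one>\<^bsub>Q\<^esub>" using NN_mem[OF N] q_one assms by auto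
  have "\<kappa> (Lm n a) = F.Lm (q n) (\<kappa> a)" using \<kappa>_quotient_hom assms n(1) unfolding quotient_hom_iff[OF \<kappa>(1,3)] by blast
  also have "\<dots> = \<kappa> a" unfolding n(2) using F.Lm_one star_homsD(2)[OF \<kappa>(1) assms(2)] by blast
  finally show ?thesis .
qed

end

section \<open>Profinite groups\<close>

text \<open>The limit is closed in a product of finite discrete spaces, hence compact. A basic
  neighbourhood restricts finitely many coordinates; directedness gives one index \<open>k\<close>
  beyond all of them, and the kernel of the \<open>k\<close>-th coordinate lies inside.\<close>

theorem profinite_imp_pro_group:
  fixes G :: "('g, 'm) monoid_scheme" (structure)
  assumes "profinite_group TYPE('i) TYPE('f) G T"
  shows "pro_group G T"
proof -
  obtain I :: "'i set" and r and F :: "'i \<Rightarrow> 'f monoid" and \<phi> h where tg: "topological_group G T"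
    and S: "finite_inverse_system I r F \<phi>" and h: "h \<in> iso G (inverse_limit_group I r F \<phi>)"
    and hm: "homeomorphic_map T (inverse_limit_topology I r F \<phi>) h"
    using assms unfolding profinite_group_def by blast
  interpret group G using tg by (simp add: topological_group_def)
  have top: "topspace T = carrier G" using tg by (simp add: topological_group_def)
  have I: "I \<noteq> {}" and dir: "\<And>i j. i \<in> I ==> j \<in> I ==> \<exists>k\<in>I. (i, k) \<in> r \<and> (j, k) \<in> r" and po: "partial_order_on I r"
    and gF: "\<And>i. i \<in> I ==> group (F i)" and fF: "\<And>i. i \<in> I ==> finite (carrier (F i))"
    and \<phi>: "\<And>i j. i \<in> I ==> j \<in> I ==> (i, j) \<in> r ==> \<phi> i j \<in> hom (F j) (F i)"
    using S unfolding finite_inverse_system_def by blast+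
  let ?L = "inverse_limit_set I r F \<phi>" and ?X = "product_topology (\<lambda>i. discrete_topology (carrier (F i))) I"
  have LX: "?L \<subseteq> topspace ?X" by (auto simp: inverse_limit_set_def)
  have proj: "continuous_map ?X (discrete_topology (carrier (F i))) (\<lambda>x. x i)" if "i \<in> I" for i
    using continuous_map_product_projection[OF that] .
  have closed: "closedin ?X {x \<in> topspace ?X. \<phi> i j (x j) = x i}" if "i \<in> I" "j \<in> I" "(i, j) \<in> r" for i j
  proof (rule closedin_continuous_maps_eq[OF Hausdorff_space_discrete_topology _ proj[OF that(1)]])
    have "continuous_map (discrete_topology (carrier (F j))) (discrete_topology (carrier (F i))) (\<phi> i j)"
      using \<phi>[OF that] by (auto simp: hom_def)
    from continuous_map_compose[OF proj[OF that(2)] this]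
    show "continuous_map ?X (discrete_topology (carrier (F i))) (\<lambda>x. \<phi> i j (x j))" by (simp add: o_def)
  qed
  have "?L = topspace ?X \<inter> \<Inter> {{x \<in> topspace ?X. \<phi> i j (x j) = x i} | i j. i \<in> I \<and> j \<in> I \<and> (i, j) \<in> r}"
    by (auto simp: inverse_limit_set_def)
  also have "closedin ?X \<dots>"
  \<comment> \<open>\<open>closedin_Inter\<close> asks for a nonempty family; the intersection of
    the empty one is the whole type.\<close>
  proof (cases "{{x \<in> topspace ?X. \<phi> i j (x j) = x i} | i j. i \<in> I \<and> j \<in> I \<and> (i, j) \<in> r} = {}")
    case False
    then show ?thesis by (intro closedin_Int closedin_topspace closedin_Inter) (use closed in blast)+
  qed (metis Inter_empty Int_UNIV_right closedin_topspace)
  finally have "closedin ?X ?L" .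
  moreover have "compact_space ?X" using fF by (simp add: compact_space_product_topology compact_space_discrete_topology)
  ultimately have "compact_space (inverse_limit_topology I r F \<phi>)"
    unfolding inverse_limit_topology_def using closedin_compact_space compact_space_subtopology by blast
  then have cT: "compact_space T" using homeomorphic_compact_space[OF homeomorphic_map_imp_homeomorphic_space[OF hm]] by blast
  have hL: "h x \<in> ?L" if "x \<in> carrier G" for x using h that by (auto simp: iso_def hom_def inverse_limit_group_def)
  have hF: "h x i \<in> carrier (F i)" if "x \<in> carrier G" "i \<in> I" for x i using hL[OF that(1)] that(2) by (auto simp: inverse_limit_set_def)
  have hm_mult: "h (x \<otimes> y) i = h x i \<otimes>\<^bsub>F i\<^esub> h y i" if "x \<in> carrier G" "y \<in> carrier G" "i \<in> I" for x y i
    using h that by (simp add: iso_def hom_def inverse_limit_group_def)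
  have h1: "h \<one> i = \<one>\<^bsub>F i\<^esub>" if i: "i \<in> I" for i
  proof -
    interpret Fi: group "F i" by (rule gF[OF i])
    show ?thesis using hm_mult[OF one_closed one_closed i] hF[OF one_closed i] by simp
  qed
  have ch: "continuous_map T (discrete_topology (carrier (F i))) (\<lambda>x. h x i)" if i: "i \<in> I" for i
  proof -
    have "continuous_map T ?X h"
      using homeomorphic_imp_continuous_map[OF hm] by (simp add: inverse_limit_topology_def continuous_map_in_subtopology)
    from continuous_map_compose[OF this proj[OF i]] show ?thesis by (simp add: o_def)
  qed
  have dirJ: "\<exists>k\<in>I. \<forall>j\<in>J. (j, k) \<in> r" if "finite J" "J \<subseteq> I" for J
    using that
  proof (induction J)
    case empty
    then show ?case using I by blast
  next
    case (insert j J)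
    then obtain k where k: "k \<in> I" "\<forall>j\<in>J. (j, k) \<in> r" by auto
    obtain l where l: "l \<in> I" "(j, l) \<in> r" "(k, l) \<in> r" using dir[of j k] insert.prems k(1) by auto
    have "\<forall>a b c. (a, b) \<in> r \<longrightarrow> (b, c) \<in> r \<longrightarrow> (a, c) \<in> r"
      using po unfolding partial_order_on_def preorder_on_def trans_def by blast
    then show ?case using k l by (intro bexI[OF _ l(1)]) blast
  qed
  show ?thesis
  proof (intro pro_group.intro pro_group_axioms.intro group_axioms tg cT)
    fix U assume U: "openin T U" "\<one> \<in> U"
    have US: "U \<subseteq> carrier G" using openin_subset[OF U(1)] top by simp
    have "openin (inverse_limit_topology I r F \<phi>) (h ` U)" using homeomorphic_map_openness[OF hm] US U(1) top by simp
    then obtain W where W: "openin ?X W" "h ` U = W \<inter> ?L" unfolding inverse_limit_topology_def openin_subtopology by blast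
    have "h \<one> \<in> W" using U(2) W(2) by blast
    then obtain B where B: "finite {i \<in> I. B i \<noteq> carrier (F i)}" "h \<one> \<in> Pi\<^sub>E I B" "Pi\<^sub>E I B \<subseteq> W"
      using W(1) unfolding openin_product_topology_alt by force
    obtain k where k: "k \<in> I" "\<forall>j\<in>{i \<in> I. B i \<noteq> carrier (F i)}. (j, k) \<in> r" using dirJ[OF B(1)] by blast
    let ?K = "{g \<in> carrier G. h g k = h \<one> k}"
    have "finite ((\<lambda>g. h g k) ` carrier G)" using fF[OF k(1)] hF k(1) by (meson finite_subset image_subsetI)
    then have "?K \<lhd> G" "finite (rcosets ?K)"
      by (rule fibre_normal[rotated]; use hm_mult k(1) in simp)+
    moreover have "closedin T ?K"
      using closedin_continuous_map_preimage[OF ch[OF k(1)], of "{h \<one> k}"] hF[OF one_closed k(1)] top by simp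
    moreover have "?K \<subseteq> U"
    proof
      fix g assume g: "g \<in> ?K"
      have "h g i \<in> B i" if i: "i \<in> I" for i
      proof (cases "B i = carrier (F i)")
        case True
        then show ?thesis using hF g i by simp
      next
        case False
        then have ik: "(i, k) \<in> r" using k(2) i by blast
        have "\<phi> i k (h x k) = h x i" if "x \<in> carrier G" for x
          using hL[OF that] i k(1) ik by (simp add: inverse_limit_set_def)
        then have "h g i = h \<one> i" using g one_closed by (metis (mono_tags, lifting) mem_Collect_eq)
        then show ?thesis using B(2) i by auto
      qed
      then have "h g \<in> Pi\<^sub>E I B" using hL[of g] g by (auto simp: inverse_limit_set_def PiE_iff)
      then have "h g \<in> h ` U" using B(3) W(2) hL g by auto
      then obtain u where "u \<in> U" "h g = h u" by blast
      then show "g \<in> U" using h US g by (metis (mono_tags, lifting) iso_iff inj_onD mem_Collect_eq subsetD)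
    qed
    ultimately show "\<exists>N\<in>finite_index_normal G T. N \<subseteq> U" unfolding finite_index_normal_def by blast
  qed
qed

section \<open>The pro-C*-topology\<close>

context pro_group
begin

text \<open>Gathers what the remaining proof uses of \<open>kappa\<close>: the second fact gives
  continuity of representations trivial on \<open>N\<close>, the third puts whole lines into
  neighbourhoods.\<close>

lemma pro_seminorm:
  assumes N: "N \<in> NN"
  shows "a \<in> CC ==> pro_seminorm G T N (a \<ominus>\<^bsub>Cs\<^esub> a) = 0"
    "a \<in> CC ==> anorm Cs (\<iota> (eM N) \<otimes>\<^bsub>Cs\<^esub> a) \<le> pro_seminorm G T N a"
    "\<lbrakk>n \<in> N; a \<in> CC; b \<in> CC; y \<in> CC\<rbrakk> \<Longrightarrow>
      pro_seminorm G T N ((y \<oplus>\<^bsub>Cs\<^esub> t \<odot>\<^bsub>Cs\<^esub> (Lm n a \<ominus>\<^bsub>Cs\<^esub> a)) \<ominus>\<^bsub>Cs\<^esub> b) = pro_seminorm G T N (y \<ominus>\<^bsub>Cs\<^esub> b)"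
proof -
  interpret finite_quotient G T N by unfold_locales (rule N)
  note k = star_homsD[OF \<kappa>(1)]
  have s: "pro_seminorm G T N a = anorm F.Cs (\<kappa> a)" for a
    by (simp add: pro_seminorm_def kappa_eq quotient_cstar_def)
  have dif: "\<kappa> (a \<ominus>\<^bsub>Cs\<^esub> b) = \<kappa> a \<ominus>\<^bsub>F.Cs\<^esub> \<kappa> b" if "a \<in> CC" "b \<in> CC" for a b
    using k that by (simp add: A.diff_eq F.A.diff_eq)
  show "pro_seminorm G T N (a \<ominus>\<^bsub>Cs\<^esub> a) = 0" if "a \<in> CC"
    using dif[OF that that] k(2)[OF that] by (simp add: s)
  show "anorm Cs (\<iota> (eM N) \<otimes>\<^bsub>Cs\<^esub> a) \<le> pro_seminorm G T N a" if "a \<in> CC" using \<kappa>(4)[OF that] s by simp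
  assume n: "n \<in> N" and a: "a \<in> CC" and b: "b \<in> CC" and y: "y \<in> CC"
  have L: "Lm n a \<in> CC" using NN_mem[OF N n] a by simp
  have "\<kappa> (t \<odot>\<^bsub>Cs\<^esub> (Lm n a \<ominus>\<^bsub>Cs\<^esub> a)) = \<zero>\<^bsub>F.Cs\<^esub>"
    using L a k(2,4) \<kappa>_Lm[OF n a] by (simp add: dif)
  then have "\<kappa> (y \<oplus>\<^bsub>Cs\<^esub> t \<odot>\<^bsub>Cs\<^esub> (Lm n a \<ominus>\<^bsub>Cs\<^esub> a)) = \<kappa> y" using k(2,3) y L a by simp
  then show "pro_seminorm G T N ((y \<oplus>\<^bsub>Cs\<^esub> t \<odot>\<^bsub>Cs\<^esub> (Lm n a \<ominus>\<^bsub>Cs\<^esub> a)) \<ominus>\<^bsub>Cs\<^esub> b) = pro_seminorm G T N (y \<ominus>\<^bsub>Cs\<^esub> b)"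
    using dif b y L a by (simp add: s)
qed

lemma openin_pro_ball:
  "N \<in> NN ==> a \<in> CC ==> e > 0 ==> openin (pro_topology G T) {b \<in> CC. pro_seminorm G T N (b \<ominus>\<^bsub>Cs\<^esub> a) < e}"
  unfolding pro_topology_def by (rule topology_generated_by_Basis) blast

lemma topspace_pro [simp]: "topspace (pro_topology G T) = CC"
proof
  show "topspace (pro_topology G T) \<subseteq> CC" by (auto simp: pro_topology_def)
  show "CC \<subseteq> topspace (pro_topology G T)"
  proof
    fix a assume a: "a \<in> CC"
    show "a \<in> topspace (pro_topology G T)"
      using openin_subset[OF openin_pro_ball[OF carrier_NN a zero_less_one]] pro_seminorm(1)[OF carrier_NN a] a by auto
  qed
qed

text \<open>Open sets of the pro-C*-topology contain whole lines: \<open>\<kappa>\<^sub>N\<close> annihilates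
  \<open>u\<^sub>n a - a\<close> for \<open>n \<in> N\<close>.\<close>

lemma pro_open_lines:
  assumes "openin (pro_topology G T) U"
  shows "\<forall>y\<in>U. \<exists>N\<in>NN. \<forall>n\<in>N. \<forall>a\<in>CC. \<forall>t. y \<oplus>\<^bsub>Cs\<^esub> t \<odot>\<^bsub>Cs\<^esub> (Lm n a \<ominus>\<^bsub>Cs\<^esub> a) \<in> U"
  using openin_topology_generated_by[OF assms[unfolded pro_topology_def]]
proof (induction rule: generate_topology_on.induct)
  case Empty
  then show ?case by simp
next
  case (Int U V)
  show ?case
  proof
    fix y assume y: "y \<in> U \<inter> V"
    obtain N where N: "N \<in> NN" "\<forall>n\<in>N. \<forall>a\<in>CC. \<forall>t. y \<oplus>\<^bsub>Cs\<^esub> t \<odot>\<^bsub>Cs\<^esub> (Lm n a \<ominus>\<^bsub>Cs\<^esub> a) \<in> U"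
      using bspec[OF Int.IH(1) IntD1[OF y]] by (rule bexE)
    obtain M where M: "M \<in> NN" "\<forall>n\<in>M. \<forall>a\<in>CC. \<forall>t. y \<oplus>\<^bsub>Cs\<^esub> t \<odot>\<^bsub>Cs\<^esub> (Lm n a \<ominus>\<^bsub>Cs\<^esub> a) \<in> V"
      using bspec[OF Int.IH(2) IntD2[OF y]] by (rule bexE)
    show "\<exists>N\<in>NN. \<forall>n\<in>N. \<forall>a\<in>CC. \<forall>t. y \<oplus>\<^bsub>Cs\<^esub> t \<odot>\<^bsub>Cs\<^esub> (Lm n a \<ominus>\<^bsub>Cs\<^esub> a) \<in> U \<inter> V"
      by (intro bexI[OF _ Int_NN[OF N(1) M(1)]] ballI allI IntI) (use N(2) M(2) in blast)+
  qed
next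
  case (UN K)
  show ?case
  proof
    fix y assume "y \<in> \<Union> K"
    then obtain k where k: "k \<in> K" "y \<in> k" by blast
    obtain N where "N \<in> NN" "\<forall>n\<in>N. \<forall>a\<in>CC. \<forall>t. y \<oplus>\<^bsub>Cs\<^esub> t \<odot>\<^bsub>Cs\<^esub> (Lm n a \<ominus>\<^bsub>Cs\<^esub> a) \<in> k"
      using bspec[OF UN.IH[OF k(1)] k(2)] by (rule bexE)
    then show "\<exists>N\<in>NN. \<forall>n\<in>N. \<forall>a\<in>CC. \<forall>t. y \<oplus>\<^bsub>Cs\<^esub> t \<odot>\<^bsub>Cs\<^esub> (Lm n a \<ominus>\<^bsub>Cs\<^esub> a) \<in> \<Union> K"
      using k(1) by blast
  qed
next
  case (Basis U)
  then obtain N b e where U: "N \<in> NN" "b \<in> CC" "U = {a \<in> CC. pro_seminorm G T N (a \<ominus>\<^bsub>Cs\<^esub> b) < e}" by blast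
  show ?case
  proof (intro ballI bexI[OF _ U(1)] allI)
    fix y n a t assume y: "y \<in> U" and n: "n \<in> N" and a: "a \<in> CC"
    have "Lm n a \<in> CC" using NN_mem[OF U(1) n] a by simp
    then show "y \<oplus>\<^bsub>Cs\<^esub> t \<odot>\<^bsub>Cs\<^esub> (Lm n a \<ominus>\<^bsub>Cs\<^esub> a) \<in> U"
      using pro_seminorm(3)[OF U(1) n a U(2), of y t] y a unfolding U(3) by simp
  qed
qed

text \<open>Normality makes membership of \<open>s \<otimes> g\<close> and of
  \<open>g \<otimes> s\<close> in \<open>N\<close> equivalent. The identity is used to show that the
  adjoint of \<open>v g\<close> is \<open>v (inv g)\<close>.\<close>

lemma inv_cnj_lt_eM: assumes N: "N \<in> NN" and g: "g \<in> GG" shows "inv_cnj (lt g (eM N)) = lt (inv g) (eM N)"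
proof (rule cont_eqI)
  fix s assume s: "s \<in> GG"
  have "inv g \<otimes> inv s \<in> N \<longleftrightarrow> g \<otimes> s \<in> N"
  proof -
    have "inv g \<otimes> inv s = inv (s \<otimes> g)" using s g by (simp add: inv_mult_group)
    moreover have "s \<otimes> g \<in> N \<longleftrightarrow> g \<otimes> s \<in> N"
    proof
      assume "s \<otimes> g \<in> N"
      then show "g \<otimes> s \<in> N" using normal.inv_op_closed2[OF NN_normal[OF N] g, of "s \<otimes> g"] s g by (simp add: m_assoc)
    next
      assume "g \<otimes> s \<in> N"
      then show "s \<otimes> g \<in> N" using normal.inv_op_closed1[OF NN_normal[OF N] g, of "g \<otimes> s"] s g by (simp add: m_assoc inv_mult_cancel)
    qed
    ultimately show ?thesis using N_inv[OF N, of "s \<otimes> g"] s g by simp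
  qed
  then show "inv_cnj (lt g (eM N)) s = lt (inv g) (eM N) s" using s g by (simp add: inv_cnj_apply lt_apply eM_def)
qed (use N g in simp_all)

end

section \<open>Representations with finite range\<close>

context pro_hilbert
begin

context
  fixes v :: "'g \<Rightarrow> 'h \<Rightarrow> 'h"
  assumes B: "\<And>g. g \<in> GG ==> v g \<in> carrier BO"
    and m: "\<And>g h x. g \<in> GG ==> h \<in> GG ==> x \<in> carrier H ==> v (g \<otimes> h) x = v g (v h x)"
    and one: "\<And>x. x \<in> carrier H ==> v \<one> x = x"
begin

text \<open>Formulated for bare families of operators because two kinds occur: given unitary
  representations, and corresponding representations whose unitarity is not yet known. Each supplies
  the closed kernel by its own argument.\<close>

lemma finite_range_trivial:
  assumes fin: "finite (v ` GG)" and cl: "closedin T {g \<in> GG. \<forall>x\<in>HH. v g x = x}"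
  shows "\<exists>N\<in>NN. \<forall>n\<in>N. \<forall>x\<in>HH. v n x = x"
proof -
  have "v (g \<otimes> h) = v (g' \<otimes> h')" if "g \<in> GG" "h \<in> GG" "g' \<in> GG" "h' \<in> GG" "v g = v g'" "v h = v h'" for g h g' h'
    by (rule BO_eqI) (use that B m in simp_all)
  from fibre_normal[of v, OF this fin]
  have "{g \<in> GG. v g = v \<one>} \<lhd> G" "finite (rcosets {g \<in> GG. v g = v \<one>})" by blast+
  moreover have "{g \<in> GG. v g = v \<one>} = {g \<in> GG. \<forall>x\<in>HH. v g x = x}"
  proof (rule Collect_cong, rule conj_cong[OF refl])
    fix g assume g: "g \<in> GG"
    show "v g = v \<one> \<longleftrightarrow> (\<forall>x\<in>HH. v g x = x)"
    proof
      show "v g = v \<one>" if "\<forall>x\<in>HH. v g x = x" by (rule BO_eqI[OF B[OF g] B[OF one_closed]]) (use that one in simp)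
    qed (simp add: one)
  qed
  ultimately have "{g \<in> GG. \<forall>x\<in>HH. v g x = x} \<in> NN" using cl unfolding finite_index_normal_def by simp
  then show ?thesis by (rule bexI[rotated]) simp
qed

text \<open>Each operator agrees with that of the representative of its coset, and there are
  finitely many cosets.\<close>

lemma trivial_finite_range:
  assumes N: "N \<in> NN" and t: "\<And>n x. n \<in> N ==> x \<in> HH ==> v n x = x"
  shows "finite (v ` GG)"
proof -
  have "v s = v (rep (N #> s))" if s: "s \<in> GG" for s
  proof (rule BO_eqI[OF B[OF s]])
    let ?r = "rep (N #> s)"
    have r: "?r \<in> GG" "N #> ?r = N #> s" using rep[OF N coset_in[OF N s]] by auto
    then show "v ?r \<in> BB" by (intro B)
    fix x assume x: "x \<in> HH"
    have "N #> (inv ?r \<otimes> s) = N #> \<one>" using coset_mult[OF N, of "inv ?r" s "inv ?r" ?r] r s by simp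
    then have n: "inv ?r \<otimes> s \<in> N" using coset_mem_iff[OF N NN_rcoset[OF N]] r s coset_mult_one[OF subgroup.subset[OF NN_subgroup[OF N]]] by simp
    have "v (?r \<otimes> (inv ?r \<otimes> s)) x = v ?r x" using m[of ?r "inv ?r \<otimes> s" x] t[OF n x] r s x by simp
    then show "v s x = v ?r x" using r s by (simp add: inv_mult_cancel)
  qed
  then have "v ` GG \<subseteq> (\<lambda>C. v (rep C)) ` (rcosets N)" using coset_in[OF N] by (intro image_subsetI) (metis imageI)
  then show ?thesis by (rule finite_subset) (simp add: NN_finite[OF N])
qed

end

end

context nondegenerate_rep
begin

lemma pro_hilbert: "pro_hilbert G T H"
  by (intro pro_hilbert.intro pro_group_axioms hilbert_axioms)

lemmas finite_range_trivial = pro_hilbert.finite_range_trivial[OF pro_hilbert v(1) v_mult v_one _ kernel_closed]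
  and trivial_finite_range = pro_hilbert.trivial_finite_range[OF pro_hilbert v(1) v_mult v_one]

lemma continuous_imp_trivial:
  assumes c: "pro_continuous G T H \<pi>"
  shows "\<exists>N\<in>NN. \<forall>n\<in>N. \<forall>x\<in>HH. v n x = x"
proof -
  obtain U where U: "openin (pro_topology G T) U" "\<zero>\<^bsub>Cs\<^esub> \<in> U" "\<forall>y\<in>U. opn (\<pi> y \<ominus>\<^bsub>BO\<^esub> \<pi> \<zero>\<^bsub>Cs\<^esub>) < 1"
    using c unfolding pro_continuous_def bounded_ops_simps B.continuous_map_norm_topology topspace_pro
    using A.M.zero_closed zero_less_one by blast
  obtain N where N: "N \<in> NN" "\<forall>n\<in>N. \<forall>a\<in>CC. \<forall>t. \<zero>\<^bsub>Cs\<^esub> \<oplus>\<^bsub>Cs\<^esub> t \<odot>\<^bsub>Cs\<^esub> (Lm n a \<ominus>\<^bsub>Cs\<^esub> a) \<in> U"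
    using pro_open_lines[OF U(1)] U(2) by blast
  have "v n x = x" if n: "n \<in> N" and x: "x \<in> HH" for n x
  proof -
    have nG: "n \<in> GG" by (rule NN_mem[OF N(1) n])
    have "v n = (\<lambda>x\<in>HH. x)"
    proof (rule total_eq[OF v(1)[OF nG] id_BO])
      fix a x assume a: "a \<in> CC" and x: "x \<in> HH"
      define z where "z = Lm n a \<ominus>\<^bsub>Cs\<^esub> a"
      have z: "z \<in> CC" using nG a by (simp add: z_def)
      have lt: "cmod t * opn (\<pi> z) < 1" for t
      proof -
        have "t \<odot>\<^bsub>Cs\<^esub> z \<in> U" using N(2) n a z unfolding z_def by fastforce
        then have "opn (\<pi> (t \<odot>\<^bsub>Cs\<^esub> z) \<ominus>\<^bsub>BO\<^esub> \<pi> \<zero>\<^bsub>Cs\<^esub>) < 1" using U(3) by blast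
        moreover have "\<pi> (t \<odot>\<^bsub>Cs\<^esub> z) \<ominus>\<^bsub>BO\<^esub> \<pi> \<zero>\<^bsub>Cs\<^esub> = t \<odot>\<^bsub>BO\<^esub> \<pi> z"
          using \<pi>_ops(4)[of "\<zero>\<^bsub>Cs\<^esub>" 0] \<pi>_ops(4)[OF z, of t] z by (simp add: B.diff_zero[unfolded bounded_ops_simps] del: bounded_ops_simps)
        ultimately show ?thesis using B.nrm_smult[of "\<pi> z" t] z by simp
      qed
      have "opn (\<pi> z) \<le> 0"
      proof (rule ccontr)
        assume "\<not> opn (\<pi> z) \<le> 0"
        \<comment> \<open>This multiple of \<open>z\<close> would have an image of norm exactly
          1.\<close>
        then show False using lt[of "complex_of_real (1 / opn (\<pi> z))"] by (simp add: norm_divide)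
      qed
      then have "\<pi> z = \<zero>\<^bsub>BO\<^esub>" using z by (intro B.eq_zeroI) auto
      then have "\<pi> z x = \<zero>\<^bsub>H\<^esub>" using x by simp
      then show "v n (\<pi> a x) = (\<lambda>x\<in>HH. x) (\<pi> a x)"
        using v(2)[OF nG a x] diff_eq_zero[of "\<pi> (Lm n a) x" "\<pi> a x"] nG a x by (simp add: z_def \<pi>_diff)
    qed
    then show ?thesis using x by simp
  qed
  then show ?thesis using N(1) by blast
qed

context
  fixes N assumes N: "N \<in> NN" and t: "\<And>n x. n \<in> N ==> x \<in> carrier H ==> v n x = x"
begin

lemma trivial_imp_continuous: "pro_continuous G T H \<pi>"
  unfolding pro_continuous_def bounded_ops_simps B.continuous_map_norm_topology topspace_pro
proof (intro conjI ballI allI impI)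
  fix x and e :: real assume x: "x \<in> CC" and e: "e > 0"
  let ?U = "{y \<in> CC. pro_seminorm G T N (y \<ominus>\<^bsub>Cs\<^esub> x) < e}"
  have "opn (\<pi> y \<ominus>\<^bsub>BO\<^esub> \<pi> x) < e" if y: "y \<in> ?U" for y
  proof -
    have yc: "y \<in> CC" and yx: "y \<ominus>\<^bsub>Cs\<^esub> x \<in> CC" using y x by auto
    have "\<pi> y \<ominus>\<^bsub>BO\<^esub> \<pi> x = \<pi> (\<iota> (eM N) \<otimes>\<^bsub>Cs\<^esub> (y \<ominus>\<^bsub>Cs\<^esub> x))"
      unfolding \<pi>_minus[OF yc x, symmetric]
    proof (rule BO_eqI)
      fix \<xi> assume \<xi>: "\<xi> \<in> HH"
      show "\<pi> (y \<ominus>\<^bsub>Cs\<^esub> x) \<xi> = \<pi> (\<iota> (eM N) \<otimes>\<^bsub>Cs\<^esub> (y \<ominus>\<^bsub>Cs\<^esub> x)) \<xi>"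
        using \<pi>_mult[OF iota_closed[OF eM_cont[OF N]] yx \<xi>] trivial_on_N[OF N t N subset_refl, of "\<pi> (y \<ominus>\<^bsub>Cs\<^esub> x) \<xi>"] yx \<xi> by simp
    qed (use yx N in simp_all)
    then show ?thesis
      using \<pi>_contractive[of "\<iota> (eM N) \<otimes>\<^bsub>Cs\<^esub> (y \<ominus>\<^bsub>Cs\<^esub> x)"] pro_seminorm(2)[OF N yx] y N yx by simp
  qed
  then show "\<exists>U. openin (pro_topology G T) U \<and> x \<in> U \<and> (\<forall>y\<in>U. opn (\<pi> y \<ominus>\<^bsub>BO\<^esub> \<pi> x) < e)"
    using openin_pro_ball[OF N x e] pro_seminorm(1)[OF N x] x e by (intro exI[of _ ?U]) simp
qed simp

text \<open>As \<open>p M\<close> is the identity, \<open>v g\<close> is itself the image of an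
  element of the algebra. Both the unitarity of \<open>v\<close> and the injectivity of the
  correspondence rest on this.\<close>

lemma v_eq: assumes g: "g \<in> GG" and M: "M \<in> NN" "M \<subseteq> N" shows "v g = \<pi> (\<iota> (lt g (eM M)))"
proof (rule BO_eqI[OF v(1)[OF g]])
  fix x assume x: "x \<in> HH"
  show "v g x = \<pi> (\<iota> (lt g (eM M))) x"
    using v(2)[OF g iota_closed[OF eM_cont[OF M(1)]] x] trivial_on_N[OF N t M x] Lm(2)[OF g eM_cont[OF M(1)]] by simp
qed (use g M in simp)

text \<open>By \<open>v_eq\<close> the adjoint of \<open>v g\<close> is the image of a star in the
  algebra, which is \<open>v (inv g)\<close>. Strong continuity is immediate, as \<open>v\<close> is
  the identity on the open subgroup \<open>N\<close>.\<close>

lemma v_unitary_rep: "v \<in> unitary_reps G T H"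
proof (rule pro_hilbert.unitary_repsI[OF pro_hilbert v_extensional v(1) v_mult v_one])
  fix g x y assume g: "g \<in> GG" and x: "x \<in> HH" and y: "y \<in> HH"
  have "star BO (v g) = v (inv g)"
    using \<pi>_ops(6)[of "\<iota> (lt g (eM N))"] iota_ops(4)[of "lt g (eM N)"] g N inv_cnj_lt_eM[OF N g]
    by (simp add: v_eq[OF _ N subset_refl])
  then have "ip (v g x) (v g y) = ip x (v (inv g) (v g y))"
    using star_BO(2)[OF v(1)[OF g] x, of "v g y"] v(1)[OF g] y by simp
  then show "ip (v g x) (v g y) = ip x y" using v_mult[of "inv g" g y] v_one[OF y] g y by simp
next
  fix x and e :: real assume "x \<in> HH" "e > 0"
  then show "\<exists>N\<in>NN. \<forall>n\<in>N. hn (v n x \<ominus>\<^bsub>H\<^esub> x) < e" using N t by (intro bexI[of _ N]) (simp_all add: diff_self)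
qed

end

end

context unitary_rep
begin

lemma kernel_closed: "closedin T {g \<in> GG. \<forall>x\<in>HH. v g x = x}"
proof -
  have "closedin T {g \<in> GG. v g x = x}" if x: "x \<in> HH" for x
  proof -
    have "closedin (norm_topology H hn) {x}" unfolding closedin_norm_topology
    proof (intro conjI ballI impI)
      fix y assume y: "y \<in> HH" and c: "\<forall>e>0. \<exists>z\<in>{x}. hn (z \<ominus>\<^bsub>H\<^esub> y) < e"
      have "hn (x \<ominus>\<^bsub>H\<^esub> y) \<le> 0" by (rule field_le_epsilon) (use c in \<open>auto intro: less_imp_le\<close>)
      then show "y \<in> {x}" using eqI_dist[OF x y] by simp
    qed (use x in simp)
    then show ?thesis
      using closedin_continuous_map_preimage[of T "norm_topology H hn" "\<lambda>g. v g x" "{x}"] unitary_rep x unfolding unitary_reps_def by simp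
  qed
  then have "closedin T (\<Inter>x\<in>HH. {g \<in> GG. v g x = x})" by (intro closedin_INT) auto
  moreover have "(\<Inter>x\<in>HH. {g \<in> GG. v g x = x}) = {g \<in> GG. \<forall>x\<in>HH. v g x = x}" using M.zero_closed by blast
  ultimately show ?thesis by simp
qed

text \<open>\<open>vf (eM N)\<close> is the identity, so every vector is in the range of an operator
  \<open>\<pi> a\<close>, which gives nondegeneracy; translating \<open>eM N\<close> by
  \<open>g\<close> and applying \<open>vf_left\<close> recovers \<open>v g\<close>.\<close>

lemma finite_range_integrated:
  assumes fin: "finite (v ` GG)"
  shows "\<exists>\<pi>\<in>nondegenerate_reps Cs H. pro_continuous G T H \<pi> \<and> corresponding_rep G T H \<pi> = v"
proof -
  have ph: "pro_hilbert G T H" by (intro pro_hilbert.intro pro_group_axioms hilbert_axioms)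
  obtain N where N: "N \<in> NN" "\<And>n x. n \<in> N ==> x \<in> HH ==> v n x = x"
    using pro_hilbert.finite_range_trivial[OF ph v_BO v_mult v_one fin kernel_closed] by blast
  obtain \<pi> where \<pi>: "\<pi> \<in> star_homs Cs BO" "\<And>f. f \<in> CF ==> \<pi> (\<iota> f) = vf f" using integrated_rep by blast
  note k = star_homsD[OF \<pi>(1)]
  have e: "vf (eM N) x = x" if x: "x \<in> HH" for x
    by (rule vf_eM_fixed[OF N(1) x]) (use N(2) x in blast)
  have nd: "\<pi> \<in> nondegenerate_reps Cs H"
  proof -
    have "K = HH" if K: "closed_subspace K" "{\<pi> a \<xi> | a \<xi>. a \<in> CC \<and> \<xi> \<in> HH} \<subseteq> K" for K
    proof -
      have "x \<in> K" if x: "x \<in> HH" for x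
      proof -
        have "\<pi> (\<iota> (eM N)) x \<in> K" using K(2) x iota_closed[OF eM_cont[OF N(1)]] by blast
        then show ?thesis using \<pi>(2)[OF eM_cont[OF N(1)]] e[OF x] by simp
      qed
      then show ?thesis using K(1) unfolding closed_subspace_def by blast
    qed
    then have "closed_span H {\<pi> a \<xi> | a \<xi>. a \<in> CC \<and> \<xi> \<in> HH} = HH"
      by (rule closed_spanI) (use k(2) in auto)
    then show ?thesis using \<pi>(1) by (simp add: nondegenerate_reps_def)
  qed
  interpret R: nondegenerate_rep G T H \<pi> by unfold_locales (rule nd)
  have "R.v g x = v g x" if g: "g \<in> GG" and x: "x \<in> HH" for g x
  proof -
    have lf: "lt g (eM N) \<in> CF" using g N(1) by simp
    have "R.v g (\<pi> (\<iota> (eM N)) x) = \<pi> (\<iota> (lt g (eM N))) x"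
      using R.v(2)[OF g iota_closed[OF eM_cont[OF N(1)]] x] Lm(2)[OF g eM_cont[OF N(1)]] by simp
    then show ?thesis using \<pi>(2)[OF lf] \<pi>(2)[OF eM_cont[OF N(1)]] vf_left[OF eM_cont[OF N(1)] g x] e[OF x] by (simp add: lt_def)
  qed
  then have vg: "R.v g = v g" if "g \<in> GG" for g using BO_eqI[OF R.v(1)[OF that] v_BO[OF that]] that by blast
  have "v \<in> extensional GG" using unitary_rep by (simp add: unitary_reps_def)
  then have "R.v = v" by (rule extensionalityI[OF R.v_extensional]) (rule vg)
  moreover have "pro_continuous G T H \<pi>"
    by (rule R.trivial_imp_continuous[OF N(1)]) (use vg NN_mem[OF N(1)] N(2) in simp)
  ultimately show ?thesis using nd by blast
qed

end

theorem (in pro_hilbert) finite_range_correspondence: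
  shows "\<forall>\<pi>\<in>nondegenerate_reps Cs H. pro_continuous G T H \<pi> \<longleftrightarrow> finite (corresponding_rep G T H \<pi> ` GG)"
    and "bij_betw (corresponding_rep G T H) {\<pi> \<in> nondegenerate_reps Cs H. pro_continuous G T H \<pi>}
      {v \<in> unitary_reps G T H. finite (v ` GG)}"
proof -
  have nd: "nondegenerate_rep G T H \<pi>" if "\<pi> \<in> nondegenerate_reps Cs H" for \<pi> using that by unfold_locales
  have iff: "pro_continuous G T H \<pi> \<longleftrightarrow> finite (corresponding_rep G T H \<pi> ` GG)"
    and tr: "pro_continuous G T H \<pi> ==> \<exists>N\<in>NN. \<forall>n\<in>N. \<forall>x\<in>HH. corresponding_rep G T H \<pi> n x = x"
    and un: "pro_continuous G T H \<pi> ==> corresponding_rep G T H \<pi> \<in> unitary_reps G T H"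
    if \<pi>: "\<pi> \<in> nondegenerate_reps Cs H" for \<pi>
  proof -
    interpret R: nondegenerate_rep G T H \<pi> by (rule nd[OF \<pi>])
    show "pro_continuous G T H \<pi> \<longleftrightarrow> finite (R.v ` GG)"
      using R.continuous_imp_trivial R.trivial_finite_range R.finite_range_trivial R.trivial_imp_continuous by metis
    show "pro_continuous G T H \<pi> ==> \<exists>N\<in>NN. \<forall>n\<in>N. \<forall>x\<in>HH. R.v n x = x" by (rule R.continuous_imp_trivial)
    show "pro_continuous G T H \<pi> ==> R.v \<in> unitary_reps G T H" using R.continuous_imp_trivial R.v_unitary_rep by metis
  qed
  show "\<forall>\<pi>\<in>nondegenerate_reps Cs H. pro_continuous G T H \<pi> \<longleftrightarrow> finite (corresponding_rep G T H \<pi> ` GG)" using iff by blast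
  show "bij_betw (corresponding_rep G T H) {\<pi> \<in> nondegenerate_reps Cs H. pro_continuous G T H \<pi>}
      {v \<in> unitary_reps G T H. finite (v ` GG)}"
    unfolding bij_betw_def
  proof
    show "corresponding_rep G T H ` {\<pi> \<in> nondegenerate_reps Cs H. pro_continuous G T H \<pi>} = {v \<in> unitary_reps G T H. finite (v ` GG)}"
    proof
      show "corresponding_rep G T H ` {\<pi> \<in> nondegenerate_reps Cs H. pro_continuous G T H \<pi>} \<subseteq> {v \<in> unitary_reps G T H. finite (v ` GG)}"
        using iff un by auto
      show "{v \<in> unitary_reps G T H. finite (v ` GG)} \<subseteq> corresponding_rep G T H ` {\<pi> \<in> nondegenerate_reps Cs H. pro_continuous G T H \<pi>}"
        using unitary_rep.finite_range_integrated[OF unitary_rep_intro[OF hilbert_space]] by blast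
    qed
    show "inj_on (corresponding_rep G T H) {\<pi> \<in> nondegenerate_reps Cs H. pro_continuous G T H \<pi>}"
    proof (rule inj_onI)
      fix \<pi> \<pi>' assume a: "\<pi> \<in> {\<pi> \<in> nondegenerate_reps Cs H. pro_continuous G T H \<pi>}" "\<pi>' \<in> {\<pi> \<in> nondegenerate_reps Cs H. pro_continuous G T H \<pi>}"
        and eq: "corresponding_rep G T H \<pi> = corresponding_rep G T H \<pi>'"
      interpret R: nondegenerate_rep G T H \<pi> by (rule nd) (use a in simp)
      interpret S: nondegenerate_rep G T H \<pi>' by (rule nd) (use a in simp)
      obtain N where N: "N \<in> NN" "\<And>n x. n \<in> N ==> x \<in> HH ==> R.v n x = x" using tr a by blast
      \<comment> \<open>By \<open>v_eq\<close> both representations take the same value at each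
        translate of \<open>eM M\<close>, and for \<open>M\<close> inside \<open>N\<close> these are
        total.\<close>
      have "{b \<in> CC. \<pi> b = \<pi>' b} = CC"
      proof (rule density_principle[OF A.equalizer_closed[OF normed_module_BO] N(1)])
        show "bounded_between Cs (anorm Cs) BO opn \<pi>" "bounded_between Cs (anorm Cs) BO opn \<pi>'"
          by (rule R.\<pi>_bounded S.\<pi>_bounded)+
        fix g M assume g: "g \<in> GG" "M \<in> NN" "M \<subseteq> N"
        have "\<pi> (\<iota> (lt g (eM M))) = R.v g" by (rule R.v_eq[OF N g, symmetric])
        also have "\<dots> = \<pi>' (\<iota> (lt g (eM M)))" unfolding eq by (rule S.v_eq[OF N(1) _ g]) (use N(2) eq in simp)
        finally show "\<iota> (lt g (eM M)) \<in> {b \<in> CC. \<pi> b = \<pi>' b}" using g by simp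
      qed
      then show "\<pi> = \<pi>'" by (intro extensionalityI[OF R.\<pi>_ops(1) S.\<pi>_ops(1)]) blast
    qed
  qed
qed

theorem proposition2p14:
  fixes G :: "('g, 'm) monoid_scheme" and T :: "'g topology" and H :: "'h hilbert"
  assumes "profinite_group TYPE('i) TYPE('f) G T"
    and "hilbert_space H"
  shows "(\<forall>\<pi>\<in>nondegenerate_reps (group_cstar G T) H.
            pro_continuous G T H \<pi> \<longleftrightarrow> finite (corresponding_rep G T H \<pi> ` carrier G)) \<and>
         bij_betw (corresponding_rep G T H)
           {\<pi> \<in> nondegenerate_reps (group_cstar G T) H. pro_continuous G T H \<pi>}
           {v \<in> unitary_reps G T H. finite (v ` carrier G)}"
proof -
  interpret pro_hilbert G T H
    by (intro pro_hilbert.intro profinite_imp_pro_group[OF assms(1)] hilbert.intro assms(2))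
  show ?thesis using finite_range_correspondence by blast
qed

end
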